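(* Let $G$ be a group in the class $w\mathcal T$. Let $\sigma$ be a Bernoulli shift action of $G$ on the probability space $(X,\mu)=\prod_{g\in G}(X_0,\mu_0)_g$, and let $\beta$ be a free measure preserving action of a discrete group $\Gamma$ on $(X,\mu)$ that commutes with $\sigma$ and such that the restriction $\sigma^\Gamma$ of $\sigma$ to the fixed point algebra $\{a\in L^\infty(X,\mu)\mid \beta_h(a)=a,\ \forall h\in\Gamma\}$ is still a free action of $G$. Denote by $\mathrm{Char}_\beta(\Gamma)$ the group of characters $\gamma$ of $\Gamma$ for which there exists a unitary element $u\in L^\infty(X,\mu)$ with $\beta_h(u)=\gamma(h)u$ for all $h\in\Gamma$. Then $\mathrm H^1(\sigma^\Gamma,G)=\mathrm{Char}(G)\times\mathrm{Char}_\beta(\Gamma)$ as topological groups (where $\mathrm{Char}_\beta(\Gamma)$ has the discrete topology).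
   Context: All groups are countable discrete; probability spaces are standard. A measure preserving (m.p.) action of $G$ on $(X,\mu)$ is also viewed as an integral preserving action on $A=L^\infty(X,\mu)$; an action on a (sub)algebra $L^\infty$ is called free if the corresponding action on the underlying probability space is (essentially) free. $\mathcal U(A)$ is the group of unitary elements of $A$, and $\|a\|_2=(\int|a|^2d\mu)^{1/2}$. Bernoulli shift: $(X_0,\mu_0)$ is a non-trivial standard probability space and $G$ acts on $\prod_{g\in G}(X_0,\mu_0)_g$ by left translation of the coordinates. 1-cohomology: a 1-cocycle for an action $\sigma$ of $G$ on $A$ is a map $w:G\to\mathcal U(A)$ with $w_g\sigma_g(w_h)=w_{gh}$ for all $g,h\in G$. $\mathrm Z^1(\sigma,G)$ is the group of 1-cocycles, with pointwise multiplication and the topology of pointwise convergence in $\|\cdot\|_2$. $\mathrm B^1(\sigma,G)$ is the subgroup of coboundaries $g\mapsto\sigma_g(u)u^*$, $u\in\mathcal U(A)$. $\mathrm H^1(\sigma,G)=\mathrm Z^1(\sigma,G)/\mathrm B^1(\sigma,G)$ with the quotient topology. $\mathrm{Char}(G)$ is the compact group of homomorphisms $G\to\mathbb T$ with the topology of pointwise convergence. Relative property (T): for a subgroup $H\subset G$, the pair $(G,H)$ has the relative property (T) if every unitary representation of $G$ that weakly contains the trivial representation of $G$ contains the trivial representation of $H$ when restricted to $H$. wq-normal: an infinite subgroup $H\subset G$ is wq-normal in $G$ if for every intermediate subgroup $H\subset K\subsetneq G$ there exists $g\in G\setminus K$ with $gKg^{-1}\cap K$ infinite. Class $w\mathcal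 T$: all countable discrete groups $G$ having an infinite wq-normal subgroup $H\subset G$ such that $(G,H)$ has the relative property (T). *)

theory Defs
  imports "HOL-Probability.Probability" "HOL-Algebra.Coset" "HOL-Algebra.Module"
begin

section \<open>Unitary representations and the relative property (T)\<close>

definition complex_ring :: "complex ring" where
  "complex_ring = \<lparr>carrier = UNIV, monoid.mult = (*), one = 1, ring.zero = 0, add = (+)\<rparr>"

text \<open>Only the additive group and the scalar multiplication of the underlying module record
  are used; its fields \<open>mult\<close> and \<open>one\<close> play no role. The inner product is linear in the
  first argument.\<close>

record 'v hilbert = "(complex, 'v) module" +
  inprod :: "'v \<Rightarrow> 'v \<Rightarrow> complex"

definition hnorm :: "('v, 'm) hilbert_scheme \<Rightarrow> 'v \<Rightarrow> real" where
  "hnorm V x = sqrt (Re (inprod V x x))"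

locale hilbert_space = Module.module complex_ring V for V :: "('v, 'm) hilbert_scheme" +
  assumes inprod_commute:
      "\<lbrakk>x \<in> carrier V; y \<in> carrier V\<rbrakk> \<Longrightarrow> inprod V x y = cnj (inprod V y x)"
    and inprod_add_left:
      "\<lbrakk>x \<in> carrier V; y \<in> carrier V; z \<in> carrier V\<rbrakk>
        \<Longrightarrow> inprod V (x \<oplus>\<^bsub>V\<^esub> y) z = inprod V x z + inprod V y z"
    and inprod_smult_left:
      "\<lbrakk>x \<in> carrier V; y \<in> carrier V\<rbrakk> \<Longrightarrow> inprod V (c \<odot>\<^bsub>V\<^esub> x) y = c * inprod V x y"
    and inprod_pos:
      "\<lbrakk>x \<in> carrier V; x \<noteq> \<zero>\<^bsub>V\<^esub>\<rbrakk> \<Longrightarrow> Re (inprod V x x) > 0"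
    and complete:
      "Metric_space.mcomplete (carrier V) (\<lambda>x y. hnorm V (x \<ominus>\<^bsub>V\<^esub> y))"

definition linear_isometry ::
    "('v, 'm) hilbert_scheme \<Rightarrow> ('w, 'n) hilbert_scheme \<Rightarrow> ('v \<Rightarrow> 'w) \<Rightarrow> bool" where
  "linear_isometry V W J \<longleftrightarrow>
     J \<in> carrier V \<rightarrow> carrier W \<and>
     (\<forall>x\<in>carrier V. \<forall>y\<in>carrier V. J (x \<oplus>\<^bsub>V\<^esub> y) = J x \<oplus>\<^bsub>W\<^esub> J y) \<and>
     (\<forall>c. \<forall>x\<in>carrier V. J (c \<odot>\<^bsub>V\<^esub> x) = c \<odot>\<^bsub>W\<^esub> J x) \<and>
     (\<forall>x\<in>carrier V. \<forall>y\<in>carrier V. inprod W (J x) (J y) = inprod V x y)"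

definition unitary_rep ::
    "('g, 'a) monoid_scheme \<Rightarrow> ('v, 'm) hilbert_scheme \<Rightarrow> ('g \<Rightarrow> 'v \<Rightarrow> 'v) \<Rightarrow> bool" where
  "unitary_rep G V \<pi> \<longleftrightarrow>
     hilbert_space V \<and>
     (\<forall>g\<in>carrier G. linear_isometry V V (\<pi> g) \<and> \<pi> g ` carrier V = carrier V) \<and>
     (\<forall>x\<in>carrier V. \<pi> \<one>\<^bsub>G\<^esub> x = x) \<and>
     (\<forall>g\<in>carrier G. \<forall>h\<in>carrier G. \<forall>x\<in>carrier V. \<pi> (g \<otimes>\<^bsub>G\<^esub> h) x = \<pi> g (\<pi> h x))"

definition complex_hilbert :: "complex hilbert" where
  "complex_hilbert =
     \<lparr>carrier = UNIV, monoid.mult = (*), one = 1, ring.zero = 0, add = (+), smult = (*),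
      inprod = (\<lambda>x y. x * cnj y)\<rparr>"

definition trivial_rep :: "'g \<Rightarrow> complex \<Rightarrow> complex" where
  "trivial_rep g z = z"

lemma hilbert_space_complex: "hilbert_space complex_hilbert"
proof -
  let ?V = complex_hilbert
  have ring: "cring complex_ring"
    by (rule cringI, rule abelian_groupI, goal_cases)
      (auto simp: complex_ring_def algebra_simps Units_def
        intro!: comm_monoidI exI[of _ "- x" for x :: complex])
  have ab: "abelian_group ?V"
    by (rule abelian_groupI) (auto simp: complex_hilbert_def algebra_simps intro: exI[of _ "- x" for x :: complex])
  have m: "Module.module complex_ring ?V"
    by (rule moduleI[OF ring ab]) (auto simp: complex_hilbert_def complex_ring_def algebra_simps)
  have neg: "\<ominus>\<^bsub>?V\<^esub> x = - x" for x
    by (rule abelian_group.minus_equality[OF ab])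
      (auto simp: complex_hilbert_def)
  then have minus: "x \<ominus>\<^bsub>?V\<^esub> y = x - y" for x y
    by (simp add: a_minus_def complex_hilbert_def)
  have norm: "hnorm ?V x = cmod x" for x
    by (simp add: hnorm_def complex_hilbert_def cmod_def power2_eq_square)
  have dist: "(\<lambda>x y. hnorm ?V (x \<ominus>\<^bsub>?V\<^esub> y)) = dist"
    by (simp add: fun_eq_iff norm minus dist_norm)
  have car: "carrier ?V = UNIV" by (simp add: complex_hilbert_def)
  have comp: "Metric_space.mcomplete (carrier ?V) (\<lambda>x y. hnorm ?V (x \<ominus>\<^bsub>?V\<^esub> y))"
    unfolding dist car using complete_UNIV mcomplete_iff_complete by blast
  have p: "Re (x * cnj x) > 0" if "x \<noteq> 0" for x :: complex
    using that by (simp add: complex_neq_0 power2_eq_square)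
  show ?thesis
    by (intro hilbert_space.intro m hilbert_space_axioms.intro comp)
      (use p in \<open>auto simp: complex_hilbert_def algebra_simps\<close>)
qed

lemma unitary_rep_trivial: "unitary_rep G complex_hilbert trivial_rep"
  by (auto simp: unitary_rep_def hilbert_space_complex linear_isometry_def trivial_rep_def)

definition rep_contained ::
    "('g, 'a) monoid_scheme \<Rightarrow> ('v, 'm) hilbert_scheme \<Rightarrow> ('g \<Rightarrow> 'v \<Rightarrow> 'v)
      \<Rightarrow> ('w, 'n) hilbert_scheme \<Rightarrow> ('g \<Rightarrow> 'w \<Rightarrow> 'w) \<Rightarrow> bool" where
  "rep_contained G V \<pi> W \<rho> \<longleftrightarrow>
     (\<exists>J. linear_isometry V W J \<and>
       (\<forall>g\<in>carrier G. \<forall>x\<in>carrier V. J (\<pi> g x) = \<rho> g (J x)))"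

text \<open>Weak containment in the sense of Fell, for a discrete group: every diagonal matrix
  coefficient of \<open>\<pi>\<close> is, uniformly on finite subsets, approximated by finite sums of diagonal
  matrix coefficients of \<open>\<rho>\<close>.\<close>

definition rep_weakly_contained ::
    "('g, 'a) monoid_scheme \<Rightarrow> ('v, 'm) hilbert_scheme \<Rightarrow> ('g \<Rightarrow> 'v \<Rightarrow> 'v)
      \<Rightarrow> ('w, 'n) hilbert_scheme \<Rightarrow> ('g \<Rightarrow> 'w \<Rightarrow> 'w) \<Rightarrow> bool" where
  "rep_weakly_contained G V \<pi> W \<rho> \<longleftrightarrow>
     (\<forall>\<xi>\<in>carrier V. \<forall>F \<epsilon>. finite F \<and> F \<subseteq> carrier G \<and> \<epsilon> > 0 \<longrightarrow>
       (\<exists>\<eta>s. set \<eta>s \<subseteq> carrier W \<and>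
         (\<forall>g\<in>F. cmod (inprod V (\<pi> g \<xi>) \<xi> - (\<Sum>\<eta>\<leftarrow>\<eta>s. inprod W (\<rho> g \<eta>) \<eta>)) < \<epsilon>)))"

text \<open>Representations range over all Hilbert space structures whose vectors form a set of
  sequences \<^typ>\<open>nat \<Rightarrow> complex\<close>. Up to isomorphism these include all separable Hilbert
  spaces. For countable \<open>G\<close> this is no restriction: a representation weakly containing the
  trivial one has a separable subrepresentation that still does.\<close>

definition relative_property_T :: "('g, 'a) monoid_scheme \<Rightarrow> 'g set \<Rightarrow> bool" where
  "relative_property_T G H \<longleftrightarrow>
     (\<forall>(V :: (nat \<Rightarrow> complex) hilbert) \<pi>.
        unitary_rep G V \<pi> \<and> rep_weakly_contained G complex_hilbert trivial_rep V \<pi>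
        \<longrightarrow> rep_contained (G\<lparr>carrier := H\<rparr>) complex_hilbert trivial_rep V \<pi>)"

definition wq_normal :: "'g set \<Rightarrow> ('g, 'a) monoid_scheme \<Rightarrow> bool" where
  "wq_normal H G \<longleftrightarrow>
     (\<forall>K. subgroup K G \<and> H \<subseteq> K \<and> K \<noteq> carrier G \<longrightarrow>
       (\<exists>g\<in>carrier G - K. infinite ((g <#\<^bsub>G\<^esub> K #>\<^bsub>G\<^esub> inv\<^bsub>G\<^esub> g) \<inter> K)))"

definition class_wT :: "('g, 'a) monoid_scheme \<Rightarrow> bool" where
  "class_wT G \<longleftrightarrow>
     Group.group G \<and> countable (carrier G) \<and>
     (\<exists>H. subgroup H G \<and> infinite H \<and> wq_normal H G \<and> relative_property_T G H)"


section \<open>Measure preserving actions\<close>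

definition standard_borel :: "'x measure \<Rightarrow> bool" where
  "standard_borel M \<longleftrightarrow>
     (\<exists>T. completely_metrizable_space T \<and> separable_space T \<and>
          topspace T = space M \<and> sets M = sigma_sets (space M) {U. openin T U})"

definition standard_prob_space :: "'x measure \<Rightarrow> bool" where
  "standard_prob_space M \<longleftrightarrow> prob_space M \<and> standard_borel M"

definition nontrivial_prob_space :: "'x measure \<Rightarrow> bool" where
  "nontrivial_prob_space M \<longleftrightarrow> \<not> (\<exists>x. AE y in M. y = x)"

text \<open>As usual for actions on measure spaces, the action axioms are only required almost
  everywhere.\<close>

definition mp_action ::
    "('g, 'a) monoid_scheme \<Rightarrow> 'x measure \<Rightarrow> ('g \<Rightarrow> 'x \<Rightarrow> 'x) \<Rightarrow> bool" where
  "mp_action G M T \<longleftrightarrow>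
     (\<forall>g\<in>carrier G. T g \<in> M \<rightarrow>\<^sub>M M \<and> distr M M (T g) = M) \<and>
     (AE x in M. T \<one>\<^bsub>G\<^esub> x = x) \<and>
     (\<forall>g\<in>carrier G. \<forall>h\<in>carrier G. AE x in M. T (g \<otimes>\<^bsub>G\<^esub> h) x = T g (T h x))"

definition ess_free ::
    "('g, 'a) monoid_scheme \<Rightarrow> 'x measure \<Rightarrow> ('g \<Rightarrow> 'x \<Rightarrow> 'x) \<Rightarrow> bool" where
  "ess_free G M T \<longleftrightarrow> (\<forall>g\<in>carrier G - {\<one>\<^bsub>G\<^esub>}. AE x in M. T g x \<noteq> x)"

definition bernoulli_space :: "('g, 'a) monoid_scheme \<Rightarrow> 'x measure \<Rightarrow> ('g \<Rightarrow> 'x) measure" where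
  "bernoulli_space G M0 = (\<Pi>\<^sub>M g\<in>carrier G. M0)"

definition bernoulli_shift ::
    "('g, 'a) monoid_scheme \<Rightarrow> 'g \<Rightarrow> ('g \<Rightarrow> 'x) \<Rightarrow> ('g \<Rightarrow> 'x)" where
  "bernoulli_shift G g x = (\<lambda>k\<in>carrier G. x (inv\<^bsub>G\<^esub> g \<otimes>\<^bsub>G\<^esub> k))"


section \<open>The algebra of essentially bounded functions\<close>

text \<open>Elements of \<open>L\<^sup>\<infinity>(M)\<close> are classes of measurable functions modulo equality almost
  everywhere, represented as sets of functions.\<close>

definition aeclass :: "'x measure \<Rightarrow> ('x \<Rightarrow> complex) \<Rightarrow> ('x \<Rightarrow> complex) set" where
  "aeclass M f = {h \<in> borel_measurable M. AE x in M. h x = f x}"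

definition Linf :: "'x measure \<Rightarrow> ('x \<Rightarrow> complex) set set" where
  "Linf M = aeclass M ` {f \<in> borel_measurable M. \<exists>C. AE x in M. cmod (f x) \<le> C}"

definition Lmult ::
    "'x measure \<Rightarrow> ('x \<Rightarrow> complex) set \<Rightarrow> ('x \<Rightarrow> complex) set \<Rightarrow> ('x \<Rightarrow> complex) set" where
  "Lmult M a b = {h \<in> borel_measurable M. \<exists>f\<in>a. \<exists>g\<in>b. AE x in M. h x = f x * g x}"

definition Lstar :: "'x measure \<Rightarrow> ('x \<Rightarrow> complex) set \<Rightarrow> ('x \<Rightarrow> complex) set" where
  "Lstar M a = {h \<in> borel_measurable M. \<exists>f\<in>a. AE x in M. h x = cnj (f x)}"

definition Lconst :: "'x measure \<Rightarrow> complex \<Rightarrow> ('x \<Rightarrow> complex) set" where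
  "Lconst M c = aeclass M (\<lambda>_. c)"

text \<open>The class on \<open>M\<close> of \<open>f \<circ> p\<close>, where \<open>f\<close> represents \<open>a \<in> L\<^sup>\<infinity>(N)\<close> and \<open>p\<close> is a measure
  preserving map from \<open>M\<close> to \<open>N\<close>.\<close>

definition Lpullback ::
    "'x measure \<Rightarrow> ('x \<Rightarrow> 'y) \<Rightarrow> ('y \<Rightarrow> complex) set \<Rightarrow> ('x \<Rightarrow> complex) set" where
  "Lpullback M p a = {h \<in> borel_measurable M. \<exists>f\<in>a. AE x in M. h x = f (p x)}"

definition L2_dist :: "'x measure \<Rightarrow> ('x \<Rightarrow> complex) set \<Rightarrow> ('x \<Rightarrow> complex) set \<Rightarrow> real" where
  "L2_dist M a b = sqrt (\<integral>x. (cmod ((SOME f. f \<in> a) x - (SOME f. f \<in> b) x))\<^sup>2 \<partial>M)"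

lemma aeclass_eq_iff:
  assumes "f \<in> borel_measurable M" "g \<in> borel_measurable M"
  shows "aeclass M f = aeclass M g \<longleftrightarrow> (AE x in M. f x = g x)"
proof
  assume "aeclass M f = aeclass M g"
  moreover have "f \<in> aeclass M f" using assms by (simp add: aeclass_def)
  ultimately show "AE x in M. f x = g x" by (simp add: aeclass_def)
next
  assume "AE x in M. f x = g x"
  then show "aeclass M f = aeclass M g"
    unfolding aeclass_def by (auto elim: AE_mp[rotated] eventually_mono)
qed

lemma Lmult_aeclass:
  assumes "f \<in> borel_measurable M" "g \<in> borel_measurable M"
  shows "Lmult M (aeclass M f) (aeclass M g) = aeclass M (\<lambda>x. f x * g x)"
proof (intro equalityI subsetI)
  fix h assume "h \<in> Lmult M (aeclass M f) (aeclass M g)"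
  then obtain f' g' where h: "h \<in> borel_measurable M"
    and AEs: "AE x in M. f' x = f x" "AE x in M. g' x = g x" "AE x in M. h x = f' x * g' x"
    by (auto simp: Lmult_def aeclass_def)
  from AEs have "AE x in M. h x = f x * g x" by eventually_elim simp
  with h show "h \<in> aeclass M (\<lambda>x. f x * g x)" by (simp add: aeclass_def)
qed (use assms in \<open>auto simp: Lmult_def aeclass_def\<close>)

lemma Lstar_aeclass:
  assumes "f \<in> borel_measurable M"
  shows "Lstar M (aeclass M f) = aeclass M (\<lambda>x. cnj (f x))"
proof (intro equalityI subsetI)
  fix h assume "h \<in> Lstar M (aeclass M f)"
  then obtain f' where h: "h \<in> borel_measurable M"
    and AEs: "AE x in M. f' x = f x" "AE x in M. h x = cnj (f' x)"
    by (auto simp: Lstar_def aeclass_def)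
  from AEs have "AE x in M. h x = cnj (f x)" by eventually_elim simp
  with h show "h \<in> aeclass M (\<lambda>x. cnj (f x))" by (simp add: aeclass_def)
qed (use assms in \<open>auto simp: Lstar_def aeclass_def\<close>)

lemma Lpullback_aeclass:
  assumes p: "p \<in> M \<rightarrow>\<^sub>M N" "distr M N p = N" and f: "f \<in> borel_measurable N"
  shows "Lpullback M p (aeclass N f) = aeclass M (\<lambda>x. f (p x))"
proof (intro equalityI subsetI)
  fix h assume "h \<in> Lpullback M p (aeclass N f)"
  then obtain f' where h: "h \<in> borel_measurable M" and f': "f' \<in> borel_measurable N"
    and AEs: "AE y in N. f' y = f y" "AE x in M. h x = f' (p x)"
    by (auto simp: Lpullback_def aeclass_def)
  have "AE y in distr M N p. f' y = f y" using AEs(1) by (simp only: p(2))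
  then have "AE x in M. f' (p x) = f (p x)"
    using f f' p(1) by (subst (asm) AE_distr_iff) auto
  with AEs(2) have "AE x in M. h x = f (p x)" by eventually_elim simp
  with h show "h \<in> aeclass M (\<lambda>x. f (p x))" by (simp add: aeclass_def)
qed (use assms in \<open>auto simp: Lpullback_def aeclass_def\<close>)

lemma L2_dist_aeclass:
  assumes [measurable]: "f \<in> borel_measurable M" "g \<in> borel_measurable M"
  shows "L2_dist M (aeclass M f) (aeclass M g) = sqrt (\<integral>x. (cmod (f x - g x))\<^sup>2 \<partial>M)"
proof -
  have ex: "(SOME h. h \<in> aeclass M k) \<in> aeclass M k" if "k \<in> borel_measurable M" for k
    by (rule someI[of _ k]) (use that in \<open>simp add: aeclass_def\<close>)
  define f' g' where "f' = (SOME h. h \<in> aeclass M f)" and "g' = (SOME h. h \<in> aeclass M g)"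
  have [measurable]: "f' \<in> borel_measurable M" "g' \<in> borel_measurable M"
    and AEs: "AE x in M. f' x = f x" "AE x in M. g' x = g x"
    using ex[of f] ex[of g] assms by (auto simp: f'_def g'_def aeclass_def)
  have "AE x in M. (cmod (f' x - g' x))\<^sup>2 = (cmod (f x - g x))\<^sup>2"
    using AEs by eventually_elim simp
  then have "(\<integral>x. (cmod (f' x - g' x))\<^sup>2 \<partial>M) = (\<integral>x. (cmod (f x - g x))\<^sup>2 \<partial>M)"
    by (intro integral_cong_AE) auto
  then show ?thesis by (simp add: L2_dist_def f'_def g'_def)
qed

lemma minkowski_L2:
  fixes f g h :: "'x \<Rightarrow> real"
  assumes i: "integrable M (\<lambda>x. (f x)\<^sup>2)" "integrable M (\<lambda>x. (g x)\<^sup>2)" "integrable M (\<lambda>x. (h x)\<^sup>2)"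
    and le: "\<And>x. \<bar>h x\<bar> \<le> \<bar>f x\<bar> + \<bar>g x\<bar>"
  shows "sqrt (\<integral>x. (h x)\<^sup>2 \<partial>M) \<le> sqrt (\<integral>x. (f x)\<^sup>2 \<partial>M) + sqrt (\<integral>x. (g x)\<^sup>2 \<partial>M)"
proof (rule field_le_epsilon)
  fix e :: real assume e: "e > 0"
  define a b where "a = sqrt (\<integral>x. (f x)\<^sup>2 \<partial>M)" and "b = sqrt (\<integral>x. (g x)\<^sup>2 \<partial>M)"
  define c d where "c = a + e / 2" and "d = b + e / 2"
  have ab: "a \<ge> 0" "b \<ge> 0" and a2: "a\<^sup>2 = (\<integral>x. (f x)\<^sup>2 \<partial>M)" "b\<^sup>2 = (\<integral>x. (g x)\<^sup>2 \<partial>M)"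
    by (auto simp: a_def b_def)
  have cd: "c > 0" "d > 0" "a\<^sup>2 \<le> c\<^sup>2" "b\<^sup>2 \<le> d\<^sup>2" using ab e by (auto simp: c_def d_def power_mono)
  have pt: "(h x)\<^sup>2 \<le> (1 + d / c) * (f x)\<^sup>2 + (1 + c / d) * (g x)\<^sup>2" for x
  proof -
    have "(h x)\<^sup>2 \<le> (\<bar>f x\<bar> + \<bar>g x\<bar>)\<^sup>2" using le[of x] by (metis abs_ge_zero power2_abs power_mono)
    also have "\<dots> = (f x)\<^sup>2 + (g x)\<^sup>2 + 2 * (\<bar>f x\<bar> * \<bar>g x\<bar>)" by (simp add: power2_sum)
    also have "2 * (\<bar>f x\<bar> * \<bar>g x\<bar>) \<le> d / c * (f x)\<^sup>2 + c / d * (g x)\<^sup>2"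
    proof -
      have "0 \<le> (d * \<bar>f x\<bar> - c * \<bar>g x\<bar>)\<^sup>2 / (c * d)" using cd by simp
      also have "\<dots> = d / c * (f x)\<^sup>2 + c / d * (g x)\<^sup>2 - 2 * (\<bar>f x\<bar> * \<bar>g x\<bar>)"
        using cd by (simp add: power2_diff power_mult_distrib field_simps) (simp add: power2_eq_square)
      finally show ?thesis by simp
    qed
    finally show ?thesis by (simp add: algebra_simps)
  qed
  have "(\<integral>x. (h x)\<^sup>2 \<partial>M) \<le> (\<integral>x. (1 + d / c) * (f x)\<^sup>2 + (1 + c / d) * (g x)\<^sup>2 \<partial>M)"
    using i pt by (intro integral_mono) auto
  also have "\<dots> = (1 + d / c) * a\<^sup>2 + (1 + c / d) * b\<^sup>2" using i by (simp add: a2)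
  also have "\<dots> \<le> (1 + d / c) * c\<^sup>2 + (1 + c / d) * d\<^sup>2"
    using cd by (intro add_mono mult_left_mono) auto
  also have "\<dots> = (c + d)\<^sup>2" using cd by (simp add: field_simps power2_eq_square)
  finally have "sqrt (\<integral>x. (h x)\<^sup>2 \<partial>M) \<le> c + d" using cd by (simp add: real_le_lsqrt)
  then show "sqrt (\<integral>x. (h x)\<^sup>2 \<partial>M) \<le> sqrt (\<integral>x. (f x)\<^sup>2 \<partial>M) + sqrt (\<integral>x. (g x)\<^sup>2 \<partial>M) + e"
    by (simp add: c_def d_def a_def b_def)
qed

lemma Metric_space_Linf:
  assumes "prob_space M"
  shows "Metric_space (Linf M) (L2_dist M)"
proof -
  interpret prob_space M by fact
  have int: "integrable M (\<lambda>x. (cmod (f x - g x))\<^sup>2)"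
    if [measurable]: "f \<in> borel_measurable M" "g \<in> borel_measurable M"
      and "AE x in M. cmod (f x) \<le> C" "AE x in M. cmod (g x) \<le> D" for f g C D
  proof (rule integrable_const_bound)
    show "AE x in M. norm ((cmod (f x - g x))\<^sup>2) \<le> (C + D)\<^sup>2"
      using that(3,4)
    proof eventually_elim
      case (elim x)
      then have "cmod (f x - g x) \<le> C + D" by (smt (verit) norm_triangle_ineq4)
      then show ?case by (simp add: power_mono)
    qed
  qed simp
  show ?thesis
  proof
    fix a b show "0 \<le> L2_dist M a b" by (simp add: L2_dist_def)
    show "L2_dist M a b = L2_dist M b a" by (simp add: L2_dist_def norm_minus_commute)
  next
    fix a b assume "a \<in> Linf M" "b \<in> Linf M"
    then obtain f g C D where fg: "a = aeclass M f" "b = aeclass M g"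
      "f \<in> borel_measurable M" "g \<in> borel_measurable M"
      "AE x in M. cmod (f x) \<le> C" "AE x in M. cmod (g x) \<le> D"
      by (auto simp: Linf_def)
    have "L2_dist M a b = 0 \<longleftrightarrow> (AE x in M. (cmod (f x - g x))\<^sup>2 = 0)"
      unfolding fg(1,2) L2_dist_aeclass[OF fg(3,4)]
      using integral_nonneg_eq_0_iff_AE[OF int[OF fg(3-6)]] by simp
    then show "L2_dist M a b = 0 \<longleftrightarrow> a = b"
      by (simp add: fg(1,2) aeclass_eq_iff[OF fg(3,4)])
  next
    fix a b c assume "a \<in> Linf M" "b \<in> Linf M" "c \<in> Linf M"
    then obtain f g h C D E where fg: "a = aeclass M f" "b = aeclass M g" "c = aeclass M h"
      "f \<in> borel_measurable M" "g \<in> borel_measurable M" "h \<in> borel_measurable M"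
      "AE x in M. cmod (f x) \<le> C" "AE x in M. cmod (g x) \<le> D" "AE x in M. cmod (h x) \<le> E"
      unfolding Linf_def by blast
    show "L2_dist M a c \<le> L2_dist M a b + L2_dist M b c"
      unfolding fg(1,2,3) L2_dist_aeclass[OF fg(4,5)] L2_dist_aeclass[OF fg(5,6)] L2_dist_aeclass[OF fg(4,6)]
      using int[OF fg(4,5,7,8)] int[OF fg(5,6,8,9)] int[OF fg(4,6,7,9)]
      by (rule minkowski_L2) (smt (verit) norm_ge_zero norm_diff_triangle_ineq norm_triangle_ineq diff_add_cancel add_diff_eq)
  qed
qed

definition Lunitary :: "'x measure \<Rightarrow> ('x \<Rightarrow> complex) set set \<Rightarrow> ('x \<Rightarrow> complex) set set" where
  "Lunitary M B = {u \<in> B. Lmult M u (Lstar M u) = Lconst M 1}"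

definition unitary_topology ::
    "'x measure \<Rightarrow> ('x \<Rightarrow> complex) set set \<Rightarrow> ('x \<Rightarrow> complex) set topology" where
  "unitary_topology M B =
     subtopology (Metric_space.mtopology (Linf M) (L2_dist M)) (Lunitary M B)"

definition induced_action ::
    "('g, 'a) monoid_scheme \<Rightarrow> 'x measure \<Rightarrow> ('g \<Rightarrow> 'x \<Rightarrow> 'x)
      \<Rightarrow> 'g \<Rightarrow> ('x \<Rightarrow> complex) set \<Rightarrow> ('x \<Rightarrow> complex) set" where
  "induced_action G M T g a = Lpullback M (T (inv\<^bsub>G\<^esub> g)) a"

definition fixed_algebra ::
    "('h, 'b) monoid_scheme \<Rightarrow> 'x measure \<Rightarrow> ('h \<Rightarrow> 'x \<Rightarrow> 'x) \<Rightarrow> ('x \<Rightarrow> complex) set set" where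
  "fixed_algebra \<Gamma> M \<beta> =
     {a \<in> Linf M. \<forall>h\<in>carrier \<Gamma>. induced_action \<Gamma> M \<beta> h a = a}"

text \<open>Freeness of an action \<open>\<theta>\<close> on a subalgebra \<open>B\<close> of \<open>L\<^sup>\<infinity>(M)\<close>: the algebra \<open>B\<close> is identified
  with \<open>L\<^sup>\<infinity>(N)\<close> for a standard probability space \<open>N\<close> by means of a measure preserving map
  \<open>p\<close> from \<open>M\<close> to \<open>N\<close>, and the action on \<open>N\<close> inducing \<open>\<theta>\<close> is essentially free. The space
  \<open>N\<close> with its action is unique up to isomorphism, and since every standard Borel space is
  isomorphic to a Borel subset of the line, it can be taken to consist of real numbers.\<close>

definition free_on_subalgebra ::
    "('g, 'a) monoid_scheme \<Rightarrow> 'x measure \<Rightarrow> ('x \<Rightarrow> complex) set set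
      \<Rightarrow> ('g \<Rightarrow> ('x \<Rightarrow> complex) set \<Rightarrow> ('x \<Rightarrow> complex) set) \<Rightarrow> bool" where
  "free_on_subalgebra G M B \<theta> \<longleftrightarrow>
     (\<exists>(N :: real measure) p S.
        standard_prob_space N \<and> p \<in> M \<rightarrow>\<^sub>M N \<and> distr M N p = N \<and>
        Lpullback M p ` Linf N = B \<and>
        mp_action G N S \<and>
        (\<forall>g\<in>carrier G. \<forall>a\<in>Linf N.
           \<theta> g (Lpullback M p a) = Lpullback M p (induced_action G N S g a)) \<and>
        ess_free G N S)"


section \<open>First cohomology of an action\<close>

text \<open>Here \<open>B\<close> is a subalgebra of \<open>L\<^sup>\<infinity>(M)\<close> and \<open>\<theta>\<close> is an action of \<open>G\<close> on \<open>B\<close>.\<close>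

definition Z1 ::
    "('g, 'a) monoid_scheme \<Rightarrow> 'x measure \<Rightarrow> ('x \<Rightarrow> complex) set set
      \<Rightarrow> ('g \<Rightarrow> ('x \<Rightarrow> complex) set \<Rightarrow> ('x \<Rightarrow> complex) set)
      \<Rightarrow> ('g \<Rightarrow> ('x \<Rightarrow> complex) set) monoid" where
  "Z1 G M B \<theta> =
     \<lparr>carrier = {w \<in> carrier G \<rightarrow>\<^sub>E Lunitary M B.
        \<forall>g\<in>carrier G. \<forall>h\<in>carrier G. Lmult M (w g) (\<theta> g (w h)) = w (g \<otimes>\<^bsub>G\<^esub> h)},
      monoid.mult = (\<lambda>v w. \<lambda>g\<in>carrier G. Lmult M (v g) (w g)),
      one = (\<lambda>g\<in>carrier G. Lconst M 1)\<rparr>"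

definition B1 ::
    "('g, 'a) monoid_scheme \<Rightarrow> 'x measure \<Rightarrow> ('x \<Rightarrow> complex) set set
      \<Rightarrow> ('g \<Rightarrow> ('x \<Rightarrow> complex) set \<Rightarrow> ('x \<Rightarrow> complex) set)
      \<Rightarrow> ('g \<Rightarrow> ('x \<Rightarrow> complex) set) set" where
  "B1 G M B \<theta> = (\<lambda>u. \<lambda>g\<in>carrier G. Lmult M (\<theta> g u) (Lstar M u)) ` Lunitary M B"

definition H1 ::
    "('g, 'a) monoid_scheme \<Rightarrow> 'x measure \<Rightarrow> ('x \<Rightarrow> complex) set set
      \<Rightarrow> ('g \<Rightarrow> ('x \<Rightarrow> complex) set \<Rightarrow> ('x \<Rightarrow> complex) set)
      \<Rightarrow> ('g \<Rightarrow> ('x \<Rightarrow> complex) set) set monoid" where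
  "H1 G M B \<theta> = Z1 G M B \<theta> Mod B1 G M B \<theta>"

definition Z1_topology ::
    "('g, 'a) monoid_scheme \<Rightarrow> 'x measure \<Rightarrow> ('x \<Rightarrow> complex) set set
      \<Rightarrow> ('g \<Rightarrow> ('x \<Rightarrow> complex) set \<Rightarrow> ('x \<Rightarrow> complex) set)
      \<Rightarrow> ('g \<Rightarrow> ('x \<Rightarrow> complex) set) topology" where
  "Z1_topology G M B \<theta> =
     subtopology (product_topology (\<lambda>_. unitary_topology M B) (carrier G)) (carrier (Z1 G M B \<theta>))"

definition quotient_topology :: "'a topology \<Rightarrow> ('a \<Rightarrow> 'b) \<Rightarrow> 'b topology" where
  "quotient_topology X f =
     topology (\<lambda>U. U \<subseteq> f ` topspace X \<and> openin X {x \<in> topspace X. f x \<in> U})"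

lemma openin_quotient_topology:
  "openin (quotient_topology X f) U \<longleftrightarrow>
     U \<subseteq> f ` topspace X \<and> openin X {x \<in> topspace X. f x \<in> U}"
proof -
  have "istopology (\<lambda>U. U \<subseteq> f ` topspace X \<and> openin X {x \<in> topspace X. f x \<in> U})"
    unfolding istopology_def
  proof (intro conjI allI impI)
    fix S T
    assume "S \<subseteq> f ` topspace X \<and> openin X {x \<in> topspace X. f x \<in> S}"
      and "T \<subseteq> f ` topspace X \<and> openin X {x \<in> topspace X. f x \<in> T}"
    moreover have "{x \<in> topspace X. f x \<in> S \<inter> T} =
        {x \<in> topspace X. f x \<in> S} \<inter> {x \<in> topspace X. f x \<in> T}"
      by auto
    ultimately show "S \<inter> T \<subseteq> f ` topspace X" "openin X {x \<in> topspace X. f x \<in> S \<inter> T}"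
      by auto
  next
    fix \<K>
    assume K: "\<forall>K\<in>\<K>. K \<subseteq> f ` topspace X \<and> openin X {x \<in> topspace X. f x \<in> K}"
    then show "\<Union> \<K> \<subseteq> f ` topspace X"
      by auto
    have "{x \<in> topspace X. f x \<in> \<Union> \<K>} = (\<Union>K\<in>\<K>. {x \<in> topspace X. f x \<in> K})"
      by auto
    then show "openin X {x \<in> topspace X. f x \<in> \<Union> \<K>}"
      using K by (auto intro: openin_Union)
  qed
  then show ?thesis
    by (simp add: quotient_topology_def topology_inverse')
qed

lemma topspace_quotient_topology [simp]: "topspace (quotient_topology X f) = f ` topspace X"
proof -
  have "{x \<in> topspace X. f x \<in> f ` topspace X} = topspace X"
    by auto
  then have "openin (quotient_topology X f) (f ` topspace X)"
    by (simp add: openin_quotient_topology)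
  then show ?thesis
    by (meson openin_quotient_topology openin_subset openin_topspace subset_antisym)
qed

lemma quotient_map_quotient_topology: "quotient_map X (quotient_topology X f) f"
  by (simp add: quotient_map_def openin_quotient_topology)

definition H1_topology ::
    "('g, 'a) monoid_scheme \<Rightarrow> 'x measure \<Rightarrow> ('x \<Rightarrow> complex) set set
      \<Rightarrow> ('g \<Rightarrow> ('x \<Rightarrow> complex) set \<Rightarrow> ('x \<Rightarrow> complex) set)
      \<Rightarrow> ('g \<Rightarrow> ('x \<Rightarrow> complex) set) set topology" where
  "H1_topology G M B \<theta> =
     quotient_topology (Z1_topology G M B \<theta>) (\<lambda>w. B1 G M B \<theta> #>\<^bsub>Z1 G M B \<theta>\<^esub> w)"


section \<open>Character groups\<close>

definition circle_group :: "complex monoid" where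
  "circle_group = \<lparr>carrier = sphere 0 1, monoid.mult = (*), one = 1\<rparr>"

definition char_group :: "('g, 'a) monoid_scheme \<Rightarrow> ('g \<Rightarrow> complex) monoid" where
  "char_group G =
     \<lparr>carrier = hom G circle_group \<inter> extensional (carrier G),
      monoid.mult = (\<lambda>\<gamma> \<delta>. \<lambda>g\<in>carrier G. \<gamma> g * \<delta> g),
      one = (\<lambda>g\<in>carrier G. 1)\<rparr>"

definition char_topology :: "('g, 'a) monoid_scheme \<Rightarrow> ('g \<Rightarrow> complex) topology" where
  "char_topology G =
     subtopology (product_topology (\<lambda>_. euclidean) (carrier G)) (carrier (char_group G))"

definition eigenchar_group ::
    "('h, 'b) monoid_scheme \<Rightarrow> 'x measure \<Rightarrow> ('h \<Rightarrow> 'x \<Rightarrow> 'x) \<Rightarrow> ('h \<Rightarrow> complex) monoid" where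
  "eigenchar_group \<Gamma> M \<beta> =
     (char_group \<Gamma>)\<lparr>carrier := {\<gamma> \<in> carrier (char_group \<Gamma>).
        \<exists>u\<in>Lunitary M (Linf M). \<forall>h\<in>carrier \<Gamma>.
          induced_action \<Gamma> M \<beta> h u = Lmult M (Lconst M (\<gamma> h)) u}\<rparr>"

definition topological_group_isomorphic ::
    "('a, 'c) monoid_scheme \<Rightarrow> 'a topology \<Rightarrow> ('b, 'd) monoid_scheme \<Rightarrow> 'b topology \<Rightarrow> bool" where
  "topological_group_isomorphic A X B Y \<longleftrightarrow> (\<exists>\<phi>\<in>iso A B. homeomorphic_map X Y \<phi>)"

end

theory Submission
  imports Defs
begin

text \<open>Every unitary cocycle \<open>w\<close> of the Bernoulli shift is cohomologous to a character. On the product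
  of two copies of the shift with a shift on i.i.d. uniform labels there is a path of equivariant
  factor maps \<open>\<psi>\<^sub>t\<close> from the first copy to the second. For \<open>s\<close> close to \<open>t\<close> the cocycles \<open>w \<circ> \<psi>\<^sub>s\<close> and
  \<open>w \<circ> \<psi>\<^sub>t\<close> almost agree, so the relative property (T) makes their restrictions to \<open>H\<close>
  cohomologous; finitely many steps lead from \<open>0\<close> to \<open>1\<close> and give a unitary \<open>v(x, y)\<close> with
  \<open>w\<^sub>h(x) v(h\<^sup>-\<^sup>1x, h\<^sup>-\<^sup>1y) = v(x, y) w\<^sub>h(y)\<close>. Mixing forces \<open>v\<close> to be a product \<open>f(x) g(y)\<close>, so that \<open>w\<close> is
  cohomologous to a character on \<open>H\<close>, and then on \<open>G\<close> because \<open>H\<close> is wq-normal.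

  A cocycle with values in the fixed point algebra is thus \<open>w\<^sub>g = \<theta>(g) \<sigma>\<^sub>g(u) u\<^sup>*\<close> with \<open>\<theta>\<close> a character and
  \<open>u\<close> a unitary of the full algebra. Invariance of \<open>w\<close> under \<open>\<beta>\<close> together with ergodicity of the shift
  makes \<open>u\<close> an eigenvector of \<open>\<beta>\<close> for some \<open>\<gamma>\<close>, and \<open>w \<mapsto> (\<theta>, \<gamma>)\<close> has the coboundaries as its
  kernel. For continuity one shows, again by the relative property (T), that \<open>u\<close> has a mean bounded
  away from \<open>0\<close> when \<open>w\<close> is close to \<open>1\<close>; this forces \<open>\<gamma> = 1\<close> and controls \<open>\<theta>\<close>.\<close>

section \<open>Countably generated measure spaces\<close>

text \<open>The relative property (T) is available here only qualitatively, for representations on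
  Hilbert spaces of complex sequences, and this shapes the proof in two ways. Square integrable
  functions must be encoded as sequences, which a countable generating system of sets makes
  possible. And there is no Kazhdan pair, that is, no finite set with a tolerance valid for all
  representations at once: uniform statements are proved by contradiction, from a sequence of
  counterexamples whose representations are summed up, so that an invariant vector of the sum has a
  nonzero component in one of them. The path takes the place of a one-parameter group of
  automorphisms of the doubled shift. Switching coordinates by random labels works for every base
  space, atoms included, at the price that the maps \<open>interp t\<close> are not invertible. An
  invariant vector has invariant modulus, which ergodicity makes constant; this is how vectors
  become unitaries. The bound 1/2 for the mean of \<open>u\<close> in the spectral gap serves twice:
  below it, \<open>u\<close> minus its mean is long enough to be normalised; above it, the mean can
  be divided out, which gives the Lipschitz constant 2 for the character.\<close>

definition countably_generated :: "'a measure \<Rightarrow> bool" where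
  "countably_generated K \<longleftrightarrow>
     (\<exists>C. countable C \<and> C \<subseteq> Pow (space K) \<and> sets K = sigma_sets (space K) C)"

lemma countably_generatedI:
  assumes "countable C" "C \<subseteq> sets K" "sets K \<subseteq> sigma_sets (space K) C"
  shows "countably_generated K"
  unfolding countably_generated_def
  using assms sets.sigma_sets_subset[of C K] sets.sets_into_space
  by (intro exI[of _ C]) blast

text \<open>Finite intersections of countably many sets are still countably many. The enumeration by
  \<open>nat\<close> serves the encoding of functions as sequences; stability under intersection and
  the presence of the whole space serve the Dynkin argument that makes this encoding
  injective.\<close>

lemma countably_generated_Int_stable:
  assumes "countably_generated K"
  obtains E :: "nat \<Rightarrow> 'a set"
  where "range E \<subseteq> sets K" "sets K = sigma_sets (space K) (range E)"
    "Int_stable (range E)" "space K \<in> range E"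
proof -
  obtain C where C: "countable C" "C \<subseteq> Pow (space K)" "sets K = sigma_sets (space K) C"
    using assms by (auto simp: countably_generated_def)
  \<comment> \<open>Intersecting with \<open>space K\<close> turns the empty intersection into the
    whole space instead of \<open>UNIV\<close>.\<close>
  define C' where "C' = (\<lambda>F. space K \<inter> \<Inter>F) ` {F. finite F \<and> F \<subseteq> C}"
  have sub: "C \<subseteq> sets K" using C by auto
  have count: "countable C'"
    unfolding C'_def using countable_Collect_finite_subset[OF C(1)] by blast
  have sp: "space K \<in> C'"
    unfolding C'_def by (rule image_eqI[of _ _ "{}"]) auto
  have C'_sets: "C' \<subseteq> sets K"
  proof
    fix A assume "A \<in> C'"
    then obtain F where F: "finite F" "F \<subseteq> C" "A = space K \<inter> \<Inter>F" by (auto simp: C'_def)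
    show "A \<in> sets K"
    proof (cases "F = {}")
      case False
      have "\<Inter>F \<in> sets K" if "finite F" "F \<noteq> {}" "F \<subseteq> sets K" for F
        using that by (induction F rule: finite_ne_induct) auto
      with False show ?thesis using F sub by auto
    qed (use F in auto)
  qed
  have CC': "C \<subseteq> C'"
  proof
    fix A assume A: "A \<in> C"
    then have "A = space K \<inter> \<Inter>{A}" using C(2) by auto
    with A show "A \<in> C'" unfolding C'_def by blast
  qed
  have Int: "Int_stable C'"
  proof (rule Int_stableI)
    fix A B assume "A \<in> C'" "B \<in> C'"
    then obtain F1 F2 where "finite F1" "F1 \<subseteq> C" "A = space K \<inter> \<Inter>F1"
      "finite F2" "F2 \<subseteq> C" "B = space K \<inter> \<Inter>F2" by (auto simp: C'_def)
    then show "A \<inter> B \<in> C'"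
      unfolding C'_def by (intro image_eqI[of _ _ "F1 \<union> F2"]) auto
  qed
  define E where "E = from_nat_into C'"
  have rE: "range E = C'"
    unfolding E_def using sp count by (intro range_from_nat_into) auto
  have "sets K = sigma_sets (space K) C'"
    using C(3) CC' C'_sets sigma_sets_mono'[OF CC'] sets.sigma_sets_subset[OF C'_sets] by blast
  then show thesis using that[of E] rE C'_sets Int sp by auto
qed

text \<open>Preimages commute with complements and countable unions, so only generators have to be
  checked. The inclusion of \<open>f\<close> in the function space
  \<open>\<Omega> \<rightarrow> S\<close> makes the complement in \<open>S\<close> correspond to the
  complement in \<open>\<Omega>\<close>.\<close>

lemma countably_generated_preimage:
  assumes X: "\<And>A. A \<in> C \<Longrightarrow> {x \<in> \<Omega>. f x \<in> A} \<in> sigma_sets \<Omega> D"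
    and f: "f \<in> \<Omega> \<rightarrow> S" and A: "A \<in> sigma_sets S C"
  shows "{x \<in> \<Omega>. f x \<in> A} \<in> sigma_sets \<Omega> D"
  using A
proof induction
  case (Compl a)
  have "{x \<in> \<Omega>. f x \<in> S - a} = \<Omega> - {x \<in> \<Omega>. f x \<in> a}" using f by auto
  then show ?case using Compl sigma_sets.Compl[of "{x \<in> \<Omega>. f x \<in> a}"] by simp
next
  case (Union a)
  have "{x \<in> \<Omega>. f x \<in> \<Union>(range a)} = (\<Union>i. {x \<in> \<Omega>. f x \<in> a i})" by auto
  then show ?case using Union sigma_sets.Union[of "\<lambda>i. {x \<in> \<Omega>. f x \<in> a i}"] by simp
qed (auto intro: X sigma_sets.Empty)

text \<open>Strips with one full side, taken over the two countable generators, suffice: every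
  measurable rectangle is the intersection of two strips.\<close>

lemma countably_generated_pair:
  assumes "countably_generated K" "countably_generated L"
  shows "countably_generated (K \<Otimes>\<^sub>M L)"
proof -
  obtain C where C: "countable C" "C \<subseteq> Pow (space K)" "sets K = sigma_sets (space K) C"
    using assms by (auto simp: countably_generated_def)
  obtain D where D: "countable D" "D \<subseteq> Pow (space L)" "sets L = sigma_sets (space L) D"
    using assms by (auto simp: countably_generated_def)
  let ?O = "space K \<times> space L"
  let ?E = "(\<lambda>A. A \<times> space L) ` C \<union> (\<lambda>B. space K \<times> B) ` D"
  have E: "?E \<subseteq> Pow ?O" using C(2) D(2) by auto
  interpret S: sigma_algebra ?O "sigma_sets ?O ?E" by (rule sigma_algebra_sigma_sets[OF E])
  have 1: "A \<times> space L \<in> sigma_sets ?O ?E" if "A \<in> sets K" for A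
  proof -
    have *: "{x \<in> ?O. fst x \<in> B} = B \<times> space L" if "B \<subseteq> space K" for B using that by auto
    have "{x \<in> ?O. fst x \<in> A} \<in> sigma_sets ?O ?E"
    proof (rule countably_generated_preimage[where S="space K" and C=C])
      fix B assume "B \<in> C"
      moreover from this have "{x \<in> ?O. fst x \<in> B} = B \<times> space L" using C(2) by (intro *) auto
      ultimately show "{x \<in> ?O. fst x \<in> B} \<in> sigma_sets ?O ?E" by (simp add: sigma_sets.Basic)
    qed (use that C(3) in auto)
    then show ?thesis using *[of A] sets.sets_into_space[OF that] by simp
  qed
  have 2: "space K \<times> B \<in> sigma_sets ?O ?E" if "B \<in> sets L" for B
  proof -
    have *: "{x \<in> ?O. snd x \<in> B} = space K \<times> B" if "B \<subseteq> space L" for B using that by auto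
    have "{x \<in> ?O. snd x \<in> B} \<in> sigma_sets ?O ?E"
    proof (rule countably_generated_preimage[where S="space L" and C=D])
      fix A assume "A \<in> D"
      moreover from this have "{x \<in> ?O. snd x \<in> A} = space K \<times> A" using D(2) by (intro *) auto
      ultimately show "{x \<in> ?O. snd x \<in> A} \<in> sigma_sets ?O ?E" by (simp add: sigma_sets.Basic)
    qed (use that D(3) in auto)
    then show ?thesis using *[of B] sets.sets_into_space[OF that] by simp
  qed
  have "a \<times> b \<in> sigma_sets ?O ?E" if "a \<in> sets K" "b \<in> sets L" for a b
  proof -
    have "a \<times> b = (a \<times> space L) \<inter> (space K \<times> b)"
      using sets.sets_into_space[OF that(1)] sets.sets_into_space[OF that(2)] by blast
    then show ?thesis using S.Int[OF 1[OF that(1)] 2[OF that(2)]] by simp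
  qed
  then have "sets (K \<Otimes>\<^sub>M L) \<subseteq> sigma_sets ?O ?E"
    unfolding sets_pair_measure by (intro S.sigma_sets_subset) auto
  moreover have "?E \<subseteq> sets (K \<Otimes>\<^sub>M L)"
  proof -
    have "C \<subseteq> sets K" "D \<subseteq> sets L" unfolding C(3) D(3) by auto
    then show ?thesis by auto
  qed
  moreover have "countable ?E" using C(1) D(1) by simp
  ultimately show ?thesis by (intro countably_generatedI[of ?E]) (simp_all only: space_pair_measure)
qed

text \<open>The product sigma-algebra is generated by conditions on single coordinates; countably
  many coordinates with countably many generators each leave countably many conditions.\<close>

lemma countably_generated_PiM:
  assumes "countable I" "\<And>i. i \<in> I \<Longrightarrow> countably_generated (K i)"
  shows "countably_generated (PiM I K)"
proof -
  from assms(2)[unfolded countably_generated_def] obtain C where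
    C': "\<forall>i\<in>I. countable (C i) \<and> C i \<subseteq> Pow (space (K i)) \<and>
      sets (K i) = sigma_sets (space (K i)) (C i)"
    using bchoice[of I "\<lambda>i C. countable C \<and> C \<subseteq> Pow (space (K i)) \<and>
      sets (K i) = sigma_sets (space (K i)) C"] by meson
  then have C: "\<And>i. i \<in> I \<Longrightarrow> countable (C i)" "\<And>i. i \<in> I \<Longrightarrow> C i \<subseteq> Pow (space (K i))"
    "\<And>i. i \<in> I \<Longrightarrow> sets (K i) = sigma_sets (space (K i)) (C i)"
    by simp_all
  let ?O = "\<Pi>\<^sub>E i\<in>I. space (K i)"
  let ?E = "\<Union>i\<in>I. (\<lambda>A. {f \<in> ?O. f i \<in> A}) ` C i"
  have E: "?E \<subseteq> Pow ?O" by auto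
  interpret S: sigma_algebra ?O "sigma_sets ?O ?E" by (rule sigma_algebra_sigma_sets[OF E])
  have "{f \<in> ?O. f i \<in> A} \<in> sigma_sets ?O ?E" if "i \<in> I" "A \<in> sets (K i)" for i A
    by (rule countably_generated_preimage[where S="space (K i)" and C="C i" and f="\<lambda>f. f i"])
      (use that C(3)[OF that(1)] in \<open>auto intro!: sigma_sets.Basic\<close>)
  then have "sets (PiM I K) \<subseteq> sigma_sets ?O ?E"
    unfolding sets_PiM_single by (intro S.sigma_sets_subset) auto
  moreover have "?E \<subseteq> sets (PiM I K)"
  proof
    fix A assume "A \<in> ?E"
    then obtain i B where "i \<in> I" "B \<in> C i" "A = {f \<in> ?O. f i \<in> B}" by blast
    moreover from this have "B \<in> sets (K i)" using C(3) by auto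
    ultimately show "A \<in> sets (PiM I K)"
      unfolding sets_PiM_single by (intro sigma_sets.Basic) blast
  qed
  moreover have "countable ?E" using C(1) assms(1) by simp
  ultimately show ?thesis by (intro countably_generatedI[of ?E]) (simp_all only: space_PiM)
qed

lemma countably_generated_pmf:
  "countably_generated (measure_pmf p)" for p :: "nat pmf"
proof (rule countably_generatedI[of "range (\<lambda>n. {n})"])
  interpret S: sigma_algebra "UNIV" "sigma_sets UNIV (range (\<lambda>n::nat. {n}))"
    by (rule sigma_algebra_sigma_sets) auto
  have "A \<in> sigma_sets UNIV (range (\<lambda>n. {n}))" for A :: "nat set"
  proof -
    have "(\<Union>n\<in>A. {n}) \<in> sigma_sets UNIV (range (\<lambda>n::nat. {n}))"
      by (intro S.countable_UN') auto
    then show ?thesis by simp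
  qed
  then show "sets (measure_pmf p) \<subseteq> sigma_sets (space (measure_pmf p)) (range (\<lambda>n. {n}))"
    by auto
qed auto

lemma countably_generated_restrict_lborel:
  assumes "S \<in> sets borel"
  shows "countably_generated (restrict_space lborel (S :: real set))"
proof -
  obtain B :: "real set set" where B: "countable B" "topological_basis B"
    using ex_countable_basis by blast
  have bor: "sets (borel :: real measure) = sigma_sets UNIV B"
    unfolding borel_eq_countable_basis[OF B] by (simp add: sets_measure_of)
  have "sets (restrict_space lborel S) = sigma_sets S ((\<inter>) S ` B)"
    using sigma_sets_Int[of S UNIV B] assms by (simp add: sets_restrict_space bor)
  then show ?thesis
    unfolding countably_generated_def using B(1) assms
    by (intro exI[of _ "(\<inter>) S ` B"]) (auto simp: space_restrict_space)
qed

text \<open>The generators are the balls of radius 1/(n+1) around the points of a countable dense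
  set. Every open set is the union of those balls that it contains.\<close>

lemma countably_generated_standard_borel:
  assumes "standard_borel K"
  shows "countably_generated K"
proof -
  obtain T where T: "completely_metrizable_space T" "separable_space T" "topspace T = space K"
    "sets K = sigma_sets (space K) {U. openin T U}"
    using assms by (auto simp: standard_borel_def)
  obtain X d where X: "Metric_space X d" "T = Metric_space.mtopology X d"
    using T(1) by (auto simp: completely_metrizable_space_def)
  interpret Metric_space X d by fact
  have XK: "X = space K" using T(3) X(2) by simp
  obtain D where D: "countable D" "D \<subseteq> X" "T closure_of D = X"
    using T(2,3) X(2) by (auto simp: separable_space_def)
  define C where "C = (\<lambda>(x, n). mball x (inverse (Suc n))) ` (D \<times> (UNIV :: nat set))"
  have C: "countable C" unfolding C_def using D(1) by auto
  have C_sub: "C \<subseteq> sets K"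
    unfolding T(4) C_def X(2) by (auto intro!: sigma_sets.Basic)
  have "U \<in> sigma_sets (space K) C" if U: "openin T U" for U
  proof -
    have Csp: "C \<subseteq> Pow (space K)" 
    proof
      fix A assume "A \<in> C"
      then obtain x e where "A = mball x e" by (auto simp: C_def)
      then show "A \<in> Pow (space K)" using mball_subset_mspace[of x e] XK by simp
    qed
    interpret S: sigma_algebra "space K" "sigma_sets (space K) C"
      by (rule sigma_algebra_sigma_sets[OF Csp])
    have "U = \<Union>{A \<in> C. A \<subseteq> U}"
    proof (intro equalityI subsetI)
      fix x assume x: "x \<in> U"
      obtain r where r: "r > 0" "mball x r \<subseteq> U"
        using U x openin_mtopology[of U] X(2) by metis
      have xX: "x \<in> X" using openin_subset[OF U] x T(3) XK by blast
      \<comment> \<open>Half the radius: a ball around a dense point \<open>y\<close> closer than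
        r/2 to \<open>x\<close>, itself of radius less than r/2, stays inside
        \<open>mball x r\<close>.\<close>
      obtain n where n: "inverse (Suc n) < r / 2"
        using reals_Archimedean[of "r/2"] r(1) half_gt_zero[of r] by blast
      have e: "0 < inverse (real (Suc n))" by simp
      have "x \<in> T closure_of D" using D(3) xX by simp
      then have "\<forall>r>0. \<exists>y\<in>D. y \<in> mball x r"
        unfolding X(2) metric_closure_of by blast
      with e obtain y where y: "y \<in> D" "y \<in> mball x (inverse (Suc n))"
        by blast
      have "mball y (inverse (Suc n)) \<subseteq> mball x r"
      proof
        fix z assume "z \<in> mball y (inverse (Suc n))"
        then have "d x y < r / 2" "d y z < r / 2" "y \<in> X" "z \<in> X"
          using y(2) n by (simp_all del: of_nat_Suc)
        then show "z \<in> mball x r"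
          using xX triangle[of x y z] by (simp add: in_mball)
      qed
      moreover have "x \<in> mball y (inverse (Suc n))"
        using y(2) commute[of x y] by (simp del: of_nat_Suc)
      ultimately show "x \<in> \<Union>{A \<in> C. A \<subseteq> U}"
        using y(1) r(2) unfolding C_def by blast
    qed blast
    moreover have "\<Union>{A \<in> C. A \<subseteq> U} \<in> sigma_sets (space K) C"
      by (intro S.countable_Union countable_subset[OF _ C]) auto
    ultimately show ?thesis by simp
  qed
  then have "sets K \<subseteq> sigma_sets (space K) C"
    unfolding T(4) by (intro sigma_sets_mono) auto
  then show ?thesis using C C_sub by (rule countably_generatedI[rotated 2])
qed

text \<open>The sets over which \<open>f\<close> integrates to 0 form a Dynkin system containing the
  generator \<open>E\<close>. That \<open>E\<close> contains the whole space is what starts the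
  complement step.\<close>

lemma AE_zero_if_integrals_zero:
  fixes f :: "'a \<Rightarrow> complex"
  assumes "sigma_finite_measure K" and f: "integrable K f"
    and E: "sets K = sigma_sets (space K) E" "Int_stable E" "E \<subseteq> Pow (space K)" "space K \<in> E"
    and 0: "\<And>A. A \<in> E \<Longrightarrow> (\<integral>x. indicator A x *\<^sub>R f x \<partial>K) = 0"
  shows "AE x in K. f x = 0"
proof (rule sigma_finite_measure.density_zero[OF assms(1) f])
  have i: "integrable K (\<lambda>x. indicator A x *\<^sub>R f x)" if "A \<in> sets K" for A
    using integrable_mult_indicator[OF that f] .
  have "(\<integral>x. indicator A x *\<^sub>R f x \<partial>K) = 0" if "A \<in> sigma_sets (space K) E" for A
    using E(2,3) that
  proof (induction rule: sigma_sets_induct_disjoint)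
    case (basic A) then show ?case by (rule 0)
  next
    case empty then show ?case by simp
  next
    case (compl A)
    then have A: "A \<in> sets K" using E by simp
    have "(\<integral>x. indicator (space K - A) x *\<^sub>R f x \<partial>K) =
        (\<integral>x. indicator (space K) x *\<^sub>R f x - indicator A x *\<^sub>R f x \<partial>K)"
      by (intro Bochner_Integration.integral_cong) (auto simp: indicator_def)
    also have "\<dots> = 0"
      using i[OF A] i[of "space K"] compl 0[OF E(4)] by (subst Bochner_Integration.integral_diff) auto
    finally show ?case .
  next
    case (union A)
    then have A: "range A \<subseteq> sets K" using E by simp
    have "set_lebesgue_integral K (\<Union>i. A i) f = (\<Sum>i. set_lebesgue_integral K (A i) f)"
      using A union(1) i[of "\<Union>i. A i"]
      by (intro lebesgue_integral_countable_add)
        (auto simp: disjoint_family_on_def set_integrable_def)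
    also have "\<dots> = 0" using union by (simp add: set_lebesgue_integral_def)
    finally show ?case by (simp add: set_lebesgue_integral_def)
  qed
  then show "set_lebesgue_integral K A f = 0" if "A \<in> sets K" for A
    using that E by (simp add: set_lebesgue_integral_def)
qed

section \<open>Measure preserving maps\<close>

definition measure_preserving :: "'a measure \<Rightarrow> 'b measure \<Rightarrow> ('a \<Rightarrow> 'b) \<Rightarrow> bool" where
  "measure_preserving K L p \<longleftrightarrow> p \<in> K \<rightarrow>\<^sub>M L \<and> distr K L p = L"

lemma measure_preserving_measurable: "measure_preserving K L p \<Longrightarrow> p \<in> K \<rightarrow>\<^sub>M L"
  by (simp add: measure_preserving_def)

lemma measure_preserving_id: "measure_preserving K K (\<lambda>x. x)"
  by (simp add: measure_preserving_def distr_id)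

lemma measure_preserving_AE:
  assumes "measure_preserving K L p" "AE x in L. P x"
  shows "AE x in K. P (p x)"
  using assms AE_distrD[of p K L P] unfolding measure_preserving_def by metis

lemma measure_preserving_integral:
  fixes f :: "'b \<Rightarrow> 'c::{banach, second_countable_topology}"
  assumes "measure_preserving K L p" "f \<in> borel_measurable L"
  shows "(\<integral>x. f (p x) \<partial>K) = (\<integral>x. f x \<partial>L)"
  using assms integral_distr[of p K L f] by (simp add: measure_preserving_def)

lemma measure_preserving_integrable:
  fixes f :: "'b \<Rightarrow> 'c::{banach, second_countable_topology}"
  assumes "measure_preserving K L p" "integrable L f"
  shows "integrable K (\<lambda>x. f (p x))"
  using assms integrable_distr[of p K L f] by (simp add: measure_preserving_def)

lemma measure_preserving_measure:
  assumes "measure_preserving K L p" "A \<in> sets L"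
  shows "measure K (p -` A \<inter> space K) = measure L A"
  using assms measure_distr[of p K L A] by (simp add: measure_preserving_def)

lemma measure_preserving_comp:
  assumes "measure_preserving K L p" "measure_preserving L M q"
  shows "measure_preserving K M (\<lambda>x. q (p x))"
  using assms distr_distr[of q L M p K]
  by (auto simp: measure_preserving_def o_def intro: measurable_compose)

lemma borel_measurable_cnj [measurable]: "cnj \<in> borel_measurable borel"
  by (intro borel_measurable_continuous_onI continuous_intros)

section \<open>Square integrable functions\<close>

text \<open>These are genuine functions, not classes. Equality almost everywhere is divided out only
  later, when functions are encoded by their integrals.\<close>

definition L2 :: "'a measure \<Rightarrow> ('a \<Rightarrow> complex) set" where
  "L2 K = {f \<in> borel_measurable K. integrable K (\<lambda>x. (cmod (f x))\<^sup>2)}"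

definition norm2 :: "'a measure \<Rightarrow> ('a \<Rightarrow> complex) \<Rightarrow> real" where
  "norm2 K f = sqrt (\<integral>x. (cmod (f x))\<^sup>2 \<partial>K)"

lemma L2_measurable [measurable_dest]: "f \<in> L2 K \<Longrightarrow> f \<in> borel_measurable K"
  by (simp add: L2_def)

lemma norm2_nonneg: "0 \<le> norm2 K f"
  by (simp add: norm2_def)

lemma L2_add:
  assumes "f \<in> L2 K" "g \<in> L2 K"
  shows "(\<lambda>x. f x + g x) \<in> L2 K"
proof -
  have [measurable]: "f \<in> borel_measurable K" "g \<in> borel_measurable K"
    using assms by (auto simp: L2_def)
  have "integrable K (\<lambda>x. 2 * (cmod (f x))\<^sup>2 + 2 * (cmod (g x))\<^sup>2)"
    using assms by (simp add: L2_def)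
  then have "integrable K (\<lambda>x. (cmod (f x + g x))\<^sup>2)"
  proof (rule Bochner_Integration.integrable_bound)
    have "(cmod (f x + g x))\<^sup>2 \<le> 2 * (cmod (f x))\<^sup>2 + 2 * (cmod (g x))\<^sup>2" for x
    proof -
      have "(cmod (f x + g x))\<^sup>2 \<le> (cmod (f x) + cmod (g x))\<^sup>2"
        by (intro power_mono norm_triangle_ineq norm_ge_zero)
      also have "\<dots> \<le> 2 * (cmod (f x))\<^sup>2 + 2 * (cmod (g x))\<^sup>2"
        using sum_squares_bound[of "cmod (f x)" "cmod (g x)"] by (simp add: power2_sum)
      finally show ?thesis .
    qed
    then show "AE x in K. norm ((cmod (f x + g x))\<^sup>2)
        \<le> norm (2 * (cmod (f x))\<^sup>2 + 2 * (cmod (g x))\<^sup>2)"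
      by (intro AE_I2) simp
  qed simp
  then show ?thesis by (simp add: L2_def)
qed

lemma L2_cmult: "f \<in> L2 K \<Longrightarrow> (\<lambda>x. c * f x) \<in> L2 K"
  by (auto simp: L2_def norm_mult power_mult_distrib)

lemma L2_diff:
  assumes "f \<in> L2 K" "g \<in> L2 K"
  shows "(\<lambda>x. f x - g x) \<in> L2 K"
  using L2_add[OF assms(1) L2_cmult[OF assms(2), of "-1"]] by simp

lemma L2_zero: "(\<lambda>x. 0) \<in> L2 K"
  by (simp add: L2_def)

lemma L2_integrable_mult_cnj:
  assumes "f \<in> L2 K" "g \<in> L2 K"
  shows "integrable K (\<lambda>x. f x * cnj (g x))"
proof -
  have [measurable]: "f \<in> borel_measurable K" "g \<in> borel_measurable K"
    using assms by (auto simp: L2_def)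
  have "integrable K (\<lambda>x. (cmod (f x))\<^sup>2 + (cmod (g x))\<^sup>2)"
    using assms by (simp add: L2_def)
  then show ?thesis
  proof (rule Bochner_Integration.integrable_bound)
    have "cmod (f x) * cmod (g x) \<le> (cmod (f x))\<^sup>2 + (cmod (g x))\<^sup>2" for x
    proof -
      have "0 \<le> cmod (f x) * cmod (g x)" by simp
      then show ?thesis using sum_squares_bound[of "cmod (f x)" "cmod (g x)"] by linarith
    qed
    then show "AE x in K. norm (f x * cnj (g x)) \<le> norm ((cmod (f x))\<^sup>2 + (cmod (g x))\<^sup>2)"
      by (intro AE_I2) (simp add: norm_mult)
  qed simp
qed

lemma norm2_triangle:
  assumes "f \<in> L2 K" "g \<in> L2 K"
  shows "norm2 K (\<lambda>x. f x + g x) \<le> norm2 K f + norm2 K g"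
  unfolding norm2_def
  by (rule minkowski_L2)
    (use assms L2_add[OF assms] in \<open>auto simp: L2_def norm_triangle_ineq\<close>)

context prob_space begin

lemma L2_integrable: "f \<in> L2 M \<Longrightarrow> integrable M f"
proof -
  assume f: "f \<in> L2 M"
  then have [measurable]: "f \<in> borel_measurable M" by (simp add: L2_def)
  have "integrable M (\<lambda>x. 1 + (cmod (f x))\<^sup>2)" using f by (simp add: L2_def)
  then show ?thesis
  proof (rule Bochner_Integration.integrable_bound)
    have "cmod (f x) \<le> 1 + (cmod (f x))\<^sup>2" for x
      using sum_squares_bound[of 1 "cmod (f x)"] norm_ge_zero[of "f x"]
      unfolding power_one mult_1_right by linarith
    then show "AE x in M. norm (f x) \<le> norm (1 + (cmod (f x))\<^sup>2)"
      by (intro AE_I2) simp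
  qed simp
qed

text \<open>This is the nonnegativity of the variance of the modulus of \<open>f\<close>.\<close>

lemma integral_norm_le_norm2:
  assumes "f \<in> L2 M"
  shows "(\<integral>x. cmod (f x) \<partial>M) \<le> norm2 M f"
proof -
  have i: "integrable M (\<lambda>x. cmod (f x))" using L2_integrable[OF assms] by simp
  have "(\<integral>x. cmod (f x) \<partial>M)\<^sup>2 \<le> (\<integral>x. (cmod (f x))\<^sup>2 \<partial>M)"
  proof -
    have "0 \<le> variance (\<lambda>x. cmod (f x))" by simp
    also have "\<dots> = (\<integral>x. (cmod (f x))\<^sup>2 \<partial>M) - (\<integral>x. cmod (f x) \<partial>M)\<^sup>2"
      using assms by (intro variance_eq[OF i]) (simp add: L2_def)
    finally show ?thesis by simp
  qed
  then show ?thesis unfolding norm2_def by (rule real_le_rsqrt)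
qed

lemma bounded_L2:
  assumes "f \<in> borel_measurable M" "\<And>x. cmod (f x) \<le> C"
  shows "f \<in> L2 M"
proof -
  have "integrable M (\<lambda>x. (cmod (f x))\<^sup>2)"
    using assms by (intro integrable_const_bound[of _ "C\<^sup>2"]) (auto intro!: power_mono)
  with assms show ?thesis by (simp add: L2_def)
qed

text \<open>An L2-Cauchy sequence is L1-Cauchy on a probability space, so a subsequence converges
  almost everywhere. Fatou's lemma along this subsequence carries the Cauchy estimate over to the
  limit \<open>F\<close>.\<close>

lemma L2_complete:
  fixes f :: "nat \<Rightarrow> 'a \<Rightarrow> complex"
  assumes f: "\<And>n. f n \<in> L2 M"
    and C: "\<And>e. e > 0 \<Longrightarrow> \<exists>N. \<forall>n\<ge>N. \<forall>m\<ge>N. norm2 M (\<lambda>x. f n x - f m x) < e"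
  obtains F where "F \<in> L2 M" "(\<lambda>n. norm2 M (\<lambda>x. f n x - F x)) \<longlonglongrightarrow> 0"
proof -
  have [measurable]: "f n \<in> borel_measurable M" for n using f by (simp add: L2_def)
  have L1: "\<exists>N. \<forall>i\<ge>N. \<forall>j\<ge>N. (\<integral>x. norm (f i x - f j x) \<partial>M) < e" if e: "e > 0" for e
  proof -
    obtain N where N: "\<forall>n\<ge>N. \<forall>m\<ge>N. norm2 M (\<lambda>x. f n x - f m x) < e" using C[OF e] by blast
    have "(\<integral>x. norm (f i x - f j x) \<partial>M) < e" if "i \<ge> N" "j \<ge> N" for i j
      using le_less_trans[OF integral_norm_le_norm2[OF L2_diff[OF f[of i] f[of j]]]] N that by simp
    then show ?thesis by blast
  qed
  obtain r where r: "strict_mono r" "AE x in M. Cauchy (\<lambda>i. f (r i) x)"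
    by (rule cauchy_L1_AE_cauchy_subseq[of M f]) (use L2_integrable[OF f] L1 in auto)
  define F where "F x = lim (\<lambda>i. f (r i) x)" for x
  have [measurable]: "F \<in> borel_measurable M"
    unfolding F_def by (rule borel_measurable_lim_metric) simp
  have lim: "AE x in M. (\<lambda>i. f (r i) x) \<longlonglongrightarrow> F x"
    using r(2)
  proof eventually_elim
    case (elim x)
    then show ?case unfolding F_def by (simp add: Cauchy_convergent_iff convergent_LIMSEQ_iff)
  qed
  have est: "integrable M (\<lambda>x. (cmod (f n x - F x))\<^sup>2) \<and> norm2 M (\<lambda>x. f n x - F x) \<le> e"
    if e: "e > 0" and N: "\<And>n m. n \<ge> N \<Longrightarrow> m \<ge> N \<Longrightarrow> norm2 M (\<lambda>x. f n x - f m x) < e" and n: "n \<ge> N"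
    for n e N
  proof -
    have "(\<integral>\<^sup>+x. ennreal ((cmod (f n x - F x))\<^sup>2) \<partial>M)
        = (\<integral>\<^sup>+x. liminf (\<lambda>i. ennreal ((cmod (f n x - f (r i) x))\<^sup>2)) \<partial>M)"
    proof (rule nn_integral_cong_AE)
      show "AE x in M. ennreal ((cmod (f n x - F x))\<^sup>2)
          = liminf (\<lambda>i. ennreal ((cmod (f n x - f (r i) x))\<^sup>2))"
        using lim
      proof eventually_elim
        case (elim x)
        have "(\<lambda>i. ennreal ((cmod (f n x - f (r i) x))\<^sup>2)) \<longlonglongrightarrow> ennreal ((cmod (f n x - F x))\<^sup>2)"
          by (intro tendsto_ennrealI tendsto_intros elim)
        then show ?case by (rule lim_imp_Liminf[OF sequentially_bot, symmetric])
      qed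
    qed
    also have "\<dots> \<le> liminf (\<lambda>i. \<integral>\<^sup>+x. ennreal ((cmod (f n x - f (r i) x))\<^sup>2) \<partial>M)"
      by (rule nn_integral_liminf) simp
    also have "\<dots> \<le> ennreal (e\<^sup>2)"
    proof (rule Liminf_le)
      show "\<forall>\<^sub>F i in sequentially. (\<integral>\<^sup>+x. ennreal ((cmod (f n x - f (r i) x))\<^sup>2) \<partial>M) \<le> ennreal (e\<^sup>2)"
        using eventually_ge_at_top[of N]
      proof eventually_elim
        case (elim i)
        then have "norm2 M (\<lambda>x. f n x - f (r i) x) < e"
          using N[OF n] seq_suble[OF r(1), of i] le_trans by blast
        then have "(norm2 M (\<lambda>x. f n x - f (r i) x))\<^sup>2 \<le> e\<^sup>2"
          by (intro power_mono norm2_nonneg) simp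
        then have "(\<integral>x. (cmod (f n x - f (r i) x))\<^sup>2 \<partial>M) \<le> e\<^sup>2"
          by (simp add: norm2_def)
        moreover have "integrable M (\<lambda>x. (cmod (f n x - f (r i) x))\<^sup>2)"
          using L2_diff[OF f f, of n "r i"] by (simp add: L2_def)
        ultimately show ?case
          by (subst nn_integral_eq_integral) (auto intro: ennreal_leI)
      qed
    qed simp
    finally have fin: "(\<integral>\<^sup>+x. ennreal ((cmod (f n x - F x))\<^sup>2) \<partial>M) \<le> ennreal (e\<^sup>2)" .
    then have i: "integrable M (\<lambda>x. (cmod (f n x - F x))\<^sup>2)"
      by (intro integrableI_bounded) (auto simp: le_less_trans[OF _ ennreal_less_top])
    then have "(\<integral>x. (cmod (f n x - F x))\<^sup>2 \<partial>M) \<le> e\<^sup>2"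
      using fin by (subst (asm) nn_integral_eq_integral) auto
    then have "norm2 M (\<lambda>x. f n x - F x) \<le> e"
      unfolding norm2_def using e by (intro real_le_lsqrt) auto
    with i show ?thesis by simp
  qed
  have "F \<in> L2 M"
  proof -
    obtain N where N: "\<And>n m. n \<ge> N \<Longrightarrow> m \<ge> N \<Longrightarrow> norm2 M (\<lambda>x. f n x - f m x) < 1"
      using C[of 1] by auto
    have "(\<lambda>x. f N x - F x) \<in> L2 M" using est[OF _ N, of N] by (simp add: L2_def)
    from L2_diff[OF f[of N] this] show ?thesis by simp
  qed
  moreover have "(\<lambda>n. norm2 M (\<lambda>x. f n x - F x)) \<longlonglongrightarrow> 0"
  proof (rule LIMSEQ_I)
    fix e :: real assume e: "e > 0"
    then obtain N where N: "\<And>n m. n \<ge> N \<Longrightarrow> m \<ge> N \<Longrightarrow> norm2 M (\<lambda>x. f n x - f m x) < e / 2"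
      using C[of "e/2"] by auto
    have "norm (norm2 M (\<lambda>x. f n x - F x) - 0) < e" if "n \<ge> N" for n
      using est[OF _ N that] e norm2_nonneg[of M] by auto
    then show "\<exists>N. \<forall>n\<ge>N. norm (norm2 M (\<lambda>x. f n x - F x) - 0) < e" by blast
  qed
  ultimately show thesis by (rule that)
qed

end

section \<open>Hilbert spaces of square integrable functions\<close>

text \<open>The sets in \<open>D\<close> cut out the closed subspace of functions whose integrals
  over them vanish. With \<open>D\<close> empty this is all of L2; with the whole space as its only
  member it is the space of functions of mean zero.\<close>

locale l2_space = prob_space K for K :: "'a measure" +
  fixes E :: "nat \<Rightarrow> 'a set" and D :: "'a set set"
  assumes E: "range E \<subseteq> sets K" "sets K = sigma_sets (space K) (range E)"
      "Int_stable (range E)" "space K \<in> range E"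
    and D: "D \<subseteq> sets K"
begin

definition vecs :: "('a \<Rightarrow> complex) set" where
  "vecs = {f \<in> L2 K. \<forall>A\<in>D. (\<integral>x. indicator A x *\<^sub>R f x \<partial>K) = 0}"

text \<open>An element of \<open>L\<^sup>2\<close> is encoded by its integrals over a countable generating \<open>\<pi>\<close>-system;
  this is linear and injective modulo equality almost everywhere.\<close>

definition enc :: "('a \<Rightarrow> complex) \<Rightarrow> nat \<Rightarrow> complex" where
  "enc f = (\<lambda>n. \<integral>x. indicator (E n) x *\<^sub>R f x \<partial>K)"

definition dec :: "(nat \<Rightarrow> complex) \<Rightarrow> 'a \<Rightarrow> complex" where
  "dec v = (SOME f. f \<in> vecs \<and> enc f = v)"

definition ip :: "('a \<Rightarrow> complex) \<Rightarrow> ('a \<Rightarrow> complex) \<Rightarrow> complex" where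
  "ip f g = (\<integral>x. f x * cnj (g x) \<partial>K)"

definition proj :: "(nat \<Rightarrow> complex) \<Rightarrow> nat \<Rightarrow> complex" where
  "proj v = (if v \<in> enc ` vecs then v else (\<lambda>_. 0))"

text \<open>Sequences outside the carrier are treated as zero: the class of metric spaces demands a
  distance that is symmetric on the whole type.\<close>

definition V :: "(nat \<Rightarrow> complex) hilbert" where
  "V = \<lparr>carrier = enc ` vecs, monoid.mult = (\<lambda>v w. v), one = (\<lambda>_. 0), ring.zero = (\<lambda>_. 0),
     add = (\<lambda>v w n. proj v n + proj w n), smult = (\<lambda>c v n. c * v n),
     inprod = (\<lambda>v w. ip (dec v) (dec w))\<rparr>"

lemma vecs_L2: "f \<in> vecs \<Longrightarrow> f \<in> L2 K"
  by (simp add: vecs_def)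

lemma integrable_indicator_L2:
  assumes "f \<in> L2 K" "A \<in> sets K"
  shows "integrable K (\<lambda>x. indicator A x *\<^sub>R f x)"
  using integrable_mult_indicator[OF assms(2) L2_integrable[OF assms(1)]] .

lemma E_sets: "E n \<in> sets K"
  using E(1) by auto

lemma enc_add:
  assumes "f \<in> L2 K" "g \<in> L2 K"
  shows "enc (\<lambda>x. f x + g x) = (\<lambda>n. enc f n + enc g n)"
  using assms by (auto simp: enc_def scaleR_add_right integrable_indicator_L2 E_sets)

lemma enc_cmult: "enc (\<lambda>x. c * f x) = (\<lambda>n. c * enc f n)"
  by (simp add: enc_def mult_scaleR_right[symmetric] del: mult_scaleR_right)

lemma vecs_add:
  assumes "f \<in> vecs" "g \<in> vecs"
  shows "(\<lambda>x. f x + g x) \<in> vecs"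
proof -
  have "(\<integral>x. indicator A x *\<^sub>R (f x + g x) \<partial>K) = 0" if "A \<in> D" for A
    using assms that D by (auto simp: scaleR_add_right vecs_def integrable_indicator_L2 subset_iff)
  with assms show ?thesis by (simp add: vecs_def L2_add)
qed

lemma vecs_cmult:
  assumes "f \<in> vecs"
  shows "(\<lambda>x. c * f x) \<in> vecs"
proof -
  have "(\<integral>x. indicator A x *\<^sub>R (c * f x) \<partial>K) = 0" if "A \<in> D" for A
    using assms that by (simp add: mult_scaleR_right[symmetric] vecs_def del: mult_scaleR_right)
  with assms show ?thesis by (simp add: vecs_def L2_cmult)
qed

lemma vecs_zero: "(\<lambda>_. 0) \<in> vecs"
  by (simp add: vecs_def L2_zero)

lemma vecs_diff: "f \<in> vecs \<Longrightarrow> g \<in> vecs \<Longrightarrow> (\<lambda>x. f x - g x) \<in> vecs"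
  using vecs_add[of f "\<lambda>x. -1 * g x"] vecs_cmult[of g "-1"] by simp

lemma enc_cong_AE:
  assumes "f \<in> borel_measurable K" "g \<in> borel_measurable K" "AE x in K. f x = g x"
  shows "enc f = enc g"
proof
  fix n
  have [measurable]: "f \<in> borel_measurable K" "g \<in> borel_measurable K" "E n \<in> sets K"
    using assms E_sets by auto
  show "enc f n = enc g n"
    unfolding enc_def
  proof (rule integral_cong_AE)
    show "AE x in K. indicator (E n) x *\<^sub>R f x = indicator (E n) x *\<^sub>R g x"
      using assms(3) by eventually_elim simp
  qed simp_all
qed

lemma enc_eqD:
  assumes "f \<in> L2 K" "g \<in> L2 K" "enc f = enc g"
  shows "AE x in K. f x = g x"
proof -
  have d: "(\<lambda>x. f x - g x) \<in> L2 K" using assms by (intro L2_diff)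
  have "AE x in K. f x - g x = 0"
  proof (rule AE_zero_if_integrals_zero[OF _ L2_integrable[OF d] E(2,3) _ E(4)])
    show "sigma_finite_measure K" by unfold_locales
    show "range E \<subseteq> Pow (space K)" using E(1) sets.sets_into_space by blast
    fix A assume "A \<in> range E"
    then obtain n where n: "A = E n" by blast
    have "(\<integral>x. indicator A x *\<^sub>R (f x - g x) \<partial>K) = enc f n - enc g n"
      using assms(1,2) by (simp add: n enc_def scaleR_diff_right integrable_indicator_L2 E_sets)
    then show "(\<integral>x. indicator A x *\<^sub>R (f x - g x) \<partial>K) = 0" using assms(3) by simp
  qed
  then show ?thesis by simp
qed

lemma dec:
  assumes "v \<in> enc ` vecs"
  shows "dec v \<in> vecs \<and> enc (dec v) = v"
proof -
  have "\<exists>f. f \<in> vecs \<and> enc f = v" using assms by auto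
  then show ?thesis unfolding dec_def by (rule someI_ex)
qed

lemma dec_enc:
  assumes "f \<in> vecs"
  shows "AE x in K. dec (enc f) x = f x"
  using dec[of "enc f"] assms by (intro enc_eqD vecs_L2) auto

lemma ip_cong_AE:
  assumes "f \<in> borel_measurable K" "g \<in> borel_measurable K" "f' \<in> borel_measurable K" "g' \<in> borel_measurable K"
    and "AE x in K. f x = f' x" "AE x in K. g x = g' x"
  shows "ip f g = ip f' g'"
  unfolding ip_def
proof (rule integral_cong_AE)
  show "AE x in K. f x * cnj (g x) = f' x * cnj (g' x)"
    using assms(5,6) by eventually_elim simp
qed (use assms(1-4) in measurable)

lemma inprod_enc:
  assumes "f \<in> vecs" "g \<in> vecs"
  shows "inprod V (enc f) (enc g) = ip f g"
proof -
  have "dec (enc f) \<in> vecs" "dec (enc g) \<in> vecs" using assms dec by auto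
  then show ?thesis
    unfolding V_def using dec_enc assms
    by (auto intro!: ip_cong_AE simp: vecs_def L2_def)
qed

lemma ip_self: "ip f f = of_real ((norm2 K f)\<^sup>2)"
proof -
  have "ip f f = (\<integral>x. complex_of_real ((cmod (f x))\<^sup>2) \<partial>K)"
    unfolding ip_def by (simp add: complex_norm_square[symmetric] del: of_real_power)
  then show ?thesis by (simp add: norm2_def del: of_real_power)
qed

lemma hnorm_enc: "f \<in> vecs \<Longrightarrow> hnorm V (enc f) = norm2 K f"
  by (simp add: hnorm_def inprod_enc ip_self norm2_nonneg)

lemma carrier_V: "carrier V = enc ` vecs"
  by (simp add: V_def)

lemma add_V: "v \<oplus>\<^bsub>V\<^esub> w = (\<lambda>n. proj v n + proj w n)"
  by (simp add: V_def)

lemma proj_id: "v \<in> carrier V \<Longrightarrow> proj v = v"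
  by (simp add: carrier_V proj_def)

lemma zero_V: "\<zero>\<^bsub>V\<^esub> = (\<lambda>_. 0)"
  by (simp add: V_def)

lemma smult_V: "c \<odot>\<^bsub>V\<^esub> v = (\<lambda>n. c * v n)"
  by (simp add: V_def)

lemma enc_zero: "enc (\<lambda>_. 0) = (\<lambda>_. 0)"
  by (simp add: enc_def)

lemma zero_carrier: "(\<lambda>_. 0) \<in> carrier V"
  using vecs_zero enc_zero by (auto simp: carrier_V intro: image_eqI[of _ _ "\<lambda>_. 0"])

lemma proj_carrier: "proj v \<in> carrier V"
  using zero_carrier by (simp add: proj_def carrier_V)

lemma V_smult_enc: "c \<odot>\<^bsub>V\<^esub> enc f = enc (\<lambda>x. c * f x)"
  by (simp add: smult_V enc_cmult)

lemma carrier_cmult: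
  assumes "v \<in> carrier V"
  shows "(\<lambda>n. c * v n) \<in> carrier V"
proof -
  obtain f where f: "f \<in> vecs" "v = enc f" using assms by (auto simp: carrier_V)
  then have "(\<lambda>n. c * v n) = enc (\<lambda>x. c * f x)" by (simp add: enc_cmult)
  then show ?thesis using f(1) vecs_cmult by (auto simp: carrier_V)
qed

lemma V_add_enc:
  assumes "f \<in> vecs" "g \<in> vecs"
  shows "enc f \<oplus>\<^bsub>V\<^esub> enc g = enc (\<lambda>x. f x + g x)"
  using assms by (simp add: add_V proj_def enc_add vecs_L2)

lemma carrier_add:
  assumes "v \<in> carrier V" "w \<in> carrier V"
  shows "(\<lambda>n. v n + w n) \<in> carrier V"
proof -
  obtain f g where fg: "f \<in> vecs" "v = enc f" "g \<in> vecs" "w = enc g"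
    using assms by (auto simp: carrier_V)
  then have "(\<lambda>n. v n + w n) = enc (\<lambda>x. f x + g x)" by (simp add: enc_add vecs_L2)
  then show ?thesis using fg vecs_add by (auto simp: carrier_V)
qed

lemma carrier_uminus: "v \<in> carrier V \<Longrightarrow> (\<lambda>n. - v n) \<in> carrier V"
  using carrier_cmult[of v "-1"] by simp

lemma V_abelian: "abelian_group V"
proof (rule abelian_groupI)
  fix u v w assume uvw: "u \<in> carrier V" "v \<in> carrier V" "w \<in> carrier V"
  show "u \<oplus>\<^bsub>V\<^esub> v \<oplus>\<^bsub>V\<^esub> w = u \<oplus>\<^bsub>V\<^esub> (v \<oplus>\<^bsub>V\<^esub> w)"
    using uvw by (simp add: add_V proj_id carrier_add add.assoc)
next
  fix v assume v: "v \<in> carrier V"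
  then show "\<exists>w\<in>carrier V. w \<oplus>\<^bsub>V\<^esub> v = \<zero>\<^bsub>V\<^esub>"
    using carrier_uminus[OF v]
    by (intro bexI[of _ "\<lambda>n. - v n"]) (simp_all add: add_V zero_V proj_id)
qed (simp_all add: carrier_add zero_V zero_carrier add_V proj_id add.commute)

lemma V_module: "Module.module complex_ring V"
proof (rule moduleI[OF _ V_abelian])
  show "cring complex_ring"
    using hilbert_space.axioms(1)[OF hilbert_space_complex] by (rule module.axioms(1))
qed (simp_all add: smult_V add_V carrier_cmult proj_id complex_ring_def algebra_simps)

text \<open>The formula holds for every sequence \<open>w\<close>, also outside the carrier, where
  \<open>proj w\<close> is 0. It is needed in this generality because the distance must be symmetric
  on the whole type.\<close>

lemma a_inv_V: "\<ominus>\<^bsub>V\<^esub> w = (\<lambda>n. - proj w n)"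
  unfolding a_inv_def m_inv_def
proof (rule the_equality)
  show "(\<lambda>n. - proj w n) \<in> carrier (add_monoid V) \<and>
      w \<otimes>\<^bsub>add_monoid V\<^esub> (\<lambda>n. - proj w n) = \<one>\<^bsub>add_monoid V\<^esub> \<and>
      (\<lambda>n. - proj w n) \<otimes>\<^bsub>add_monoid V\<^esub> w = \<one>\<^bsub>add_monoid V\<^esub>"
    using carrier_uminus[OF proj_carrier[of w]] by (simp add: add_V zero_V proj_id)
next
  fix y assume "y \<in> carrier (add_monoid V) \<and>
      w \<otimes>\<^bsub>add_monoid V\<^esub> y = \<one>\<^bsub>add_monoid V\<^esub> \<and> y \<otimes>\<^bsub>add_monoid V\<^esub> w = \<one>\<^bsub>add_monoid V\<^esub>"
  then have "y \<in> carrier V" "y \<oplus>\<^bsub>V\<^esub> w = \<zero>\<^bsub>V\<^esub>" by simp_all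
  then have "\<And>n. y n + proj w n = 0" by (simp add: add_V zero_V proj_id fun_eq_iff)
  then show "y = (\<lambda>n. - proj w n)" by (simp add: fun_eq_iff eq_neg_iff_add_eq_0)
qed

lemma V_minus: "v \<ominus>\<^bsub>V\<^esub> w = (\<lambda>n. proj v n - proj w n)"
  using carrier_uminus[OF proj_carrier[of w]] by (simp add: a_minus_def a_inv_V add_V proj_id)

lemma V_minus_enc:
  assumes "f \<in> vecs" "g \<in> vecs"
  shows "enc f \<ominus>\<^bsub>V\<^esub> enc g = enc (\<lambda>x. f x - g x)"
proof -
  have "enc (\<lambda>x. f x - g x) = enc (\<lambda>x. f x + -1 * g x)" by simp
  also have "\<dots> = (\<lambda>n. enc f n - enc g n)"
    using assms vecs_cmult[of g "-1"] by (subst enc_add) (simp_all add: vecs_L2 enc_cmult[of "-1", simplified])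
  finally show ?thesis using assms by (simp add: V_minus proj_def)
qed

lemma norm2_eq_0:
  assumes "f \<in> L2 K" "norm2 K f = 0"
  shows "AE x in K. f x = 0"
proof -
  have "AE x in K. (cmod (f x))\<^sup>2 = 0"
    using assms by (subst integral_nonneg_eq_0_iff_AE[symmetric]) (auto simp: L2_def norm2_def)
  then show ?thesis by simp
qed

lemma norm2_minus_commute: "norm2 K (\<lambda>x. f x - g x) = norm2 K (\<lambda>x. g x - f x)"
  by (simp add: norm2_def norm_minus_commute)

lemma V_Metric_space: "Metric_space (carrier V) (\<lambda>x y. hnorm V (x \<ominus>\<^bsub>V\<^esub> y))"
proof
  have d: "hnorm V (enc f \<ominus>\<^bsub>V\<^esub> enc g) = norm2 K (\<lambda>x. f x - g x)" if "f \<in> vecs" "g \<in> vecs" for f g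
    using that by (simp add: V_minus_enc hnorm_enc vecs_diff)
  have proj_enc: "\<exists>f\<in>vecs. proj v = enc f" for v
    using proj_carrier[of v] by (auto simp: carrier_V)
  have minus_proj: "v \<ominus>\<^bsub>V\<^esub> w = proj v \<ominus>\<^bsub>V\<^esub> proj w" for v w
    using proj_carrier by (simp add: V_minus proj_id)
  show "0 \<le> hnorm V (v \<ominus>\<^bsub>V\<^esub> w)" for v w
    using proj_enc[of v] proj_enc[of w] by (auto simp: minus_proj[of v w] d norm2_nonneg)
  show "hnorm V (v \<ominus>\<^bsub>V\<^esub> w) = hnorm V (w \<ominus>\<^bsub>V\<^esub> v)" for v w
    using proj_enc[of v] proj_enc[of w] norm2_minus_commute
    by (auto simp: minus_proj[of v w] minus_proj[of w v] d)
  show "hnorm V (v \<ominus>\<^bsub>V\<^esub> w) = 0 \<longleftrightarrow> v = w" if vw: "v \<in> carrier V" "w \<in> carrier V" for v w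
  proof -
    obtain f g where fg: "f \<in> vecs" "v = enc f" "g \<in> vecs" "w = enc g"
      using vw by (auto simp: carrier_V)
    have 1: "AE x in K. f x = g x" if "norm2 K (\<lambda>x. f x - g x) = 0"
      using norm2_eq_0[OF vecs_L2[OF vecs_diff[OF fg(1,3)]] that] by simp
    have 2: "norm2 K (\<lambda>x. f x - g x) = 0" if "AE x in K. f x = g x"
    proof -
      have [measurable]: "f \<in> borel_measurable K" "g \<in> borel_measurable K"
        using L2_measurable[OF vecs_L2] fg by auto
      have "(\<integral>x. (cmod (f x - g x))\<^sup>2 \<partial>K) = (\<integral>x. 0 \<partial>K)"
      proof (rule integral_cong_AE)
        show "AE x in K. (cmod (f x - g x))\<^sup>2 = 0" using that by eventually_elim simp
      qed simp_all
      then show ?thesis by (simp add: norm2_def)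
    qed
    have "norm2 K (\<lambda>x. f x - g x) = 0 \<longleftrightarrow> enc f = enc g"
      using 1 2 enc_cong_AE[OF L2_measurable[OF vecs_L2] L2_measurable[OF vecs_L2], of f g]
        enc_eqD[OF vecs_L2 vecs_L2, of f g] fg by blast
    then show ?thesis by (simp add: fg d)
  qed
  show "hnorm V (u \<ominus>\<^bsub>V\<^esub> w) \<le> hnorm V (u \<ominus>\<^bsub>V\<^esub> v) + hnorm V (v \<ominus>\<^bsub>V\<^esub> w)"
    if uvw: "u \<in> carrier V" "v \<in> carrier V" "w \<in> carrier V" for u v w
  proof -
    obtain f g h where fg: "f \<in> vecs" "u = enc f" "g \<in> vecs" "v = enc g" "h \<in> vecs" "w = enc h"
      using uvw by (auto simp: carrier_V)
    show ?thesis
      using norm2_triangle[OF vecs_L2[OF vecs_diff[OF fg(1,3)]] vecs_L2[OF vecs_diff[OF fg(3,5)]]]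
      by (simp add: fg d)
  qed
qed

lemma V_mcomplete: "Metric_space.mcomplete (carrier V) (\<lambda>x y. hnorm V (x \<ominus>\<^bsub>V\<^esub> y))"
proof -
  interpret Met: Metric_space "carrier V" "\<lambda>x y. hnorm V (x \<ominus>\<^bsub>V\<^esub> y)" by (rule V_Metric_space)
  have d: "hnorm V (enc f \<ominus>\<^bsub>V\<^esub> enc g) = norm2 K (\<lambda>x. f x - g x)" if "f \<in> vecs" "g \<in> vecs" for f g
    using that by (simp add: V_minus_enc hnorm_enc vecs_diff)
  show ?thesis
    unfolding Met.mcomplete_def
  proof (intro allI impI)
    fix s assume s: "Met.MCauchy s"
    define f where "f n = dec (s n)" for n
    have "range s \<subseteq> carrier V" using s unfolding Met.MCauchy_def by blast
    then have "s n \<in> enc ` vecs" for n by (auto simp: carrier_V)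
    then have f: "\<And>n. f n \<in> vecs" "\<And>n. s n = enc (f n)" using dec by (simp_all add: f_def)
    have C: "\<exists>N. \<forall>n\<ge>N. \<forall>m\<ge>N. norm2 K (\<lambda>x. f n x - f m x) < e" if e: "e > 0" for e
    proof -
      obtain N where "\<forall>n n'. N \<le> n \<longrightarrow> N \<le> n' \<longrightarrow> hnorm V (s n \<ominus>\<^bsub>V\<^esub> s n') < e"
        using conjunct2[OF s[unfolded Met.MCauchy_def]] e by blast
      then show ?thesis using f d by auto
    qed
    obtain F where F: "F \<in> L2 K" "(\<lambda>n. norm2 K (\<lambda>x. f n x - F x)) \<longlonglongrightarrow> 0"
      by (rule L2_complete[of f]) (use f vecs_L2 C in auto)
    \<comment> \<open>The subspace is closed: the integral over \<open>A\<close> is dominated by the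
      L2 norm, so its vanishing passes from the \<open>f n\<close> to their limit.\<close>
    have "(\<integral>x. indicator A x *\<^sub>R F x \<partial>K) = 0" if A: "A \<in> D" for A
    proof -
      have [measurable]: "A \<in> sets K" using A D by auto
      have "norm (\<integral>x. indicator A x *\<^sub>R F x \<partial>K) \<le> norm2 K (\<lambda>x. f n x - F x)" for n
      proof -
        have L: "(\<lambda>x. f n x - F x) \<in> L2 K" by (rule L2_diff[OF vecs_L2[OF f(1)] F(1)])
        have "(\<integral>x. indicator A x *\<^sub>R F x \<partial>K) = - (\<integral>x. indicator A x *\<^sub>R (f n x - F x) \<partial>K)"
          using f(1)[of n] A integrable_indicator_L2[OF F(1), of A] integrable_indicator_L2[OF vecs_L2[OF f(1)], of A n]
          by (simp add: scaleR_diff_right vecs_def)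
        then have "norm (\<integral>x. indicator A x *\<^sub>R F x \<partial>K) = norm (\<integral>x. indicator A x *\<^sub>R (f n x - F x) \<partial>K)"
          by simp
        also have "\<dots> \<le> (\<integral>x. norm (indicator A x *\<^sub>R (f n x - F x)) \<partial>K)"
          by (rule integral_norm_bound)
        also have "\<dots> \<le> (\<integral>x. norm (f n x - F x) \<partial>K)"
        proof (rule integral_mono)
          show "integrable K (\<lambda>x. norm (indicator A x *\<^sub>R (f n x - F x)))"
            using integrable_indicator_L2[OF L, of A] by (intro integrable_norm) simp
        qed (use L2_integrable[OF L] in \<open>auto simp: indicator_def\<close>)
        also have "\<dots> \<le> norm2 K (\<lambda>x. f n x - F x)" by (rule integral_norm_le_norm2[OF L])
        finally show ?thesis .
      qed
      then have "norm (\<integral>x. indicator A x *\<^sub>R F x \<partial>K) \<le> 0"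
        by (intro LIMSEQ_le_const[OF F(2)] exI[of _ 0] allI impI)
      then show ?thesis by simp
    qed
    with F(1) have Fv: "F \<in> vecs" by (simp add: vecs_def)
    have "limitin Met.mtopology s (enc F) sequentially"
      unfolding Met.limit_metric_sequentially
    proof (intro conjI allI impI)
      show "enc F \<in> carrier V" using Fv by (simp add: carrier_V)
      fix e :: real assume "e > 0"
      then obtain N where "\<And>n. n \<ge> N \<Longrightarrow> norm (norm2 K (\<lambda>x. f n x - F x) - 0) < e"
        using LIMSEQ_D[OF F(2)] by blast
      then show "\<exists>N. \<forall>n\<ge>N. s n \<in> carrier V \<and> hnorm V (s n \<ominus>\<^bsub>V\<^esub> enc F) < e"
        by (intro exI[of _ N]) (simp add: f(2) d[OF f(1) Fv] norm2_nonneg carrier_V f(1))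
    qed
    then show "\<exists>v. limitin Met.mtopology s v sequentially" by blast
  qed
qed

lemma ip_add_left:
  assumes "f \<in> L2 K" "g \<in> L2 K" "h \<in> L2 K"
  shows "ip (\<lambda>x. f x + g x) h = ip f h + ip g h"
  using L2_integrable_mult_cnj[OF assms(1,3)] L2_integrable_mult_cnj[OF assms(2,3)]
  by (simp add: ip_def distrib_right)

lemma ip_cnj: "ip f g = cnj (ip g f)"
proof -
  have "ip f g = (\<integral>x. cnj (g x * cnj (f x)) \<partial>K)"
    unfolding ip_def by (rule Bochner_Integration.integral_cong) (simp_all add: mult.commute)
  also have "\<dots> = cnj (ip g f)" unfolding ip_def by (rule Bochner_Integration.integral_cnj)
  finally show ?thesis .
qed

lemma V_hilbert: "hilbert_space V"
proof (intro hilbert_space.intro V_module hilbert_space_axioms.intro V_mcomplete)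
  fix u v w c
  assume "u \<in> carrier V" "v \<in> carrier V"
  then obtain f g where fg: "f \<in> vecs" "u = enc f" "g \<in> vecs" "v = enc g"
    by (auto simp: carrier_V)
  show "inprod V u v = cnj (inprod V v u)"
    using fg ip_cnj[of f g] by (simp add: inprod_enc)
  show "inprod V (c \<odot>\<^bsub>V\<^esub> u) v = c * inprod V u v"
    using fg by (simp add: V_smult_enc inprod_enc vecs_cmult ip_def mult.assoc)
  assume "w \<in> carrier V"
  then obtain h where h: "h \<in> vecs" "w = enc h"
    by (auto simp: carrier_V)
  show "inprod V (u \<oplus>\<^bsub>V\<^esub> v) w = inprod V u w + inprod V v w"
    using fg h by (simp add: V_add_enc inprod_enc vecs_add ip_add_left vecs_L2)
next
  fix u
  assume "u \<in> carrier V" and nz: "u \<noteq> \<zero>\<^bsub>V\<^esub>"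
  then obtain f where f: "f \<in> vecs" "u = enc f"
    by (auto simp: carrier_V)
  have "norm2 K f \<noteq> 0"
  proof
    assume "norm2 K f = 0"
    then have "enc f = enc (\<lambda>_. 0)"
      using norm2_eq_0[OF vecs_L2[OF f(1)]] L2_measurable[OF vecs_L2[OF f(1)]]
      by (intro enc_cong_AE) auto
    with nz show False by (simp add: f enc_zero zero_V)
  qed
  then show "0 < Re (inprod V u u)"
    using f norm2_nonneg[of K f] by (simp add: inprod_enc ip_self)
qed

end

section \<open>Multiplier representations and the relative property (T)\<close>

text \<open>The representation translates by \<open>T\<close> and multiplies by \<open>c\<close>;
  \<open>c_mult\<close> is exactly what makes it multiplicative. The cocycle identity is known
  almost everywhere only, whereas the shifts obey the action laws at every point of the
  space.\<close>

locale multiplier_rep = l2_space K E D + group G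
  for K :: "'a measure" and E D and G :: "('g, 'm) monoid_scheme" (structure) +
  fixes T :: "'g \<Rightarrow> 'a \<Rightarrow> 'a" and c :: "'g \<Rightarrow> 'a \<Rightarrow> complex"
  assumes T: "\<And>g. g \<in> carrier G \<Longrightarrow> measure_preserving K K (T g)"
    and T_one: "\<And>x. x \<in> space K \<Longrightarrow> T \<one> x = x"
    and T_mult: "\<And>g h x. \<lbrakk>g \<in> carrier G; h \<in> carrier G; x \<in> space K\<rbrakk> \<Longrightarrow> T (g \<otimes> h) x = T g (T h x)"
    and c_measurable: "\<And>g. g \<in> carrier G \<Longrightarrow> c g \<in> borel_measurable K"
    and c_norm: "\<And>g x. cmod (c g x) = 1"
    and c_mult: "\<And>g h. \<lbrakk>g \<in> carrier G; h \<in> carrier G\<rbrakk> \<Longrightarrow>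
        AE x in K. c (g \<otimes> h) x = c g x * c h (T (inv g) x)"
begin

definition \<rho> :: "'g \<Rightarrow> ('a \<Rightarrow> complex) \<Rightarrow> 'a \<Rightarrow> complex" where
  "\<rho> g f = (\<lambda>x. c g x * f (T (inv g) x))"

definition \<pi> :: "'g \<Rightarrow> (nat \<Rightarrow> complex) \<Rightarrow> nat \<Rightarrow> complex" where
  "\<pi> g v = enc (\<rho> g (dec v))"

lemma T_AE: "g \<in> carrier G \<Longrightarrow> AE x in K. P x \<Longrightarrow> AE x in K. P (T g x)"
  by (rule measure_preserving_AE[OF T])

lemma \<rho>_measurable:
  assumes "g \<in> carrier G" "f \<in> borel_measurable K"
  shows "\<rho> g f \<in> borel_measurable K"
  using assms c_measurable measurable_compose[OF measure_preserving_measurable[OF T[of "inv g"]] assms(2)]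
  by (auto simp: \<rho>_def)

lemma \<rho>_L2:
  assumes g: "g \<in> carrier G" and f: "f \<in> L2 K"
  shows "\<rho> g f \<in> L2 K"
proof -
  have "integrable K (\<lambda>x. (cmod (f (T (inv g) x)))\<^sup>2)"
    using f g by (intro measure_preserving_integrable[OF T, of "inv g" "\<lambda>x. (cmod (f x))\<^sup>2"]) (auto simp: L2_def)
  then show ?thesis
    using \<rho>_measurable[OF g, of f] f by (simp add: L2_def \<rho>_def norm_mult c_norm)
qed

lemma \<rho>_cong:
  assumes "g \<in> carrier G" "AE x in K. f x = f' x"
  shows "AE x in K. \<rho> g f x = \<rho> g f' x"
  using T_AE[OF inv_closed[OF assms(1)] assms(2)] unfolding \<rho>_def by eventually_elim simp

lemma c_one: "AE x in K. c \<one> x = 1"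
proof -
  have "AE x in K. c \<one> x = c \<one> x * c \<one> x"
    using c_mult[OF one_closed one_closed] AE_space by eventually_elim (simp add: T_one)
  then show ?thesis
  proof eventually_elim
    case (elim x)
    then have "c \<one> x * (c \<one> x - 1) = 0" by (simp add: algebra_simps)
    moreover have "c \<one> x \<noteq> 0" using c_norm[of \<one> x] by auto
    ultimately show ?case by simp
  qed
qed

lemma \<rho>_one: "AE x in K. \<rho> \<one> f x = f x"
  using c_one AE_space unfolding \<rho>_def by eventually_elim (simp add: T_one)

lemma \<rho>_mult:
  assumes "g \<in> carrier G" "h \<in> carrier G"
  shows "AE x in K. \<rho> (g \<otimes> h) f x = \<rho> g (\<rho> h f) x"
  using c_mult[OF assms] AE_space
proof eventually_elim
  case (elim x)
  have "T (inv (g \<otimes> h)) x = T (inv h) (T (inv g) x)"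
    using assms elim by (simp add: inv_mult_group T_mult)
  with elim show ?case by (simp add: \<rho>_def)
qed

lemma ip_\<rho>:
  assumes g: "g \<in> carrier G" and f: "f \<in> L2 K" "f' \<in> L2 K"
  shows "ip (\<rho> g f) (\<rho> g f') = ip f f'"
proof -
  have "c g x * cnj (c g x) = 1" for x
    using c_norm[of g x] by (simp add: complex_norm_square[symmetric])
  then have "\<rho> g f x * cnj (\<rho> g f' x) = f (T (inv g) x) * cnj (f' (T (inv g) x))" for x
    by (simp add: \<rho>_def mult_ac)
  then have "ip (\<rho> g f) (\<rho> g f') = (\<integral>x. f (T (inv g) x) * cnj (f' (T (inv g) x)) \<partial>K)"
    by (simp add: ip_def)
  also have "\<dots> = ip f f'"
    unfolding ip_def using f g L2_measurable
    by (intro measure_preserving_integral[OF T, of "inv g" "\<lambda>x. f x * cnj (f' x)"]) auto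
  finally show ?thesis .
qed

context
  assumes inv: "\<And>g f. g \<in> carrier G \<Longrightarrow> f \<in> vecs \<Longrightarrow> \<rho> g f \<in> vecs"
begin

lemma \<pi>_enc:
  assumes "g \<in> carrier G" "f \<in> vecs"
  shows "\<pi> g (enc f) = enc (\<rho> g f)"
  unfolding \<pi>_def
proof (rule enc_cong_AE)
  have "dec (enc f) \<in> vecs" using dec assms(2) by blast
  then show "\<rho> g (dec (enc f)) \<in> borel_measurable K" "\<rho> g f \<in> borel_measurable K"
    using assms inv L2_measurable[OF vecs_L2] by blast+
  show "AE x in K. \<rho> g (dec (enc f)) x = \<rho> g f x"
    by (rule \<rho>_cong[OF assms(1) dec_enc[OF assms(2)]])
qed

lemma enc_AE: "f \<in> vecs \<Longrightarrow> g \<in> vecs \<Longrightarrow> AE x in K. f x = g x \<Longrightarrow> enc f = enc g"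
  by (intro enc_cong_AE L2_measurable vecs_L2)

lemma unitary_rep_\<pi>: "unitary_rep G V \<pi>"
  unfolding unitary_rep_def
proof (intro conjI ballI)
  show "hilbert_space V" by (rule V_hilbert)
  show mult: "\<pi> (g \<otimes> h) v = \<pi> g (\<pi> h v)" if gh: "g \<in> carrier G" "h \<in> carrier G" and v: "v \<in> carrier V" for g h v
  proof -
    obtain f where f: "f \<in> vecs" "v = enc f" using v by (auto simp: carrier_V)
    have "enc (\<rho> (g \<otimes> h) f) = enc (\<rho> g (\<rho> h f))"
      using gh f by (intro enc_AE inv \<rho>_mult) auto
    then show ?thesis using gh f inv by (simp add: \<pi>_enc)
  qed
  show one: "\<pi> \<one> v = v" if v: "v \<in> carrier V" for v
  proof -
    obtain f where f: "f \<in> vecs" "v = enc f" using v by (auto simp: carrier_V)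
    have "enc (\<rho> \<one> f) = enc f" using f by (intro enc_AE inv \<rho>_one) auto
    then show ?thesis using f by (simp add: \<pi>_enc)
  qed
  have closed: "\<pi> g v \<in> carrier V" if "g \<in> carrier G" "v \<in> carrier V" for g v
    using that inv by (auto simp: carrier_V \<pi>_enc)
  show "\<pi> g ` carrier V = carrier V" if g: "g \<in> carrier G" for g
  proof (intro equalityI subsetI)
    fix v assume v: "v \<in> carrier V"
    have "\<pi> g (\<pi> (inv g) v) = v"
      using mult[OF g inv_closed[OF g] v] one[OF v] g by simp
    then show "v \<in> \<pi> g ` carrier V"
      using closed[OF inv_closed[OF g] v] by (intro image_eqI[of _ _ "\<pi> (inv g) v"]) auto
  qed (use g closed in auto)
  show "linear_isometry V V (\<pi> g)" if g: "g \<in> carrier G" for g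
    unfolding linear_isometry_def
  proof (intro conjI ballI allI)
    show "\<pi> g \<in> carrier V \<rightarrow> carrier V" using closed g by auto
    fix v w k assume "v \<in> carrier V"
    then obtain f where f: "f \<in> vecs" "v = enc f" by (auto simp: carrier_V)
    have "\<rho> g (\<lambda>x. k * f x) = (\<lambda>x. k * \<rho> g f x)" by (simp add: \<rho>_def mult_ac)
    then show "\<pi> g (k \<odot>\<^bsub>V\<^esub> v) = k \<odot>\<^bsub>V\<^esub> \<pi> g v"
      using f g inv by (simp add: \<pi>_enc V_smult_enc vecs_cmult)
    assume "w \<in> carrier V"
    then obtain f' where f': "f' \<in> vecs" "w = enc f'" by (auto simp: carrier_V)
    have "\<rho> g (\<lambda>x. f x + f' x) = (\<lambda>x. \<rho> g f x + \<rho> g f' x)" by (simp add: \<rho>_def distrib_left)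
    then show "\<pi> g (v \<oplus>\<^bsub>V\<^esub> w) = \<pi> g v \<oplus>\<^bsub>V\<^esub> \<pi> g w"
      using f f' g inv by (simp add: \<pi>_enc V_add_enc vecs_add)
    show "inprod V (\<pi> g v) (\<pi> g w) = inprod V v w"
      using f f' g inv by (simp add: \<pi>_enc inprod_enc ip_\<rho> vecs_L2)
  qed
qed

text \<open>For the trivial representation, Fell's weak containment follows from the almost
  invariant vectors in \<open>almost\<close>: a coefficient of the trivial representation is a
  constant, and a single vector, scaled by \<open>z\<close>, approximates it. The image of 1 under
  the resulting embedding is the invariant vector; it has norm 1, hence is not null.\<close>

lemma relative_property_T_invariant_vector:
  assumes H: "relative_property_T G H" "H \<subseteq> carrier G"
    and almost: "\<And>F \<epsilon>. finite F \<Longrightarrow> F \<subseteq> carrier G \<Longrightarrow> \<epsilon> > 0 \<Longrightarrow>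
      \<exists>f\<in>vecs. \<forall>g\<in>F. cmod (1 - (\<integral>x. c g x * f (T (inv g) x) * cnj (f x) \<partial>K)) < \<epsilon>"
  obtains f where "f \<in> L2 K" "f \<in> vecs" "\<not> (AE x in K. f x = 0)"
    "\<And>h. h \<in> H \<Longrightarrow> AE x in K. c h x * f (T (inv h) x) = f x"
proof -
  have "rep_weakly_contained G complex_hilbert trivial_rep V \<pi>"
    unfolding rep_weakly_contained_def
  proof (intro ballI allI impI)
    fix z :: complex and F and \<epsilon> :: real
    assume "finite F \<and> F \<subseteq> carrier G \<and> \<epsilon> > 0"
    then have F: "finite F" "F \<subseteq> carrier G" "\<epsilon> > 0" by auto
    \<comment> \<open>Scaling by \<open>z\<close> multiplies the error by the square of its modulus;
      the added 1 covers the case that \<open>z\<close> is 0 and makes the final inequality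
      strict.\<close>
    define \<delta> where "\<delta> = \<epsilon> / (1 + (cmod z)\<^sup>2)"
    have pos: "0 < 1 + (cmod z)\<^sup>2" by (simp add: add_pos_nonneg)
    have \<delta>: "\<delta> > 0" using F pos by (simp add: \<delta>_def)
    obtain f where f: "f \<in> vecs"
      "\<And>g. g \<in> F \<Longrightarrow> cmod (1 - (\<integral>x. c g x * f (T (inv g) x) * cnj (f x) \<partial>K)) < \<delta>"
      using almost[OF F(1,2) \<delta>] by blast
    have zf: "(\<lambda>x. z * f x) \<in> vecs" using f by (intro vecs_cmult)
    have "cmod (inprod complex_hilbert (trivial_rep g z) z
        - inprod V (\<pi> g (enc (\<lambda>x. z * f x))) (enc (\<lambda>x. z * f x))) < \<epsilon>" if g: "g \<in> F" for g
    proof -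
      have gG: "g \<in> carrier G" using g F by auto
      have "inprod V (\<pi> g (enc (\<lambda>x. z * f x))) (enc (\<lambda>x. z * f x)) = ip (\<rho> g (\<lambda>x. z * f x)) (\<lambda>x. z * f x)"
        using gG zf inv by (simp add: \<pi>_enc inprod_enc)
      also have "\<dots> = (\<integral>x. (z * cnj z) * (c g x * f (T (inv g) x) * cnj (f x)) \<partial>K)"
        unfolding ip_def \<rho>_def by (rule Bochner_Integration.integral_cong) (auto simp: mult_ac)
      also have "\<dots> = z * cnj z * (\<integral>x. c g x * f (T (inv g) x) * cnj (f x) \<partial>K)" by simp
      finally have "inprod complex_hilbert (trivial_rep g z) z
          - inprod V (\<pi> g (enc (\<lambda>x. z * f x))) (enc (\<lambda>x. z * f x))
          = z * cnj z * (1 - (\<integral>x. c g x * f (T (inv g) x) * cnj (f x) \<partial>K))"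
        by (simp add: complex_hilbert_def trivial_rep_def right_diff_distrib)
      then have "cmod (inprod complex_hilbert (trivial_rep g z) z
          - inprod V (\<pi> g (enc (\<lambda>x. z * f x))) (enc (\<lambda>x. z * f x)))
          = (cmod z)\<^sup>2 * cmod (1 - (\<integral>x. c g x * f (T (inv g) x) * cnj (f x) \<partial>K))"
        by (simp add: norm_mult power2_eq_square)
      also have "\<dots> \<le> (cmod z)\<^sup>2 * \<delta>" using f(2)[OF g] by (intro mult_left_mono) auto
      also have "\<dots> < (1 + (cmod z)\<^sup>2) * \<delta>" using \<delta> by simp
      also have "\<dots> = \<epsilon>" using pos by (simp add: \<delta>_def)
      finally show ?thesis .
    qed
    then show "\<exists>\<eta>s. set \<eta>s \<subseteq> carrier V \<and> (\<forall>g\<in>F. cmod (inprod complex_hilbert (trivial_rep g z) z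
        - (\<Sum>\<eta>\<leftarrow>\<eta>s. inprod V (\<pi> g \<eta>) \<eta>)) < \<epsilon>)"
      using zf by (intro exI[of _ "[enc (\<lambda>x. z * f x)]"]) (auto simp: carrier_V)
  qed
  then have "rep_contained (G\<lparr>carrier := H\<rparr>) complex_hilbert trivial_rep V \<pi>"
    using H(1) unitary_rep_\<pi> unfolding relative_property_T_def by blast
  then obtain J where J: "linear_isometry complex_hilbert V J"
    "\<And>h z. h \<in> H \<Longrightarrow> J (trivial_rep h z) = \<pi> h (J z)"
    by (auto simp: rep_contained_def complex_hilbert_def)
  have 1: "J 1 \<in> carrier V" and 2: "inprod V (J 1) (J 1) = 1"
    using J(1) by (auto simp: linear_isometry_def complex_hilbert_def)
  from 1 obtain f where f: "f \<in> vecs" "J 1 = enc f" by (auto simp: carrier_V)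
  have "\<not> (AE x in K. f x = 0)"
  proof
    assume "AE x in K. f x = 0"
    then have "ip f f = ip (\<lambda>_. 0) (\<lambda>_. 0)"
      using f(1) by (intro ip_cong_AE) (auto intro: L2_measurable vecs_L2)
    then show False using 2 f by (simp add: inprod_enc) (simp add: ip_def)
  qed
  moreover have "AE x in K. c h x * f (T (inv h) x) = f x" if h: "h \<in> H" for h
  proof -
    have hG: "h \<in> carrier G" using h H by auto
    have "enc (\<rho> h f) = enc f"
      using J(2)[OF h, of 1] f hG by (simp add: trivial_rep_def \<pi>_enc)
    then have "AE x in K. \<rho> h f x = f x"
      using f hG inv by (intro enc_eqD vecs_L2)
    then show ?thesis by (simp add: \<rho>_def)
  qed
  ultimately show thesis using that f(1) vecs_L2 by blast
qed

end

end

section \<open>Mixing actions\<close>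

text \<open>Limits along this filter are limits as \<open>h\<close> leaves every finite subset of
  \<open>H\<close>.\<close>

definition along :: "'h set \<Rightarrow> 'h filter" where
  "along H = inf cofinite (principal H)"

lemma eventually_along: "eventually P (along H) \<longleftrightarrow> finite {h \<in> H. \<not> P h}"
proof -
  have "{h. \<not> (h \<in> H \<longrightarrow> P h)} = {h \<in> H. \<not> P h}" by auto
  then show ?thesis by (simp add: along_def eventually_inf_principal eventually_cofinite)
qed

lemma eventually_alongI:
  assumes "\<And>h. h \<in> H \<Longrightarrow> P h"
  shows "eventually P (along H)"
proof -
  have "{h \<in> H. \<not> P h} = {}" using assms by blast
  then show ?thesis unfolding eventually_along by (simp only: finite.emptyI)
qed

lemma along_neq_bot: "infinite H \<Longrightarrow> along H \<noteq> bot"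
  by (simp add: trivial_limit_def eventually_along)

text \<open>The index set is an arbitrary set, with no group structure, so that the notion can be
  restricted to infinite subsets and reindexed by inverses.\<close>

definition mixing :: "'h set \<Rightarrow> 'a measure \<Rightarrow> ('h \<Rightarrow> 'a \<Rightarrow> 'a) \<Rightarrow> bool" where
  "mixing H K T \<longleftrightarrow>
     (\<forall>h\<in>H. measure_preserving K K (T h)) \<and>
     (\<forall>A\<in>sets K. \<forall>B\<in>sets K.
        ((\<lambda>h. measure K (A \<inter> (T h -` B \<inter> space K))) \<longlongrightarrow> measure K A * measure K B) (along H))"

lemma mixing_measure_preserving: "mixing H K T \<Longrightarrow> h \<in> H \<Longrightarrow> measure_preserving K K (T h)"
  by (simp add: mixing_def)

lemma mixing_measurable: "mixing H K T \<Longrightarrow> h \<in> H \<Longrightarrow> T h \<in> K \<rightarrow>\<^sub>M K"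
  by (rule measure_preserving_measurable[OF mixing_measure_preserving])

text \<open>A Dynkin argument for convergence. The only delicate step is a disjoint union, where
  limit and sum have to be exchanged: the bound by \<open>measure K\<close> gives a summable
  majorant independent of \<open>h\<close>, so that Tannery's theorem applies.\<close>

lemma tendsto_sigma_sets:
  fixes \<nu> :: "'h \<Rightarrow> 'a set \<Rightarrow> real" and m :: "'a set \<Rightarrow> real"
  assumes K: "sets K = sigma_sets (space K) E" "E \<subseteq> Pow (space K)" "Int_stable E"
    and F: "F \<noteq> bot" and fin: "finite_measure K"
    and bound: "\<forall>\<^sub>F h in F. \<forall>A\<in>sets K. \<bar>\<nu> h A\<bar> \<le> measure K A"
    and empty: "m {} = 0"
    and compl: "\<forall>\<^sub>F h in F. \<forall>A\<in>sets K. \<nu> h (space K - A) = \<nu> h (space K) - \<nu> h A"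
      "\<And>A. A \<in> sets K \<Longrightarrow> m (space K - A) = m (space K) - m A"
    and sums: "\<forall>\<^sub>F h in F. \<forall>A. range A \<subseteq> sets K \<longrightarrow> disjoint_family A \<longrightarrow>
        (\<lambda>i. \<nu> h (A i)) sums \<nu> h (\<Union>i::nat. A i)"
      "\<And>A. range A \<subseteq> sets K \<Longrightarrow> disjoint_family A \<Longrightarrow> (\<lambda>i. m (A i)) sums m (\<Union>i::nat. A i)"
    and space: "((\<lambda>h. \<nu> h (space K)) \<longlongrightarrow> m (space K)) F"
    and E: "\<And>A. A \<in> E \<Longrightarrow> ((\<lambda>h. \<nu> h A) \<longlongrightarrow> m A) F"
    and A: "A \<in> sets K"
  shows "((\<lambda>h. \<nu> h A) \<longlongrightarrow> m A) F"
proof -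
  interpret finite_measure K by fact
  have "A \<in> sigma_sets (space K) E" using A K by simp
  with K(3,2) show ?thesis
  proof (induction rule: sigma_sets_induct_disjoint)
    case (basic A)
    then show ?case by (rule E)
  next
    case empty
    have "\<forall>\<^sub>F h in F. \<nu> h {} = m {}"
      using bound
    proof eventually_elim
      case (elim h)
      then have "\<bar>\<nu> h {}\<bar> \<le> measure K {}" by blast
      then show ?case using \<open>m {} = 0\<close> by simp
    qed
    then show ?case by (rule tendsto_eventually)
  next
    case (compl A)
    then have A: "A \<in> sets K" using K by simp
    have "((\<lambda>h. \<nu> h (space K) - \<nu> h A) \<longlongrightarrow> m (space K) - m A) F"
      by (intro tendsto_diff space compl)
    moreover have "\<forall>\<^sub>F h in F. \<nu> h (space K) - \<nu> h A = \<nu> h (space K - A)"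
      using assms(8) by eventually_elim (simp add: A)
    ultimately show ?case
      using assms(9)[OF A] by (simp add: tendsto_cong)
  next
    case (union A)
    then have A: "range A \<subseteq> sets K" using K by simp
    have s: "summable (\<lambda>i. measure K (A i))"
      using finite_measure_UNION[OF A union(1)] by (simp add: sums_iff)
    have b: "\<forall>\<^sub>F (k, h) in at_top \<times>\<^sub>F F. norm (\<nu> h (A k)) \<le> measure K (A k)"
      unfolding eventually_prod_filter
    proof (intro exI conjI allI impI)
      show "eventually (\<lambda>_::nat. True) at_top" by simp
      show "\<forall>\<^sub>F h in F. \<forall>A\<in>sets K. \<bar>\<nu> h A\<bar> \<le> measure K A" by (rule bound)
      fix k h assume "\<forall>A\<in>sets K. \<bar>\<nu> h A\<bar> \<le> measure K A"
      then show "case (k, h) of (k, h) \<Rightarrow> norm (\<nu> h (A k)) \<le> measure K (A k)"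
        using A by (auto simp: subset_iff)
    qed
    have "((\<lambda>h. \<Sum>k. \<nu> h (A k)) \<longlongrightarrow> (\<Sum>k. m (A k))) F"
      using tannerys_theorem[where a="\<lambda>k h. \<nu> h (A k)" and b="\<lambda>k. m (A k)", OF union(3) b s F] by blast
    moreover have "\<forall>\<^sub>F h in F. (\<Sum>k. \<nu> h (A k)) = \<nu> h (\<Union>k. A k)"
      using sums(1)
    proof eventually_elim
      case (elim h)
      then show ?case using A union(1) by (simp add: sums_iff)
    qed
    moreover have "(\<Sum>k. m (A k)) = m (\<Union>k. A k)"
      using sums(2)[OF A union(1)] by (simp add: sums_iff)
    ultimately show ?case by (simp add: tendsto_cong)
  qed
qed

text \<open>The previous lemma is used twice: first in \<open>A\<close> with \<open>B\<close> fixed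
  in the generator, then in \<open>B\<close> with \<open>A\<close> arbitrary. In the second round
  the majorant is the measure of \<open>B\<close>, because \<open>T h\<close> preserves
  measure.\<close>

lemma mixingI_generator:
  assumes H: "infinite H" and "prob_space K"
    and T: "\<And>h. h \<in> H \<Longrightarrow> measure_preserving K K (T h)"
    and K: "sets K = sigma_sets (space K) E" "E \<subseteq> Pow (space K)" "Int_stable E"
    and E: "\<And>A B. A \<in> E \<Longrightarrow> B \<in> E \<Longrightarrow>
      ((\<lambda>h. measure K (A \<inter> (T h -` B \<inter> space K))) \<longlongrightarrow> measure K A * measure K B) (along H)"
  shows "mixing H K T"
proof -
  interpret prob_space K by fact
  let ?F = "along H"
  have F: "?F \<noteq> bot" using along_neq_bot[OF H] .
  have evH: "\<forall>\<^sub>F h in ?F. h \<in> H" by (simp add: eventually_along)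
  have pre: "T h -` B \<inter> space K \<in> sets K" if "h \<in> H" "B \<in> sets K" for h B
    using measurable_sets[OF measure_preserving_measurable[OF T[OF that(1)]] that(2)] .
  have pm: "measure K (T h -` B \<inter> space K) = measure K B" if "h \<in> H" "B \<in> sets K" for h B
    using measure_preserving_measure[OF T[OF that(1)] that(2)] .
  have ES: "A \<in> sets K" if "A \<in> E" for A using that K by simp
  have sm: "measure K (space K) = 1" by (rule prob_space)
  have A_any: "((\<lambda>h. measure K (A \<inter> (T h -` B \<inter> space K))) \<longlongrightarrow> measure K A * measure K B) ?F"
    if A: "A \<in> sets K" and B: "B \<in> E" for A B
  proof (rule tendsto_sigma_sets[OF K F, where m="\<lambda>A. measure K A * measure K B" and
        \<nu>="\<lambda>h A. measure K (A \<inter> (T h -` B \<inter> space K))"])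
    show "finite_measure K" by unfold_locales
    show "\<forall>\<^sub>F h in ?F. \<forall>A\<in>sets K. \<bar>measure K (A \<inter> (T h -` B \<inter> space K))\<bar> \<le> measure K A"
      by (intro always_eventually allI ballI) (simp add: finite_measure_mono)
    show "\<forall>\<^sub>F h in ?F. \<forall>A\<in>sets K. measure K ((space K - A) \<inter> (T h -` B \<inter> space K)) =
        measure K (space K \<inter> (T h -` B \<inter> space K)) - measure K (A \<inter> (T h -` B \<inter> space K))"
      using evH
    proof eventually_elim
      case (elim h)
      have "measure K ((space K - A) \<inter> (T h -` B \<inter> space K)) =
          measure K (space K \<inter> (T h -` B \<inter> space K)) - measure K (A \<inter> (T h -` B \<inter> space K))"
        if "A \<in> sets K" for A
      proof -
        have "(space K - A) \<inter> (T h -` B \<inter> space K) =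
            (space K \<inter> (T h -` B \<inter> space K)) - (A \<inter> (T h -` B \<inter> space K))" by auto
        moreover note pre[OF elim ES[OF B]] that
        moreover have "A \<inter> (T h -` B \<inter> space K) \<subseteq> space K \<inter> (T h -` B \<inter> space K)" by blast
        ultimately show ?thesis
          using finite_measure_Diff[of "space K \<inter> (T h -` B \<inter> space K)" "A \<inter> (T h -` B \<inter> space K)"]
          by (simp only: sets.Int sets.top)
      qed
      then show ?case by blast
    qed
    show "\<forall>\<^sub>F h in ?F. \<forall>A. range A \<subseteq> sets K \<longrightarrow> disjoint_family A \<longrightarrow>
        (\<lambda>i. measure K (A i \<inter> (T h -` B \<inter> space K))) sums measure K ((\<Union>i::nat. A i) \<inter> (T h -` B \<inter> space K))"
      using evH
    proof eventually_elim
      case (elim h)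
      have "(\<lambda>i. measure K (A i \<inter> (T h -` B \<inter> space K))) sums measure K (\<Union>i. A i \<inter> (T h -` B \<inter> space K))"
        if "range A \<subseteq> sets K" "disjoint_family A" for A :: "nat \<Rightarrow> _"
        using that pre[OF elim ES[OF B]]
        by (intro finite_measure_UNION) (auto simp: disjoint_family_on_def)
      then show ?case by simp
    qed
    show "(\<lambda>i. measure K (A i) * measure K B) sums (measure K (\<Union>i::nat. A i) * measure K B)"
      if "range A \<subseteq> sets K" "disjoint_family A" for A
      by (intro sums_mult2 finite_measure_UNION that)
    show "((\<lambda>h. measure K (space K \<inter> (T h -` B \<inter> space K))) \<longlongrightarrow> measure K (space K) * measure K B) ?F"
    proof (rule tendsto_eventually)
      show "\<forall>\<^sub>F h in ?F. measure K (space K \<inter> (T h -` B \<inter> space K)) = measure K (space K) * measure K B"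
        using evH by eventually_elim (simp add: pm ES B sm Int_absorb1)
    qed
  qed (use A B E in \<open>auto simp: prob_compl left_diff_distrib sm\<close>)
  have "((\<lambda>h. measure K (A \<inter> (T h -` B \<inter> space K))) \<longlongrightarrow> measure K A * measure K B) ?F"
    if A: "A \<in> sets K" and B: "B \<in> sets K" for A B
  proof (rule tendsto_sigma_sets[OF K F, where m="\<lambda>B. measure K A * measure K B" and
        \<nu>="\<lambda>h B. measure K (A \<inter> (T h -` B \<inter> space K))"])
    show "finite_measure K" by unfold_locales
    show "\<forall>\<^sub>F h in ?F. \<forall>B\<in>sets K. \<bar>measure K (A \<inter> (T h -` B \<inter> space K))\<bar> \<le> measure K B"
      using evH
    proof eventually_elim
      case (elim h)
      have "measure K (A \<inter> (T h -` B \<inter> space K)) \<le> measure K B" if "B \<in> sets K" for B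
      proof -
        have "measure K (A \<inter> (T h -` B \<inter> space K)) \<le> measure K (T h -` B \<inter> space K)"
          using pre[OF elim that] by (intro finite_measure_mono Int_lower2)
        then show ?thesis by (simp only: pm[OF elim that])
      qed
      then show ?case by simp
    qed
    show "\<forall>\<^sub>F h in ?F. \<forall>B\<in>sets K. measure K (A \<inter> (T h -` (space K - B) \<inter> space K)) =
        measure K (A \<inter> (T h -` space K \<inter> space K)) - measure K (A \<inter> (T h -` B \<inter> space K))"
      using evH
    proof eventually_elim
      case (elim h)
      have "measure K (A \<inter> (T h -` (space K - B) \<inter> space K)) =
          measure K (A \<inter> (T h -` space K \<inter> space K)) - measure K (A \<inter> (T h -` B \<inter> space K))"
        if "B \<in> sets K" for B
      proof -
        have "A \<inter> (T h -` (space K - B) \<inter> space K) =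
            (A \<inter> (T h -` space K \<inter> space K)) - (A \<inter> (T h -` B \<inter> space K))" by auto
        moreover have "T h -` B \<inter> space K \<subseteq> T h -` space K \<inter> space K"
          using sets.sets_into_space[OF that] by blast
        moreover note pre[OF elim that] pre[OF elim sets.top] A
        ultimately show ?thesis
          using finite_measure_Diff[of "A \<inter> (T h -` space K \<inter> space K)" "A \<inter> (T h -` B \<inter> space K)"]
          by (simp only: sets.Int) blast
      qed
      then show ?case by blast
    qed
    show "\<forall>\<^sub>F h in ?F. \<forall>B. range B \<subseteq> sets K \<longrightarrow> disjoint_family B \<longrightarrow>
        (\<lambda>i. measure K (A \<inter> (T h -` B i \<inter> space K))) sums measure K (A \<inter> (T h -` (\<Union>i::nat. B i) \<inter> space K))"
      using evH
    proof eventually_elim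
      case (elim h)
      have "(\<lambda>i. measure K (A \<inter> (T h -` B i \<inter> space K))) sums measure K (A \<inter> (T h -` (\<Union>i::nat. B i) \<inter> space K))"
        if B: "range B \<subseteq> sets K" "disjoint_family B" for B :: "nat \<Rightarrow> _"
      proof -
        have "A \<inter> (T h -` (\<Union>i. B i) \<inter> space K) = (\<Union>i. A \<inter> (T h -` B i \<inter> space K))" by auto
        moreover have "(\<lambda>i. measure K (A \<inter> (T h -` B i \<inter> space K))) sums
            measure K (\<Union>i. A \<inter> (T h -` B i \<inter> space K))"
        proof (rule finite_measure_UNION)
          have "A \<inter> (T h -` B i \<inter> space K) \<in> sets K" for i
            using B(1) by (intro sets.Int A pre[OF elim]) auto
          then show "range (\<lambda>i. A \<inter> (T h -` B i \<inter> space K)) \<subseteq> sets K" by blast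
          show "disjoint_family (\<lambda>i. A \<inter> (T h -` B i \<inter> space K))"
            using B(2) unfolding disjoint_family_on_def by blast
        qed
        ultimately show ?thesis by simp
      qed
      then show ?case by simp
    qed
    show "(\<lambda>i. measure K A * measure K (B i)) sums (measure K A * measure K (\<Union>i::nat. B i))"
      if "range B \<subseteq> sets K" "disjoint_family B" for B
      by (intro sums_mult finite_measure_UNION that)
    show "((\<lambda>h. measure K (A \<inter> (T h -` space K \<inter> space K))) \<longlongrightarrow> measure K A * measure K (space K)) ?F"
    proof (rule tendsto_eventually)
      show "\<forall>\<^sub>F h in ?F. measure K (A \<inter> (T h -` space K \<inter> space K)) = measure K A * measure K (space K)"
        using evH
      proof eventually_elim
        case (elim h)
        have "A \<inter> (T h -` space K \<inter> space K) = A"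
          using measurable_space[OF measure_preserving_measurable[OF T[OF elim]]] sets.sets_into_space[OF A] by auto
        then show ?case by (simp add: sm)
      qed
    qed
    show "((\<lambda>h. measure K (A \<inter> (T h -` B \<inter> space K))) \<longlongrightarrow> measure K A * measure K B) ?F"
      if "B \<in> E" for B using A_any[OF A that] .
  qed (use B in \<open>auto simp: prob_compl right_diff_distrib sm\<close>)
  then show ?thesis using T by (simp add: mixing_def)
qed

section \<open>Ergodicity of mixing actions\<close>

text \<open>Correlating an invariant set with itself, mixing gives that its measure equals its own
  square, so it is 0 or 1. The set where a function exceeds its mean cannot have measure 1, hence is
  null; this is applied to \<open>f\<close> and to its negative.\<close>

lemma mixing_invariant_real_const:
  fixes f :: "'a \<Rightarrow> real"
  assumes mix: "mixing H K T" and H: "infinite H" and K: "prob_space K"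
    and f: "integrable K f" and inv: "\<And>h. h \<in> H \<Longrightarrow> AE x in K. f (T h x) = f x"
  shows "AE x in K. f x = (\<integral>x. f x \<partial>K)"
proof -
  interpret prob_space K by fact
  have [measurable]: "f \<in> borel_measurable K" using f by simp
  define c where "c = (\<integral>x. f x \<partial>K)"
  have zero_one: "prob A = 0 \<or> prob A = 1"
    if A[measurable]: "A \<in> sets K" and eq: "\<And>h. h \<in> H \<Longrightarrow> AE x in K. T h x \<in> A \<longleftrightarrow> x \<in> A" for A
  proof -
    have 1: "((\<lambda>h. measure K (A \<inter> (T h -` A \<inter> space K))) \<longlongrightarrow> prob A * prob A) (along H)"
      using mix A unfolding mixing_def by blast
    have "\<forall>\<^sub>F h in along H. measure K (A \<inter> (T h -` A \<inter> space K)) = prob A"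
    proof -
      have "measure K (A \<inter> (T h -` A \<inter> space K)) = prob A" if h: "h \<in> H" for h
      proof (rule finite_measure_eq_AE)
        have [measurable]: "T h \<in> K \<rightarrow>\<^sub>M K"
          using mixing_measurable[OF mix h] .
        show "AE x in K. x \<in> A \<inter> (T h -` A \<inter> space K) \<longleftrightarrow> x \<in> A"
          using eq[OF h] AE_space by eventually_elim auto
        show "A \<inter> (T h -` A \<inter> space K) \<in> sets K" by measurable
      qed simp
      then show ?thesis by (rule eventually_alongI)
    qed
    then have "((\<lambda>h. measure K (A \<inter> (T h -` A \<inter> space K))) \<longlongrightarrow> prob A) (along H)"
      by (rule tendsto_eventually)
    then have "prob A * prob A = prob A"
      by (rule tendsto_unique[OF along_neq_bot[OF H] 1])
    then show ?thesis by simp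
  qed
  have half: "AE x in K. \<not> g x > (\<integral>x. g x \<partial>K)"
    if g: "integrable K g" and ginv: "\<And>h. h \<in> H \<Longrightarrow> AE x in K. g (T h x) = g x" for g :: "'a \<Rightarrow> real"
  proof -
    have [measurable]: "g \<in> borel_measurable K" using g by simp
    define d where "d = (\<integral>x. g x \<partial>K)"
    let ?A = "{x \<in> space K. g x > d}"
    have "prob ?A = 0 \<or> prob ?A = 1"
    proof (rule zero_one)
      fix h assume h: "h \<in> H"
      have [measurable]: "T h \<in> K \<rightarrow>\<^sub>M K"
        using mixing_measurable[OF mix h] .
      show "AE x in K. T h x \<in> ?A \<longleftrightarrow> x \<in> ?A"
        using ginv[OF h] AE_space
      proof eventually_elim
        case (elim x)
        then show ?case using measurable_space[of "T h" K K x] by simp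
      qed
    qed measurable
    moreover have "prob ?A \<noteq> 1"
    proof
      assume "prob ?A = 1"
      then have ae: "AE x in K. g x > d" by (subst (asm) prob_Collect_eq_1) auto
      then have "(\<integral>x. d \<partial>K) < (\<integral>x. g x \<partial>K)"
        using g by (intro integral_less_AE_space) (auto simp: emeasure_space_1)
      then show False by (simp add: d_def prob_space)
    qed
    ultimately have "prob ?A = 0" by simp
    then show ?thesis by (subst (asm) prob_Collect_eq_0) (auto simp: d_def)
  qed
  have "AE x in K. \<not> f x > c" "AE x in K. \<not> - f x > - c"
    using half[OF f inv] half[of "\<lambda>x. - f x"] f inv by (simp_all add: c_def)
  then show ?thesis by eventually_elim (simp add: c_def)
qed

lemma mixing_invariant_const:
  fixes f :: "'a \<Rightarrow> complex"
  assumes mix: "mixing H K T" and H: "infinite H" and K: "prob_space K"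
    and f: "integrable K f" and inv: "\<And>h. h \<in> H \<Longrightarrow> AE x in K. f (T h x) = f x"
  shows "AE x in K. f x = (\<integral>x. f x \<partial>K)"
proof -
  have "AE x in K. Re (f (T h x)) = Re (f x)" "AE x in K. Im (f (T h x)) = Im (f x)" if "h \<in> H" for h
    using inv[OF that] by (auto elim: eventually_mono)
  then have "AE x in K. Re (f x) = (\<integral>x. Re (f x) \<partial>K)" "AE x in K. Im (f x) = (\<integral>x. Im (f x) \<partial>K)"
    using mixing_invariant_real_const[OF mix H K, of "\<lambda>x. Re (f x)"]
      mixing_invariant_real_const[OF mix H K, of "\<lambda>x. Im (f x)"]
      integrable_Re[OF f] integrable_Im[OF f] by blast+
  then show ?thesis
  proof eventually_elim
    case (elim x)
    then show ?case using integral_Re[OF f] integral_Im[OF f] by (simp only: complex_eq_iff)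
  qed
qed

section \<open>Product actions\<close>

lemma measure_preserving_pair:
  assumes "prob_space K" "prob_space L" "measure_preserving K K' p" "measure_preserving L L' q"
    "prob_space K'" "prob_space L'"
  shows "measure_preserving (K \<Otimes>\<^sub>M L) (K' \<Otimes>\<^sub>M L') (\<lambda>z. (p (fst z), q (snd z)))"
proof -
  interpret L': prob_space L' by fact
  have "distr K K' p \<Otimes>\<^sub>M distr L L' q = distr (K \<Otimes>\<^sub>M L) (K' \<Otimes>\<^sub>M L') (\<lambda>(x, y). (p x, q y))"
    using assms(3,4) L'.sigma_finite_measure_axioms
    by (intro pair_measure_distr) (auto simp: measure_preserving_def)
  then show ?thesis
    using assms(3,4) by (auto simp: measure_preserving_def split_beta')
qed

text \<open>On rectangles the correlations factorise, so their limits multiply; rectangles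
  generate.\<close>

lemma mixing_pair:
  assumes H: "infinite H" and K: "prob_space K" and L: "prob_space L"
    and T: "mixing H K T" and S: "mixing H L S"
  shows "mixing H (K \<Otimes>\<^sub>M L) (\<lambda>h z. (T h (fst z), S h (snd z)))"
proof -
  interpret K: prob_space K by fact
  interpret L: prob_space L by fact
  interpret KL: pair_prob_space K L ..
  let ?E = "{a \<times> b | a b. a \<in> sets K \<and> b \<in> sets L}"
  let ?R = "\<lambda>h z. (T h (fst z), S h (snd z))"
  show ?thesis
  proof (rule mixingI_generator[OF H])
    show "prob_space (K \<Otimes>\<^sub>M L)" by unfold_locales
    show "measure_preserving (K \<Otimes>\<^sub>M L) (K \<Otimes>\<^sub>M L) (?R h)" if "h \<in> H" for h
      using that T S by (intro measure_preserving_pair K L) (auto simp: mixing_def)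
    show "sets (K \<Otimes>\<^sub>M L) = sigma_sets (space (K \<Otimes>\<^sub>M L)) ?E"
      by (simp add: sets_pair_measure space_pair_measure)
    show "?E \<subseteq> Pow (space (K \<Otimes>\<^sub>M L))"
      using pair_measure_closed[of K L] by (simp add: space_pair_measure)
    show "Int_stable ?E" by (rule Int_stable_pair_measure_generator)
    fix A B assume "A \<in> ?E" "B \<in> ?E"
    then obtain a1 b1 a2 b2 where s: "a1 \<in> sets K" "b1 \<in> sets L" "A = a1 \<times> b1"
      "a2 \<in> sets K" "b2 \<in> sets L" "B = a2 \<times> b2" by blast
    have m: "measure (K \<Otimes>\<^sub>M L) (a \<times> b) = measure K a * measure L b" if "a \<in> sets K" "b \<in> sets L" for a b
      using that by (simp add: L.emeasure_pair_measure_Times measure_def enn2real_mult)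
    have "((\<lambda>h. measure K (a1 \<inter> (T h -` a2 \<inter> space K)) * measure L (b1 \<inter> (S h -` b2 \<inter> space L)))
        \<longlongrightarrow> (measure K a1 * measure K a2) * (measure L b1 * measure L b2)) (along H)"
      using T S s by (intro tendsto_mult) (auto simp: mixing_def)
    moreover have "\<forall>\<^sub>F h in along H.
        measure K (a1 \<inter> (T h -` a2 \<inter> space K)) * measure L (b1 \<inter> (S h -` b2 \<inter> space L)) =
        measure (K \<Otimes>\<^sub>M L) (A \<inter> (?R h -` B \<inter> space (K \<Otimes>\<^sub>M L)))"
    proof -
      have "measure K (a1 \<inter> (T h -` a2 \<inter> space K)) * measure L (b1 \<inter> (S h -` b2 \<inter> space L)) =
        measure (K \<Otimes>\<^sub>M L) (A \<inter> (?R h -` B \<inter> space (K \<Otimes>\<^sub>M L)))" if h: "h \<in> H" for h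
      proof -
        have [measurable]: "T h \<in> K \<rightarrow>\<^sub>M K" "S h \<in> L \<rightarrow>\<^sub>M L"
          using mixing_measurable[OF T h] mixing_measurable[OF S h] by simp_all
        have "A \<inter> (?R h -` B \<inter> space (K \<Otimes>\<^sub>M L)) =
            (a1 \<inter> (T h -` a2 \<inter> space K)) \<times> (b1 \<inter> (S h -` b2 \<inter> space L))"
          using s by (auto simp: space_pair_measure)
        moreover have "a1 \<inter> (T h -` a2 \<inter> space K) \<in> sets K" "b1 \<inter> (S h -` b2 \<inter> space L) \<in> sets L"
          using s by measurable
        ultimately show ?thesis by (simp add: m)
      qed
      then show ?thesis by (rule eventually_alongI)
    qed
    ultimately show "((\<lambda>h. measure (K \<Otimes>\<^sub>M L) (A \<inter> (?R h -` B \<inter> space (K \<Otimes>\<^sub>M L))))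
        \<longlongrightarrow> measure (K \<Otimes>\<^sub>M L) A * measure (K \<Otimes>\<^sub>M L) B) (along H)"
      using s by (simp add: m tendsto_cong mult_ac)
  qed
qed

section \<open>Bernoulli shifts\<close>

context group begin

lemma bernoulli_shift_one: "x \<in> space (bernoulli_space G M0) \<Longrightarrow> bernoulli_shift G \<one> x = x"
  by (auto simp: bernoulli_shift_def bernoulli_space_def space_PiM PiE_def extensional_def fun_eq_iff)

lemma bernoulli_shift_mult:
  assumes "g \<in> carrier G" "h \<in> carrier G"
  shows "bernoulli_shift G (g \<otimes> h) x = bernoulli_shift G g (bernoulli_shift G h x)"
  using assms by (auto simp: bernoulli_shift_def fun_eq_iff inv_mult_group m_assoc)

lemma bernoulli_shift_measure_preserving:
  assumes "prob_space M0" "g \<in> carrier G"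
  shows "measure_preserving (bernoulli_space G M0) (bernoulli_space G M0) (bernoulli_shift G g)"
proof -
  have inj: "inj_on (\<lambda>k. inv g \<otimes> k) (carrier G)" using assms by (simp add: inj_on_def)
  have "distr (PiM (carrier G) (\<lambda>_. M0)) (PiM (carrier G) (\<lambda>_. M0)) (\<lambda>\<omega>. \<lambda>n\<in>carrier G. \<omega> (inv g \<otimes> n))
      = PiM (carrier G) (\<lambda>_. M0)"
    using assms by (intro distr_PiM_reindex inj) auto
  moreover have "(\<lambda>\<omega>. \<lambda>n\<in>carrier G. \<omega> (inv g \<otimes> n)) \<in>
      PiM (carrier G) (\<lambda>_. M0) \<rightarrow>\<^sub>M PiM (carrier G) (\<lambda>_. M0)"
    using assms by (intro measurable_restrict measurable_component_singleton) auto
  ultimately show ?thesis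
    by (simp add: measure_preserving_def bernoulli_space_def bernoulli_shift_def[abs_def])
qed

lemma measure_bernoulli_cylinder:
  assumes M0: "prob_space M0" and "J \<subseteq> carrier G" "finite J" "\<And>j. j \<in> J \<Longrightarrow> X j \<in> sets M0"
  shows "measure (bernoulli_space G M0) {x \<in> space (bernoulli_space G M0). \<forall>j\<in>J. x j \<in> X j}
    = (\<Prod>j\<in>J. measure M0 (X j))"
proof -
  interpret P: product_prob_space "\<lambda>_. M0" "carrier G"
    using M0 by (simp add: product_prob_space_def product_prob_space_axioms_def product_sigma_finite_def
        prob_space_imp_sigma_finite)
  have "emeasure (bernoulli_space G M0) {x \<in> space (bernoulli_space G M0). \<forall>j\<in>J. x j \<in> X j}
      = (\<Prod>j\<in>J. emeasure M0 (X j))"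
    unfolding bernoulli_space_def using assms by (intro P.emeasure_PiM_Collect) auto
  also have "\<dots> = ennreal (\<Prod>j\<in>J. measure M0 (X j))"
    using M0 by (simp add: finite_measure.emeasure_eq_measure prob_space.finite_measure prod_ennreal)
  finally show ?thesis by (simp add: measure_def[of "bernoulli_space G M0"] prod_nonneg)
qed

lemma prod_algebra_cylinder:
  assumes A: "A \<in> prod_algebra (carrier G) (\<lambda>_. M0)"
  obtains J X where "J \<subseteq> carrier G" "finite J" "\<And>j. j \<in> J \<Longrightarrow> X j \<in> sets M0"
    "A = {x \<in> space (bernoulli_space G M0). \<forall>j\<in>J. x j \<in> X j}"
proof -
  obtain J X where JX: "A = prod_emb (carrier G) (\<lambda>_. M0) J (Pi\<^sub>E J X)" "finite J" "J \<subseteq> carrier G"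
    "\<And>j. j \<in> J \<Longrightarrow> X j \<in> sets M0"
    using prod_algebraE[OF A] by metis
  have "A = {x \<in> space (bernoulli_space G M0). \<forall>j\<in>J. x j \<in> X j}"
    using JX(3) sets.sets_into_space[OF JX(4)] unfolding JX(1) bernoulli_space_def
    by (auto simp: prod_emb_def space_PiM Pi_iff)
  then show thesis using JX that by blast
qed

text \<open>Two cylinders over finite coordinate sets \<open>J\<close> and \<open>L\<close> become
  independent once the translate of \<open>L\<close> by the inverse of \<open>h\<close> misses
  \<open>J\<close>. The exceptional \<open>h\<close> are among the finitely many products of an
  element of \<open>L\<close> with the inverse of an element of \<open>J\<close>, so the correlation
  is eventually equal to its limit.\<close>

lemma bernoulli_shift_mixing:
  assumes M0: "prob_space M0" and H: "infinite H" "H \<subseteq> carrier G"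
  shows "mixing H (bernoulli_space G M0) (bernoulli_shift G)"
proof -
  let ?I = "carrier G" and ?K = "bernoulli_space G M0"
  interpret P: product_prob_space "\<lambda>_. M0" ?I
    using M0 by (simp add: product_prob_space_def product_prob_space_axioms_def product_sigma_finite_def
        prob_space_imp_sigma_finite)
  have K: "?K = PiM ?I (\<lambda>_. M0)" by (simp add: bernoulli_space_def)
  let ?cyl = "\<lambda>J X. {x \<in> space ?K. \<forall>j\<in>J. x j \<in> X j}"
  note cyl = measure_bernoulli_cylinder[OF M0]
  show ?thesis
  proof (rule mixingI_generator[OF H(1)])
    show "prob_space ?K" unfolding K by unfold_locales
    show "measure_preserving ?K ?K (bernoulli_shift G h)" if "h \<in> H" for h
      using that H by (intro bernoulli_shift_measure_preserving M0) auto
    show "sets ?K = sigma_sets (space ?K) (prod_algebra ?I (\<lambda>_. M0))"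
      by (simp add: K sets_PiM space_PiM)
    show "prod_algebra ?I (\<lambda>_. M0) \<subseteq> Pow (space ?K)"
      using prod_algebra_sets_into_space[of ?I "\<lambda>_. M0"] by (simp add: K space_PiM)
    show "Int_stable (prod_algebra ?I (\<lambda>_. M0))" by (rule Int_stable_prod_algebra)
    fix A B assume A: "A \<in> prod_algebra ?I (\<lambda>_. M0)" and B: "B \<in> prod_algebra ?I (\<lambda>_. M0)"
    obtain J X where J: "J \<subseteq> ?I" "finite J" "\<And>j. j \<in> J \<Longrightarrow> X j \<in> sets M0" "A = ?cyl J X"
      using prod_algebra_cylinder[OF A, of thesis] by blast
    obtain L Y where L: "L \<subseteq> ?I" "finite L" "\<And>j. j \<in> L \<Longrightarrow> Y j \<in> sets M0" "B = ?cyl L Y"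
      using prod_algebra_cylinder[OF B, of thesis] by blast
    let ?m = "\<lambda>h. measure ?K (A \<inter> (bernoulli_shift G h -` B \<inter> space ?K))"
    have indep: "?m h = measure ?K A * measure ?K B"
      if h: "h \<in> ?I" and disj: "J \<inter> (\<lambda>j. inv h \<otimes> j) ` L = {}" for h
    proof -
      let ?L = "(\<lambda>j. inv h \<otimes> j) ` L"
      \<comment> \<open>The intersection of the two events is again a cylinder; its conditions are
        those of \<open>X\<close> on \<open>J\<close> and those of \<open>Y\<close> on the translate
        of \<open>L\<close>, compatible by disjointness.\<close>
      define Z where "Z j = (if j \<in> J then X j else Y (h \<otimes> j))" for j
      have hL: "h \<otimes> (inv h \<otimes> j) = j" if j: "j \<in> L" for j
      proof -
        have "j \<in> ?I" using j L(1) by blast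
        then show ?thesis using h by (simp add: m_assoc[symmetric])
      qed
      have inj: "inj_on (\<lambda>j. inv h \<otimes> j) L"
      proof (rule inj_onI)
        fix x y assume xy: "x \<in> L" "y \<in> L" "inv h \<otimes> x = inv h \<otimes> y"
        have "h \<otimes> (inv h \<otimes> x) = h \<otimes> (inv h \<otimes> y)" by (simp only: xy(3))
        then show "x = y" by (simp only: hL[OF xy(1)] hL[OF xy(2)])
      qed
      have LG: "?L \<subseteq> ?I" using L(1) m_closed[OF inv_closed[OF h]] by blast
      have ZJ: "Z j = X j" if "j \<in> J" for j using that by (simp add: Z_def)
      have ZL: "Z (inv h \<otimes> j) = Y j" if j: "j \<in> L" for j
      proof -
        have "inv h \<otimes> j \<notin> J" using j disj by blast
        then show ?thesis by (simp only: Z_def hL[OF j] if_False)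
      qed
      have sh: "bernoulli_shift G h x \<in> space ?K" if "x \<in> space ?K" for x
        using that measurable_space[OF measure_preserving_measurable[OF bernoulli_shift_measure_preserving[OF M0 h]]] by simp
      have "A \<inter> (bernoulli_shift G h -` B \<inter> space ?K) = ?cyl (J \<union> ?L) Z"
      proof (intro equalityI subsetI)
        fix x assume "x \<in> A \<inter> (bernoulli_shift G h -` B \<inter> space ?K)"
        then have x: "x \<in> space ?K" "\<And>j. j \<in> J \<Longrightarrow> x j \<in> X j" "\<And>j. j \<in> L \<Longrightarrow> x (inv h \<otimes> j) \<in> Y j"
          using L(1) unfolding J(4) L(4) by (auto simp: bernoulli_shift_def subset_iff)
        then have "x j \<in> Z j" if "j \<in> J \<union> ?L" for j
          using that by (elim UnE imageE) (simp_all only: ZJ ZL)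
        with x(1) show "x \<in> ?cyl (J \<union> ?L) Z" by blast
      next
        fix x assume x: "x \<in> ?cyl (J \<union> ?L) Z"
        then have xK: "x \<in> space ?K" and xZ: "\<And>j. j \<in> J \<union> ?L \<Longrightarrow> x j \<in> Z j" by blast+
        have xX: "x j \<in> X j" if "j \<in> J" for j
          using xZ[of j] that ZJ[OF that] by simp
        have xY: "bernoulli_shift G h x j \<in> Y j" if "j \<in> L" for j
        proof -
          have "x (inv h \<otimes> j) \<in> Z (inv h \<otimes> j)" using that by (intro xZ) blast
          moreover have "j \<in> ?I" using that L(1) by blast
          ultimately show ?thesis by (simp only: ZL[OF that] bernoulli_shift_def restrict_apply' if_True)
        qed
        show "x \<in> A \<inter> (bernoulli_shift G h -` B \<inter> space ?K)"
          unfolding J(4) L(4) using xK xX xY sh by blast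
      qed
      also have "measure ?K (?cyl (J \<union> ?L) Z) = (\<Prod>j\<in>J \<union> ?L. measure M0 (Z j))"
      proof (rule cyl)
        show "Z j \<in> sets M0" if "j \<in> J \<union> ?L" for j
          using that J(3) L(3) by (elim UnE imageE) (simp_all only: ZJ ZL)
      qed (use J(1,2) L(2) LG in blast)+
      also have "\<dots> = (\<Prod>j\<in>J. measure M0 (Z j)) * (\<Prod>j\<in>?L. measure M0 (Z j))"
        using J L disj by (intro prod.union_disjoint) auto
      also have "(\<Prod>j\<in>?L. measure M0 (Z j)) = (\<Prod>j\<in>L. measure M0 (Y j))"
        by (simp add: prod.reindex[OF inj] ZL)
      also have "(\<Prod>j\<in>J. measure M0 (Z j)) = (\<Prod>j\<in>J. measure M0 (X j))"
        by (simp add: ZJ)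
      finally show ?thesis by (simp only: J(4) L(4) cyl[OF J(1-3)] cyl[OF L(1-3)])
    qed
    have "\<forall>\<^sub>F h in along H. ?m h = measure ?K A * measure ?K B"
      unfolding eventually_along
    proof (rule finite_subset)
      show "{h \<in> H. ?m h \<noteq> measure ?K A * measure ?K B} \<subseteq> (\<lambda>(j, k). k \<otimes> inv j) ` (J \<times> L)"
      proof
        fix h assume h: "h \<in> {h \<in> H. ?m h \<noteq> measure ?K A * measure ?K B}"
        then have hG: "h \<in> ?I" using H by auto
        have "?m h \<noteq> measure ?K A * measure ?K B" using h by simp
        then have "J \<inter> (\<lambda>j. inv h \<otimes> j) ` L \<noteq> {}" using indep[OF hG] by argo
        then obtain j k where jk: "j \<in> J" "k \<in> L" "j = inv h \<otimes> k" by blast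
        have kG: "k \<in> ?I" using jk(2) L(1) by blast
        have "k \<otimes> inv j = k \<otimes> (inv k \<otimes> h)" using hG kG by (simp add: jk(3) inv_mult_group)
        also have "\<dots> = h" using hG kG by (simp add: m_assoc[symmetric])
        finally have "k \<otimes> inv j = h" .
        then show "h \<in> (\<lambda>(j, k). k \<otimes> inv j) ` (J \<times> L)" using jk by force
      qed
      show "finite ((\<lambda>(j, k). k \<otimes> inv j) ` (J \<times> L))" using J L by simp
    qed
    then show "(?m \<longlongrightarrow> measure ?K A * measure ?K B) (along H)"
      by (rule tendsto_eventually)
  qed
qed

end

section \<open>Separation of variables\<close>

lemma measure_preserving_fst:
  assumes "prob_space L"
  shows "measure_preserving (K \<Otimes>\<^sub>M L) K fst"
  using prob_space.distr_pair_fst[OF assms] by (simp add: measure_preserving_def)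

lemma measure_preserving_snd:
  assumes "prob_space K" "prob_space L"
  shows "measure_preserving (K \<Otimes>\<^sub>M L) L snd"
proof -
  interpret K: prob_space K by fact
  interpret L: prob_space L by fact
  interpret P: pair_prob_space L K ..
  have "measure_preserving (K \<Otimes>\<^sub>M L) (L \<Otimes>\<^sub>M K) (\<lambda>(x, y). (y, x))"
    unfolding measure_preserving_def
    by (intro conjI P.distr_pair_swap[symmetric] measurable_pair_swap')
  from measure_preserving_comp[OF this measure_preserving_fst[OF assms(1)]]
  moreover have "(\<lambda>z::'a \<times> 'b. fst (case z of (x, y) \<Rightarrow> (y, x))) = snd" by (auto simp: fun_eq_iff)
  ultimately show ?thesis by (simp only:)
qed

lemma (in prob_space) AE_obtain:
  assumes "AE x in M. P x"
  obtains x where "x \<in> space M" "P x"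
proof (rule ccontr)
  assume "\<not> thesis"
  then have no: "\<And>x. x \<in> space M \<Longrightarrow> \<not> P x" using that by blast
  have "AE x in M. False" using assms AE_space by eventually_elim (use no in blast)
  then show False by simp
qed

lemma mult_cnj_unit: "cmod z = 1 \<Longrightarrow> z * cnj z = 1"
  by (simp add: complex_norm_square[symmetric])

lemma unit_eq_cnj_mult: "cmod z = 1 \<Longrightarrow> z * x = y \<longleftrightarrow> x = cnj z * y"
  using mult_cnj_unit[of z] by (metis mult.assoc mult.commute mult_1)

lemma (in prob_space) integrable_bounded_complex:
  fixes f :: "'a \<Rightarrow> complex"
  assumes "f \<in> borel_measurable M" "\<And>x. cmod (f x) \<le> C"
  shows "integrable M f"
  using assms by (intro integrable_const_bound[of _ C]) auto

lemma (in prob_space) integral_norm_bounded: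
  fixes f :: "'a \<Rightarrow> complex"
  assumes "f \<in> borel_measurable M" "\<And>x. cmod (f x) \<le> 1"
  shows "cmod (\<integral>x. f x \<partial>M) \<le> 1"
proof -
  have i: "integrable M f" by (rule integrable_bounded_complex[OF assms])
  have "cmod (\<integral>x. f x \<partial>M) \<le> (\<integral>x. cmod (f x) \<partial>M)" by (rule integral_norm_bound)
  also have "\<dots> \<le> (\<integral>x. 1 \<partial>M)" using i assms(2) by (intro integral_mono) auto
  finally show ?thesis by (simp add: prob_space)
qed

locale unit_kernel = K: prob_space K + L: prob_space L
  for K :: "'a measure" and L :: "'b measure" +
  fixes v :: "'a \<times> 'b \<Rightarrow> complex"
  assumes v_measurable [measurable]: "v \<in> borel_measurable (K \<Otimes>\<^sub>M L)"
    and v_norm: "\<And>z. cmod (v z) = 1"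
begin

sublocale KL: pair_prob_space K L ..
sublocale KK: pair_prob_space K K ..
sublocale K_KL: pair_prob_space K "K \<Otimes>\<^sub>M L" ..

text \<open>The kernel of \<open>v v\<^sup>*\<close>, where \<open>v\<close> is viewed as an integral operator from \<open>L\<^sup>2(L)\<close> to
  \<open>L\<^sup>2(K)\<close>.\<close>

definition \<kappa> :: "'a \<Rightarrow> 'a \<Rightarrow> complex" where
  "\<kappa> x x' = (\<integral>y. v (x, y) * cnj (v (x', y)) \<partial>L)"

lemma \<kappa>_measurable [measurable]: "case_prod \<kappa> \<in> borel_measurable (K \<Otimes>\<^sub>M K)"
  unfolding \<kappa>_def by measurable

lemma \<kappa>_section [measurable]:
  assumes "x' \<in> space K"
  shows "(\<lambda>x. \<kappa> x x') \<in> borel_measurable K"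
  using measurable_compose[OF measurable_Pair2'[OF assms] \<kappa>_measurable] by simp

lemma v_section [measurable]: "x \<in> space K \<Longrightarrow> (\<lambda>y. v (x, y)) \<in> borel_measurable L"
  by measurable

lemma \<kappa>_norm: "x \<in> space K \<Longrightarrow> x' \<in> space K \<Longrightarrow> cmod (\<kappa> x x') \<le> 1"
  unfolding \<kappa>_def by (intro L.integral_norm_bounded) (auto simp: norm_mult v_norm)

text \<open>If \<open>\<kappa>\<close> vanished, then so would the quadratic form of the operator
  with this kernel. For the indicator of a set \<open>A\<close> this form is the squared norm of the
  function w(y), the integral of v(x, y) over x in \<open>A\<close>. Hence \<open>v\<close>
  integrates to 0 over all rectangles and is null, against its modulus 1.\<close>

lemma \<kappa>_nonzero: "\<not> (AE x' in K. AE x in K. \<kappa> x x' = 0)"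
proof
  assume 0: "AE x' in K. AE x in K. \<kappa> x x' = 0"
  have w0: "AE y in L. (\<integral>x. indicator A x *\<^sub>R v (x, y) \<partial>K) = 0"
    if A[measurable]: "A \<in> sets K" for A
  proof -
    let ?u = "\<lambda>x y. indicator A x *\<^sub>R v (x, y)"
    define w where "w y = (\<integral>x. ?u x y \<partial>K)" for y
    have u1: "cmod (?u x y) \<le> 1" for x y by (auto simp: v_norm indicator_def)
    have [measurable]: "w \<in> borel_measurable L" unfolding w_def by measurable
    have w1: "cmod (w y) \<le> 1" if "y \<in> space L" for y
      unfolding w_def using that u1 by (intro K.integral_norm_bounded) measurable
    \<comment> \<open>The bound on \<open>w\<close> is only available on the space of
      \<open>L\<close>; the extension by 0 makes it hold everywhere.\<close>
    define w' where "w' y = (if y \<in> space L then w y else 0)" for y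
    have [measurable]: "w' \<in> borel_measurable L"
      by (subst measurable_cong[of L w' w]) (auto simp: w'_def)
    have w'1: "cmod (w' y) \<le> 1" for y using w1 by (simp add: w'_def)
    have inner: "(\<integral>y. w' y * cnj (?u x' y) \<partial>L) = indicator A x' *\<^sub>R (\<integral>x. indicator A x *\<^sub>R \<kappa> x x' \<partial>K)"
      if x': "x' \<in> space K" for x'
    proof -
      have [measurable]: "(\<lambda>y. v (x', y)) \<in> borel_measurable L" using x' by measurable
      have "(\<integral>y. w' y * cnj (?u x' y) \<partial>L) = (\<integral>y. (\<integral>x. ?u x y * cnj (?u x' y) \<partial>K) \<partial>L)"
      proof (rule Bochner_Integration.integral_cong)
        fix y assume y: "y \<in> space L"
        show "w' y * cnj (?u x' y) = (\<integral>x. ?u x y * cnj (?u x' y) \<partial>K)"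
          by (simp only: w'_def w_def y if_True integral_mult_left_zero)
      qed simp
      also have "\<dots> = (\<integral>x. (\<integral>y. ?u x y * cnj (?u x' y) \<partial>L) \<partial>K)"
      proof (rule KL.Fubini_integral)
        show "integrable (K \<Otimes>\<^sub>M L) (\<lambda>(x, y). ?u x y * cnj (?u x' y))"
        proof (rule KL.integrable_bounded_complex[where C=1])
          show "cmod (case z of (x, y) \<Rightarrow> ?u x y * cnj (?u x' y)) \<le> 1" for z
            using u1 by (auto simp: split_beta' norm_mult v_norm indicator_def)
        qed measurable
      qed
      also have "\<dots> = (\<integral>x. indicator A x' *\<^sub>R (indicator A x *\<^sub>R \<kappa> x x') \<partial>K)"
        by (rule Bochner_Integration.integral_cong) (auto simp: \<kappa>_def indicator_def)
      also have "\<dots> = indicator A x' *\<^sub>R (\<integral>x. indicator A x *\<^sub>R \<kappa> x x' \<partial>K)"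
        by (rule integral_scaleR_right)
      finally show ?thesis .
    qed
    have z: "AE x' in K. (\<integral>y. w' y * cnj (?u x' y) \<partial>L) = 0"
      using 0 AE_space
    proof eventually_elim
      case (elim x')
      have [measurable]: "(\<lambda>x. \<kappa> x x') \<in> borel_measurable K"
        by (rule \<kappa>_section[OF elim(2)])
      have "(\<integral>x. indicator A x *\<^sub>R \<kappa> x x' \<partial>K) = (\<integral>x. 0 \<partial>K)"
      proof (rule integral_cong_AE)
        show "AE x in K. indicator A x *\<^sub>R \<kappa> x x' = 0" using elim(1) by eventually_elim simp
      qed measurable
      then show ?case using inner[OF elim(2)] by simp
    qed
    have "(\<integral>y. w' y * cnj (w' y) \<partial>L) = (\<integral>y. (\<integral>x'. w' y * cnj (?u x' y) \<partial>K) \<partial>L)"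
    proof (rule Bochner_Integration.integral_cong)
      fix y assume y: "y \<in> space L"
      show "w' y * cnj (w' y) = (\<integral>x'. w' y * cnj (?u x' y) \<partial>K)"
        by (simp only: w'_def w_def y if_True integral_mult_right_zero Bochner_Integration.integral_cnj)
    qed simp
    also have "\<dots> = (\<integral>x'. (\<integral>y. w' y * cnj (?u x' y) \<partial>L) \<partial>K)"
    proof (rule KL.Fubini_integral)
      show "integrable (K \<Otimes>\<^sub>M L) (\<lambda>(x', y). w' y * cnj (?u x' y))"
      proof (rule KL.integrable_bounded_complex[where C=1])
        show "cmod (case z of (x', y) \<Rightarrow> w' y * cnj (?u x' y)) \<le> 1" for z
          using w'1 by (auto simp: split_beta' norm_mult v_norm indicator_def)
      qed measurable
    qed
    also have "\<dots> = (\<integral>x'. 0 \<partial>K)"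
      using z by (intro integral_cong_AE) measurable
    finally have "(\<integral>y. complex_of_real ((cmod (w' y))\<^sup>2) \<partial>L) = 0"
      by (simp add: complex_norm_square del: of_real_power)
    then have "(\<integral>y. (cmod (w' y))\<^sup>2 \<partial>L) = 0"
      by (simp only: integral_complex_of_real of_real_eq_0_iff)
    moreover have "integrable L (\<lambda>y. (cmod (w' y))\<^sup>2)"
      using w'1 by (intro L.integrable_const_bound[of _ 1]) (auto simp: power_le_one)
    ultimately have "AE y in L. (cmod (w' y))\<^sup>2 = 0"
      by (subst (asm) integral_nonneg_eq_0_iff_AE) auto
    then show ?thesis
      using AE_space by eventually_elim (simp add: w'_def w_def)
  qed
  have "AE z in K \<Otimes>\<^sub>M L. v z = 0"
  proof (rule AE_zero_if_integrals_zero)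
    show "sigma_finite_measure (K \<Otimes>\<^sub>M L)" by unfold_locales
    show "integrable (K \<Otimes>\<^sub>M L) v" by (rule KL.integrable_bounded_complex[where C=1]) (auto simp: v_norm)
    let ?E = "{a \<times> b | a b. a \<in> sets K \<and> b \<in> sets L}"
    show "sets (K \<Otimes>\<^sub>M L) = sigma_sets (space (K \<Otimes>\<^sub>M L)) ?E"
      by (simp add: sets_pair_measure space_pair_measure)
    show "?E \<subseteq> Pow (space (K \<Otimes>\<^sub>M L))"
      using pair_measure_closed[of K L] by (simp add: space_pair_measure)
    show "Int_stable ?E" by (rule Int_stable_pair_measure_generator)
    show "space (K \<Otimes>\<^sub>M L) \<in> ?E" by (auto simp: space_pair_measure)
    fix E assume "E \<in> ?E"
    then obtain A B where E: "E = A \<times> B" and A [measurable]: "A \<in> sets K" and [measurable]: "B \<in> sets L" by blast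
    have "(\<integral>z. indicator E z *\<^sub>R v z \<partial>(K \<Otimes>\<^sub>M L)) = (\<integral>y. (\<integral>x. indicator E (x, y) *\<^sub>R v (x, y) \<partial>K) \<partial>L)"
    proof -
      have "integrable (K \<Otimes>\<^sub>M L) (\<lambda>(x, y). indicator E (x, y) *\<^sub>R v (x, y))"
        by (rule KL.integrable_bounded_complex[where C=1]) (auto simp: E v_norm indicator_def)
      from KL.integral_snd[OF this] show ?thesis by (simp add: split_beta')
    qed
    also have "\<dots> = (\<integral>y. 0 \<partial>L)"
    proof (rule integral_cong_AE)
      show "AE y in L. (\<integral>x. indicator E (x, y) *\<^sub>R v (x, y) \<partial>K) = 0"
        using w0[OF A]
      proof eventually_elim
        case (elim y)
        have "(\<integral>x. indicator E (x, y) *\<^sub>R v (x, y) \<partial>K) = (\<integral>x. indicator B y *\<^sub>R (indicator A x *\<^sub>R v (x, y)) \<partial>K)"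
          by (rule Bochner_Integration.integral_cong) (auto simp: E indicator_def)
        with elim show ?case by (simp only: integral_scaleR_right) simp
      qed
    qed (simp_all add: E)
    finally show "(\<integral>z. indicator E z *\<^sub>R v z \<partial>(K \<Otimes>\<^sub>M L)) = 0" by simp
  qed
  then obtain z where "v z = 0" by (rule KL.AE_obtain)
  then show False using v_norm[of z] by simp
qed

text \<open>By the equation for \<open>v\<close>, the function \<open>v(x, y) cnj(v(x', y)) cnj(\<kappa>(x, x'))\<close> is invariant, hence
  constant by mixing. The constant is not \<open>0\<close>, so for a generic \<open>x'\<close> the function \<open>v(x, y)\<close> is a
  multiple of \<open>\<kappa>(x, x') v(x', y)\<close>.\<close>

lemma separation:
  fixes T :: "'h \<Rightarrow> 'a \<Rightarrow> 'a" and S :: "'h \<Rightarrow> 'b \<Rightarrow> 'b"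
  assumes H: "infinite H" and T: "mixing H K T" and S: "mixing H L S"
    and a [measurable]: "\<And>h. h \<in> H \<Longrightarrow> a h \<in> borel_measurable K" and a_norm: "\<And>h x. cmod (a h x) = 1"
    and b [measurable]: "\<And>h. h \<in> H \<Longrightarrow> b h \<in> borel_measurable L" and b_norm: "\<And>h y. cmod (b h y) = 1"
    and eq: "\<And>h. h \<in> H \<Longrightarrow> AE z in K \<Otimes>\<^sub>M L. a h (fst z) * v (T h (fst z), S h (snd z)) = v z * b h (snd z)"
  obtains f where "f \<in> borel_measurable K" "\<And>x. cmod (f x) = 1"
    "\<And>h. h \<in> H \<Longrightarrow> \<exists>c. cmod c = 1 \<and> (AE x in K. a h x * f (T h x) = c * f x)"
proof -
  let ?KKL = "K \<Otimes>\<^sub>M (K \<Otimes>\<^sub>M L)"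
  \<comment> \<open>Triples are (x', x, y), with x' in the first place so that a generic x' can be
    fixed at the end.\<close>
  define R where "R h z = (T h (fst z), T h (fst (snd z)), S h (snd (snd z)))" for h and z :: "'a \<times> 'a \<times> 'b"
  define p where "p z = v (fst (snd z), snd (snd z)) * cnj (v (fst z, snd (snd z))) * cnj (\<kappa> (fst (snd z)) (fst z))"
    for z :: "'a \<times> 'a \<times> 'b"
  have KLp: "prob_space (K \<Otimes>\<^sub>M L)" "prob_space ?KKL" by unfold_locales
  have R: "mixing H ?KKL R"
    using mixing_pair[OF H K.prob_space_axioms KLp(1) T mixing_pair[OF H K.prob_space_axioms L.prob_space_axioms T S]]
    by (simp add: R_def[abs_def])
  have [measurable]: "(\<lambda>z. \<kappa> (fst (snd z)) (fst z)) \<in> borel_measurable ?KKL"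
    using measurable_compose[OF _ \<kappa>_measurable, of "\<lambda>z. (fst (snd z), fst z)" ?KKL] by simp
  have p_meas [measurable]: "p \<in> borel_measurable ?KKL"
    unfolding p_def by measurable
  have p_bound: "AE z in ?KKL. cmod (p z) \<le> 1"
    using AE_space
  proof eventually_elim
    case (elim z)
    then show ?case using \<kappa>_norm[of "fst (snd z)" "fst z"]
      by (auto simp: p_def norm_mult v_norm space_pair_measure)
  qed
  have p_int: "integrable ?KKL p"
    by (rule K_KL.integrable_const_bound[OF p_bound]) simp
  have good: "AE x in K. AE y in L. a h x * v (T h x, S h y) = v (x, y) * b h y" if "h \<in> H" for h
    using KL.AE_pair[OF eq[OF that]] by simp
  \<comment> \<open>Substituting \<open>S h y\<close> for \<open>y\<close> does not change the
    integral; the factors \<open>b h y\<close> then cancel against their conjugates, and only the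
    values of \<open>a h\<close>, which do not depend on \<open>y\<close>, remain.\<close>
  have \<kappa>_inv: "\<kappa> (T h x) (T h x') = cnj (a h x) * a h x' * \<kappa> x x'"
    if h: "h \<in> H" and xx: "x \<in> space K" "x' \<in> space K"
      and g: "AE y in L. a h x * v (T h x, S h y) = v (x, y) * b h y"
        "AE y in L. a h x' * v (T h x', S h y) = v (x', y) * b h y" for h x x'
  proof -
    have [measurable]: "T h \<in> K \<rightarrow>\<^sub>M K" "S h \<in> L \<rightarrow>\<^sub>M L"
      using mixing_measurable[OF T h] mixing_measurable[OF S h] by simp_all
    have Tx: "T h x \<in> space K" "T h x' \<in> space K"
      using xx measurable_space[of "T h" K K] by auto
    have [measurable]: "(\<lambda>y. v (T h x, y)) \<in> borel_measurable L" "(\<lambda>y. v (T h x', y)) \<in> borel_measurable L"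
      "(\<lambda>y. v (x, y)) \<in> borel_measurable L" "(\<lambda>y. v (x', y)) \<in> borel_measurable L"
      using v_section[OF Tx(1)] v_section[OF Tx(2)] v_section[OF xx(1)] v_section[OF xx(2)] by simp_all
    have "\<kappa> (T h x) (T h x') = (\<integral>y. v (T h x, S h y) * cnj (v (T h x', S h y)) \<partial>L)"
      unfolding \<kappa>_def
      by (rule measure_preserving_integral[symmetric, OF mixing_measure_preserving[OF S h]]) measurable
    also have "\<dots> = (\<integral>y. (cnj (a h x) * a h x') * (v (x, y) * cnj (v (x', y))) \<partial>L)"
    proof (rule integral_cong_AE)
      show "AE y in L. v (T h x, S h y) * cnj (v (T h x', S h y)) = (cnj (a h x) * a h x') * (v (x, y) * cnj (v (x', y)))"
        using g
      proof eventually_elim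
        case (elim y)
        have 1: "v (T h x, S h y) = cnj (a h x) * (v (x, y) * b h y)"
          using elim(1) unit_eq_cnj_mult[OF a_norm[of h x]] by blast
        have 2: "v (T h x', S h y) = cnj (a h x') * (v (x', y) * b h y)"
          using elim(2) unit_eq_cnj_mult[OF a_norm[of h x']] by blast
        have "v (T h x, S h y) * cnj (v (T h x', S h y)) =
            (cnj (a h x) * a h x') * (v (x, y) * cnj (v (x', y))) * (b h y * cnj (b h y))"
          unfolding 1 2 by (simp add: mult_ac)
        then show ?case by (simp add: mult_cnj_unit[OF b_norm])
      qed
    qed measurable
    also have "\<dots> = cnj (a h x) * a h x' * \<kappa> x x'" unfolding \<kappa>_def by simp
    finally show ?thesis .
  qed
  have p_inv: "AE z in ?KKL. p (R h z) = p z" if h: "h \<in> H" for h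
  proof -
    have mp1: "measure_preserving ?KKL K fst" by (rule measure_preserving_fst[OF KLp(1)])
    have mp2: "measure_preserving ?KKL (K \<Otimes>\<^sub>M L) snd"
      by (rule measure_preserving_snd[OF K.prob_space_axioms KLp(1)])
    have mp3: "measure_preserving ?KKL K (\<lambda>z. fst (snd z))"
      by (rule measure_preserving_comp[OF mp2 measure_preserving_fst[OF L.prob_space_axioms]])
    have mp4: "measure_preserving ?KKL (K \<Otimes>\<^sub>M L) (\<lambda>z. (fst z, snd (snd z)))"
      using measure_preserving_pair[OF K.prob_space_axioms KLp(1) _ measure_preserving_snd[OF K.prob_space_axioms L.prob_space_axioms]
        K.prob_space_axioms L.prob_space_axioms, of "\<lambda>x. x"] by (simp add: measure_preserving_def distr_id)
    note g1 = measure_preserving_AE[OF mp1 good[OF h]] and g2 = measure_preserving_AE[OF mp3 good[OF h]]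
    note e1 = measure_preserving_AE[OF mp2 eq[OF h]] and e2 = measure_preserving_AE[OF mp4 eq[OF h]]
    show ?thesis
      using g1 g2 e1 e2 AE_space
    proof eventually_elim
      case (elim z)
      obtain x' x y where z: "z = (x', x, y)" by (cases z)
      have sp: "x \<in> space K" "x' \<in> space K" using elim(5) by (auto simp: z space_pair_measure)
      have k: "\<kappa> (T h x) (T h x') = cnj (a h x) * a h x' * \<kappa> x x'"
        using elim(1,2) by (intro \<kappa>_inv[OF h sp]) (simp_all add: z)
      have 1: "v (T h x, S h y) = cnj (a h x) * (v (x, y) * b h y)"
        using elim(3) unit_eq_cnj_mult[OF a_norm[of h x]] by (simp add: z)
      have 2: "v (T h x', S h y) = cnj (a h x') * (v (x', y) * b h y)"
        using elim(4) unit_eq_cnj_mult[OF a_norm[of h x']] by (simp add: z)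
      have "p (R h z) = v (x, y) * cnj (v (x', y)) * cnj (\<kappa> x x') *
          (b h y * cnj (b h y)) * (a h x * cnj (a h x)) * (a h x' * cnj (a h x'))"
        unfolding p_def R_def z fst_conv snd_conv 1 2 k by (simp add: mult_ac)
      then show "p (R h z) = p z"
        by (simp add: mult_cnj_unit[OF b_norm] mult_cnj_unit[OF a_norm] p_def z)
    qed
  qed
  obtain c where c: "AE z in ?KKL. p z = c"
    using mixing_invariant_const[OF R H KLp(2) p_int p_inv] by blast
  have cx: "AE x' in K. AE z in K \<Otimes>\<^sub>M L. p (x', z) = c"
    using K_KL.AE_pair[OF c] .
  \<comment> \<open>All factors of \<open>p\<close> other than the one from \<open>\<kappa>\<close>
    have modulus 1.\<close>
  have c0: "c \<noteq> 0"
  proof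
    assume c: "c = 0"
    have "AE x' in K. AE x in K. \<kappa> x x' = 0"
      using cx
    proof eventually_elim
      case (elim x')
      have "AE x in K. AE y in L. p (x', x, y) = c" using KL.AE_pair[OF elim] by simp
      then show ?case
      proof eventually_elim
        case (elim x)
        then obtain y where "p (x', x, y) = c" by (rule L.AE_obtain)
        then show ?case using c v_norm[of "(x, y)"] v_norm[of "(x', y)"] by (auto simp: p_def)
      qed
    qed
    then show False using \<kappa>_nonzero by blast
  qed
  from cx obtain x0 where x0: "x0 \<in> space K" "AE z in K \<Otimes>\<^sub>M L. p (x0, z) = c"
    by (rule K.AE_obtain)
  \<comment> \<open>With u = v(x, y) cnj(v(x0, y)), of modulus 1, the constancy of \<open>p\<close>
    reads u cnj(\<kappa>(x, x0)) = c. Solving for u gives \<kappa>(x, x0) / cnj c, which is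
    therefore independent of y. The next definition only repairs the modulus on a null set.\<close>
  define f0 where "f0 x = \<kappa> x x0 / cnj c" for x
  define f where "f x = (if cmod (f0 x) = 1 then f0 x else 1)" for x
  define g where "g y = v (x0, y)" for y
  have [measurable]: "f0 \<in> borel_measurable K"
    unfolding f0_def using x0(1) by measurable
  have f_meas [measurable]: "f \<in> borel_measurable K" unfolding f_def by measurable
  have f_norm: "cmod (f x) = 1" for x by (simp add: f_def)
  have g_norm: "cmod (g y) = 1" for y by (simp add: g_def v_norm)
  have vfg: "AE z in K \<Otimes>\<^sub>M L. v z = f (fst z) * g (snd z)"
    using x0(2)
  proof eventually_elim
    case (elim z)
    obtain x y where z: "z = (x, y)" by (cases z)
    let ?u = "v (x, y) * cnj (v (x0, y))"
    have e: "?u * cnj (\<kappa> x x0) = c" using elim by (simp add: p_def z)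
    have u: "cmod ?u = 1" by (simp add: norm_mult v_norm)
    have "cnj (\<kappa> x x0) = cnj ?u * c" using e unit_eq_cnj_mult[OF u] by blast
    then have "\<kappa> x x0 = ?u * cnj c" by (metis complex_cnj_cnj complex_cnj_mult)
    then have f0: "f0 x = ?u" using c0 by (simp add: f0_def)
    then have "f x = ?u" using u by (simp add: f_def)
    then have "f x * g y = v (x, y) * (v (x0, y) * cnj (v (x0, y)))" by (simp add: g_def mult_ac)
    then show ?case by (simp add: z mult_cnj_unit[OF v_norm])
  qed
  have "\<exists>c. cmod c = 1 \<and> (AE x in K. a h x * f (T h x) = c * f x)" if h: "h \<in> H" for h
  proof -
    have mp: "measure_preserving (K \<Otimes>\<^sub>M L) (K \<Otimes>\<^sub>M L) (\<lambda>z. (T h (fst z), S h (snd z)))"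
      using mixing_measure_preserving[OF T h] mixing_measure_preserving[OF S h]
      by (intro measure_preserving_pair K.prob_space_axioms L.prob_space_axioms)
    \<comment> \<open>Inserting v = f(x) g(y) separates the equation into F(x) = q(y) for almost all
      pairs; both sides are then constant.\<close>
    define F where "F x = a h x * f (T h x) * cnj (f x)" for x
    define q where "q y = g y * b h y * cnj (g (S h y))" for y
    have "AE z in K \<Otimes>\<^sub>M L. F (fst z) = q (snd z)"
      using eq[OF h] vfg measure_preserving_AE[OF mp vfg]
    proof eventually_elim
      case (elim z)
      obtain x y where z: "z = (x, y)" by (cases z)
      have 1: "a h x * (f (T h x) * g (S h y)) = f x * g y * b h y" using elim by (simp add: z)
      have "F x * (g (S h y) * cnj (g (S h y))) = (a h x * (f (T h x) * g (S h y))) * cnj (f x) * cnj (g (S h y))"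
        by (simp add: F_def mult_ac)
      also have "\<dots> = q y * (f x * cnj (f x))" unfolding 1 by (simp add: q_def mult_ac)
      finally show ?case by (simp add: z mult_cnj_unit[OF g_norm] mult_cnj_unit[OF f_norm])
    qed
    then have xy: "AE x in K. AE y in L. F x = q y" using KL.AE_pair by force
    then obtain x1 where x1: "AE y in L. F x1 = q y" by (rule K.AE_obtain)
    have "AE x in K. F x = F x1"
      using xy
    proof eventually_elim
      case (elim x)
      then have "AE y in L. F x = F x1" using x1 by eventually_elim simp
      then show ?case by simp
    qed
    then have "AE x in K. a h x * f (T h x) = F x1 * f x"
    proof eventually_elim
      case (elim x)
      have "F x * f x = a h x * f (T h x) * (f x * cnj (f x))" by (simp add: F_def mult_ac)
      then show ?case using elim by (simp add: mult_cnj_unit[OF f_norm])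
    qed
    moreover have "cmod (F x1) = 1" by (simp add: F_def norm_mult a_norm f_norm)
    ultimately show ?thesis by blast
  qed
  then show thesis using that f_meas f_norm by blast
qed

end

section \<open>Sequences of almost invariant vectors\<close>

locale mp_group_action = group G + X: prob_space X
  for G :: "('g, 'm) monoid_scheme" (structure) and X :: "'a measure" +
  fixes T :: "'g \<Rightarrow> 'a \<Rightarrow> 'a"
  assumes T: "\<And>g. g \<in> carrier G \<Longrightarrow> measure_preserving X X (T g)"
    and T_one: "\<And>x. x \<in> space X \<Longrightarrow> T \<one> x = x"
    and T_mult: "\<And>g h x. \<lbrakk>g \<in> carrier G; h \<in> carrier G; x \<in> space X\<rbrakk> \<Longrightarrow> T (g \<otimes> h) x = T g (T h x)"
begin

text \<open>The modulus is prescribed at every point and for every \<open>g\<close>, even outside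
  the carrier. This avoids exceptional null sets in computations and is the reason for the default
  value 1 in the cocycles built later.\<close>

definition unit_cocycle :: "('g \<Rightarrow> 'a \<Rightarrow> complex) \<Rightarrow> bool" where
  "unit_cocycle c \<longleftrightarrow>
     (\<forall>g\<in>carrier G. c g \<in> borel_measurable X) \<and> (\<forall>g x. cmod (c g x) = 1) \<and>
     (\<forall>g\<in>carrier G. \<forall>h\<in>carrier G. AE x in X. c (g \<otimes> h) x = c g x * c h (T (inv g) x))"

text \<open>The representations on the orthogonal complement of the indicators of \<open>D\<close> given by the cocycles
  \<open>c n\<close> are summed up: their direct sum lives on \<open>L\<^sup>2\<close> of the product of \<open>X\<close> with a geometric
  distribution.\<close>

lemma relative_property_T_sequence:
  fixes c :: "nat \<Rightarrow> 'g \<Rightarrow> 'a \<Rightarrow> complex" and D :: "'a set set"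
  assumes relT: "relative_property_T G H" and H: "H \<subseteq> carrier G"
    and cg: "countably_generated X"
    and c: "\<And>n. unit_cocycle (c n)"
    and D: "D \<subseteq> sets X"
    and inv: "\<And>n g f. \<lbrakk>g \<in> carrier G; f \<in> L2 X; \<And>A. A \<in> D \<Longrightarrow> (\<integral>x. indicator A x *\<^sub>R f x \<partial>X) = 0\<rbrakk>
      \<Longrightarrow> \<forall>A\<in>D. (\<integral>x. indicator A x *\<^sub>R (c n g x * f (T (inv g) x)) \<partial>X) = 0"
    and \<xi>: "\<And>n. \<xi> n \<in> L2 X" "\<And>n A. A \<in> D \<Longrightarrow> (\<integral>x. indicator A x *\<^sub>R \<xi> n x \<partial>X) = 0"
    and almost: "\<And>g. g \<in> carrier G \<Longrightarrow>
      (\<lambda>n. \<integral>x. c n g x * \<xi> n (T (inv g) x) * cnj (\<xi> n x) \<partial>X) \<longlonglongrightarrow> 1"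
  obtains n f where "f \<in> L2 X" "\<And>A. A \<in> D \<Longrightarrow> (\<integral>x. indicator A x *\<^sub>R f x \<partial>X) = 0"
    "\<not> (AE x in X. f x = 0)" "\<And>h. h \<in> H \<Longrightarrow> AE x in X. c n h x * f (T (inv h) x) = f x"
proof -
  \<comment> \<open>Only full support matters: every \<open>n\<close> has positive mass, so that
    almost surely in \<open>n\<close> means for all \<open>n\<close>, and no summand is
    lost.\<close>
  define q :: "nat pmf" where "q = geometric_pmf (1/2)"
  let ?P = "measure_pmf q"
  have q_pos: "pmf q n > 0" for n by (simp add: q_def)
  have q_AE: "(AE n in ?P. Q n) \<longleftrightarrow> (\<forall>n. Q n)" for Q
    using q_pos by (auto simp: AE_measure_pmf_iff set_pmf_eq less_imp_neq[symmetric])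
  interpret K: pair_prob_space ?P X ..
  let ?K = "?P \<Otimes>\<^sub>M X"
  define \<tau> where "\<tau> g z = (fst z :: nat, T g (snd z))" for g z
  define d where "d g z = c (fst z :: nat) g (snd z)" for g z
  define \<D> where "\<D> = {{n :: nat} \<times> A | n A. A \<in> D}"
  have c_meas: "c n g \<in> borel_measurable X" and c_norm: "cmod (c n g x) = 1" if "g \<in> carrier G" for n g x
    using c[of n] that by (auto simp: unit_cocycle_def)
  have T_meas: "T g \<in> X \<rightarrow>\<^sub>M X" if "g \<in> carrier G" for g
    using measure_preserving_measurable[OF T[OF that]] .
  have "countably_generated ?K" by (intro countably_generated_pair countably_generated_pmf cg)
  then obtain E :: "nat \<Rightarrow> (nat \<times> 'a) set" where E: "range E \<subseteq> sets ?K"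
    "sets ?K = sigma_sets (space ?K) (range E)" "Int_stable (range E)" "space ?K \<in> range E"
    by (rule countably_generated_Int_stable)
  have sets_single: "{n} \<times> A \<in> sets ?K" if "A \<in> sets X" for n A
    using that by simp
  have integral_single: "(\<integral>z. indicator ({n} \<times> A) z *\<^sub>R f z \<partial>?K) = pmf q n *\<^sub>R (\<integral>x. indicator A x *\<^sub>R f (n, x) \<partial>X)"
    if f: "integrable ?K f" and A: "A \<in> sets X" for f :: "nat \<times> 'a \<Rightarrow> complex" and n A
  proof -
    have "integrable ?K (\<lambda>z. indicator ({n} \<times> A) z *\<^sub>R f z)"
      using integrable_mult_indicator[OF sets_single[OF A] f] .
    then have "(\<integral>z. indicator ({n} \<times> A) z *\<^sub>R f z \<partial>?K) =
        (\<integral>m. (\<integral>x. indicator ({n} \<times> A) (m, x) *\<^sub>R f (m, x) \<partial>X) \<partial>?P)"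
      by (rule K.integral_fst'[symmetric])
    also have "\<dots> = (\<integral>m. indicator {n} m *\<^sub>R (\<integral>x. indicator A x *\<^sub>R f (n, x) \<partial>X) \<partial>?P)"
    proof (rule Bochner_Integration.integral_cong)
      fix m
      show "(\<integral>x. indicator ({n} \<times> A) (m, x) *\<^sub>R f (m, x) \<partial>X) = indicator {n} m *\<^sub>R (\<integral>x. indicator A x *\<^sub>R f (n, x) \<partial>X)"
        by (cases "m = n") (simp_all add: indicator_def)
    qed simp
    also have "\<dots> = pmf q n *\<^sub>R (\<integral>x. indicator A x *\<^sub>R f (n, x) \<partial>X)"
    proof -
      have "(\<integral>m. indicator {n} m *\<^sub>R (\<integral>x. indicator A x *\<^sub>R f (n, x) \<partial>X) \<partial>?P) =
          (\<integral>m. indicator {n} m \<partial>?P) *\<^sub>R (\<integral>x. indicator A x *\<^sub>R f (n, x) \<partial>X)"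
        by (rule integral_scaleR_left) (rule measure_pmf.integrable_const_bound[of _ 1], auto)
      then show ?thesis by (simp add: measure_pmf_single)
    qed
    finally show ?thesis .
  qed
  have section_L2: "(\<lambda>x. f (n, x)) \<in> L2 X" if f: "f \<in> L2 ?K" for f n
  proof -
    have [measurable]: "f \<in> borel_measurable ?K" using f by (simp add: L2_def)
    have "integrable ?K (\<lambda>z. (cmod (f z))\<^sup>2)" using f by (simp add: L2_def)
    then have "AE n in ?P. integrable X (\<lambda>x. (cmod (f (n, x)))\<^sup>2)" by (rule K.AE_integrable_fst')
    then have "integrable X (\<lambda>x. (cmod (f (n, x)))\<^sup>2)" by (simp add: q_AE)
    moreover have "(\<lambda>x. f (n, x)) \<in> borel_measurable X" by measurable
    ultimately show ?thesis by (simp add: L2_def)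
  qed
  have "measure_preserving ?K ?K (\<lambda>z. (fst z, T g (snd z)))" if "g \<in> carrier G" for g
    by (rule measure_preserving_pair[OF prob_space_measure_pmf X.prob_space_axioms measure_preserving_id T[OF that]
      prob_space_measure_pmf X.prob_space_axioms])
  then have \<tau>: "measure_preserving ?K ?K (\<tau> g)" if "g \<in> carrier G" for g
    using that by (simp add: \<tau>_def[abs_def])
  have d_meas: "d g \<in> borel_measurable ?K" if g: "g \<in> carrier G" for g
  proof -
    have "(\<lambda>z. c n g (snd z)) \<in> borel_measurable ?K" for n
      using measurable_compose[OF measurable_snd c_meas[OF g]] .
    then have "(\<lambda>z. c (fst z) g (snd z)) \<in> borel_measurable ?K"
      by (intro measurable_compose_countable'[where g=fst and I=UNIV and f="\<lambda>n z. c n g (snd z)"]) auto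
    then show ?thesis by (simp add: d_def[abs_def])
  qed
  define d' where "d' g z = (if g \<in> carrier G then d g z else 1)" for g z
  have d'_eq: "d' g z = c (fst z) g (snd z)" if "g \<in> carrier G" for g z
    using that by (simp add: d'_def d_def)
  have d_mult: "AE z in ?K. d' (g \<otimes> h) z = d' g z * d' h (\<tau> (inv g) z)"
    if gh: "g \<in> carrier G" "h \<in> carrier G" for g h
  proof (rule K.AE_pair_measure)
    have [measurable]: "d' (g \<otimes> h) \<in> borel_measurable ?K" "d' g \<in> borel_measurable ?K" "d' h \<in> borel_measurable ?K"
      using d_meas gh by (simp_all add: d'_def[abs_def])
    have [measurable]: "\<tau> (inv g) \<in> ?K \<rightarrow>\<^sub>M ?K" using measure_preserving_measurable[OF \<tau>] gh by simp
    show "{z \<in> space ?K. d' (g \<otimes> h) z = d' g z * d' h (\<tau> (inv g) z)} \<in> sets ?K" by measurable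
    show "AE n in ?P. AE x in X. d' (g \<otimes> h) (n, x) = d' g (n, x) * d' h (\<tau> (inv g) (n, x))"
      using c gh by (simp add: q_AE d'_eq \<tau>_def unit_cocycle_def)
  qed
  interpret R: multiplier_rep ?K E \<D> G \<tau> d'
  proof (intro multiplier_rep.intro l2_space.intro l2_space_axioms.intro multiplier_rep_axioms.intro)
    show "\<D> \<subseteq> sets ?K" using D sets_single by (auto simp: \<D>_def)
    show "\<tau> \<one> z = z" if "z \<in> space ?K" for z
      using that T_one by (cases z) (simp add: \<tau>_def space_pair_measure)
    show "\<tau> (g \<otimes> h) z = \<tau> g (\<tau> h z)" if "g \<in> carrier G" "h \<in> carrier G" "z \<in> space ?K" for g h z
      using that T_mult by (cases z) (simp add: \<tau>_def space_pair_measure)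
    show "cmod (d' g z) = 1" for g z using c_norm by (simp add: d'_def d_def)
    show "d' g \<in> borel_measurable ?K" if "g \<in> carrier G" for g
      using d_meas[OF that] that by (simp add: d'_def[abs_def])
  qed (use E \<tau> d_mult in \<open>auto intro: K.prob_space_axioms is_group\<close>)
  have vecsD: "(\<integral>x. indicator A x *\<^sub>R f (n, x) \<partial>X) = 0" if f: "f \<in> R.vecs" and A: "A \<in> D" for f n A
  proof -
    have "(\<integral>z. indicator ({n} \<times> A) z *\<^sub>R f z \<partial>?K) = 0" 
    proof -
      have "{n} \<times> A \<in> \<D>" using A unfolding \<D>_def by blast
      then show ?thesis using f unfolding R.vecs_def by blast
    qed
    moreover have "A \<in> sets X" using A D by blast
    ultimately show ?thesis
      using integral_single[OF K.L2_integrable[OF R.vecs_L2[OF f]], of A n] q_pos[of n] by simp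
  qed
  have vecsI: "f \<in> R.vecs" if f: "f \<in> L2 ?K" and 0: "\<And>n A. A \<in> D \<Longrightarrow> (\<integral>x. indicator A x *\<^sub>R f (n, x) \<partial>X) = 0" for f
  proof -
    have "(\<integral>z. indicator ({n} \<times> A) z *\<^sub>R f z \<partial>?K) = 0" if A: "A \<in> D" for n A
      using integral_single[OF K.L2_integrable[OF f], of A n] 0[OF A] A D by (simp add: subset_iff)
    then have "\<forall>A\<in>\<D>. (\<integral>z. indicator A z *\<^sub>R f z \<partial>?K) = 0"
      unfolding \<D>_def by (intro ballI) (elim CollectE exE conjE, simp only:)
    then show ?thesis using f unfolding R.vecs_def by blast
  qed
  have R_inv: "R.\<rho> g f \<in> R.vecs" if g: "g \<in> carrier G" and f: "f \<in> R.vecs" for g f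
  proof (rule vecsI)
    show "R.\<rho> g f \<in> L2 ?K" by (rule R.\<rho>_L2[OF g R.vecs_L2[OF f]])
    fix n A assume A: "A \<in> D"
    have "R.\<rho> g f (n, x) = c n g x * f (n, T (inv g) x)" for x
      using g by (simp add: R.\<rho>_def d'_eq \<tau>_def)
    moreover have "(\<integral>x. indicator A x *\<^sub>R (c n g x * f (n, T (inv g) x)) \<partial>X) = 0"
      by (rule bspec[OF inv[OF g section_L2[OF R.vecs_L2[OF f]] vecsD[OF f]] A])
    ultimately show "(\<integral>x. indicator A x *\<^sub>R R.\<rho> g f (n, x) \<partial>X) = 0" by simp
  qed
  have al: "\<exists>f\<in>R.vecs. \<forall>g\<in>F. cmod (1 - (\<integral>z. d' g z * f (\<tau> (inv g) z) * cnj (f z) \<partial>?K)) < \<epsilon>"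
    if F: "finite F" "F \<subseteq> carrier G" and \<epsilon>: "\<epsilon> > 0" for F \<epsilon>
  proof -
    have "\<forall>\<^sub>F n in sequentially. \<forall>g\<in>F. dist (\<integral>x. c n g x * \<xi> n (T (inv g) x) * cnj (\<xi> n x) \<partial>X) 1 < \<epsilon>"
    proof (rule eventually_ball_finite[OF F(1)], intro ballI)
      fix g assume "g \<in> F"
      then have "g \<in> carrier G" using F(2) by blast
      then show "\<forall>\<^sub>F n in sequentially. dist (\<integral>x. c n g x * \<xi> n (T (inv g) x) * cnj (\<xi> n x) \<partial>X) 1 < \<epsilon>"
        by (rule tendstoD[OF almost \<epsilon>])
    qed
    then obtain n where n: "\<And>g. g \<in> F \<Longrightarrow> dist (\<integral>x. c n g x * \<xi> n (T (inv g) x) * cnj (\<xi> n x) \<partial>X) 1 < \<epsilon>"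
      by (auto simp: eventually_sequentially)
    \<comment> \<open>The vector \<open>\<xi> n\<close> placed in the n-th summand. The division by
      the square root of the mass of \<open>n\<close> makes its matrix coefficients under the
      product measure equal to those of \<open>\<xi> n\<close> over \<open>X\<close>.\<close>
    define f where "f z = indicator {n} (fst z) *\<^sub>R ((1 / sqrt (pmf q n)) *\<^sub>R \<xi> n (snd z))" for z :: "nat \<times> 'a"
    have [measurable]: "\<xi> n \<in> borel_measurable X" using \<xi>(1) by (simp add: L2_def)
    have f_L2: "f \<in> L2 ?K"
    proof -
      have 1: "(\<lambda>z. indicator {n} (fst z) :: real) \<in> borel_measurable ?K"
        by (rule measurable_compose[OF measurable_fst]) simp
      have 2: "(\<lambda>z. \<xi> n (snd z)) \<in> borel_measurable ?K"
        by (rule measurable_compose[OF measurable_snd]) simp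
      have [measurable]: "f \<in> borel_measurable ?K"
        unfolding f_def by (intro borel_measurable_scaleR borel_measurable_const 1 2)
      have "integrable ?K (\<lambda>z. (cmod (\<xi> n (snd z)))\<^sup>2)"
        using \<xi>(1) by (intro measure_preserving_integrable[OF measure_preserving_snd[OF prob_space_measure_pmf
              X.prob_space_axioms], of "\<lambda>x. (cmod (\<xi> n x))\<^sup>2"]) (simp add: L2_def)
      then have "integrable ?K (\<lambda>z. indicator ({n} \<times> space X) z *\<^sub>R ((1 / pmf q n) * (cmod (\<xi> n (snd z)))\<^sup>2))"
        by (intro integrable_mult_indicator integrable_mult_right sets_single) auto
      then have "integrable ?K (\<lambda>z. (cmod (f z))\<^sup>2)"
      proof (rule Bochner_Integration.integrable_cong[THEN iffD1, rotated -1])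
        fix z assume "z \<in> space ?K"
        then show "indicator ({n} \<times> space X) z *\<^sub>R ((1 / pmf q n) * (cmod (\<xi> n (snd z)))\<^sup>2) = (cmod (f z))\<^sup>2"
          using q_pos[of n]
          by (cases z) (auto simp: f_def indicator_def power_divide space_pair_measure norm_divide)
      qed simp
      then show ?thesis by (simp add: L2_def)
    qed
    have "f \<in> R.vecs"
    proof (rule vecsI[OF f_L2])
      fix m A assume A: "A \<in> D"
      have "(\<integral>x. indicator A x *\<^sub>R f (m, x) \<partial>X) = (indicator {n} m / sqrt (pmf q n)) *\<^sub>R (\<integral>x. indicator A x *\<^sub>R \<xi> n x \<partial>X)"
        unfolding integral_scaleR_right[symmetric]
        by (rule Bochner_Integration.integral_cong) (simp_all add: f_def mult_ac)
      then show "(\<integral>x. indicator A x *\<^sub>R f (m, x) \<partial>X) = 0" using \<xi>(2)[OF A] by simp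
    qed
    moreover have "cmod (1 - (\<integral>z. d' g z * f (\<tau> (inv g) z) * cnj (f z) \<partial>?K)) < \<epsilon>" if g: "g \<in> F" for g
    proof -
      have gG: "g \<in> carrier G" using g F by auto
      let ?I = "\<integral>x. c n g x * \<xi> n (T (inv g) x) * cnj (\<xi> n x) \<partial>X"
      have "integrable ?K (\<lambda>z. R.\<rho> g f z * cnj (f z))"
        by (intro L2_integrable_mult_cnj R.\<rho>_L2 gG f_L2)
      then have i: "integrable ?K (\<lambda>z. d' g z * f (\<tau> (inv g) z) * cnj (f z))" by (simp add: R.\<rho>_def)
      have "(\<integral>z. d' g z * f (\<tau> (inv g) z) * cnj (f z) \<partial>?K) =
          (\<integral>z. indicator ({n} \<times> space X) z *\<^sub>R (d' g z * f (\<tau> (inv g) z) * cnj (f z)) \<partial>?K)"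
        by (rule Bochner_Integration.integral_cong) (auto simp: f_def indicator_def space_pair_measure)
      also have "\<dots> = pmf q n *\<^sub>R (\<integral>x. indicator (space X) x *\<^sub>R (d' g (n, x) * f (\<tau> (inv g) (n, x)) * cnj (f (n, x))) \<partial>X)"
        by (rule integral_single[OF i]) simp
      also have "\<dots> = pmf q n *\<^sub>R (\<integral>x. (1 / pmf q n) *\<^sub>R (c n g x * \<xi> n (T (inv g) x) * cnj (\<xi> n x)) \<partial>X)"
      proof -
        have s: "complex_of_real (sqrt (pmf q n)) * complex_of_real (sqrt (pmf q n)) = complex_of_real (pmf q n)"
          by (simp flip: of_real_mult)
        have "(\<integral>x. indicator (space X) x *\<^sub>R (d' g (n, x) * f (\<tau> (inv g) (n, x)) * cnj (f (n, x))) \<partial>X) =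
            (\<integral>x. (1 / pmf q n) *\<^sub>R (c n g x * \<xi> n (T (inv g) x) * cnj (\<xi> n x)) \<partial>X)"
          using gG by (intro Bochner_Integration.integral_cong)
            (simp_all add: f_def \<tau>_def d'_eq scaleR_conv_of_real s[symmetric])
        then show ?thesis by simp
      qed
      also have "\<dots> = ?I" using q_pos[of n] by simp
      finally show ?thesis using n[OF g] by (simp add: dist_norm norm_minus_commute)
    qed
    ultimately show ?thesis by blast
  qed
  obtain f where f: "f \<in> L2 ?K" "f \<in> R.vecs" "\<not> (AE z in ?K. f z = 0)"
    "\<And>h. h \<in> H \<Longrightarrow> AE z in ?K. d' h z * f (\<tau> (inv h) z) = f z"
    using R.relative_property_T_invariant_vector[OF R_inv relT H al, of thesis] by blast
  \<comment> \<open>A vector of the direct sum that is not null has a component that is not null,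
    and each component is invariant for its own cocycle.\<close>
  have "\<exists>n. \<not> (AE x in X. f (n, x) = 0)"
  proof (rule ccontr)
    assume "\<nexists>n. \<not> (AE x in X. f (n, x) = 0)"
    then have "AE n in ?P. AE x in X. f (n, x) = 0" by (simp add: q_AE)
    moreover have "{z \<in> space ?K. f z = 0} \<in> sets ?K"
      using L2_measurable[OF f(1)] by measurable
    ultimately have "AE z in ?K. f z = 0" by (intro K.AE_pair_measure)
    with f(3) show False by simp
  qed
  then obtain n where n: "\<not> (AE x in X. f (n, x) = 0)" by blast
  show thesis
  proof (rule that[of "\<lambda>x. f (n, x)" n])
    show "(\<lambda>x. f (n, x)) \<in> L2 X" by (rule section_L2[OF f(1)])
    show "(\<integral>x. indicator A x *\<^sub>R f (n, x) \<partial>X) = 0" if "A \<in> D" for A by (rule vecsD[OF f(2) that])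
    show "\<not> (AE x in X. f (n, x) = 0)" by (rule n)
    show "AE x in X. c n h x * f (n, T (inv h) x) = f (n, x)" if h: "h \<in> H" for h
    proof -
      have hG: "h \<in> carrier G" using h H by auto
      have "AE m in ?P. AE x in X. d' h (m, x) * f (\<tau> (inv h) (m, x)) = f (m, x)"
        using K.AE_pair[OF f(4)[OF h]] .
      then show ?thesis using hG by (simp add: q_AE d'_eq \<tau>_def)
    qed
  qed
qed

end

section \<open>A path of factor maps between independent Bernoulli shifts\<close>

definition unit_interval :: "real measure" where
  "unit_interval = restrict_space lborel {0<..1}"

lemma space_unit_interval: "space unit_interval = {0<..1}"
  by (simp add: unit_interval_def space_restrict_space)

lemma prob_space_unit_interval: "prob_space unit_interval"
  by (rule prob_spaceI) (simp add: unit_interval_def space_restrict_space emeasure_restrict_space)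

lemma measurable_unit_interval [measurable]: "(\<lambda>r. r) \<in> borel_measurable unit_interval"
  unfolding unit_interval_def by (intro measurable_restrict_space1) simp

lemma measure_unit_interval_diff:
  "measure unit_interval {r \<in> space unit_interval. (r \<le> s) \<noteq> (r \<le> t)} \<le> \<bar>s - t\<bar>"
proof -
  have "{r \<in> space unit_interval. (r \<le> s) \<noteq> (r \<le> t)} = {min s t<..max s t} \<inter> {0<..1}"
    by (auto simp: space_unit_interval)
  then have "measure unit_interval {r \<in> space unit_interval. (r \<le> s) \<noteq> (r \<le> t)} =
      measure unit_interval ({min s t<..max s t} \<inter> {0<..1})"
    by (simp only:)
  also have "\<dots> = measure lborel ({min s t<..max s t} \<inter> {0<..1})"
    unfolding unit_interval_def by (rule measure_restrict_space) auto
  also have "\<dots> \<le> measure lborel {min s t<..max s t}"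
    by (intro measure_mono_fmeasurable) (auto simp: fmeasurable_def)
  also have "\<dots> = \<bar>s - t\<bar>" by simp
  finally show ?thesis .
qed

locale bernoulli_group = group G for G :: "('g, 'm) monoid_scheme" (structure) +
  fixes M0 :: "'x measure"
  assumes countable_carrier: "countable (carrier G)" and M0: "prob_space M0"
begin

abbreviation X :: "('g \<Rightarrow> 'x) measure" where "X \<equiv> bernoulli_space G M0"
abbreviation U :: "('g \<Rightarrow> real) measure" where "U \<equiv> bernoulli_space G unit_interval"
abbreviation W :: "(('g \<Rightarrow> 'x) \<times> ('g \<Rightarrow> 'x) \<times> ('g \<Rightarrow> real)) measure" where "W \<equiv> X \<Otimes>\<^sub>M (X \<Otimes>\<^sub>M U)"

definition shift2 :: "'g \<Rightarrow> ('g \<Rightarrow> 'x) \<times> ('g \<Rightarrow> real) \<Rightarrow> ('g \<Rightarrow> 'x) \<times> ('g \<Rightarrow> real)" where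
  "shift2 g z = (bernoulli_shift G g (fst z), bernoulli_shift G g (snd z))"

definition shift3 :: "'g \<Rightarrow> ('g \<Rightarrow> 'x) \<times> ('g \<Rightarrow> 'x) \<times> ('g \<Rightarrow> real) \<Rightarrow> ('g \<Rightarrow> 'x) \<times> ('g \<Rightarrow> 'x) \<times> ('g \<Rightarrow> real)" where
  "shift3 g z = (bernoulli_shift G g (fst z), shift2 g (snd z))"

text \<open>At time \<open>t\<close> exactly the coordinates with label at most \<open>t\<close> are taken from the second copy.
  Labels lie in \<open>{0<..1}\<close>, so that \<open>t = 0\<close> and \<open>t = 1\<close> give the two projections everywhere.\<close>

definition interp :: "real \<Rightarrow> ('g \<Rightarrow> 'x) \<times> ('g \<Rightarrow> 'x) \<times> ('g \<Rightarrow> real) \<Rightarrow> 'g \<Rightarrow> 'x" where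
  "interp t z = (\<lambda>k\<in>carrier G. if snd (snd z) k \<le> t then fst (snd z) k else fst z k)"

lemma prob_space_bernoulli: "prob_space N \<Longrightarrow> prob_space (bernoulli_space G N)"
  unfolding bernoulli_space_def by (intro prob_space_PiM)

sublocale X: prob_space X by (rule prob_space_bernoulli[OF M0])
sublocale U: prob_space U by (rule prob_space_bernoulli[OF prob_space_unit_interval])
sublocale XU: pair_prob_space X U ..
sublocale W: pair_prob_space X "X \<Otimes>\<^sub>M U" ..

lemma component_measurable:
  "k \<in> carrier G \<Longrightarrow> (\<lambda>x. x k) \<in> bernoulli_space G N \<rightarrow>\<^sub>M N"
  unfolding bernoulli_space_def by (rule measurable_component_singleton)

lemma component_measure_preserving:
  assumes "prob_space N" "k \<in> carrier G"
  shows "measure_preserving (bernoulli_space G N) N (\<lambda>x. x k)"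
  unfolding measure_preserving_def
  using component_measurable[OF assms(2), of N] distr_PiM_component[of "carrier G" "\<lambda>_. N" k] assms
  by (simp add: bernoulli_space_def)

lemma component3:
  assumes "k \<in> carrier G"
  shows "measure_preserving W unit_interval (\<lambda>z. snd (snd z) k)"
  using measure_preserving_comp[OF measure_preserving_comp[OF
      measure_preserving_snd[OF X.prob_space_axioms XU.prob_space_axioms]
      measure_preserving_snd[OF X.prob_space_axioms U.prob_space_axioms]]
      component_measure_preserving[OF prob_space_unit_interval assms]] .

text \<open>The choice made at a coordinate depends on the label at this coordinate alone, and the
  shift moves the labels together with both copies.\<close>

lemma interp_equivariant:
  assumes g: "g \<in> carrier G"
  shows "interp t (shift3 g z) = bernoulli_shift G g (interp t z)"
  using g by (auto simp: interp_def shift3_def shift2_def bernoulli_shift_def fun_eq_iff)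

lemma coordinate3_bounds:
  assumes "z \<in> space W" "k \<in> carrier G"
  shows "0 < snd (snd z) k" "snd (snd z) k \<le> 1"
  using measurable_space[OF measure_preserving_measurable[OF component3[OF assms(2)]] assms(1)]
  by (simp_all add: space_unit_interval)

lemma bernoulli_extensional: "x \<in> space (bernoulli_space G N) \<Longrightarrow> k \<notin> carrier G \<Longrightarrow> x k = undefined"
  by (simp add: bernoulli_space_def space_PiM PiE_iff extensional_def)

lemma interp_0:
  assumes z: "z \<in> space W"
  shows "interp 0 z = fst z"
proof
  fix k
  have "fst z \<in> space X" using z by (auto simp: space_pair_measure)
  then show "interp 0 z k = fst z k"
    using coordinate3_bounds[OF z, of k] bernoulli_extensional[of "fst z" M0 k]
    by (cases "k \<in> carrier G") (simp_all add: interp_def)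
qed

lemma interp_1:
  assumes z: "z \<in> space W"
  shows "interp 1 z = fst (snd z)"
proof
  fix k
  have "fst (snd z) \<in> space X" using z by (auto simp: space_pair_measure)
  then show "interp 1 z k = fst (snd z) k"
    using coordinate3_bounds[OF z, of k] bernoulli_extensional[of "fst (snd z)" M0 k]
    by (cases "k \<in> carrier G") (simp_all add: interp_def)
qed

lemma interp_measurable: "interp t \<in> W \<rightarrow>\<^sub>M X"
proof -
  have "(\<lambda>z. \<lambda>k\<in>carrier G. if snd (snd z) k \<le> t then fst (snd z) k else fst z k) \<in> W \<rightarrow>\<^sub>M PiM (carrier G) (\<lambda>_. M0)"
  proof (rule measurable_restrict)
  fix k assume k: "k \<in> carrier G"
  have "(\<lambda>z. snd (snd z) k) \<in> W \<rightarrow>\<^sub>M unit_interval"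
    using measure_preserving_measurable[OF component3[OF k]] .
  from measurable_compose[OF this measurable_unit_interval]
  have [measurable]: "(\<lambda>z. snd (snd z) k) \<in> borel_measurable W" by simp
  have [measurable]: "(\<lambda>z. fst (snd z) k) \<in> W \<rightarrow>\<^sub>M M0" "(\<lambda>z. fst z k) \<in> W \<rightarrow>\<^sub>M M0"
    using measurable_compose[OF measurable_compose[OF measurable_snd measurable_fst] component_measurable[OF k]]
      measurable_compose[OF measurable_fst component_measurable[OF k]] by blast+
  show "(\<lambda>z. if snd (snd z) k \<le> t then fst (snd z) k else fst z k) \<in> W \<rightarrow>\<^sub>M M0" by measurable
  qed
  then show ?thesis by (simp only: interp_def[abs_def] bernoulli_space_def[of G M0])
qed

text \<open>The event is split according to the set \<open>I\<close> of coordinates in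
  \<open>J\<close> whose label is at most \<open>t\<close>. Then the conditions bear on the second
  copy over \<open>I\<close> and on the first copy over the rest, and by independence their
  probability is the same product for every \<open>I\<close>.\<close>

lemma measure_interp_cylinder:
  assumes J: "J \<subseteq> carrier G" "finite J" and F: "\<And>j. j \<in> J \<Longrightarrow> F j \<in> sets M0"
  shows "measure W {z \<in> space W. \<forall>j\<in>J. interp t z j \<in> F j} = (\<Prod>j\<in>J. measure M0 (F j))"
proof -
  let ?L = "{r \<in> space unit_interval. r \<le> t}" and ?G = "{r \<in> space unit_interval. \<not> r \<le> t}"
  have LG: "?L \<in> sets unit_interval" "?G \<in> sets unit_interval" by measurable
  define CX where "CX I = {x \<in> space X. \<forall>j\<in>I. x j \<in> F j}" for I
  define CU where "CU I = {u \<in> space U. \<forall>j\<in>J. u j \<in> (if j \<in> I then ?L else ?G)}" for I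
  \<comment> \<open>Within the event that the labels at most \<open>t\<close> are exactly those over
    \<open>I\<close>, the cylinder condition becomes a product condition on the two copies.\<close>
  define R where "R I = CX (J - I) \<times> (CX I \<times> CU I)" for I
  have cyl_sets: "{x \<in> space (bernoulli_space G N). \<forall>j\<in>I. x j \<in> A j} \<in> sets (bernoulli_space G N)"
    if I: "I \<subseteq> J" and A: "\<And>j. j \<in> I \<Longrightarrow> A j \<in> sets N" for I and N :: "'y measure" and A
  proof (rule sets.sets_Collect_finite_All)
    fix j assume j: "j \<in> I"
    show "{x \<in> space (bernoulli_space G N). x j \<in> A j} \<in> sets (bernoulli_space G N)"
      using j I J A[OF j] by (intro measurable_sets_Collect[OF component_measurable]) auto
  qed (use finite_subset[OF I J(2)] in simp)
  have CX: "CX I \<in> sets X" "measure X (CX I) = (\<Prod>j\<in>I. measure M0 (F j))" if I: "I \<subseteq> J" for I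
  proof -
    have FI: "F j \<in> sets M0" if "j \<in> I" for j using that I F by blast
    show "CX I \<in> sets X" unfolding CX_def by (rule cyl_sets[OF I FI])
    show "measure X (CX I) = (\<Prod>j\<in>I. measure M0 (F j))"
      unfolding CX_def using I J finite_subset[OF I J(2)]
      by (intro measure_bernoulli_cylinder[OF M0] FI) auto
  qed
  have CU: "CU I \<in> sets U" for I
    unfolding CU_def by (rule cyl_sets) (use LG in auto)
  have R: "R I \<in> sets W" "measure W (R I) = (\<Prod>j\<in>J. measure M0 (F j)) * measure U (CU I)" if I: "I \<subseteq> J" for I
  proof -
    have JI: "J - I \<subseteq> J" by blast
    show "R I \<in> sets W" unfolding R_def by (intro pair_measureI CX CU I JI)
    have "measure W (R I) = measure X (CX (J - I)) * (measure X (CX I) * measure U (CU I))"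
      unfolding R_def using CX(1)[OF I] CX(1)[OF JI] CU
      by (simp add: XU.emeasure_pair_measure_Times U.emeasure_pair_measure_Times measure_def enn2real_mult)
    also have "\<dots> = (\<Prod>j\<in>J. measure M0 (F j)) * measure U (CU I)"
      using prod.subset_diff[OF I J(2), of "\<lambda>j. measure M0 (F j)"] by (simp add: CX I JI)
    finally show "measure W (R I) = (\<Prod>j\<in>J. measure M0 (F j)) * measure U (CU I)" .
  qed
  have U_unique: "u \<in> CU I \<longleftrightarrow> u \<in> space U \<and> I = {j \<in> J. u j \<le> t}" if I: "I \<subseteq> J" for I u
  proof -
    have sp: "u j \<in> space unit_interval" if u: "u \<in> space U" and j: "j \<in> J" for j
    proof -
      have "j \<in> carrier G" using j J(1) by blast
      from measurable_space[OF component_measurable[OF this] u] show ?thesis .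
    qed
    show ?thesis
    proof
      assume "u \<in> CU I"
      then have uU: "u \<in> space U" and u: "\<And>j. j \<in> J \<Longrightarrow> u j \<in> (if j \<in> I then ?L else ?G)"
        unfolding CU_def by blast+
      have "u j \<le> t \<longleftrightarrow> j \<in> I" if "j \<in> J" for j
        using u[OF that] by (cases "j \<in> I") simp_all
      with I uU show "u \<in> space U \<and> I = {j \<in> J. u j \<le> t}" by blast
    next
      assume u: "u \<in> space U \<and> I = {j \<in> J. u j \<le> t}"
      have "u j \<in> (if j \<in> I then ?L else ?G)" if "j \<in> J" for j
        using u sp[OF _ that] that by simp
      with u show "u \<in> CU I" unfolding CU_def by blast
    qed
  qed
  have CU_eq: "I = I'" if "I \<subseteq> J" "I' \<subseteq> J" "u \<in> CU I" "u \<in> CU I'" for I I' u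
    using U_unique[OF that(1)] U_unique[OF that(2)] that(3,4) by simp
  have disj: "disjoint_family_on CU (Pow J)" "disjoint_family_on R (Pow J)"
  proof -
    show "disjoint_family_on CU (Pow J)"
      unfolding disjoint_family_on_def using CU_eq by (metis Pow_iff disjoint_iff)
    show "disjoint_family_on R (Pow J)"
      unfolding disjoint_family_on_def
    proof (intro ballI impI)
      fix I I' assume I: "I \<in> Pow J" "I' \<in> Pow J" "I \<noteq> I'"
      have "z \<notin> R I'" if "z \<in> R I" for z
        using CU_eq[of I I' "snd (snd z)"] I that by (auto simp: R_def)
      then show "R I \<inter> R I' = {}" by blast
    qed
  qed
  have UN: "(\<Union>I\<in>Pow J. CU I) = space U"
  proof (intro equalityI subsetI)
    fix u assume "u \<in> (\<Union>I\<in>Pow J. CU I)"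
    then show "u \<in> space U" unfolding CU_def by blast
  next
    fix u assume u: "u \<in> space U"
    have "{j \<in> J. u j \<le> t} \<subseteq> J" by blast
    from U_unique[OF this, of u] u show "u \<in> (\<Union>I\<in>Pow J. CU I)" by blast
  qed
  have "{z \<in> space W. \<forall>j\<in>J. interp t z j \<in> F j} = (\<Union>I\<in>Pow J. R I)"
  proof (intro equalityI subsetI)
    fix z assume z: "z \<in> {z \<in> space W. \<forall>j\<in>J. interp t z j \<in> F j}"
    obtain x y u where zz: "z = (x, y, u)" by (cases z)
    define I where "I = {j \<in> J. u j \<le> t}"
    have sp: "x \<in> space X" "y \<in> space X" "u \<in> space U" using z by (auto simp: zz space_pair_measure)
    have 1: "(if u j \<le> t then y j else x j) \<in> F j" if "j \<in> J" for j
    proof -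
      have "interp t z j \<in> F j" using z that by blast
      moreover have "j \<in> carrier G" using that J by blast
      ultimately show ?thesis by (simp only: interp_def zz restrict_apply' fst_conv snd_conv)
    qed
    have "x j \<in> F j" if "j \<in> J - I" for j using 1[of j] that by (simp add: I_def)
    then have x: "x \<in> CX (J - I)" using sp(1) unfolding CX_def by blast
    have "y j \<in> F j" if "j \<in> I" for j using 1[of j] that by (simp add: I_def)
    then have y: "y \<in> CX I" using sp(2) unfolding CX_def by blast
    have I: "I \<subseteq> J" by (auto simp: I_def)
    then have "u \<in> CU I" using U_unique[OF I] sp(3) I_def by blast
    with x y I show "z \<in> (\<Union>I\<in>Pow J. R I)" unfolding R_def zz by blast
  next
    fix z assume "z \<in> (\<Union>I\<in>Pow J. R I)"
    then obtain I where I: "I \<subseteq> J" "z \<in> R I" by blast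
    obtain x y u where zz: "z = (x, y, u)" by (cases z)
    have m: "x \<in> CX (J - I)" "y \<in> CX I" "u \<in> CU I" using I(2) unfolding R_def zz by blast+
    have u: "u \<in> space U" "I = {j \<in> J. u j \<le> t}" using U_unique[OF I(1)] m(3) by blast+
    have "interp t z j \<in> F j" if j: "j \<in> J" for j
    proof -
      have "j \<in> carrier G" using j J by blast
      then have "interp t z j = (if u j \<le> t then y j else x j)" by (simp add: interp_def zz)
      moreover have "(if u j \<le> t then y j else x j) \<in> F j"
        using m(1,2) j unfolding u(2) CX_def by auto
      ultimately show ?thesis by simp
    qed
    moreover have "z \<in> space W" using m u by (auto simp: zz CX_def space_pair_measure)
    ultimately show "z \<in> {z \<in> space W. \<forall>j\<in>J. interp t z j \<in> F j}" by blast
  qed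
  then have "measure W {z \<in> space W. \<forall>j\<in>J. interp t z j \<in> F j} = measure W (\<Union>I\<in>Pow J. R I)" by simp
  also have "\<dots> = (\<Sum>I\<in>Pow J. measure W (R I))"
    using J(2) R(1) disj(2) by (intro W.finite_measure_finite_Union) auto
  also have "\<dots> = (\<Sum>I\<in>Pow J. (\<Prod>j\<in>J. measure M0 (F j)) * measure U (CU I))"
    using R(2) by (intro sum.cong) auto
  also have "\<dots> = (\<Prod>j\<in>J. measure M0 (F j)) * (\<Sum>I\<in>Pow J. measure U (CU I))"
    by (simp add: sum_distrib_left)
  also have "(\<Sum>I\<in>Pow J. measure U (CU I)) = measure U (\<Union>I\<in>Pow J. CU I)"
    using J(2) CU disj(1) by (intro U.finite_measure_finite_Union[symmetric]) auto
  also have "\<dots> = 1" unfolding UN by (rule U.prob_space)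
  finally show ?thesis by simp
qed

lemma interp_measure_preserving: "measure_preserving W X (interp t)"
proof -
  interpret P: product_prob_space "\<lambda>_. M0" "carrier G"
    using M0 by (simp add: product_prob_space_def product_prob_space_axioms_def product_sigma_finite_def
        prob_space_imp_sigma_finite)
  have "distr W X (interp t) = PiM (carrier G) (\<lambda>_. M0)"
  proof (rule P.PiM_eq)
    show "sets (distr W X (interp t)) = sets (PiM (carrier G) (\<lambda>_. M0))"
      by (simp add: bernoulli_space_def)
    fix J F assume J: "finite J" "J \<subseteq> carrier G" and F: "\<And>j. j \<in> J \<Longrightarrow> F j \<in> sets M0"
    let ?A = "prod_emb (carrier G) (\<lambda>_. M0) J (Pi\<^sub>E J F)"
    have A: "?A = {x \<in> space X. \<forall>j\<in>J. x j \<in> F j}"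
      using J(2) sets.sets_into_space[OF F] unfolding bernoulli_space_def
      by (auto simp: prod_emb_def space_PiM Pi_iff)
    have As: "?A \<in> sets X" unfolding bernoulli_space_def using J F by (intro sets_PiM_I) auto
    have "interp t -` ?A \<inter> space W = {z \<in> space W. \<forall>j\<in>J. interp t z j \<in> F j}"
      unfolding A using measurable_space[OF interp_measurable] by blast
    then have "measure (distr W X (interp t)) ?A = (\<Prod>j\<in>J. measure M0 (F j))"
      using measure_distr[OF interp_measurable As] measure_interp_cylinder[OF J(2,1) F] by simp
    then have "emeasure (distr W X (interp t)) ?A = ennreal (\<Prod>j\<in>J. measure M0 (F j))"
      using W.finite_measure_distr[OF interp_measurable] by (simp add: finite_measure.emeasure_eq_measure)
    also have "\<dots> = (\<Prod>j\<in>J. emeasure M0 (F j))"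
      using M0 by (simp add: finite_measure.emeasure_eq_measure prob_space.finite_measure prod_ennreal)
    finally show "emeasure (distr W X (interp t)) ?A = (\<Prod>j\<in>J. emeasure M0 (F j))" .
  qed
  then show ?thesis
    using interp_measurable by (simp add: measure_preserving_def bernoulli_space_def)
qed

end

section \<open>Continuity of cocycles along the path\<close>

context bernoulli_group begin

definition jump :: "real \<Rightarrow> real \<Rightarrow> ('g \<Rightarrow> 'x) set \<Rightarrow> (('g \<Rightarrow> 'x) \<times> ('g \<Rightarrow> 'x) \<times> ('g \<Rightarrow> real)) set" where
  "jump s t A = {z \<in> space W. (interp s z \<in> A) \<noteq> (interp t z \<in> A)}"

lemma jump_eq: "jump s t A = ((interp s -` A \<inter> space W) - (interp t -` A \<inter> space W)) \<union>
    ((interp t -` A \<inter> space W) - (interp s -` A \<inter> space W))"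
  by (auto simp: jump_def)

lemma jump_sets: "A \<in> sets X \<Longrightarrow> jump s t A \<in> sets W"
  unfolding jump_eq using measurable_sets[OF interp_measurable] by blast

text \<open>Crude, but independent of \<open>s\<close> and \<open>t\<close>: this is the summable
  majorant for countable unions.\<close>

lemma measure_jump_le:
  assumes A: "A \<in> sets X"
  shows "measure W (jump s t A) \<le> 2 * measure X A"
proof -
  have "jump s t A \<subseteq> (interp s -` A \<inter> space W) \<union> (interp t -` A \<inter> space W)"
    by (auto simp: jump_def)
  then have "measure W (jump s t A) \<le> measure W ((interp s -` A \<inter> space W) \<union> (interp t -` A \<inter> space W))"
    using measurable_sets[OF interp_measurable A] by (intro W.finite_measure_mono) auto
  also have "\<dots> \<le> measure W (interp s -` A \<inter> space W) + measure W (interp t -` A \<inter> space W)"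
    using measurable_sets[OF interp_measurable A] by (intro measure_Un_le) auto
  also have "\<dots> = 2 * measure X A"
    by (simp add: measure_preserving_measure[OF interp_measure_preserving A])
  finally show ?thesis .
qed

text \<open>The two interpolations can differ at a coordinate only if its label lies between
  \<open>s\<close> and \<open>t\<close>, an event of probability at most |s - t|; these events are
  summed over \<open>J\<close>.\<close>

lemma measure_jump_cylinder:
  assumes J: "J \<subseteq> carrier G" "finite J" and A: "A = {x \<in> space X. \<forall>j\<in>J. x j \<in> F j}"
  shows "measure W (jump s t A) \<le> real (card J) * \<bar>s - t\<bar>"
proof -
  define N where "N j = (\<lambda>z. snd (snd z) j) -` {r \<in> space unit_interval. (r \<le> s) \<noteq> (r \<le> t)} \<inter> space W" for j
  have S: "{r \<in> space unit_interval. (r \<le> s) \<noteq> (r \<le> t)} \<in> sets unit_interval" by measurable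
  have N: "N j \<in> sets W" "measure W (N j) \<le> \<bar>s - t\<bar>" if "j \<in> J" for j
  proof -
    have j: "j \<in> carrier G" using that J by blast
    show "N j \<in> sets W"
      unfolding N_def by (rule measurable_sets[OF measure_preserving_measurable[OF component3[OF j]] S])
    show "measure W (N j) \<le> \<bar>s - t\<bar>"
      unfolding N_def measure_preserving_measure[OF component3[OF j] S] by (rule measure_unit_interval_diff)
  qed
  have "jump s t A \<subseteq> (\<Union>j\<in>J. N j)"
  proof (rule subsetI, rule ccontr)
    fix z assume z: "z \<in> jump s t A" "z \<notin> (\<Union>j\<in>J. N j)"
    have zW: "z \<in> space W" using z by (simp add: jump_def)
    have "interp s z j = interp t z j" if j: "j \<in> J" for j
    proof -
      have jG: "j \<in> carrier G" using j J by blast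
      have "snd (snd z) j \<in> space unit_interval"
        using measurable_space[OF measure_preserving_measurable[OF component3[OF jG]] zW] .
      moreover have "z \<notin> N j" using z(2) j by blast
      ultimately have "(snd (snd z) j \<le> s) = (snd (snd z) j \<le> t)" using zW by (simp add: N_def)
      then show ?thesis using jG by (simp add: interp_def)
    qed
    moreover have "interp s z \<in> space X" "interp t z \<in> space X"
      using measurable_space[OF interp_measurable zW] by auto
    ultimately have "(interp s z \<in> A) = (interp t z \<in> A)" by (simp add: A)
    then show False using z(1) by (simp add: jump_def)
  qed
  then have "measure W (jump s t A) \<le> measure W (\<Union>j\<in>J. N j)"
    using N(1) J(2) by (intro W.finite_measure_mono) auto
  also have "\<dots> \<le> (\<Sum>j\<in>J. measure W (N j))" using N(1) J(2) by (intro measure_UNION_le) auto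
  also have "\<dots> \<le> (\<Sum>j\<in>J. \<bar>s - t\<bar>)" using N(2) by (intro sum_mono)
  finally show ?thesis by simp
qed

text \<open>A Dynkin argument starting from cylinders. A set and its complement have the same jump
  set, and for a disjoint union the sum of the jumps is dominated by twice the measures, uniformly
  in \<open>n\<close>.\<close>

lemma jump_tendsto:
  fixes s t :: "nat \<Rightarrow> real"
  assumes st: "(\<lambda>n. s n - t n) \<longlonglongrightarrow> 0" and A: "A \<in> sets X"
  shows "(\<lambda>n. measure W (jump (s n) (t n) A)) \<longlonglongrightarrow> 0"
proof -
  have S: "sets X = sigma_sets (space X) (prod_algebra (carrier G) (\<lambda>_. M0))"
    by (simp add: bernoulli_space_def sets_PiM space_PiM)
  have "prod_algebra (carrier G) (\<lambda>_. M0) \<subseteq> Pow (space X)"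
    using prod_algebra_sets_into_space[of "carrier G" "\<lambda>_. M0"] by (simp add: bernoulli_space_def space_PiM)
  from Int_stable_prod_algebra this A[unfolded S] show ?thesis
  proof (induction rule: sigma_sets_induct_disjoint)
    case (basic A)
    obtain J F where J: "J \<subseteq> carrier G" "finite J" "A = {x \<in> space X. \<forall>j\<in>J. x j \<in> F j}"
      using prod_algebra_cylinder[OF basic, of thesis] by blast
    have "(\<lambda>n. real (card J) * \<bar>s n - t n\<bar>) \<longlonglongrightarrow> real (card J) * \<bar>0\<bar>"
      by (intro tendsto_intros st)
    then have lim: "(\<lambda>n. real (card J) * \<bar>s n - t n\<bar>) \<longlonglongrightarrow> 0" by simp
    show ?case
      by (rule tendsto_sandwich[OF _ _ tendsto_const lim])
        (simp_all add: measure_jump_cylinder[OF J])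
  next
    case empty
    then show ?case by (simp add: jump_def)
  next
    case (compl A)
    have "jump (s n) (t n) (space X - A) = jump (s n) (t n) A" for n
      using measurable_space[OF interp_measurable] unfolding jump_def by blast
    then show ?case using compl by simp
  next
    case (union A)
    have A: "A k \<in> sets X" for k using union(2) S by auto
    have summ: "summable (\<lambda>k. 2 * measure X (A k))"
      using X.finite_measure_UNION[of A] A union(1) by (intro summable_mult) (auto simp: sums_iff)
    have s1: "summable (\<lambda>k. measure W (jump (s n) (t n) (A k)))" for n
      by (rule summable_comparison_test[OF _ summ]) (auto intro!: exI[of _ 0] measure_jump_le A)
    have "(\<lambda>n. \<Sum>k. measure W (jump (s n) (t n) (A k))) \<longlonglongrightarrow> (\<Sum>k::nat. 0)"
    proof (rule conjunct2[OF conjunct2[OF tannerys_theorem[where M="\<lambda>k. 2 * measure X (A k)"]]])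
      show "\<forall>\<^sub>F (k, n) in at_top \<times>\<^sub>F sequentially. norm (measure W (jump (s n) (t n) (A k))) \<le> 2 * measure X (A k)"
        by (intro always_eventually) (auto intro!: measure_jump_le A)
    qed (use union(3) summ in auto)
    then have lim: "(\<lambda>n. \<Sum>k. measure W (jump (s n) (t n) (A k))) \<longlonglongrightarrow> 0" by simp
    have le: "measure W (jump (s n) (t n) (\<Union>k. A k)) \<le> (\<Sum>k. measure W (jump (s n) (t n) (A k)))" for n
    proof -
      have "measure W (jump (s n) (t n) (\<Union>k. A k)) \<le> measure W (\<Union>k. jump (s n) (t n) (A k))"
        using jump_sets A by (intro W.finite_measure_mono sets.countable_UN) (auto simp: jump_def)
      also have "\<dots> \<le> (\<Sum>k. measure W (jump (s n) (t n) (A k)))"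
        using jump_sets A s1 by (intro W.finite_measure_subadditive_countably) auto
      finally show ?thesis .
    qed
    show ?case
      by (rule tendsto_sandwich[OF _ _ tendsto_const lim]) (simp_all add: le)
  qed
qed

text \<open>The unit circle is covered by finitely many small balls. Off the jump sets of their
  preimages under \<open>f\<close>, both values of \<open>f\<close> lie in a common ball and hardly
  differ; on the jump sets, whose total measure tends to 0, they differ by at most 2.\<close>

lemma interp_correlation_tendsto:
  fixes s t :: "nat \<Rightarrow> real" and f :: "('g \<Rightarrow> 'x) \<Rightarrow> complex"
  assumes st: "(\<lambda>n. s n - t n) \<longlonglongrightarrow> 0"
    and f [measurable]: "f \<in> borel_measurable X" and f1: "\<And>x. cmod (f x) = 1"
  shows "(\<lambda>n. \<integral>z. f (interp (s n) z) * cnj (f (interp (t n) z)) \<partial>W) \<longlonglongrightarrow> 1"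
proof (rule tendstoI)
  fix e :: real assume e: "e > 0"
  \<comment> \<open>The error is at most 2d off the jump sets and eventually less than 2d on them,
    4d in all.\<close>
  define d where "d = e / 5"
  have d: "d > 0" using e by (simp add: d_def)
  obtain C where C: "finite C" "sphere (0::complex) 1 \<subseteq> (\<Union>c\<in>C. ball c d)"
    using compact_sphere[of "0::complex" 1] d unfolding compact_eq_totally_bounded by blast
  define A where "A c = f -` ball c d \<inter> space X" for c
  have A: "A c \<in> sets X" for c unfolding A_def by (rule measurable_sets[OF f]) simp
  have [measurable]: "interp r \<in> W \<rightarrow>\<^sub>M X" for r by (rule interp_measurable)
  let ?B = "\<lambda>n. \<Union>c\<in>C. jump (s n) (t n) (A c)"
  have B: "?B n \<in> sets W" for n using C(1) jump_sets[OF A] by (intro sets.finite_UN) auto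
  have close: "cmod (1 - f (interp (s n) z) * cnj (f (interp (t n) z))) \<le> 2 * d + 2 * indicator (?B n) z"
    if z: "z \<in> space W" for n z
  proof -
    let ?x = "interp (s n) z" and ?y = "interp (t n) z"
    have sp: "?x \<in> space X" "?y \<in> space X" using measurable_space[OF interp_measurable z] by auto
    have "1 - f ?x * cnj (f ?y) = (f ?y - f ?x) * cnj (f ?y)"
      by (simp add: left_diff_distrib mult_cnj_unit[OF f1])
    then have eq: "cmod (1 - f ?x * cnj (f ?y)) = dist (f ?y) (f ?x)"
      by (simp add: norm_mult f1 dist_norm)
    show ?thesis
    proof (cases "z \<in> ?B n")
      case True
      have "cmod (1 - f ?x * cnj (f ?y)) \<le> 2"
        unfolding eq dist_norm using norm_triangle_ineq4[of "f ?y" "f ?x"] by (simp add: f1)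
      moreover have "indicator (?B n) z = (1 :: real)" using True by (rule indicator_simps(1))
      ultimately show ?thesis using d by linarith
    next
      case False
      have "f ?x \<in> sphere 0 1" by (simp add: f1)
      then obtain c where c: "c \<in> C" "f ?x \<in> ball c d" using C(2) by blast
      have "z \<notin> jump (s n) (t n) (A c)" using False c(1) by blast
      then have "f ?y \<in> ball c d" using z c(2) sp by (simp add: jump_def A_def)
      with c(2) have "dist (f ?y) (f ?x) < d + d"
        by (intro dist_triangle_less_add[of "f ?y" c]) (simp_all add: dist_commute)
      then have "cmod (1 - f ?x * cnj (f ?y)) < d + d" unfolding eq .
      moreover have "indicator (?B n) z = (0 :: real)" using False by (rule indicator_simps(2))
      ultimately show ?thesis by linarith
    qed
  qed
  have est: "cmod (1 - (\<integral>z. f (interp (s n) z) * cnj (f (interp (t n) z)) \<partial>W)) \<le> 2 * d + 2 * measure W (?B n)" for n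
  proof -
    have ind: "integrable W (indicator (?B n) :: _ \<Rightarrow> real)"
      by (rule integrable_real_indicator[OF B]) (simp add: W.emeasure_eq_measure)
    have i: "integrable W (\<lambda>z. f (interp (s n) z) * cnj (f (interp (t n) z)))"
      by (rule W.integrable_bounded_complex[where C=1]) (auto simp: norm_mult f1)
    have "1 - (\<integral>z. f (interp (s n) z) * cnj (f (interp (t n) z)) \<partial>W) =
        (\<integral>z. 1 - f (interp (s n) z) * cnj (f (interp (t n) z)) \<partial>W)"
      using i by (simp add: W.prob_space)
    then have "cmod (1 - (\<integral>z. f (interp (s n) z) * cnj (f (interp (t n) z)) \<partial>W)) \<le>
        (\<integral>z. cmod (1 - f (interp (s n) z) * cnj (f (interp (t n) z))) \<partial>W)"
      by (simp only:) (rule integral_norm_bound)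
    also have "\<dots> \<le> (\<integral>z. 2 * d + 2 * indicator (?B n) z \<partial>W)"
    proof (rule integral_mono)
      show "integrable W (\<lambda>z. cmod (1 - f (interp (s n) z) * cnj (f (interp (t n) z))))"
        using i by (intro integrable_norm Bochner_Integration.integrable_diff) auto
      show "integrable W (\<lambda>z. 2 * d + 2 * indicator (?B n) z)"
        by (intro Bochner_Integration.integrable_add integrable_mult_right ind) simp
    qed (rule close)
    also have "\<dots> = 2 * d + 2 * (\<integral>z. indicator (?B n) z \<partial>W)"
      by (subst Bochner_Integration.integral_add) (use ind in \<open>simp_all add: W.prob_space\<close>)
    also have "(\<integral>z. indicator (?B n) z \<partial>W) = measure W (?B n)"
      using sets.sets_into_space[OF B, of n] by (simp only: Bochner_Integration.integral_indicator Int_absorb2)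
    finally show ?thesis .
  qed
  have "(\<lambda>n. \<Sum>c\<in>C. measure W (jump (s n) (t n) (A c))) \<longlonglongrightarrow> (\<Sum>c\<in>C. 0)"
    by (intro tendsto_sum jump_tendsto[OF st A])
  then have "(\<lambda>n. \<Sum>c\<in>C. measure W (jump (s n) (t n) (A c))) \<longlonglongrightarrow> 0" by simp
  then have "\<forall>\<^sub>F n in sequentially. dist (\<Sum>c\<in>C. measure W (jump (s n) (t n) (A c))) 0 < d"
    using d by (rule tendstoD)
  then show "\<forall>\<^sub>F n in sequentially. dist (\<integral>z. f (interp (s n) z) * cnj (f (interp (t n) z)) \<partial>W) 1 < e"
  proof eventually_elim
    case (elim n)
    have "measure W (?B n) \<le> (\<Sum>c\<in>C. measure W (jump (s n) (t n) (A c)))"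
      using C(1) jump_sets[OF A] by (intro measure_UNION_le) auto
    also have "\<dots> < d" using elim by (simp add: sum_nonneg)
    finally have "cmod (1 - (\<integral>z. f (interp (s n) z) * cnj (f (interp (t n) z)) \<partial>W)) < e"
      using est[of n] d by (simp add: d_def)
    then show ?case by (simp add: dist_norm norm_minus_commute)
  qed
qed

end

section \<open>Cocycle superrigidity\<close>

text \<open>Under an injective reindexing a finite exceptional set has a finite preimage.\<close>

lemma mixing_reindex:
  assumes "mixing H K T" "inj_on f H'" "f ` H' \<subseteq> H"
  shows "mixing H' K (\<lambda>h. T (f h))"
proof -
  have lim: "filterlim f (along H) (along H')"
    unfolding filterlim_iff eventually_along
  proof (intro allI impI)
    fix P assume "finite {h \<in> H. \<not> P h}"
    then have "finite (f ` {h \<in> H'. \<not> P (f h)})"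
      by (rule finite_subset[rotated]) (use assms(3) in auto)
    moreover have "inj_on f {h \<in> H'. \<not> P (f h)}" using assms(2) by (rule inj_on_subset) auto
    ultimately show "finite {h \<in> H'. \<not> P (f h)}" by (rule finite_imageD)
  qed
  have fH: "f h \<in> H" if "h \<in> H'" for h using assms(3) that by blast
  show ?thesis
    unfolding mixing_def
  proof (intro conjI ballI)
    show "measure_preserving K K (T (f h))" if "h \<in> H'" for h
      by (rule mixing_measure_preserving[OF assms(1) fH[OF that]])
    fix A B assume "A \<in> sets K" "B \<in> sets K"
    then have "((\<lambda>h. measure K (A \<inter> (T h -` B \<inter> space K))) \<longlongrightarrow> measure K A * measure K B) (along H)"
      using assms(1) unfolding mixing_def by blast
    from filterlim_compose[OF this lim]
    show "((\<lambda>h. measure K (A \<inter> (T (f h) -` B \<inter> space K))) \<longlongrightarrow> measure K A * measure K B) (along H')" .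
  qed
qed

text \<open>The eigenvalues cancel in f(x) cnj(f(y)), which is thus invariant under the diagonal
  action. The square of a mixing action is mixing, so this function of two variables is constant;
  fixing a generic y with f(y) nonzero shows that f is constant.\<close>

lemma mixing_eigenfunction_const:
  fixes f :: "'a \<Rightarrow> complex"
  assumes mix: "mixing H K T" and H: "infinite H" and K: "prob_space K"
    and f [measurable]: "f \<in> borel_measurable K" and f1: "\<And>x. cmod (f x) \<le> 1" and nz: "\<not> (AE x in K. f x = 0)"
    and eig: "\<And>h. h \<in> H \<Longrightarrow> \<exists>c. cmod c = 1 \<and> (AE x in K. f (T h x) = c * f x)"
  obtains c where "AE x in K. f x = c"
proof -
  interpret K: prob_space K by fact
  interpret KK: pair_prob_space K K ..
  let ?KK = "K \<Otimes>\<^sub>M K"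
  let ?F = "\<lambda>z. f (fst z) * cnj (f (snd z))"
  have KKp: "prob_space ?KK" by unfold_locales
  have inv: "AE z in ?KK. f (T h (fst z)) * cnj (f (T h (snd z))) = f (fst z) * cnj (f (snd z))" if h: "h \<in> H" for h
  proof -
    obtain c where c: "cmod c = 1" "AE x in K. f (T h x) = c * f x" using eig[OF h] by blast
    show ?thesis
      using measure_preserving_AE[OF measure_preserving_fst[OF K] c(2)]
        measure_preserving_AE[OF measure_preserving_snd[OF K K] c(2)]
    proof eventually_elim
      case (elim z)
      have "f (T h (fst z)) * cnj (f (T h (snd z))) = (c * cnj c) * (f (fst z) * cnj (f (snd z)))"
        unfolding elim by (simp add: mult_ac)
      then show ?case by (simp add: mult_cnj_unit[OF c(1)])
    qed
  qed
  have int: "integrable ?KK ?F"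
    using f1 by (intro KK.integrable_bounded_complex[where C=1]) (auto simp: norm_mult mult_le_one)
  define d where "d = (\<integral>z. ?F z \<partial>?KK)"
  have ae: "AE z in ?KK. ?F z = d"
    unfolding d_def
    by (rule mixing_invariant_const[OF mixing_pair[OF H K K mix mix] H KKp int]) (use inv in simp)
  \<comment> \<open>The variables are exchanged so that the outer quantifier fixes \<open>y\<close>
    and the inner one lets \<open>x\<close> vary.\<close>
  have sw: "measure_preserving ?KK ?KK (\<lambda>(x, y). (y, x))"
    unfolding measure_preserving_def
    by (intro conjI KK.distr_pair_swap[symmetric] measurable_pair_swap')
  have "AE z in ?KK. f (snd z) * cnj (f (fst z)) = d"
    using measure_preserving_AE[OF sw ae] by (simp add: split_beta')
  then have ae2: "AE y in K. AE x in K. f x * cnj (f y) = d" using KK.AE_pair by force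
  have "\<exists>y. f y \<noteq> 0 \<and> (AE x in K. f x * cnj (f y) = d)"
  proof (rule ccontr)
    assume no: "\<not> ?thesis"
    have "AE y in K. f y = 0" using ae2 by eventually_elim (use no in blast)
    with nz show False by simp
  qed
  then obtain y where y: "f y \<noteq> 0" "AE x in K. f x * cnj (f y) = d" by blast
  have "AE x in K. f x = d / cnj (f y)" using y(2) by eventually_elim (use y(1) in \<open>simp add: field_simps\<close>)
  then show thesis by (rule that)
qed

text \<open>The modulus is invariant, hence constant by ergodicity, and not 0; dividing by it gives
  a function of modulus 1. The value 1 is substituted on the exceptional null set.\<close>

lemma mixing_unit_normalization:
  assumes mix: "mixing H K T" and H: "infinite H" and K: "prob_space K"
    and f: "f \<in> L2 K" and nz: "\<not> (AE x in K. f x = 0)"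
    and inv: "\<And>h. h \<in> H \<Longrightarrow> AE x in K. cmod (f (T h x)) = cmod (f x)"
  obtains v and r :: real where "v \<in> borel_measurable K" "\<And>x. cmod (v x) = 1" "r > 0"
    "AE x in K. v x = f x / of_real r"
proof -
  interpret K: prob_space K by fact
  have [measurable]: "f \<in> borel_measurable K" by (rule L2_measurable[OF f])
  define r where "r = (\<integral>x. cmod (f x) \<partial>K)"
  have r: "AE x in K. cmod (f x) = r"
    unfolding r_def
    by (rule mixing_invariant_real_const[OF mix H K _ inv]) (use K.L2_integrable[OF f] in simp)
  have "r \<noteq> 0"
  proof
    assume "r = 0"
    then have "AE x in K. f x = 0" using r by simp
    with nz show False ..
  qed
  then have r0: "r > 0" unfolding r_def by (simp add: order_less_le)
  define v where "v x = (if cmod (f x) = r then f x / of_real r else 1)" for x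
  have "v \<in> borel_measurable K" unfolding v_def by measurable
  moreover have "cmod (v x) = 1" for x using r0 by (simp add: v_def norm_divide)
  moreover have "AE x in K. v x = f x / of_real r" using r by eventually_elim (simp add: v_def)
  ultimately show thesis using that r0 by blast
qed

section \<open>Group elements at which a cocycle is constant\<close>

context mp_group_action begin

lemma T_AE: "g \<in> carrier G \<Longrightarrow> AE x in X. P x \<Longrightarrow> AE x in X. P (T g x)"
  by (rule measure_preserving_AE[OF T])

lemma T_inv_comp:
  assumes "g \<in> carrier G" "h \<in> carrier G" "x \<in> space X"
  shows "T (inv (g \<otimes> h)) x = T (inv h) (T (inv g) x)"
  using assms by (simp add: inv_mult_group T_mult)

lemma unit_cocycleD:
  assumes "unit_cocycle c"
  shows "g \<in> carrier G \<Longrightarrow> c g \<in> borel_measurable X" "cmod (c g x) = 1"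
    "g \<in> carrier G \<Longrightarrow> h \<in> carrier G \<Longrightarrow> AE x in X. c (g \<otimes> h) x = c g x * c h (T (inv g) x)"
  using assms by (simp_all add: unit_cocycle_def)

lemma unit_cocycle_one:
  assumes "unit_cocycle c"
  shows "AE x in X. c \<one> x = 1"
  using unit_cocycleD(3)[OF assms one_closed one_closed] AE_space
proof eventually_elim
  case (elim x)
  then have e: "c \<one> x * c \<one> x = c \<one> x" by (simp add: T_one)
  have "c \<one> x \<noteq> 0" using unit_cocycleD(2)[OF assms, of \<one> x] by auto
  with e show ?case by simp
qed

text \<open>Where one factor is constant, the translation in the cocycle identity has no effect, so
  products of constants and, by the value at the identity, inverses are constant as well.\<close>

lemma unit_cocycle_const_subgroup:
  assumes c: "unit_cocycle c"
  shows "subgroup {g \<in> carrier G. \<exists>k. AE x in X. c g x = k} G"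
proof (rule subgroupI)
  show "{g \<in> carrier G. \<exists>k. AE x in X. c g x = k} \<noteq> {}"
    using unit_cocycle_one[OF c] one_closed by blast
next
  fix g assume "g \<in> {g \<in> carrier G. \<exists>k. AE x in X. c g x = k}"
  then obtain k where g: "g \<in> carrier G" "AE x in X. c g x = k" by blast
  have "AE x in X. c (inv g) x = cnj k"
    using unit_cocycleD(3)[OF c inv_closed[OF g(1)] g(1)] unit_cocycle_one[OF c] T_AE[OF g(1) g(2)]
  proof eventually_elim
    case (elim x)
    then have 1: "c (inv g) x * k = 1" using g(1) by simp
    then have "cmod k = 1" using unit_cocycleD(2)[OF c, of "inv g" x] by (metis mult_cancel_left2 norm_mult norm_one mult_1)
    then have "c (inv g) x = c (inv g) x * (k * cnj k)" by (simp add: mult_cnj_unit)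
    also have "\<dots> = cnj k" using 1 by (simp add: mult.assoc[symmetric])
    finally show ?case .
  qed
  then show "inv g \<in> {g \<in> carrier G. \<exists>k. AE x in X. c g x = k}" using g(1) by blast
next
  fix g h assume "g \<in> {g \<in> carrier G. \<exists>k. AE x in X. c g x = k}" "h \<in> {g \<in> carrier G. \<exists>k. AE x in X. c g x = k}"
  then obtain k l where g: "g \<in> carrier G" "AE x in X. c g x = k" and h: "h \<in> carrier G" "AE x in X. c h x = l" by blast
  have "AE x in X. c (g \<otimes> h) x = k * l"
    using unit_cocycleD(3)[OF c g(1) h(1)] g(2) T_AE[OF inv_closed[OF g(1)] h(2)]
    by eventually_elim simp
  then show "g \<otimes> h \<in> {g \<in> carrier G. \<exists>k. AE x in X. c g x = k}" using g(1) h(1) by blast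
qed blast

text \<open>Passage to a cohomologous cocycle: in the product the two intermediate values of
  \<open>f\<close> at \<open>T (inv g) x\<close> cancel.\<close>

lemma unit_cocycle_twist:
  assumes c: "unit_cocycle c" and f: "f \<in> borel_measurable X" "\<And>x. cmod (f x) = 1"
  shows "unit_cocycle (\<lambda>g x. c g x * f (T (inv g) x) * cnj (f x))"
  unfolding unit_cocycle_def
proof (intro conjI ballI allI)
  fix g assume g: "g \<in> carrier G"
  have [measurable]: "c g \<in> borel_measurable X" "f \<in> borel_measurable X" "T (inv g) \<in> X \<rightarrow>\<^sub>M X"
    using unit_cocycleD(1)[OF c g] f measure_preserving_measurable[OF T[OF inv_closed[OF g]]] by simp_all
  show "(\<lambda>x. c g x * f (T (inv g) x) * cnj (f x)) \<in> borel_measurable X" by measurable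
  fix h assume h: "h \<in> carrier G"
  show "AE x in X. c (g \<otimes> h) x * f (T (inv (g \<otimes> h)) x) * cnj (f x) =
      c g x * f (T (inv g) x) * cnj (f x) *
      (c h (T (inv g) x) * f (T (inv h) (T (inv g) x)) * cnj (f (T (inv g) x)))"
    using unit_cocycleD(3)[OF c g h] AE_space
  proof eventually_elim
    case (elim x)
    have "c g x * f (T (inv g) x) * cnj (f x) *
        (c h (T (inv g) x) * f (T (inv h) (T (inv g) x)) * cnj (f (T (inv g) x))) =
        (c g x * c h (T (inv g) x)) * f (T (inv h) (T (inv g) x)) * cnj (f x) * (f (T (inv g) x) * cnj (f (T (inv g) x)))"
      by (simp add: mult_ac)
    then show ?case by (simp add: mult_cnj_unit[OF f(2)] elim(1) T_inv_comp[OF g h elim(2)])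
  qed
next
  show "cmod (c g x * f (T (inv g) x) * cnj (f x)) = 1" for g x
    by (simp add: norm_mult f unit_cocycleD(2)[OF c])
qed

text \<open>If \<open>c\<close> is constant on \<open>K\<close> and \<open>g k' = k g\<close> with \<open>k, k' \<in> K\<close>, then \<open>c g\<close> is an eigenfunction
  of \<open>k\<close>; by mixing it is constant as soon as there are infinitely many such \<open>k\<close>.\<close>

lemma unit_cocycle_const_wq_normal:
  assumes c: "unit_cocycle c"
    and mix: "\<And>L. L \<subseteq> carrier G \<Longrightarrow> infinite L \<Longrightarrow> mixing L X T"
    and wq: "wq_normal H G" and H: "\<And>h. h \<in> H \<Longrightarrow> \<exists>k. AE x in X. c h x = k" "H \<subseteq> carrier G"
    and g: "g \<in> carrier G"
  shows "\<exists>k. AE x in X. c g x = k"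
proof -
  define K where "K = {g \<in> carrier G. \<exists>k. AE x in X. c g x = k}"
  have K: "subgroup K G" unfolding K_def by (rule unit_cocycle_const_subgroup[OF c])
  have KG: "K \<subseteq> carrier G" by (auto simp: K_def)
  have HK: "H \<subseteq> K" using H by (auto simp: K_def)
  have "K = carrier G"
  proof (rule ccontr)
    assume "K \<noteq> carrier G"
    then obtain g where g: "g \<in> carrier G" "g \<notin> K" and inf: "infinite ((g <# K #> inv g) \<inter> K)"
      using wq K HK unfolding wq_normal_def by blast
    define L where "L = (g <# K #> inv g) \<inter> K"
    have LG: "L \<subseteq> carrier G" using KG by (auto simp: L_def)
    have infL: "infinite L" using inf by (simp add: L_def)
    have inj: "inj_on (\<lambda>k. inv k) L" using LG inv_inj by (rule inj_on_subset[rotated])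
    have infI: "infinite ((\<lambda>k. inv k) ` L)" using infL finite_imageD[OF _ inj] by blast
    have IG: "(\<lambda>k. inv k) ` L \<subseteq> carrier G" using LG by auto
    have mixL: "mixing L X (\<lambda>k. T (inv k))"
      by (rule mixing_reindex[OF mix[OF IG infI] inj]) simp
    have eig: "\<exists>l. cmod l = 1 \<and> (AE x in X. c g (T (inv k) x) = l * c g x)" if k: "k \<in> L" for k
    proof -
      have kG: "k \<in> carrier G" and kK: "k \<in> K" using k LG by (auto simp: L_def)
      obtain k' where k': "k' \<in> K" "k = g \<otimes> k' \<otimes> inv g"
        using k by (auto simp: L_def l_coset_def r_coset_def)
      have k'G: "k' \<in> carrier G" using k' KG by blast
      have kg: "k \<otimes> g = g \<otimes> k'" using k'(2) g(1) k'G by (simp add: m_assoc)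
      obtain a where a: "AE x in X. c k x = a" using kK by (auto simp: K_def)
      obtain a' where a': "AE x in X. c k' x = a'" using k' by (auto simp: K_def)
      have ua: "cmod a = 1"
        using a by (rule X.AE_obtain) (use unit_cocycleD(2)[OF c] in auto)
      have ua': "cmod a' = 1"
        using a' by (rule X.AE_obtain) (use unit_cocycleD(2)[OF c] in auto)
      have "AE x in X. c g (T (inv k) x) = cnj a * a' * c g x"
        using unit_cocycleD(3)[OF c kG g(1)] unit_cocycleD(3)[OF c g(1) k'G] a T_AE[OF inv_closed[OF g(1)] a']
      proof eventually_elim
        case (elim x)
        then have "a * c g (T (inv k) x) = c g x * a'" by (simp add: kg)
        then have "c g (T (inv k) x) = cnj a * (c g x * a')" using unit_eq_cnj_mult[OF ua] by blast
        then show ?case by (simp add: mult_ac)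
      qed
      moreover have "cmod (cnj a * a') = 1" by (simp add: norm_mult ua ua')
      ultimately show ?thesis by blast
    qed
    have nz: "\<not> (AE x in X. c g x = 0)"
    proof
      assume "AE x in X. c g x = 0"
      then obtain x where "c g x = 0" by (rule X.AE_obtain)
      then show False using unit_cocycleD(2)[OF c, of g x] by simp
    qed
    have "\<exists>k. AE x in X. c g x = k"
      using mixing_eigenfunction_const[OF mixL infL X.prob_space_axioms unit_cocycleD(1)[OF c g(1)] _ nz eig]
        unit_cocycleD(2)[OF c] by (metis order_refl)
    with g show False by (simp add: K_def)
  qed
  with g show ?thesis by (auto simp: K_def)
qed

end

section \<open>Cohomology along the path and superrigidity\<close>

context bernoulli_group begin

lemma shift2_measure_preserving:
  assumes "g \<in> carrier G"
  shows "measure_preserving (X \<Otimes>\<^sub>M U) (X \<Otimes>\<^sub>M U) (shift2 g)"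
  unfolding shift2_def[abs_def]
  by (rule measure_preserving_pair[OF X.prob_space_axioms U.prob_space_axioms
      bernoulli_shift_measure_preserving[OF M0 assms]
      bernoulli_shift_measure_preserving[OF prob_space_unit_interval assms]
      X.prob_space_axioms U.prob_space_axioms])

lemma shift3_measure_preserving:
  assumes "g \<in> carrier G"
  shows "measure_preserving W W (shift3 g)"
  unfolding shift3_def[abs_def]
  by (rule measure_preserving_pair[OF X.prob_space_axioms XU.prob_space_axioms
      bernoulli_shift_measure_preserving[OF M0 assms] shift2_measure_preserving[OF assms]
      X.prob_space_axioms XU.prob_space_axioms])

sublocale XA: mp_group_action G X "bernoulli_shift G"
  by unfold_locales
    (simp_all add: bernoulli_shift_measure_preserving[OF M0] bernoulli_shift_one bernoulli_shift_mult)

sublocale WA: mp_group_action G W shift3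
proof unfold_locales
  show "shift3 \<one> z = z" if "z \<in> space W" for z
  proof -
    have "fst z \<in> space X" "fst (snd z) \<in> space X" "snd (snd z) \<in> space U"
      using that by (auto simp: space_pair_measure)
    then show ?thesis
      by (simp add: shift3_def shift2_def bernoulli_shift_one[of _ M0] bernoulli_shift_one[of _ unit_interval])
  qed
qed (simp_all add: shift3_measure_preserving shift3_def shift2_def bernoulli_shift_mult)

lemma mixing_X: "H \<subseteq> carrier G \<Longrightarrow> infinite H \<Longrightarrow> mixing H X (bernoulli_shift G)"
  by (rule bernoulli_shift_mixing[OF M0])

lemma mixing_XU: "H \<subseteq> carrier G \<Longrightarrow> infinite H \<Longrightarrow> mixing H (X \<Otimes>\<^sub>M U) shift2"
  unfolding shift2_def[abs_def]
  by (intro mixing_pair X.prob_space_axioms U.prob_space_axioms mixing_X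
      bernoulli_shift_mixing[OF prob_space_unit_interval])

lemma mixing_W: "H \<subseteq> carrier G \<Longrightarrow> infinite H \<Longrightarrow> mixing H W shift3"
  unfolding shift3_def[abs_def]
  by (intro mixing_pair X.prob_space_axioms XU.prob_space_axioms mixing_X mixing_XU)

lemma mixing_inv:
  assumes mix: "\<And>L. L \<subseteq> carrier G \<Longrightarrow> infinite L \<Longrightarrow> mixing L K T"
    and H: "H \<subseteq> carrier G" "infinite H"
  shows "mixing H K (\<lambda>h. T (inv h))"
proof -
  have inj: "inj_on (\<lambda>k. inv k) H" using H(1) inv_inj by (rule inj_on_subset[rotated])
  have inf: "infinite ((\<lambda>k. inv k) ` H)" using H(2) finite_imageD[OF _ inj] by blast
  have "(\<lambda>k. inv k) ` H \<subseteq> carrier G" using H(1) by auto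
  from mixing_reindex[OF mix[OF this inf] inj order_refl] show ?thesis .
qed

definition path_cohomologous :: "'g set \<Rightarrow> ('g \<Rightarrow> ('g \<Rightarrow> 'x) \<Rightarrow> complex) \<Rightarrow> real \<Rightarrow> real \<Rightarrow> bool" where
  "path_cohomologous H w s t \<longleftrightarrow>
     (\<exists>v. v \<in> borel_measurable W \<and> (\<forall>z. cmod (v z) = 1) \<and>
       (\<forall>h\<in>H. AE z in W. w h (interp s z) * v (shift3 (inv h) z) = v z * w h (interp t z)))"

lemma path_cohomologous_refl: "path_cohomologous H w s s"
  unfolding path_cohomologous_def by (rule exI[of _ "\<lambda>_. 1"]) simp

lemma path_cohomologous_trans:
  assumes "path_cohomologous H w r s" "path_cohomologous H w s t"
  shows "path_cohomologous H w r t"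
proof -
  obtain u where u: "u \<in> borel_measurable W" "\<And>z. cmod (u z) = 1"
    "\<And>h. h \<in> H \<Longrightarrow> AE z in W. w h (interp r z) * u (shift3 (inv h) z) = u z * w h (interp s z)"
    using assms(1) unfolding path_cohomologous_def by blast
  obtain v where v: "v \<in> borel_measurable W" "\<And>z. cmod (v z) = 1"
    "\<And>h. h \<in> H \<Longrightarrow> AE z in W. w h (interp s z) * v (shift3 (inv h) z) = v z * w h (interp t z)"
    using assms(2) unfolding path_cohomologous_def by blast
  have "AE z in W. w h (interp r z) * (u (shift3 (inv h) z) * v (shift3 (inv h) z)) = u z * v z * w h (interp t z)"
    if h: "h \<in> H" for h
    using u(3)[OF h] v(3)[OF h]
  proof eventually_elim
    case (elim z)
    have "w h (interp r z) * (u (shift3 (inv h) z) * v (shift3 (inv h) z)) =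
        u z * (w h (interp s z) * v (shift3 (inv h) z))" by (simp add: elim(1) mult.assoc[symmetric])
    then show ?case by (simp add: elim(2) mult.assoc)
  qed
  moreover have "(\<lambda>z. u z * v z) \<in> borel_measurable W" using u v by simp
  ultimately show ?thesis
    unfolding path_cohomologous_def by (intro exI[of _ "\<lambda>z. u z * v z"]) (simp add: norm_mult u v)
qed

text \<open>Equivariance of \<open>interp\<close> pulls \<open>w\<close> back to cocycles on
  \<open>W\<close>, and the quotient of two scalar cocycles is a cocycle. A vector invariant under
  the representation of this quotient intertwines the two pullbacks, which is why the quotient is
  formed.\<close>

lemma path_unit_cocycle:
  assumes w: "XA.unit_cocycle w"
  shows "WA.unit_cocycle (\<lambda>g z. w g (interp s z) * cnj (w g (interp t z)))"
  unfolding WA.unit_cocycle_def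
proof (intro conjI ballI allI)
  fix g assume g: "g \<in> carrier G"
  have "(\<lambda>z. w g (interp r z)) \<in> borel_measurable W" for r
    using measurable_compose[OF interp_measurable XA.unit_cocycleD(1)[OF w g]] .
  then show "(\<lambda>z. w g (interp s z) * cnj (w g (interp t z))) \<in> borel_measurable W" by simp
  fix h assume h: "h \<in> carrier G"
  note e = XA.unit_cocycleD(3)[OF w g h]
  show "AE z in W. w (g \<otimes> h) (interp s z) * cnj (w (g \<otimes> h) (interp t z)) =
      w g (interp s z) * cnj (w g (interp t z)) *
      (w h (interp s (shift3 (inv g) z)) * cnj (w h (interp t (shift3 (inv g) z))))"
    using measure_preserving_AE[OF interp_measure_preserving[of s] e]
      measure_preserving_AE[OF interp_measure_preserving[of t] e]
    by eventually_elim (simp add: interp_equivariant g mult_ac)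
next
  show "cmod (w g (interp s z) * cnj (w g (interp t z))) = 1" for g z
    by (simp add: norm_mult XA.unit_cocycleD(2)[OF w])
qed

lemma countably_generated_W:
  assumes "countably_generated M0"
  shows "countably_generated W"
proof -
  have "countably_generated unit_interval"
    unfolding unit_interval_def by (rule countably_generated_restrict_lborel) simp
  then show ?thesis
    unfolding bernoulli_space_def using assms countable_carrier
    by (intro countably_generated_pair countably_generated_PiM)
qed

text \<open>If no step length works, there are pairs of times that are arbitrarily close but not
  cohomologous. Continuity along the path makes the constant function 1 almost invariant for the
  sequence of quotient cocycles, and the relative property (T) yields an invariant vector for one of
  them. Normalised, it shows that this pair is cohomologous after all.\<close>

lemma path_cohomologous_near:
  assumes w: "XA.unit_cocycle w" and H: "H \<subseteq> carrier G" "infinite H"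
    and relT: "relative_property_T G H" and cg: "countably_generated M0"
  obtains N :: nat where "\<And>s t. \<bar>s - t\<bar> < inverse (real (Suc N)) \<Longrightarrow> path_cohomologous H w s t"
proof (rule ccontr)
  assume "\<not> thesis"
  then have "\<forall>n. \<exists>p. \<bar>fst p - snd p\<bar> < inverse (real (Suc n)) \<and> \<not> path_cohomologous H w (fst p) (snd p)"
    using that by (metis fst_conv snd_conv)
  then obtain p where p: "\<And>n. \<bar>fst (p n) - snd (p n)\<bar> < inverse (real (Suc n))"
    "\<And>n. \<not> path_cohomologous H w (fst (p n)) (snd (p n))" by metis
  define s t where "s n = fst (p n)" and "t n = snd (p n)" for n
  have st: "(\<lambda>n. s n - t n) \<longlonglongrightarrow> 0"
    by (rule Lim_null_comparison[OF _ LIMSEQ_inverse_real_of_nat])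
      (use p(1) in \<open>auto simp: s_def t_def less_imp_le\<close>)
  let ?c = "\<lambda>n g z. w g (interp (s n) z) * cnj (w g (interp (t n) z))"
  obtain n f where f: "f \<in> L2 W" "\<not> (AE z in W. f z = 0)"
    "\<And>h. h \<in> H \<Longrightarrow> AE z in W. ?c n h z * f (shift3 (inv h) z) = f z"
  proof (rule WA.relative_property_T_sequence[OF relT H(1) countably_generated_W[OF cg],
        where c="?c" and D="{}" and \<xi>="\<lambda>_ _. 1"])
    show "WA.unit_cocycle (?c n)" for n by (rule path_unit_cocycle[OF w])
    show "(\<lambda>_. 1) \<in> L2 W" by (rule W.bounded_L2[where C=1]) auto
    show "(\<lambda>n. \<integral>z. ?c n g z * 1 * cnj 1 \<partial>W) \<longlonglongrightarrow> 1" if "g \<in> carrier G" for g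
      using interp_correlation_tendsto[OF st XA.unit_cocycleD(1)[OF w that] XA.unit_cocycleD(2)[OF w]] by simp
  qed (use that in auto)
  have fm [measurable]: "f \<in> borel_measurable W" by (rule L2_measurable[OF f(1)])
  have mixW: "mixing H W (\<lambda>h. shift3 (inv h))" by (rule mixing_inv[OF mixing_W H])
  have c1: "cmod (?c n h z) = 1" for h z by (simp add: norm_mult XA.unit_cocycleD(2)[OF w])
  have "AE z in W. cmod (f (shift3 (inv h) z)) = cmod (f z)" if "h \<in> H" for h
    using f(3)[OF that]
  proof eventually_elim
    case (elim z)
    have "cmod (f z) = cmod (?c n h z) * cmod (f (shift3 (inv h) z))"
      by (simp only: elim[symmetric] norm_mult)
    then show ?case by (simp only: c1 mult_1)
  qed
  then obtain v and r :: real where v_meas: "v \<in> borel_measurable W" and v1: "\<And>z. cmod (v z) = 1"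
    and "r > 0" and vf: "AE z in W. v z = f z / of_real r"
    using mixing_unit_normalization[OF mixW H(2) W.prob_space_axioms f(1,2), of thesis] by blast
  have "AE z in W. w h (interp (s n) z) * v (shift3 (inv h) z) = v z * w h (interp (t n) z)" if h: "h \<in> H" for h
  proof -
    have hG: "h \<in> carrier G" using h H by blast
    show ?thesis
      using f(3)[OF h] vf WA.T_AE[OF inv_closed[OF hG] vf]
    proof eventually_elim
      case (elim z)
      have "v z * w h (interp (t n) z) = ?c n h z * f (shift3 (inv h) z) / of_real r * w h (interp (t n) z)"
        unfolding elim(1,2) ..
      also have "\<dots> = w h (interp (s n) z) * v (shift3 (inv h) z) *
          (w h (interp (t n) z) * cnj (w h (interp (t n) z)))"
        unfolding elim(3) by (simp add: mult_ac)
      finally show ?case by (simp add: mult_cnj_unit[OF XA.unit_cocycleD(2)[OF w]])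
    qed
  qed
  then have "path_cohomologous H w (s n) (t n)"
    unfolding path_cohomologous_def using v_meas v1 by blast
  then show False using p(2) by (simp add: s_def t_def)
qed

lemma path_cohomologous_0_1:
  assumes w: "XA.unit_cocycle w" and H: "H \<subseteq> carrier G" "infinite H"
    and relT: "relative_property_T G H" and cg: "countably_generated M0"
  shows "path_cohomologous H w 0 1"
proof -
  obtain N :: nat where N: "\<And>s t. \<bar>s - t\<bar> < inverse (real (Suc N)) \<Longrightarrow> path_cohomologous H w s t"
    using path_cohomologous_near[OF assms, of thesis] by blast
  \<comment> \<open>The interval is cut into N + 2 steps, since the length 1/(N+1) would not satisfy
    the strict inequality.\<close>
  have "path_cohomologous H w 0 (real k / real (Suc (Suc N)))" for k
  proof (induction k)
    case 0
    then show ?case by (simp add: path_cohomologous_refl)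
  next
    case (Suc k)
    have "\<bar>real k / real (Suc (Suc N)) - real (Suc k) / real (Suc (Suc N))\<bar> = 1 / real (Suc (Suc N))"
      by (simp add: diff_divide_distrib[symmetric])
    also have "\<dots> < inverse (real (Suc N))" by (simp add: field_simps)
    finally show ?case by (rule path_cohomologous_trans[OF Suc N])
  qed
  from this[of "Suc (Suc N)"] show ?thesis by simp
qed

theorem cocycle_superrigidity:
  assumes w: "XA.unit_cocycle w" and H: "H \<subseteq> carrier G" "infinite H" "wq_normal H G"
    and relT: "relative_property_T G H" and cg: "countably_generated M0"
  obtains f where "f \<in> borel_measurable X" "\<And>x. cmod (f x) = 1"
    "\<And>g. g \<in> carrier G \<Longrightarrow> \<exists>k. AE x in X. w g x * f (bernoulli_shift G (inv g) x) * cnj (f x) = k"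
proof -
  obtain v where v: "v \<in> borel_measurable W" "\<And>z. cmod (v z) = 1"
    "\<And>h. h \<in> H \<Longrightarrow> AE z in W. w h (interp 0 z) * v (shift3 (inv h) z) = v z * w h (interp 1 z)"
    using path_cohomologous_0_1[OF w H(1,2) relT cg] unfolding path_cohomologous_def by blast
  \<comment> \<open>The variables are split into the first copy on one side and the second copy
    together with its labels on the other; at times 0 and 1 the cocycle depends on one side
    only.\<close>
  interpret S: unit_kernel X "X \<Otimes>\<^sub>M U" v
    by unfold_locales (use v in auto)
  have hG: "h \<in> carrier G" if "h \<in> H" for h using that H by blast
  have eq: "AE z in W. w h (fst z) * v (bernoulli_shift G (inv h) (fst z), shift2 (inv h) (snd z)) = v z * w h (fst (snd z))"
    if h: "h \<in> H" for h
    using v(3)[OF h] AE_space by eventually_elim (simp add: interp_0 interp_1 shift3_def)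
  have b_meas: "(\<lambda>y. w h (fst y)) \<in> borel_measurable (X \<Otimes>\<^sub>M U)" if "h \<in> H" for h
    using measurable_compose[OF measurable_fst XA.unit_cocycleD(1)[OF w hG[OF that]]] .
  obtain f where f: "f \<in> borel_measurable X" "\<And>x. cmod (f x) = 1"
    "\<And>h. h \<in> H \<Longrightarrow> \<exists>c. cmod c = 1 \<and> (AE x in X. w h x * f (bernoulli_shift G (inv h) x) = c * f x)"
    using S.separation[OF H(2) mixing_inv[OF mixing_X H(1,2)] mixing_inv[OF mixing_XU H(1,2)]
      XA.unit_cocycleD(1)[OF w hG] XA.unit_cocycleD(2)[OF w] b_meas XA.unit_cocycleD(2)[OF w] eq, of thesis]
    by blast
  have "\<exists>k. AE x in X. w h x * f (bernoulli_shift G (inv h) x) * cnj (f x) = k" if h: "h \<in> H" for h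
  proof -
    obtain c where "AE x in X. w h x * f (bernoulli_shift G (inv h) x) = c * f x" using f(3)[OF h] by blast
    then have "AE x in X. w h x * f (bernoulli_shift G (inv h) x) * cnj (f x) = c"
      by eventually_elim (simp add: mult.assoc mult_cnj_unit[OF f(2)])
    then show ?thesis by blast
  qed
  then have "\<exists>k. AE x in X. w g x * f (bernoulli_shift G (inv g) x) * cnj (f x) = k" if "g \<in> carrier G" for g
    using XA.unit_cocycle_const_wq_normal[OF XA.unit_cocycle_twist[OF w f(1,2)] mixing_X H(3) _ H(1) that] by blast
  then show thesis using that f(1,2) by blast
qed

end

section \<open>The spectral gap of Bernoulli shifts\<close>

context bernoulli_group begin

text \<open>Put w = k u(T x) cnj(u(x)). The integral of (w - 1) u is (k - 1) times the mean of u,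
  since the shift preserves the mean; the integral of w - 1 is the second quantity. Both are bounded
  by the L1 norm, hence by the L2 norm, of w - 1. The first bound controls \<open>k\<close> once the
  mean of \<open>u\<close> is not small; the second expresses almost invariance.\<close>

lemma character_deviation:
  assumes g: "g \<in> carrier G" and u: "u \<in> borel_measurable X" "\<And>x. cmod (u x) = 1" and k: "cmod k = 1"
  shows "cmod (k - 1) * cmod (\<integral>x. u x \<partial>X) \<le> norm2 X (\<lambda>x. k * u (bernoulli_shift G (inv g) x) * cnj (u x) - 1)"
    "cmod (k * (\<integral>x. u (bernoulli_shift G (inv g) x) * cnj (u x) \<partial>X) - 1)
      \<le> norm2 X (\<lambda>x. k * u (bernoulli_shift G (inv g) x) * cnj (u x) - 1)"
proof -
  let ?T = "bernoulli_shift G (inv g)"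
  let ?w = "\<lambda>x. k * u (?T x) * cnj (u x)"
  have mp: "measure_preserving X X ?T" by (rule XA.T[OF inv_closed[OF g]])
  have [measurable]: "u \<in> borel_measurable X" "?T \<in> X \<rightarrow>\<^sub>M X"
    using u measure_preserving_measurable[OF mp] by simp_all
  have w1: "cmod (?w x - 1) \<le> 2" for x
    using norm_triangle_ineq4[of "?w x" 1] by (simp add: norm_mult u k)
  have L: "(\<lambda>x. ?w x - 1) \<in> L2 X" using w1 by (intro X.bounded_L2[where C=2]) auto
  have iu: "integrable X u" by (rule X.integrable_bounded_complex[where C=1]) (auto simp: u)
  have iuT: "integrable X (\<lambda>x. u (?T x))" by (rule measure_preserving_integrable[OF mp iu])
  have iw: "integrable X ?w" by (rule X.integrable_bounded_complex[where C=1]) (auto simp: u k norm_mult)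
  have eq: "(\<integral>x. u (?T x) \<partial>X) = (\<integral>x. u x \<partial>X)"
    by (rule measure_preserving_integral[OF mp]) simp
  have "(k - 1) * (\<integral>x. u x \<partial>X) = (\<integral>x. k * u (?T x) - u x \<partial>X)"
    using iu iuT by (simp add: eq left_diff_distrib)
  also have "\<dots> = (\<integral>x. (?w x - 1) * u x \<partial>X)"
  proof (rule Bochner_Integration.integral_cong)
    fix x
    have "(?w x - 1) * u x = k * u (?T x) * (u x * cnj (u x)) - u x" by (simp add: algebra_simps)
    then show "k * u (?T x) - u x = (?w x - 1) * u x" by (simp add: mult_cnj_unit[OF u(2)])
  qed simp
  finally have "cmod (k - 1) * cmod (\<integral>x. u x \<partial>X) = cmod (\<integral>x. (?w x - 1) * u x \<partial>X)"
    by (simp only: norm_mult[symmetric])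
  also have "\<dots> \<le> (\<integral>x. cmod ((?w x - 1) * u x) \<partial>X)" by (rule integral_norm_bound)
  also have "\<dots> = (\<integral>x. cmod (?w x - 1) \<partial>X)" by (simp add: norm_mult u)
  also have "\<dots> \<le> norm2 X (\<lambda>x. ?w x - 1)" by (rule X.integral_norm_le_norm2[OF L])
  finally show "cmod (k - 1) * cmod (\<integral>x. u x \<partial>X) \<le> norm2 X (\<lambda>x. ?w x - 1)" .
  have "k * (\<integral>x. u (?T x) * cnj (u x) \<partial>X) = (\<integral>x. ?w x \<partial>X)" by (simp add: mult.assoc)
  then have "cmod (k * (\<integral>x. u (?T x) * cnj (u x) \<partial>X) - 1) = cmod (\<integral>x. ?w x - 1 \<partial>X)"
    using iw by (simp add: X.prob_space)
  also have "\<dots> \<le> (\<integral>x. cmod (?w x - 1) \<partial>X)" by (rule integral_norm_bound)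
  also have "\<dots> \<le> norm2 X (\<lambda>x. ?w x - 1)" by (rule X.integral_norm_le_norm2[OF L])
  finally show "cmod (k * (\<integral>x. u (?T x) * cnj (u x) \<partial>X) - 1) \<le> norm2 X (\<lambda>x. ?w x - 1)" .
qed

text \<open>Mixing makes every eigenfunction constant, and a constant of mean zero is 0.\<close>

lemma no_mean_zero_eigenfunction:
  assumes H: "H \<subseteq> carrier G" "infinite H"
    and f: "f \<in> L2 X" "(\<integral>x. f x \<partial>X) = 0"
    and eig: "\<And>h. h \<in> H \<Longrightarrow> \<exists>k. cmod k = 1 \<and> (AE x in X. k * f (bernoulli_shift G (inv h) x) = f x)"
  shows "AE x in X. f x = 0"
proof (rule ccontr)
  assume nz: "\<not> (AE x in X. f x = 0)"
  have mix: "mixing H X (\<lambda>h. bernoulli_shift G (inv h))" by (rule mixing_inv[OF mixing_X H])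
  have "AE x in X. cmod (f (bernoulli_shift G (inv h) x)) = cmod (f x)" if h: "h \<in> H" for h
  proof -
    obtain k where k: "cmod k = 1" "AE x in X. k * f (bernoulli_shift G (inv h) x) = f x"
      using eig[OF h] by blast
    from k(2) show ?thesis
    proof eventually_elim
      case (elim x)
      have "cmod (f x) = cmod k * cmod (f (bernoulli_shift G (inv h) x))"
        by (simp only: elim[symmetric] norm_mult)
      then show ?case by (simp add: k(1))
    qed
  qed
  then obtain v and r :: real where v: "v \<in> borel_measurable X" "\<And>z. cmod (v z) = 1"
    and r: "r > 0" and vf: "AE z in X. v z = f z / of_real r"
    using mixing_unit_normalization[OF mix H(2) X.prob_space_axioms f(1) nz, of thesis] by blast
  have v_eig: "\<exists>c. cmod c = 1 \<and> (AE x in X. v (bernoulli_shift G (inv h) x) = c * v x)" if h: "h \<in> H" for h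
  proof -
    obtain k where k: "cmod k = 1" "AE x in X. k * f (bernoulli_shift G (inv h) x) = f x"
      using eig[OF h] by blast
    have hG: "h \<in> carrier G" using h H by blast
    have "AE x in X. v (bernoulli_shift G (inv h) x) = cnj k * v x"
      using k(2) vf XA.T_AE[OF inv_closed[OF hG] vf]
    proof eventually_elim
      case (elim x)
      have "f (bernoulli_shift G (inv h) x) = cnj k * f x"
        using elim(1) unit_eq_cnj_mult[OF k(1)] by blast
      then show ?case by (simp add: elim(2,3))
    qed
    then show ?thesis using k(1) by (intro exI[of _ "cnj k"]) simp
  qed
  have "\<not> (AE x in X. v x = 0)"
  proof
    assume "AE x in X. v x = 0"
    then obtain x where "v x = 0" by (rule X.AE_obtain)
    then show False using v(2)[of x] by simp
  qed
  then obtain c where c: "AE x in X. v x = c"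
    using mixing_eigenfunction_const[OF mix H(2) X.prob_space_axioms v(1) _ _ v_eig, of thesis] v(2) by auto
  have fc: "AE x in X. f x = of_real r * c"
    using c vf by eventually_elim (use r in \<open>simp add: field_simps\<close>)
  have "(\<integral>x. f x \<partial>X) = (\<integral>x. of_real r * c \<partial>X)"
    using fc L2_measurable[OF f(1)] by (intro integral_cong_AE) auto
  then have "of_real r * c = 0" using f(2) by (simp add: X.prob_space)
  with fc nz show False by simp
qed

text \<open>If it fails for every \<open>F\<close> and \<open>\<delta>\<close>, there are characters
  and unitaries with deviation tending to 0 but means below 1/2. The normalised mean-zero parts of
  these unitaries are then almost invariant for the twisted representations on mean-zero functions.
  The relative property (T) produces an eigenfunction of \<open>H\<close> of mean zero that is not
  null, which mixing excludes.\<close>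

lemma character_gap:
  assumes H: "H \<subseteq> carrier G" "infinite H" and relT: "relative_property_T G H" and cg: "countably_generated M0"
  obtains F \<delta> where "finite F" "F \<subseteq> carrier G" "\<delta> > 0"
    "\<And>\<theta> u. \<lbrakk>\<And>g. g \<in> carrier G \<Longrightarrow> cmod (\<theta> g) = 1;
      \<And>g h. g \<in> carrier G \<Longrightarrow> h \<in> carrier G \<Longrightarrow> \<theta> (g \<otimes> h) = \<theta> g * \<theta> h;
      u \<in> borel_measurable X; \<And>x. cmod (u x) = 1;
      \<And>g. g \<in> F \<Longrightarrow> norm2 X (\<lambda>x. \<theta> g * u (bernoulli_shift G (inv g) x) * cnj (u x) - 1) < \<delta>\<rbrakk>
      \<Longrightarrow> 1 / 2 \<le> cmod (\<integral>x. u x \<partial>X)"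
proof (rule ccontr)
  assume no: "\<not> thesis"
  note witness = that
  define P where "P F \<delta> \<theta> u \<longleftrightarrow> (\<forall>g\<in>carrier G. cmod (\<theta> g) = 1) \<and>
      (\<forall>g\<in>carrier G. \<forall>h\<in>carrier G. \<theta> (g \<otimes> h) = \<theta> g * \<theta> h) \<and>
      u \<in> borel_measurable X \<and> (\<forall>x. cmod (u x) = 1) \<and>
      (\<forall>g\<in>F. norm2 X (\<lambda>x. \<theta> g * u (bernoulli_shift G (inv g) x) * cnj (u x) - 1) < \<delta>) \<and>
      cmod (\<integral>x. u x \<partial>X) < 1 / 2" for F \<delta> \<theta> u
  have ex: "\<exists>\<theta> u. P F \<delta> \<theta> u" if F: "finite F" "F \<subseteq> carrier G" "\<delta> > 0" for F \<delta>
  proof (rule ccontr)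
    assume none: "\<nexists>\<theta> u. P F \<delta> \<theta> u"
    have "1 / 2 \<le> cmod (\<integral>x. u x \<partial>X)" if A: "\<And>g. g \<in> carrier G \<Longrightarrow> cmod (\<theta> g) = 1"
      "\<And>g h. g \<in> carrier G \<Longrightarrow> h \<in> carrier G \<Longrightarrow> \<theta> (g \<otimes> h) = \<theta> g * \<theta> h"
      "u \<in> borel_measurable X" "\<And>x. cmod (u x) = 1"
      "\<And>g. g \<in> F \<Longrightarrow> norm2 X (\<lambda>x. \<theta> g * u (bernoulli_shift G (inv g) x) * cnj (u x) - 1) < \<delta>" for \<theta> u
    proof (rule ccontr)
      assume "\<not> 1 / 2 \<le> cmod (\<integral>x. u x \<partial>X)"
      then have "P F \<delta> \<theta> u" unfolding P_def using A by (intro conjI ballI allI) simp_all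
      with none show False by blast
    qed
    then have thesis by (rule witness[OF F])
    with no show False ..
  qed
  define e where "e = from_nat_into (carrier G)"
  have e: "range e = carrier G"
    unfolding e_def using countable_carrier one_closed by (intro range_from_nat_into) auto
  \<comment> \<open>Each group element belongs to \<open>F n\<close> for all large \<open>n\<close>,
    so that smallness on \<open>F n\<close> becomes pointwise convergence on the group.\<close>
  define F where "F n = e ` {..n}" for n
  have Fn: "finite (F n)" "F n \<subseteq> carrier G" for n using e by (auto simp: F_def)
  have "\<exists>\<theta> u. P (F n) (inverse (real (Suc n))) \<theta> u" for n
    by (rule ex[OF Fn]) simp
  then obtain \<theta> u where "\<And>n. P (F n) (inverse (real (Suc n))) (\<theta> n) (u n)" by metis
  then have \<theta>1: "\<And>n g. g \<in> carrier G \<Longrightarrow> cmod (\<theta> n g) = 1"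
    and \<theta>m: "\<And>n g h. g \<in> carrier G \<Longrightarrow> h \<in> carrier G \<Longrightarrow> \<theta> n (g \<otimes> h) = \<theta> n g * \<theta> n h"
    and um [measurable]: "\<And>n. u n \<in> borel_measurable X" and u1: "\<And>n x. cmod (u n x) = 1"
    and small: "\<And>n g. g \<in> F n \<Longrightarrow> norm2 X (\<lambda>x. \<theta> n g * u n (bernoulli_shift G (inv g) x) * cnj (u n x) - 1) < inverse (real (Suc n))"
    and half: "\<And>n. cmod (\<integral>x. u n x \<partial>X) < 1 / 2"
    unfolding P_def by blast+
  let ?T = "\<lambda>g. bernoulli_shift G (inv g)"
  define a where "a n = (\<integral>x. u n x \<partial>X)" for n
  \<comment> \<open>The L2 norm of u - a, as u has modulus 1 and mean a; it is bounded below because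
    |a| < 1/2.\<close>
  define q where "q n = sqrt (1 - (cmod (a n))\<^sup>2)" for n
  have a2: "(cmod (a n))\<^sup>2 \<le> 1 / 4" for n
    using power_mono[of "cmod (a n)" "1/2" 2] half[of n] by (simp add: a_def power2_eq_square)
  have q2: "q n * q n = 1 - (cmod (a n))\<^sup>2" for n using a2[of n] by (simp add: q_def)
  have qpos: "q n > 0" for n using a2[of n] by (simp add: q_def)
  define c where "c n g x = (if g \<in> carrier G then \<theta> n g else 1)" for n g and x :: "'g \<Rightarrow> 'x"
  define \<xi> where "\<xi> n x = (u n x - a n) / of_real (q n)" for n x
  have iu: "integrable X (u n)" for n by (rule X.integrable_bounded_complex[where C=1]) (auto simp: u1)
  have ind: "(\<integral>x. indicator (space X) x *\<^sub>R f x \<partial>X) = (\<integral>x. f x \<partial>X)" for f :: "_ \<Rightarrow> complex"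
    by (rule Bochner_Integration.integral_cong) auto
  have mean0: "(\<integral>x. \<xi> n x \<partial>X) = 0" for n
    using iu[of n] by (simp add: \<xi>_def a_def X.prob_space)
  have almost: "(\<lambda>n. \<integral>x. c n g x * \<xi> n (?T g x) * cnj (\<xi> n x) \<partial>X) \<longlonglongrightarrow> 1" if g: "g \<in> carrier G" for g
  proof -
    have mp: "measure_preserving X X (?T g)" by (rule XA.T[OF inv_closed[OF g]])
    have [measurable]: "?T g \<in> X \<rightarrow>\<^sub>M X" by (rule measure_preserving_measurable[OF mp])
    obtain m where m: "e m = g" using e g by (metis imageE)
    have formula: "(\<integral>x. c n g x * \<xi> n (?T g x) * cnj (\<xi> n x) \<partial>X) =
        (\<theta> n g * (\<integral>x. u n (?T g x) * cnj (u n x) \<partial>X) - \<theta> n g * of_real ((cmod (a n))\<^sup>2)) / of_real (1 - (cmod (a n))\<^sup>2)" for n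
    proof -
      have iT: "integrable X (\<lambda>x. u n (?T g x))" by (rule measure_preserving_integrable[OF mp iu])
      have aT: "(\<integral>x. u n (?T g x) \<partial>X) = a n"
        unfolding a_def by (rule measure_preserving_integral[OF mp]) simp
      have icu: "integrable X (\<lambda>x. cnj (u n x))" using iu by simp
      have iP: "integrable X (\<lambda>x. u n (?T g x) * cnj (u n x))"
        by (rule X.integrable_bounded_complex[where C=1]) (auto simp: u1 norm_mult)
      have "(\<integral>x. c n g x * \<xi> n (?T g x) * cnj (\<xi> n x) \<partial>X) =
          (\<integral>x. (\<theta> n g / of_real (q n * q n)) * (u n (?T g x) * cnj (u n x) - a n * cnj (u n x) - cnj (a n) * u n (?T g x) + a n * cnj (a n)) \<partial>X)"
        by (rule Bochner_Integration.integral_cong) (simp_all add: c_def g \<xi>_def field_simps)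
      also have "\<dots> = (\<theta> n g / of_real (q n * q n)) *
          ((\<integral>x. u n (?T g x) * cnj (u n x) \<partial>X) - a n * cnj (a n) - cnj (a n) * a n + a n * cnj (a n))"
        using iT icu iP by (simp add: aT X.prob_space a_def[symmetric])
      also have "\<dots> = (\<theta> n g / of_real (q n * q n)) * ((\<integral>x. u n (?T g x) * cnj (u n x) \<partial>X) - of_real ((cmod (a n))\<^sup>2))"
        by (simp add: complex_norm_square mult.commute del: of_real_power)
      finally show ?thesis unfolding q2 by (simp add: right_diff_distrib diff_divide_distrib)
    qed
    \<comment> \<open>Subtracting the mean costs, besides the deviation itself, the error (theta -
      1)|a|^2, which the first bound of \<open>character_deviation\<close> controls. Each error is
      at most 1/(n+1), and the denominator 1 - |a|^2 is at least 1/2; hence the factor 4.\<close>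
    have bound: "cmod ((\<integral>x. c n g x * \<xi> n (?T g x) * cnj (\<xi> n x) \<partial>X) - 1) \<le> 4 * inverse (real (Suc n))"
      if n: "n \<ge> m" for n
    proof -
      let ?I = "\<theta> n g * (\<integral>x. u n (?T g x) * cnj (u n x) \<partial>X)"
      let ?A = "(cmod (a n))\<^sup>2"
      have gF: "g \<in> F n" using n m by (auto simp: F_def)
      have s1: "cmod (?I - 1) \<le> inverse (real (Suc n))"
        using character_deviation(2)[OF g um u1 \<theta>1[OF g], of n n] small[OF gF] by linarith
      have "cmod (\<theta> n g - 1) * cmod (a n) \<le> inverse (real (Suc n))"
        using character_deviation(1)[OF g um u1 \<theta>1[OF g], of n n] small[OF gF] unfolding a_def by linarith
      then have "cmod (\<theta> n g - 1) * cmod (a n) * cmod (a n) \<le> inverse (real (Suc n)) * 1"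
        using half[of n] by (intro mult_mono) (auto simp: a_def)
      then have s2: "cmod ((\<theta> n g - 1) * of_real ?A) \<le> inverse (real (Suc n))"
        by (simp add: norm_mult power2_eq_square mult.assoc)
      have d: "1 - ?A \<ge> 3 / 4" using a2[of n] by simp
      have d0: "complex_of_real (1 - ?A) \<noteq> 0" using d by (simp only: of_real_eq_0_iff)
      have "(\<integral>x. c n g x * \<xi> n (?T g x) * cnj (\<xi> n x) \<partial>X) - 1 =
          ((?I - 1) - (\<theta> n g - 1) * of_real ?A) / of_real (1 - ?A)"
        unfolding formula using d0 by (simp add: field_simps)
      then have "cmod ((\<integral>x. c n g x * \<xi> n (?T g x) * cnj (\<xi> n x) \<partial>X) - 1) =
          cmod ((?I - 1) - (\<theta> n g - 1) * of_real ?A) / (1 - ?A)"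
        using d by (simp only: norm_divide norm_of_real)
      also have "\<dots> \<le> (inverse (real (Suc n)) + inverse (real (Suc n))) / (1 / 2)"
      proof (rule frac_le)
        show "cmod ((?I - 1) - (\<theta> n g - 1) * of_real ?A) \<le> inverse (real (Suc n)) + inverse (real (Suc n))"
          by (rule order_trans[OF norm_triangle_ineq4 add_mono[OF s1 s2]])
      qed (use d in simp_all)
      finally show ?thesis by simp
    qed
    have lim: "(\<lambda>n. 4 * inverse (real (Suc n))) \<longlonglongrightarrow> 0"
      using tendsto_mult_right_zero[OF LIMSEQ_inverse_real_of_nat, of 4] by simp
    have "(\<lambda>n. (\<integral>x. c n g x * \<xi> n (?T g x) * cnj (\<xi> n x) \<partial>X) - 1) \<longlonglongrightarrow> 0"
      by (rule Lim_null_comparison[OF _ lim]) (use bound in \<open>auto simp: eventually_sequentially\<close>)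
    then show ?thesis by (simp add: LIM_zero_iff)
  qed
  \<comment> \<open>Taking the whole space as the only member of \<open>D\<close> restricts the
    representations to functions of mean zero; translation and multiplication by a scalar preserve
    this subspace.\<close>
  obtain n f where f: "f \<in> L2 X" "\<And>A. A \<in> {space X} \<Longrightarrow> (\<integral>x. indicator A x *\<^sub>R f x \<partial>X) = 0"
    "\<not> (AE x in X. f x = 0)" "\<And>h. h \<in> H \<Longrightarrow> AE x in X. c n h x * f (?T h x) = f x"
  proof (rule XA.relative_property_T_sequence[OF relT H(1), where c=c and D="{space X}" and \<xi>=\<xi>])
    show "countably_generated X"
      unfolding bernoulli_space_def by (intro countably_generated_PiM countable_carrier cg)
    show "XA.unit_cocycle (c n)" for n
      unfolding XA.unit_cocycle_def c_def[abs_def] by (auto simp: \<theta>1 \<theta>m)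
    show "\<forall>A\<in>{space X}. (\<integral>x. indicator A x *\<^sub>R (c n g x * f (?T g x)) \<partial>X) = 0"
      if g: "g \<in> carrier G" and f: "f \<in> L2 X"
        "\<And>A. A \<in> {space X} \<Longrightarrow> (\<integral>x. indicator A x *\<^sub>R f x \<partial>X) = 0" for n g f
    proof -
      have "(\<integral>x. f (?T g x) \<partial>X) = (\<integral>x. f x \<partial>X)"
        by (rule measure_preserving_integral[OF XA.T[OF inv_closed[OF g]] L2_measurable[OF f(1)]])
      also have "\<dots> = 0" using f(2)[of "space X"] by (simp only: ind) simp
      finally have 0: "(\<integral>x. f (?T g x) \<partial>X) = 0" .
      have "(\<integral>x. indicator (space X) x *\<^sub>R (c n g x * f (?T g x)) \<partial>X) = (\<integral>x. \<theta> n g * f (?T g x) \<partial>X)"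
        unfolding ind by (simp add: c_def g)
      also have "\<dots> = 0" using 0 by simp
      finally show ?thesis by blast
    qed
    show "\<xi> n \<in> L2 X" for n
    proof -
      have "u n \<in> L2 X" by (rule X.bounded_L2[where C=1]) (simp_all add: u1)
      moreover have "(\<lambda>_. a n) \<in> L2 X" by (rule X.bounded_L2[where C="cmod (a n)"]) simp_all
      ultimately have "(\<lambda>x. inverse (of_real (q n)) * (u n x - a n)) \<in> L2 X" by (intro L2_cmult L2_diff)
      then show ?thesis by (simp add: \<xi>_def[abs_def] divide_inverse mult.commute)
    qed
    show "(\<integral>x. indicator A x *\<^sub>R \<xi> n x \<partial>X) = 0" if "A \<in> {space X}" for n A
      using that mean0 ind by auto
    show "(\<lambda>n. \<integral>x. c n g x * \<xi> n (?T g x) * cnj (\<xi> n x) \<partial>X) \<longlonglongrightarrow> 1" if "g \<in> carrier G" for g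
      by (rule almost[OF that])
  qed (use that in auto)
  have "(\<integral>x. f x \<partial>X) = 0" using f(2)[of "space X"] by (simp only: ind) simp
  moreover have "\<exists>k. cmod k = 1 \<and> (AE x in X. k * f (?T h x) = f x)" if h: "h \<in> H" for h
    using f(4)[OF h] \<theta>1[of h n] h H(1) by (intro exI[of _ "\<theta> n h"]) (auto simp: c_def subset_iff)
  ultimately have "AE x in X. f x = 0" by (intro no_mean_zero_eigenfunction[OF H f(1)])
  with f(3) show False ..
qed

end

section \<open>Character groups\<close>

lemma char_group_iff:
  "\<theta> \<in> carrier (char_group G) \<longleftrightarrow> \<theta> \<in> extensional (carrier G) \<and> (\<forall>g\<in>carrier G. cmod (\<theta> g) = 1) \<and>
    (\<forall>g\<in>carrier G. \<forall>h\<in>carrier G. \<theta> (g \<otimes>\<^bsub>G\<^esub> h) = \<theta> g * \<theta> h)"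
  by (auto simp: char_group_def hom_def circle_group_def dist_norm)

lemma char_group_mult: "\<theta> \<otimes>\<^bsub>char_group G\<^esub> \<theta>' = (\<lambda>g\<in>carrier G. \<theta> g * \<theta>' g)"
  by (simp add: char_group_def)

lemma char_group_one: "\<one>\<^bsub>char_group G\<^esub> = (\<lambda>g\<in>carrier G. 1)"
  by (simp add: char_group_def)

lemma (in group) char_group_mult_closed:
  "\<lbrakk>\<theta> \<in> carrier (char_group G); \<theta>' \<in> carrier (char_group G)\<rbrakk>
    \<Longrightarrow> (\<lambda>g\<in>carrier G. \<theta> g * \<theta>' g) \<in> carrier (char_group G)"
  by (auto simp: char_group_iff norm_mult)

lemma (in group) char_group_cnj_closed:
  "\<theta> \<in> carrier (char_group G) \<Longrightarrow> (\<lambda>g\<in>carrier G. cnj (\<theta> g)) \<in> carrier (char_group G)"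
  by (auto simp: char_group_iff)

lemma char_group_cnj_mult:
  assumes "\<theta> \<in> carrier (char_group G)"
  shows "(\<lambda>g\<in>carrier G. cnj (\<theta> g)) \<otimes>\<^bsub>char_group G\<^esub> \<theta> = \<one>\<^bsub>char_group G\<^esub>"
  using assms mult_cnj_unit by (auto simp: char_group_iff char_group_mult char_group_one fun_eq_iff mult.commute)

lemma (in group) group_char_group: "Group.group (char_group G)"
proof (rule groupI)
  fix \<theta> assume \<theta>: "\<theta> \<in> carrier (char_group G)"
  show "\<one>\<^bsub>char_group G\<^esub> \<otimes>\<^bsub>char_group G\<^esub> \<theta> = \<theta>"
    using \<theta> by (auto simp: char_group_iff char_group_mult char_group_one fun_eq_iff extensional_def)
  show "\<exists>\<theta>'\<in>carrier (char_group G). \<theta>' \<otimes>\<^bsub>char_group G\<^esub> \<theta> = \<one>\<^bsub>char_group G\<^esub>"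
    using char_group_cnj_closed[OF \<theta>] char_group_cnj_mult[OF \<theta>] by blast
qed (auto simp: char_group_mult char_group_mult_closed char_group_one char_group_iff fun_eq_iff mult.assoc norm_mult)

section \<open>Unitaries as classes of functions\<close>

text \<open>The modulus is 1 at every point, not only almost everywhere: each unitary class has such
  a representative, and computations with it need no null sets.\<close>

definition unit_functions :: "'a measure \<Rightarrow> ('a \<Rightarrow> complex) set" where
  "unit_functions K = {f \<in> borel_measurable K. \<forall>x. cmod (f x) = 1}"

lemma unit_functions_measurable: "f \<in> unit_functions K \<Longrightarrow> f \<in> borel_measurable K"
  and unit_functions_norm: "f \<in> unit_functions K \<Longrightarrow> cmod (f x) = 1"
  by (simp_all add: unit_functions_def)

lemma unit_functions_mult: "f \<in> unit_functions K \<Longrightarrow> g \<in> unit_functions K \<Longrightarrow> (\<lambda>x. f x * g x) \<in> unit_functions K"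
  and unit_functions_cnj: "f \<in> unit_functions K \<Longrightarrow> (\<lambda>x. cnj (f x)) \<in> unit_functions K"
  and unit_functions_const: "cmod c = 1 \<Longrightarrow> (\<lambda>_. c) \<in> unit_functions K"
  by (auto simp: unit_functions_def norm_mult)

lemma aeclass_unit_Linf:
  assumes "f \<in> unit_functions K"
  shows "aeclass K f \<in> Linf K"
  using assms unfolding Linf_def unit_functions_def by (intro imageI) (auto intro!: exI[of _ 1])

lemma Lunitary_Linf_iff:
  "a \<in> Lunitary K (Linf K) \<longleftrightarrow> (\<exists>f\<in>unit_functions K. a = aeclass K f)"
proof
  assume "a \<in> Lunitary K (Linf K)"
  then obtain f where f [measurable]: "f \<in> borel_measurable K" and a: "a = aeclass K f"
    and u: "Lmult K a (Lstar K a) = Lconst K 1"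
    by (auto simp: Lunitary_def Linf_def)
  have "AE x in K. f x * cnj (f x) = 1"
    using u unfolding a Lconst_def
    by (simp add: Lstar_aeclass Lmult_aeclass aeclass_eq_iff)
  then have f1: "AE x in K. cmod (f x) = 1"
  proof eventually_elim
    case (elim x)
    then have "cmod (f x) * cmod (f x) = 1" by (metis complex_mod_cnj norm_mult norm_one)
    then show ?case by (metis norm_ge_zero abs_of_nonneg abs_square_eq_1 power2_eq_square)
  qed
  define g where "g x = (if cmod (f x) = 1 then f x else 1)" for x
  have g: "g \<in> unit_functions K" by (auto simp: unit_functions_def g_def[abs_def])
  have "a = aeclass K g"
    unfolding a using g f1
    by (subst aeclass_eq_iff) (auto simp: unit_functions_measurable g_def elim: eventually_mono)
  with g show "\<exists>f\<in>unit_functions K. a = aeclass K f" by blast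
next
  assume "\<exists>f\<in>unit_functions K. a = aeclass K f"
  then obtain f where f: "f \<in> unit_functions K" "a = aeclass K f" by blast
  have "Lmult K a (Lstar K a) = Lconst K 1"
    using f unit_functions_measurable[OF f(1)] mult_cnj_unit[OF unit_functions_norm[OF f(1)]]
    by (simp add: Lstar_aeclass Lmult_aeclass Lconst_def)
  then show "a \<in> Lunitary K (Linf K)" using aeclass_unit_Linf f by (simp add: Lunitary_def)
qed

text \<open>Multiplication by \<open>cnj (g x)\<close> preserves the modulus. This brings the
  distance of two cocycles into the form to which the spectral gap applies.\<close>

lemma L2_dist_unit:
  assumes "f \<in> unit_functions K" "g \<in> unit_functions K"
  shows "L2_dist K (aeclass K f) (aeclass K g) = norm2 K (\<lambda>x. f x * cnj (g x) - 1)"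
proof -
  have "cmod (f x * cnj (g x) - 1) = cmod (f x - g x)" for x
  proof -
    have "f x * cnj (g x) - 1 = (f x - g x) * cnj (g x)"
      using mult_cnj_unit[OF unit_functions_norm[OF assms(2), of x]] by (simp add: left_diff_distrib)
    then show ?thesis by (simp add: norm_mult unit_functions_norm[OF assms(2)])
  qed
  then show ?thesis
    by (simp add: L2_dist_aeclass unit_functions_measurable assms norm2_def)
qed

section \<open>The first cohomology group of the fixed point algebra\<close>

locale bernoulli_commuting_action = bernoulli_group G M0 + \<Gamma>: group \<Gamma>
  for G :: "('g, 'm) monoid_scheme" (structure) and M0 :: "'x measure" and \<Gamma> :: "('h, 'n) monoid_scheme" +
  fixes \<beta> :: "'h \<Rightarrow> ('g \<Rightarrow> 'x) \<Rightarrow> 'g \<Rightarrow> 'x" and H :: "'g set"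
  assumes \<beta>: "mp_action \<Gamma> X \<beta>"
    and commute: "\<And>g h. \<lbrakk>g \<in> carrier G; h \<in> carrier \<Gamma>\<rbrakk> \<Longrightarrow>
        AE x in X. \<beta> h (bernoulli_shift G g x) = bernoulli_shift G g (\<beta> h x)"
    and cg: "countably_generated M0"
    and H: "H \<subseteq> carrier G" "infinite H" "wq_normal H G" "relative_property_T G H"
begin

text \<open>The inverse is built in, so that the induced action of \<open>g\<close> on functions is
  composition with \<open>T g\<close>; likewise for \<open>b\<close>.\<close>

abbreviation "T g \<equiv> bernoulli_shift G (inv g)"
abbreviation "b h \<equiv> \<beta> (inv\<^bsub>\<Gamma>\<^esub> h)"
abbreviation "\<sigma> \<equiv> induced_action G X (bernoulli_shift G)"
abbreviation "A\<Gamma> \<equiv> fixed_algebra \<Gamma> X \<beta>"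
abbreviation "Z \<equiv> Z1 G X A\<Gamma> \<sigma>"
abbreviation "C \<equiv> char_group G"
abbreviation "E \<equiv> eigenchar_group \<Gamma> X \<beta>"

lemma T_mp: "g \<in> carrier G \<Longrightarrow> measure_preserving X X (T g)"
  by (simp add: XA.T)

lemma \<beta>_mp: "h \<in> carrier \<Gamma> \<Longrightarrow> measure_preserving X X (\<beta> h)"
  using \<beta> by (simp add: mp_action_def measure_preserving_def)

lemma b_mp: "h \<in> carrier \<Gamma> \<Longrightarrow> measure_preserving X X (b h)"
  by (simp add: \<beta>_mp)

lemma \<sigma>_aeclass:
  assumes "g \<in> carrier G" "f \<in> borel_measurable X"
  shows "\<sigma> g (aeclass X f) = aeclass X (\<lambda>x. f (T g x))"
  using T_mp[OF assms(1)] assms(2)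
  by (simp add: induced_action_def measure_preserving_def Lpullback_aeclass)

lemma \<beta>_aeclass:
  assumes "h \<in> carrier \<Gamma>" "f \<in> borel_measurable X"
  shows "induced_action \<Gamma> X \<beta> h (aeclass X f) = aeclass X (\<lambda>x. f (b h x))"
  using b_mp[OF assms(1)] assms(2)
  by (simp add: induced_action_def measure_preserving_def Lpullback_aeclass)

lemma b_comp_measurable:
  "h \<in> carrier \<Gamma> \<Longrightarrow> f \<in> borel_measurable X \<Longrightarrow> (\<lambda>x. f (b h x)) \<in> borel_measurable X"
  by (rule measurable_compose[OF measure_preserving_measurable[OF b_mp]])

lemma T_comp_measurable:
  "g \<in> carrier G \<Longrightarrow> f \<in> borel_measurable X \<Longrightarrow> (\<lambda>x. f (T g x)) \<in> borel_measurable X"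
  by (rule measurable_compose[OF measure_preserving_measurable[OF T_mp]])

lemma T_b_commute:
  assumes "g \<in> carrier G" "h \<in> carrier \<Gamma>"
  shows "AE x in X. b h (T g x) = T g (b h x)"
  using assms by (intro commute) auto

lemma Lunitary_fixed_iff:
  "a \<in> Lunitary X A\<Gamma> \<longleftrightarrow>
    (\<exists>f\<in>unit_functions X. a = aeclass X f \<and> (\<forall>h\<in>carrier \<Gamma>. AE x in X. f (b h x) = f x))"
proof -
  have "a \<in> Lunitary X A\<Gamma> \<longleftrightarrow> a \<in> Lunitary X (Linf X) \<and> (\<forall>h\<in>carrier \<Gamma>. induced_action \<Gamma> X \<beta> h a = a)"
    by (auto simp: Lunitary_def fixed_algebra_def)
  also have "\<dots> \<longleftrightarrow> (\<exists>f\<in>unit_functions X. a = aeclass X f \<and> (\<forall>h\<in>carrier \<Gamma>. induced_action \<Gamma> X \<beta> h a = a))"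
    unfolding Lunitary_Linf_iff by blast
  also have "\<dots> \<longleftrightarrow> (\<exists>f\<in>unit_functions X. a = aeclass X f \<and> (\<forall>h\<in>carrier \<Gamma>. AE x in X. f (b h x) = f x))"
    by (intro bex_cong conj_cong refl ball_cong)
      (simp_all add: \<beta>_aeclass aeclass_eq_iff unit_functions_measurable b_comp_measurable)
  finally show ?thesis .
qed

lemma eigenchar_iff:
  "\<gamma> \<in> carrier E \<longleftrightarrow> \<gamma> \<in> carrier (char_group \<Gamma>) \<and>
    (\<exists>u\<in>unit_functions X. \<forall>h\<in>carrier \<Gamma>. AE x in X. u (b h x) = \<gamma> h * u x)"
proof -
  have "induced_action \<Gamma> X \<beta> h (aeclass X u) = Lmult X (Lconst X (\<gamma> h)) (aeclass X u) \<longleftrightarrow>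
      (AE x in X. u (b h x) = \<gamma> h * u x)" if "u \<in> unit_functions X" "h \<in> carrier \<Gamma>" for u h
    using that unit_functions_measurable[OF that(1)]
    by (simp add: \<beta>_aeclass Lconst_def Lmult_aeclass aeclass_eq_iff b_comp_measurable)
  then have "(\<exists>u\<in>unit_functions X. \<forall>h\<in>carrier \<Gamma>. AE x in X. u (b h x) = \<gamma> h * u x) \<longleftrightarrow>
      (\<exists>u\<in>unit_functions X. \<forall>h\<in>carrier \<Gamma>.
        induced_action \<Gamma> X \<beta> h (aeclass X u) = Lmult X (Lconst X (\<gamma> h)) (aeclass X u))"
    by (intro bex_cong ball_cong refl) simp
  also have "\<dots> \<longleftrightarrow> (\<exists>a\<in>Lunitary X (Linf X). \<forall>h\<in>carrier \<Gamma>.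
        induced_action \<Gamma> X \<beta> h a = Lmult X (Lconst X (\<gamma> h)) a)"
    unfolding Bex_def Lunitary_Linf_iff by blast
  finally show ?thesis by (simp add: eigenchar_group_def)
qed

text \<open>A lift of a cocycle of classes to functions of modulus 1. Products, inverses and
  equality of cocycles are verified on lifts, where they are pointwise statements almost
  everywhere.\<close>

definition represents :: "('g \<Rightarrow> ('g \<Rightarrow> 'x) \<Rightarrow> complex) \<Rightarrow> ('g \<Rightarrow> (('g \<Rightarrow> 'x) \<Rightarrow> complex) set) \<Rightarrow> bool" where
  "represents f w \<longleftrightarrow> XA.unit_cocycle f \<and> (\<forall>g\<in>carrier G. \<forall>h\<in>carrier \<Gamma>. AE x in X. f g (b h x) = f g x) \<and>
    w = (\<lambda>g\<in>carrier G. aeclass X (f g))"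

lemma unit_cocycle_unit_functions: "XA.unit_cocycle f \<Longrightarrow> g \<in> carrier G \<Longrightarrow> f g \<in> unit_functions X"
  by (simp add: XA.unit_cocycle_def unit_functions_def)

lemma represents_apply: "represents f w \<Longrightarrow> g \<in> carrier G \<Longrightarrow> w g = aeclass X (f g)"
  and represents_cocycle: "represents f w \<Longrightarrow> XA.unit_cocycle f"
  by (simp_all add: represents_def)

text \<open>Representatives are chosen for each group element separately, with the constant 1 off
  the carrier; the cocycle identity of the classes becomes one almost everywhere.\<close>

lemma Z_carrier_iff: "w \<in> carrier Z \<longleftrightarrow> (\<exists>f. represents f w)"
proof
  assume "w \<in> carrier Z"
  then have w: "w \<in> carrier G \<rightarrow>\<^sub>E Lunitary X A\<Gamma>"
    "\<And>g h. g \<in> carrier G \<Longrightarrow> h \<in> carrier G \<Longrightarrow> Lmult X (w g) (\<sigma> g (w h)) = w (g \<otimes> h)"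
    by (simp_all add: Z1_def)
  have "\<exists>f\<in>unit_functions X. w g = aeclass X f \<and> (\<forall>h\<in>carrier \<Gamma>. AE x in X. f (b h x) = f x)"
    if "g \<in> carrier G" for g
    by (rule iffD1[OF Lunitary_fixed_iff PiE_mem[OF w(1) that]])
  then have "\<forall>g\<in>carrier G. \<exists>f. f \<in> unit_functions X \<and> w g = aeclass X f \<and>
      (\<forall>h\<in>carrier \<Gamma>. AE x in X. f (b h x) = f x)"
    unfolding Bex_def by (rule ballI)
  from bchoice[OF this] obtain f0 where "\<forall>g\<in>carrier G. f0 g \<in> unit_functions X \<and> w g = aeclass X (f0 g) \<and>
      (\<forall>h\<in>carrier \<Gamma>. AE x in X. f0 g (b h x) = f0 g x)" ..
  then have f0: "\<And>g. g \<in> carrier G \<Longrightarrow> f0 g \<in> unit_functions X"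
    "\<And>g. g \<in> carrier G \<Longrightarrow> w g = aeclass X (f0 g)"
    "\<And>g h. g \<in> carrier G \<Longrightarrow> h \<in> carrier \<Gamma> \<Longrightarrow> AE x in X. f0 g (b h x) = f0 g x"
    by simp_all
  define f where "f g = (if g \<in> carrier G then f0 g else (\<lambda>_. 1))" for g
  have "XA.unit_cocycle f"
    unfolding XA.unit_cocycle_def
  proof (intro conjI ballI allI)
    fix g assume g: "g \<in> carrier G"
    show "f g \<in> borel_measurable X" using f0(1)[OF g] g by (simp add: f_def unit_functions_measurable)
    fix h assume h: "h \<in> carrier G"
    have m: "f0 g \<in> borel_measurable X" "f0 h \<in> borel_measurable X" "f0 (g \<otimes> h) \<in> borel_measurable X"
      using f0(1) g h by (simp_all add: unit_functions_measurable)
    have p: "(\<lambda>x. f0 g x * f0 h (T g x)) \<in> borel_measurable X"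
      by (intro borel_measurable_times m(1) T_comp_measurable[OF g m(2)])
    have "aeclass X (\<lambda>x. f0 g x * f0 h (T g x)) = aeclass X (f0 (g \<otimes> h))"
      using w(2)[OF g h] g h m by (simp add: f0(2) \<sigma>_aeclass Lmult_aeclass T_comp_measurable)
    then have "AE x in X. f0 g x * f0 h (T g x) = f0 (g \<otimes> h) x" by (simp only: aeclass_eq_iff[OF p m(3)])
    then show "AE x in X. f (g \<otimes> h) x = f g x * f h (T g x)"
      by eventually_elim (simp add: f_def g h)
  next
    show "cmod (f g x) = 1" for g x
      using unit_functions_norm[OF f0(1)] by (cases "g \<in> carrier G") (simp_all add: f_def)
  qed
  moreover have "w = (\<lambda>g\<in>carrier G. aeclass X (f g))"
    using w(1) f0(2) by (auto simp: fun_eq_iff f_def PiE_iff extensional_def)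
  ultimately have "represents f w" using f0(3) by (simp add: represents_def f_def)
  then show "\<exists>f. represents f w" by blast
next
  assume "\<exists>f. represents f w"
  then obtain f where r: "represents f w" by blast
  have f: "XA.unit_cocycle f" "\<And>g h. g \<in> carrier G \<Longrightarrow> h \<in> carrier \<Gamma> \<Longrightarrow> AE x in X. f g (b h x) = f g x"
    and w: "w = (\<lambda>g\<in>carrier G. aeclass X (f g))"
    using r by (simp_all add: represents_def)
  have "aeclass X (f g) \<in> Lunitary X A\<Gamma>" if "g \<in> carrier G" for g
    unfolding Lunitary_fixed_iff using unit_cocycle_unit_functions[OF f(1) that] f(2)[OF that] by blast
  moreover have "Lmult X (w g) (\<sigma> g (w h)) = w (g \<otimes> h)" if gh: "g \<in> carrier G" "h \<in> carrier G" for g h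
  proof -
    have m: "f g \<in> borel_measurable X" "f h \<in> borel_measurable X" "f (g \<otimes> h) \<in> borel_measurable X"
      using XA.unit_cocycleD(1)[OF f(1)] gh by simp_all
    have p: "(\<lambda>x. f g x * f h (T g x)) \<in> borel_measurable X"
      by (intro borel_measurable_times m(1) T_comp_measurable[OF gh(1) m(2)])
    have "AE x in X. f g x * f h (T g x) = f (g \<otimes> h) x"
      using XA.unit_cocycleD(3)[OF f(1) gh] by eventually_elim simp
    then have "aeclass X (\<lambda>x. f g x * f h (T g x)) = aeclass X (f (g \<otimes> h))"
      by (simp only: aeclass_eq_iff[OF p m(3)])
    then show ?thesis
      using gh m by (simp add: w \<sigma>_aeclass Lmult_aeclass T_comp_measurable)
  qed
  ultimately show "w \<in> carrier Z" by (simp add: Z1_def w)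
qed

lemma Z_mult: "v \<otimes>\<^bsub>Z\<^esub> w = (\<lambda>g\<in>carrier G. Lmult X (v g) (w g))"
  and Z_one: "\<one>\<^bsub>Z\<^esub> = (\<lambda>g\<in>carrier G. Lconst X 1)"
  by (simp_all add: Z1_def)

lemma represents_mult:
  assumes f: "represents f v" and k: "represents k w"
  shows "represents (\<lambda>g x. f g x * k g x) (v \<otimes>\<^bsub>Z\<^esub> w)"
proof -
  have c: "XA.unit_cocycle f" "XA.unit_cocycle k" using f k by (auto simp: represents_def)
  have "XA.unit_cocycle (\<lambda>g x. f g x * k g x)"
    unfolding XA.unit_cocycle_def
  proof (intro conjI ballI allI)
    fix g h assume g: "g \<in> carrier G"
    show "(\<lambda>x. f g x * k g x) \<in> borel_measurable X"
      using XA.unit_cocycleD(1)[OF c(1) g] XA.unit_cocycleD(1)[OF c(2) g] by simp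
    assume h: "h \<in> carrier G"
    show "AE x in X. f (g \<otimes> h) x * k (g \<otimes> h) x = f g x * k g x * (f h (T g x) * k h (T g x))"
      using XA.unit_cocycleD(3)[OF c(1) g h] XA.unit_cocycleD(3)[OF c(2) g h]
      by eventually_elim (simp add: mult_ac)
  qed (simp add: norm_mult XA.unit_cocycleD(2)[OF c(1)] XA.unit_cocycleD(2)[OF c(2)])
  moreover have "AE x in X. f g (b h x) * k g (b h x) = f g x * k g x"
    if "g \<in> carrier G" "h \<in> carrier \<Gamma>" for g h
  proof -
    have "AE x in X. f g (b h x) = f g x" "AE x in X. k g (b h x) = k g x"
      using f k that by (auto simp: represents_def)
    then show ?thesis by eventually_elim simp
  qed
  moreover have "v \<otimes>\<^bsub>Z\<^esub> w = (\<lambda>g\<in>carrier G. aeclass X (\<lambda>x. f g x * k g x))"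
    using f k XA.unit_cocycleD(1)[OF c(1)] XA.unit_cocycleD(1)[OF c(2)]
    by (auto simp: represents_def Z_mult Lmult_aeclass fun_eq_iff)
  ultimately show ?thesis by (simp add: represents_def)
qed

lemma represents_one: "represents (\<lambda>_ _. 1) \<one>\<^bsub>Z\<^esub>"
  by (auto simp: represents_def XA.unit_cocycle_def Z_one Lconst_def)

lemma represents_cnj:
  assumes "represents f w"
  shows "represents (\<lambda>g x. cnj (f g x)) (\<lambda>g\<in>carrier G. aeclass X (\<lambda>x. cnj (f g x)))"
proof -
  have c: "XA.unit_cocycle f" and i: "\<And>g h. g \<in> carrier G \<Longrightarrow> h \<in> carrier \<Gamma> \<Longrightarrow> AE x in X. f g (b h x) = f g x"
    using assms by (auto simp: represents_def)
  have "XA.unit_cocycle (\<lambda>g x. cnj (f g x))"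
    unfolding XA.unit_cocycle_def
  proof (intro conjI ballI allI)
    fix g h assume g: "g \<in> carrier G"
    show "(\<lambda>x. cnj (f g x)) \<in> borel_measurable X" using XA.unit_cocycleD(1)[OF c g] by simp
    assume h: "h \<in> carrier G"
    show "AE x in X. cnj (f (g \<otimes> h) x) = cnj (f g x) * cnj (f h (T g x))"
      using XA.unit_cocycleD(3)[OF c g h] by eventually_elim simp
  qed (simp add: XA.unit_cocycleD(2)[OF c])
  moreover have "AE x in X. cnj (f g (b h x)) = cnj (f g x)" if "g \<in> carrier G" "h \<in> carrier \<Gamma>" for g h
    using i[OF that] by eventually_elim simp
  ultimately show ?thesis by (simp add: represents_def)
qed

lemma represents_eqI:
  assumes "represents f v" "represents k w" "\<And>g. g \<in> carrier G \<Longrightarrow> AE x in X. f g x = k g x"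
  shows "v = w"
proof -
  have "aeclass X (f g) = aeclass X (k g)" if "g \<in> carrier G" for g
    using aeclass_eq_iff[of "f g" X "k g"] XA.unit_cocycleD(1)[of f g] XA.unit_cocycleD(1)[of k g] assms that
    by (simp add: represents_def)
  then show ?thesis using assms(1,2) by (auto simp: represents_def fun_eq_iff)
qed

lemma group_Z: "Group.group Z"
proof (rule groupI)
  fix u v w assume "u \<in> carrier Z" "v \<in> carrier Z" "w \<in> carrier Z"
  then obtain f k l where f: "represents f u" and k: "represents k v" and l: "represents l w"
    unfolding Z_carrier_iff by blast
  show "u \<otimes>\<^bsub>Z\<^esub> v \<otimes>\<^bsub>Z\<^esub> w = u \<otimes>\<^bsub>Z\<^esub> (v \<otimes>\<^bsub>Z\<^esub> w)"
    by (rule represents_eqI[OF represents_mult[OF represents_mult[OF f k] l]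
          represents_mult[OF f represents_mult[OF k l]]]) (simp add: mult.assoc)
next
  fix u v assume "u \<in> carrier Z" "v \<in> carrier Z"
  then show "u \<otimes>\<^bsub>Z\<^esub> v \<in> carrier Z" using represents_mult unfolding Z_carrier_iff by blast
next
  show "\<one>\<^bsub>Z\<^esub> \<in> carrier Z" using represents_one unfolding Z_carrier_iff by blast
next
  fix u assume "u \<in> carrier Z"
  then obtain f where f: "represents f u" unfolding Z_carrier_iff by blast
  show "\<one>\<^bsub>Z\<^esub> \<otimes>\<^bsub>Z\<^esub> u = u"
    by (rule represents_eqI[OF represents_mult[OF represents_one f] f]) simp
  have "(\<lambda>g\<in>carrier G. aeclass X (\<lambda>x. cnj (f g x))) \<otimes>\<^bsub>Z\<^esub> u = \<one>\<^bsub>Z\<^esub>"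
  proof (rule represents_eqI[OF represents_mult[OF represents_cnj[OF f] f] represents_one])
    have "cnj (f g x) * f g x = 1" for g x
      using mult_cnj_unit[OF XA.unit_cocycleD(2)[OF represents_cocycle[OF f]]] by (subst mult.commute)
    then show "AE x in X. cnj (f g x) * f g x = 1" for g by simp
  qed
  moreover have "(\<lambda>g\<in>carrier G. aeclass X (\<lambda>x. cnj (f g x))) \<in> carrier Z"
    unfolding Z_carrier_iff by (rule exI[of _ "\<lambda>g x. cnj (f g x)"]) (rule represents_cnj[OF f])
  ultimately show "\<exists>v\<in>carrier Z. v \<otimes>\<^bsub>Z\<^esub> u = \<one>\<^bsub>Z\<^esub>" by (rule bexI)
qed

end

section \<open>Standard form of cocycles with values in the fixed point algebra\<close>

context bernoulli_commuting_action begin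

definition standard_cocycle :: "('g \<Rightarrow> complex) \<Rightarrow> (('g \<Rightarrow> 'x) \<Rightarrow> complex) \<Rightarrow> 'g \<Rightarrow> ('g \<Rightarrow> 'x) \<Rightarrow> complex" where
  "standard_cocycle \<theta> u g x = (if g \<in> carrier G then \<theta> g * u (T g x) * cnj (u x) else 1)"

text \<open>Here \<open>u\<close> is a unitary of the full algebra, so that the factor built from it
  is a coboundary there; it is one over the fixed point algebra as soon as \<open>\<gamma>\<close>
  is trivial.\<close>

definition trivialized :: "('g \<Rightarrow> (('g \<Rightarrow> 'x) \<Rightarrow> complex) set) \<Rightarrow> ('g \<Rightarrow> complex) \<Rightarrow> ('h \<Rightarrow> complex)
    \<Rightarrow> (('g \<Rightarrow> 'x) \<Rightarrow> complex) \<Rightarrow> bool" where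
  "trivialized w \<theta> \<gamma> u \<longleftrightarrow> \<theta> \<in> carrier C \<and> \<gamma> \<in> carrier E \<and> u \<in> unit_functions X \<and>
     (\<forall>h\<in>carrier \<Gamma>. AE x in X. u (b h x) = \<gamma> h * u x) \<and> represents (standard_cocycle \<theta> u) w"

lemma charD:
  assumes "\<theta> \<in> carrier C"
  shows "g \<in> carrier G \<Longrightarrow> cmod (\<theta> g) = 1"
    "g \<in> carrier G \<Longrightarrow> h \<in> carrier G \<Longrightarrow> \<theta> (g \<otimes> h) = \<theta> g * \<theta> h" "\<theta> \<in> extensional (carrier G)"
  using assms by (simp_all add: char_group_iff)

lemma eigenD:
  assumes "\<gamma> \<in> carrier E"
  shows "h \<in> carrier \<Gamma> \<Longrightarrow> cmod (\<gamma> h) = 1" "\<gamma> \<in> carrier (char_group \<Gamma>)" "\<gamma> \<in> extensional (carrier \<Gamma>)"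
  using assms by (simp_all add: eigenchar_iff char_group_iff)

text \<open>The intermediate values of \<open>u\<close> cancel in products. Applying
  \<open>b h\<close> multiplies \<open>u (T g x)\<close> and \<open>u x\<close> by the same scalar,
  since \<open>\<beta>\<close> commutes with the shift; it cancels against its conjugate, so the
  values lie in the fixed point algebra.\<close>

lemma represents_standard_cocycle:
  assumes \<theta>: "\<theta> \<in> carrier C" and \<gamma>: "\<gamma> \<in> carrier E" and u: "u \<in> unit_functions X"
    and eig: "\<And>h. h \<in> carrier \<Gamma> \<Longrightarrow> AE x in X. u (b h x) = \<gamma> h * u x"
  shows "represents (standard_cocycle \<theta> u) (\<lambda>g\<in>carrier G. aeclass X (standard_cocycle \<theta> u g))"
proof -
  have um: "u \<in> borel_measurable X" by (rule unit_functions_measurable[OF u])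
  have u1: "cmod (u x) = 1" for x by (rule unit_functions_norm[OF u])
  have "XA.unit_cocycle (standard_cocycle \<theta> u)"
    unfolding XA.unit_cocycle_def
  proof (intro conjI ballI allI)
    fix g assume g: "g \<in> carrier G"
    have "(\<lambda>x. \<theta> g * u (T g x) * cnj (u x)) \<in> borel_measurable X"
      using um T_comp_measurable[OF g um] by simp
    then show "standard_cocycle \<theta> u g \<in> borel_measurable X"
      using g by (simp add: standard_cocycle_def[abs_def])
    fix h assume h: "h \<in> carrier G"
    show "AE x in X. standard_cocycle \<theta> u (g \<otimes> h) x = standard_cocycle \<theta> u g x * standard_cocycle \<theta> u h (T g x)"
      using AE_space
    proof eventually_elim
      case (elim x)
      have "standard_cocycle \<theta> u g x * standard_cocycle \<theta> u h (T g x) =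
          \<theta> g * \<theta> h * u (T h (T g x)) * cnj (u x) * (u (T g x) * cnj (u (T g x)))"
        using g h by (simp add: standard_cocycle_def mult_ac)
      then show ?case
        using g h charD(2)[OF \<theta>] XA.T_inv_comp[OF g h elim]
        by (simp add: standard_cocycle_def mult_cnj_unit[OF u1])
    qed
  next
    show "cmod (standard_cocycle \<theta> u g x) = 1" for g x
      using charD(1)[OF \<theta>] by (simp add: standard_cocycle_def norm_mult u1)
  qed
  moreover have "AE x in X. standard_cocycle \<theta> u g (b h x) = standard_cocycle \<theta> u g x"
    if g: "g \<in> carrier G" and h: "h \<in> carrier \<Gamma>" for g h
    using eig[OF h] measure_preserving_AE[OF T_mp[OF g] eig[OF h]] T_b_commute[OF g h]
  proof eventually_elim
    case (elim x)
    have "standard_cocycle \<theta> u g (b h x) = \<theta> g * (\<gamma> h * u (T g x)) * cnj (\<gamma> h * u x)"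
      using g elim by (simp add: standard_cocycle_def)
    also have "\<dots> = \<theta> g * u (T g x) * cnj (u x) * (\<gamma> h * cnj (\<gamma> h))" by (simp add: mult_ac)
    finally show ?case using g mult_cnj_unit[OF eigenD(1)[OF \<gamma> h]] by (simp add: standard_cocycle_def)
  qed
  ultimately show ?thesis by (simp add: represents_def)
qed

lemma ex_trivialized:
  assumes "w \<in> carrier Z"
  shows "\<exists>\<theta> \<gamma> u. trivialized w \<theta> \<gamma> u"
proof -
  obtain f where f: "represents f w" using assms unfolding Z_carrier_iff by blast
  have c: "XA.unit_cocycle f" by (rule represents_cocycle[OF f])
  have fix_f: "AE x in X. f g (b h x) = f g x" if "g \<in> carrier G" "h \<in> carrier \<Gamma>" for g h
    using f that by (simp add: represents_def)
  obtain v where v: "v \<in> borel_measurable X" "\<And>x. cmod (v x) = 1"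
    "\<And>g. g \<in> carrier G \<Longrightarrow> \<exists>k. AE x in X. f g x * v (T g x) * cnj (v x) = k"
    using cocycle_superrigidity[OF c H cg, of thesis] by blast
  let ?d = "\<lambda>g x. f g x * v (T g x) * cnj (v x)"
  have d: "XA.unit_cocycle ?d" by (rule XA.unit_cocycle_twist[OF c v(1,2)])
  from bchoice[of "carrier G" "\<lambda>g k. AE x in X. ?d g x = k"] v(3)
  obtain k where k: "\<forall>g\<in>carrier G. AE x in X. ?d g x = k g" by blast
  have k1: "cmod (k g) = 1" if g: "g \<in> carrier G" for g
  proof -
    obtain x where "?d g x = k g" using bspec[OF k g] by (rule X.AE_obtain)
    then show ?thesis using XA.unit_cocycleD(2)[OF d, of g x] by simp
  qed
  have km: "k (g \<otimes> h) = k g * k h" if gh: "g \<in> carrier G" "h \<in> carrier G" for g h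
  proof -
    have "AE x in X. k (g \<otimes> h) = k g * k h"
      using XA.unit_cocycleD(3)[OF d gh] bspec[OF k gh(1)] bspec[OF k m_closed[OF gh]]
        measure_preserving_AE[OF T_mp[OF gh(1)] bspec[OF k gh(2)]]
      by eventually_elim simp
    then show ?thesis by simp
  qed
  define \<theta> where "\<theta> = restrict k (carrier G)"
  have \<theta>: "\<theta> \<in> carrier C" by (simp add: char_group_iff \<theta>_def k1 km)
  \<comment> \<open>The unitary from superrigidity satisfies f v(T x) cnj(v(x)) = k; solving for f
    puts the conjugate of v in the place of u.\<close>
  define u where "u x = cnj (v x)" for x
  have u: "u \<in> unit_functions X" using v by (simp add: u_def[abs_def] unit_functions_def)
  have u1: "cmod (u x) = 1" for x by (rule unit_functions_norm[OF u])
  have um: "u \<in> borel_measurable X" by (rule unit_functions_measurable[OF u])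
  have fu: "AE x in X. f g x = k g * u (T g x) * cnj (u x)" if g: "g \<in> carrier G" for g
    using bspec[OF k g]
  proof eventually_elim
    case (elim x)
    have "k g * u (T g x) * cnj (u x) = f g x * (v (T g x) * cnj (v (T g x))) * (v x * cnj (v x))"
      unfolding elim[symmetric] u_def by (simp add: mult_ac)
    then show ?case by (simp add: mult_cnj_unit[OF v(2)])
  qed
  have "\<exists>l. AE x in X. u (b h x) = l * u x" if h: "h \<in> carrier \<Gamma>" for h
  proof -
    \<comment> \<open>The expressions for f at x and at \<open>b h x\<close> agree; comparing them
      and cancelling the scalar \<open>k g\<close> shows that this ratio is invariant under the
      shift.\<close>
    define q where "q x = u (b h x) * cnj (u x)" for x
    have qm: "q \<in> borel_measurable X" unfolding q_def using um b_comp_measurable[OF h um] by simp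
    have q_inv: "AE x in X. q (T g x) = q x" if g: "g \<in> carrier G" for g
      using fix_f[OF g h] fu[OF g] measure_preserving_AE[OF b_mp[OF h] fu[OF g]] T_b_commute[OF g h]
    proof eventually_elim
      case (elim x)
      have "k g * u (T g (b h x)) * cnj (u (b h x)) = k g * u (T g x) * cnj (u x)"
        using elim by simp
      then have 1: "u (b h (T g x)) * cnj (u (b h x)) = u (T g x) * cnj (u x)"
        using k1[OF g] elim(4) by auto
      have "q (T g x) = (u (b h (T g x)) * cnj (u (b h x))) * cnj (u (T g x)) * (u (b h x) * 1)"
        using mult_cnj_unit[OF u1[of "b h x"]] by (simp add: q_def mult_ac)
      also have "\<dots> = q x * (u (T g x) * cnj (u (T g x)))" unfolding 1 by (simp add: q_def mult_ac)
      finally show ?case by (simp add: mult_cnj_unit[OF u1])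
    qed
    have inf: "infinite (carrier G)" using H(1,2) infinite_super by blast
    have "AE x in X. q x = (\<integral>x. q x \<partial>X)"
    proof (rule mixing_invariant_const[OF mixing_X[OF order_refl inf] inf X.prob_space_axioms])
      show "integrable X q"
        by (rule X.integrable_bounded_complex[where C=1]) (auto simp: qm q_def norm_mult u1)
      show "AE x in X. q (bernoulli_shift G g x) = q x" if "g \<in> carrier G" for g
        using q_inv[of "inv g"] that by simp
    qed
    then have "AE x in X. u (b h x) = (\<integral>x. q x \<partial>X) * u x"
    proof eventually_elim
      case (elim x)
      have "q x * u x = u (b h x) * (u x * cnj (u x))" by (simp add: q_def mult_ac)
      then show ?case by (simp add: elim mult_cnj_unit[OF u1])
    qed
    then show ?thesis by blast
  qed
  with bchoice[of "carrier \<Gamma>" "\<lambda>h l. AE x in X. u (b h x) = l * u x"]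
  obtain l where l: "\<forall>h\<in>carrier \<Gamma>. AE x in X. u (b h x) = l h * u x" by blast
  have l1: "cmod (l h) = 1" if h: "h \<in> carrier \<Gamma>" for h
  proof -
    obtain x where "u (b h x) = l h * u x" using bspec[OF l h] by (rule X.AE_obtain)
    from arg_cong[OF this, of cmod] show ?thesis by (simp add: norm_mult u1)
  qed
  \<comment> \<open>The inverses in \<open>b\<close> reverse the order of products, which does no
    harm since the eigenvalues are scalars.\<close>
  have lm: "l (h \<otimes>\<^bsub>\<Gamma>\<^esub> h') = l h * l h'" if h: "h \<in> carrier \<Gamma>" and h': "h' \<in> carrier \<Gamma>" for h h'
  proof -
    have "AE x in X. \<beta> (inv\<^bsub>\<Gamma>\<^esub> h' \<otimes>\<^bsub>\<Gamma>\<^esub> inv\<^bsub>\<Gamma>\<^esub> h) x = b h' (b h x)"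
      using \<beta> h h' by (simp add: mp_action_def)
    then have "AE x in X. b (h \<otimes>\<^bsub>\<Gamma>\<^esub> h') x = b h' (b h x)"
      using h h' by (simp add: \<Gamma>.inv_mult_group)
    then have "AE x in X. l (h \<otimes>\<^bsub>\<Gamma>\<^esub> h') * u x = l h' * (l h * u x)"
      using bspec[OF l \<Gamma>.m_closed[OF h h']] measure_preserving_AE[OF b_mp[OF h] bspec[OF l h']] bspec[OF l h]
    proof eventually_elim
      case (elim x)
      show ?case by (simp only: elim(2)[symmetric] elim(1) elim(3)) (simp only: elim(4))
    qed
    then obtain x where x: "l (h \<otimes>\<^bsub>\<Gamma>\<^esub> h') * u x = l h' * (l h * u x)" by (rule X.AE_obtain)
    have "u x \<noteq> 0" using u1[of x] by auto
    with x show ?thesis by simp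
  qed
  define \<gamma> where "\<gamma> = restrict l (carrier \<Gamma>)"
  have \<gamma>c: "\<gamma> \<in> carrier (char_group \<Gamma>)" by (simp add: char_group_iff \<gamma>_def l1 lm)
  have eig: "AE x in X. u (b h x) = \<gamma> h * u x" if "h \<in> carrier \<Gamma>" for h
    using l that by (simp add: \<gamma>_def)
  then have \<gamma>: "\<gamma> \<in> carrier E" using \<gamma>c u unfolding eigenchar_iff by blast
  have "(\<lambda>g\<in>carrier G. aeclass X (standard_cocycle \<theta> u g)) = w"
  proof (rule represents_eqI[OF represents_standard_cocycle[OF \<theta> \<gamma> u eig] f])
    fix g assume g: "g \<in> carrier G"
    show "AE x in X. standard_cocycle \<theta> u g x = f g x"
      using fu[OF g] by eventually_elim (simp add: standard_cocycle_def g \<theta>_def)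
  qed
  then have "represents (standard_cocycle \<theta> u) w"
    using represents_standard_cocycle[OF \<theta> \<gamma> u eig] by simp
  then show ?thesis unfolding trivialized_def using \<theta> \<gamma> u eig by blast
qed

text \<open>The quotient of two standard cocycles is standard, for the character k = \<theta>
  cnj(\<theta>') and the unitary s = u cnj(u'). By the gap the mean of s has modulus at least 1/2.
  As \<beta> preserves the measure, this mean is fixed under multiplication by \<gamma>(h)
  cnj(\<gamma>'(h)), whence \<gamma> = \<gamma>'; and \<open>character_deviation\<close> bounds |k -
  1| by the distance divided by the mean, which explains the factor 2.\<close>

lemma trivialized_close:
  "\<exists>F \<delta>. finite F \<and> F \<subseteq> carrier G \<and> \<delta> > 0 \<and>
    (\<forall>w w' \<theta> \<theta>' \<gamma> \<gamma>' u u'. trivialized w \<theta> \<gamma> u \<longrightarrow> trivialized w' \<theta>' \<gamma>' u' \<longrightarrow>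
      (\<forall>g\<in>F. L2_dist X (w g) (w' g) < \<delta>) \<longrightarrow>
      \<gamma> = \<gamma>' \<and> (\<forall>g\<in>carrier G. cmod (\<theta> g - \<theta>' g) \<le> 2 * L2_dist X (w g) (w' g)))"
proof -
  obtain F \<delta> where F: "finite F" "F \<subseteq> carrier G" "\<delta> > 0" and
    gap: "\<And>\<theta> u. \<lbrakk>\<And>g. g \<in> carrier G \<Longrightarrow> cmod (\<theta> g) = 1;
      \<And>g h. g \<in> carrier G \<Longrightarrow> h \<in> carrier G \<Longrightarrow> \<theta> (g \<otimes> h) = \<theta> g * \<theta> h;
      u \<in> borel_measurable X; \<And>x. cmod (u x) = 1;
      \<And>g. g \<in> F \<Longrightarrow> norm2 X (\<lambda>x. \<theta> g * u (T g x) * cnj (u x) - 1) < \<delta>\<rbrakk>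
      \<Longrightarrow> 1 / 2 \<le> cmod (\<integral>x. u x \<partial>X)"
    using character_gap[OF H(1,2,4) cg, of thesis] by blast
  show ?thesis
  proof (rule exI[of _ F], rule exI[of _ \<delta>], intro conjI F, intro allI impI)
    fix w w' \<theta> \<theta>' \<gamma> \<gamma>' u u'
    assume t: "trivialized w \<theta> \<gamma> u" and t': "trivialized w' \<theta>' \<gamma>' u'"
      and close: "\<forall>g\<in>F. L2_dist X (w g) (w' g) < \<delta>"
    have \<theta>: "\<theta> \<in> carrier C" "\<theta>' \<in> carrier C" and \<gamma>: "\<gamma> \<in> carrier E" "\<gamma>' \<in> carrier E"
      and u: "u \<in> unit_functions X" "u' \<in> unit_functions X"
      and r: "represents (standard_cocycle \<theta> u) w" "represents (standard_cocycle \<theta>' u') w'"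
      using t t' by (simp_all add: trivialized_def)
    define k where "k g = \<theta> g * cnj (\<theta>' g)" for g
    define s where "s x = u x * cnj (u' x)" for x
    have s: "s \<in> unit_functions X"
      unfolding s_def by (intro unit_functions_mult unit_functions_cnj u)
    have sm: "s \<in> borel_measurable X" and s1: "cmod (s x) = 1" for x
      using s by (simp_all add: unit_functions_def)
    have k1: "cmod (k g) = 1" if "g \<in> carrier G" for g
      using charD(1)[OF \<theta>(1) that] charD(1)[OF \<theta>(2) that] by (simp add: k_def norm_mult)
    have km: "k (g \<otimes> h) = k g * k h" if "g \<in> carrier G" "h \<in> carrier G" for g h
      using charD(2)[OF \<theta>(1) that] charD(2)[OF \<theta>(2) that] by (simp add: k_def mult_ac)
    have dist: "L2_dist X (w g) (w' g) = norm2 X (\<lambda>x. k g * s (T g x) * cnj (s x) - 1)" if g: "g \<in> carrier G" for g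
    proof -
      have "L2_dist X (w g) (w' g) = norm2 X (\<lambda>x. standard_cocycle \<theta> u g x * cnj (standard_cocycle \<theta>' u' g x) - 1)"
        unfolding represents_apply[OF r(1) g] represents_apply[OF r(2) g]
        by (intro L2_dist_unit unit_cocycle_unit_functions[OF _ g] represents_cocycle[OF r(1)] represents_cocycle[OF r(2)])
      also have "(\<lambda>x. standard_cocycle \<theta> u g x * cnj (standard_cocycle \<theta>' u' g x) - 1) = (\<lambda>x. k g * s (T g x) * cnj (s x) - 1)"
        using g by (simp add: standard_cocycle_def k_def s_def fun_eq_iff mult_ac)
      finally show ?thesis .
    qed
    have half: "1 / 2 \<le> cmod (\<integral>x. s x \<partial>X)"
    proof (rule gap[OF k1 km sm s1])
      fix g assume g: "g \<in> F"
      then have "g \<in> carrier G" using F(2) by blast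
      from dist[OF this] show "norm2 X (\<lambda>x. k g * s (T g x) * cnj (s x) - 1) < \<delta>" using bspec[OF close g] by simp
    qed
    have "\<gamma> h = \<gamma>' h" if h: "h \<in> carrier \<Gamma>" for h
    proof -
      have e: "AE x in X. u (b h x) = \<gamma> h * u x" "AE x in X. u' (b h x) = \<gamma>' h * u' x"
        using t t' h by (simp_all add: trivialized_def)
      have ae: "AE x in X. s (b h x) = \<gamma> h * cnj (\<gamma>' h) * s x"
        using e by eventually_elim (simp add: s_def mult_ac)
      have "(\<integral>x. s x \<partial>X) = (\<integral>x. s (b h x) \<partial>X)"
        by (rule measure_preserving_integral[OF b_mp[OF h] sm, symmetric])
      also have "\<dots> = (\<integral>x. \<gamma> h * cnj (\<gamma>' h) * s x \<partial>X)"
        using ae sm b_comp_measurable[OF h sm] by (intro integral_cong_AE) auto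
      also have "\<dots> = \<gamma> h * cnj (\<gamma>' h) * (\<integral>x. s x \<partial>X)" by simp
      finally have "\<gamma> h * cnj (\<gamma>' h) = 1" using half by auto
      then have "\<gamma> h * (cnj (\<gamma>' h) * \<gamma>' h) = \<gamma>' h" by (simp add: mult.assoc[symmetric])
      then show ?thesis
        using mult_cnj_unit[OF eigenD(1)[OF \<gamma>(2) h]] by (simp add: mult.commute)
    qed
    then have "\<gamma> = \<gamma>'" by (rule extensionalityI[OF eigenD(3)[OF \<gamma>(1)] eigenD(3)[OF \<gamma>(2)]])
    moreover have "cmod (\<theta> g - \<theta>' g) \<le> 2 * L2_dist X (w g) (w' g)" if g: "g \<in> carrier G" for g
    proof -
      have "k g - 1 = (\<theta> g - \<theta>' g) * cnj (\<theta>' g)"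
        using mult_cnj_unit[OF charD(1)[OF \<theta>(2) g]] by (simp add: k_def left_diff_distrib)
      then have "cmod (\<theta> g - \<theta>' g) = cmod (k g - 1)"
        by (simp add: norm_mult charD(1)[OF \<theta>(2) g])
      moreover have "cmod (k g - 1) * (1 / 2) \<le> cmod (k g - 1) * cmod (\<integral>x. s x \<partial>X)"
        by (rule mult_left_mono[OF half]) simp
      moreover have "cmod (k g - 1) * cmod (\<integral>x. s x \<partial>X) \<le> L2_dist X (w g) (w' g)"
        unfolding dist[OF g] by (rule character_deviation(1)[OF g sm s1 k1[OF g]])
      ultimately show ?thesis by linarith
    qed
    ultimately show "\<gamma> = \<gamma>' \<and> (\<forall>g\<in>carrier G. cmod (\<theta> g - \<theta>' g) \<le> 2 * L2_dist X (w g) (w' g))" by blast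
  qed
qed

text \<open>The case of distance 0 of the previous estimate, with both data trivializing the same
  cocycle.\<close>

lemma trivialized_unique:
  assumes t: "trivialized w \<theta> \<gamma> u" and t': "trivialized w \<theta>' \<gamma>' u'"
  shows "\<theta> = \<theta>'" "\<gamma> = \<gamma>'"
proof -
  have 0: "L2_dist X a a = 0" for a by (simp add: L2_dist_def)
  obtain F \<delta> where \<delta>: "\<delta> > 0" and
    cl: "\<forall>w w' \<theta> \<theta>' \<gamma> \<gamma>' u u'. trivialized w \<theta> \<gamma> u \<longrightarrow> trivialized w' \<theta>' \<gamma>' u' \<longrightarrow>
      (\<forall>g\<in>F. L2_dist X (w g) (w' g) < \<delta>) \<longrightarrow>
      \<gamma> = \<gamma>' \<and> (\<forall>g\<in>carrier G. cmod (\<theta> g - \<theta>' g) \<le> 2 * L2_dist X (w g) (w' g))"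
    using trivialized_close by (elim exE conjE)
  have c: "\<gamma> = \<gamma>' \<and> (\<forall>g\<in>carrier G. cmod (\<theta> g - \<theta>' g) \<le> 2 * L2_dist X (w g) (w g))"
    by (rule cl[rule_format, OF t t']) (simp add: 0 \<delta>)
  then show "\<gamma> = \<gamma>'" by blast
  have "\<theta> g = \<theta>' g" if "g \<in> carrier G" for g using c that by (simp add: 0)
  moreover have "\<theta> \<in> extensional (carrier G)" "\<theta>' \<in> extensional (carrier G)"
    using t t' charD(3) by (simp_all add: trivialized_def)
  ultimately show "\<theta> = \<theta>'" by (intro extensionalityI)
qed

lemma trivialized_mult:
  assumes t: "trivialized w \<theta> \<gamma> u" and t': "trivialized w' \<theta>' \<gamma>' u'"
  shows "trivialized (w \<otimes>\<^bsub>Z\<^esub> w') (\<lambda>g\<in>carrier G. \<theta> g * \<theta>' g) (\<lambda>h\<in>carrier \<Gamma>. \<gamma> h * \<gamma>' h) (\<lambda>x. u x * u' x)"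
proof -
  have \<theta>: "\<theta> \<in> carrier C" "\<theta>' \<in> carrier C" and \<gamma>: "\<gamma> \<in> carrier E" "\<gamma>' \<in> carrier E"
    and u: "u \<in> unit_functions X" "u' \<in> unit_functions X"
    and r: "represents (standard_cocycle \<theta> u) w" "represents (standard_cocycle \<theta>' u') w'"
    using t t' by (simp_all add: trivialized_def)
  let ?\<theta> = "\<lambda>g\<in>carrier G. \<theta> g * \<theta>' g" and ?\<gamma> = "\<lambda>h\<in>carrier \<Gamma>. \<gamma> h * \<gamma>' h" and ?u = "\<lambda>x. u x * u' x"
  have \<theta>'': "?\<theta> \<in> carrier C" by (rule char_group_mult_closed[OF \<theta>])
  have u'': "?u \<in> unit_functions X" by (rule unit_functions_mult[OF u])
  have eig: "AE x in X. ?u (b h x) = ?\<gamma> h * ?u x" if h: "h \<in> carrier \<Gamma>" for h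
  proof -
    have e: "AE x in X. u (b h x) = \<gamma> h * u x" "AE x in X. u' (b h x) = \<gamma>' h * u' x"
      using t t' h by (simp_all add: trivialized_def)
    then show ?thesis by eventually_elim (simp add: h mult_ac)
  qed
  have "?\<gamma> \<in> carrier (char_group \<Gamma>)" by (rule \<Gamma>.char_group_mult_closed[OF eigenD(2)[OF \<gamma>(1)] eigenD(2)[OF \<gamma>(2)]])
  then have \<gamma>'': "?\<gamma> \<in> carrier E"
    unfolding eigenchar_iff by (intro conjI bexI[OF _ u''] ballI eig)
  have std: "represents (standard_cocycle ?\<theta> ?u) (\<lambda>g\<in>carrier G. aeclass X (standard_cocycle ?\<theta> ?u g))"
    by (rule represents_standard_cocycle[OF \<theta>'' \<gamma>'' u'' eig])
  have "w \<otimes>\<^bsub>Z\<^esub> w' = (\<lambda>g\<in>carrier G. aeclass X (standard_cocycle ?\<theta> ?u g))"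
  proof (rule represents_eqI[OF represents_mult[OF r] std])
    fix g assume g: "g \<in> carrier G"
    show "AE x in X. standard_cocycle \<theta> u g x * standard_cocycle \<theta>' u' g x = standard_cocycle ?\<theta> ?u g x"
      by (rule AE_I2) (simp add: standard_cocycle_def g mult_ac)
  qed
  then have "represents (standard_cocycle ?\<theta> ?u) (w \<otimes>\<^bsub>Z\<^esub> w')" using std by (simp only:)
  then show ?thesis unfolding trivialized_def by (intro conjI ballI \<theta>'' \<gamma>'' u'' eig)
qed

end

section \<open>The homomorphism from cocycles to pairs of characters\<close>

context bernoulli_commuting_action begin

lemma E_mult: "\<gamma> \<otimes>\<^bsub>E\<^esub> \<gamma>' = (\<lambda>h\<in>carrier \<Gamma>. \<gamma> h * \<gamma>' h)"
  and E_one: "\<one>\<^bsub>E\<^esub> = (\<lambda>h\<in>carrier \<Gamma>. 1)"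
  by (simp_all add: eigenchar_group_def char_group_def)

lemma eigenchar_mult_closed:
  assumes "\<gamma> \<in> carrier E" "\<gamma>' \<in> carrier E"
  shows "(\<lambda>h\<in>carrier \<Gamma>. \<gamma> h * \<gamma>' h) \<in> carrier E"
proof -
  obtain u u' where u: "u \<in> unit_functions X" "\<forall>h\<in>carrier \<Gamma>. AE x in X. u (b h x) = \<gamma> h * u x"
    and u': "u' \<in> unit_functions X" "\<forall>h\<in>carrier \<Gamma>. AE x in X. u' (b h x) = \<gamma>' h * u' x"
    using assms by (auto simp: eigenchar_iff)
  have "AE x in X. u (b h x) * u' (b h x) = (\<lambda>h\<in>carrier \<Gamma>. \<gamma> h * \<gamma>' h) h * (u x * u' x)"
    if h: "h \<in> carrier \<Gamma>" for h
    using bspec[OF u(2) h] bspec[OF u'(2) h] by eventually_elim (simp add: h mult_ac)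
  then show ?thesis
    unfolding eigenchar_iff
    by (intro conjI bexI[OF _ unit_functions_mult[OF u(1) u'(1)]] ballI
        \<Gamma>.char_group_mult_closed[OF eigenD(2)[OF assms(1)] eigenD(2)[OF assms(2)]])
qed

lemma eigenchar_cnj_closed:
  assumes "\<gamma> \<in> carrier E"
  shows "(\<lambda>h\<in>carrier \<Gamma>. cnj (\<gamma> h)) \<in> carrier E"
proof -
  obtain u where u: "u \<in> unit_functions X" "\<forall>h\<in>carrier \<Gamma>. AE x in X. u (b h x) = \<gamma> h * u x"
    using assms by (auto simp: eigenchar_iff)
  have "AE x in X. cnj (u (b h x)) = (\<lambda>h\<in>carrier \<Gamma>. cnj (\<gamma> h)) h * cnj (u x)"
    if h: "h \<in> carrier \<Gamma>" for h
    using bspec[OF u(2) h] by eventually_elim (simp add: h)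
  then show ?thesis
    unfolding eigenchar_iff
    by (intro conjI bexI[OF _ unit_functions_cnj[OF u(1)]] ballI \<Gamma>.char_group_cnj_closed[OF eigenD(2)[OF assms]])
qed

lemma eigenchar_one: "\<one>\<^bsub>E\<^esub> \<in> carrier E"
proof -
  have "AE x in X. (1 :: complex) = (\<lambda>h\<in>carrier \<Gamma>. 1) h * 1" if "h \<in> carrier \<Gamma>" for h
    using that by simp
  moreover have "(\<lambda>h\<in>carrier \<Gamma>. 1 :: complex) \<in> carrier (char_group \<Gamma>)" by (simp add: char_group_iff)
  ultimately show ?thesis
    unfolding eigenchar_iff E_one by (intro conjI bexI[of _ "\<lambda>_. 1"] ballI unit_functions_const) simp_all
qed

lemma group_E: "Group.group E"
proof (rule groupI)
  fix \<gamma> assume \<gamma>: "\<gamma> \<in> carrier E"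
  show "\<one>\<^bsub>E\<^esub> \<otimes>\<^bsub>E\<^esub> \<gamma> = \<gamma>"
    using eigenD(3)[OF \<gamma>] by (auto simp: E_mult E_one fun_eq_iff extensional_def)
  have "(\<lambda>h\<in>carrier \<Gamma>. cnj (\<gamma> h)) \<otimes>\<^bsub>E\<^esub> \<gamma> = \<one>\<^bsub>E\<^esub>"
    using char_group_cnj_mult[OF eigenD(2)[OF \<gamma>]] by (simp add: E_mult E_one char_group_mult char_group_one)
  then show "\<exists>\<gamma>'\<in>carrier E. \<gamma>' \<otimes>\<^bsub>E\<^esub> \<gamma> = \<one>\<^bsub>E\<^esub>"
    by (rule bexI[OF _ eigenchar_cnj_closed[OF \<gamma>]])
next
  show "\<gamma> \<otimes>\<^bsub>E\<^esub> \<gamma>' \<in> carrier E" if "\<gamma> \<in> carrier E" "\<gamma>' \<in> carrier E" for \<gamma> \<gamma>'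
    unfolding E_mult by (rule eigenchar_mult_closed[OF that])
qed (auto simp: E_mult eigenchar_one fun_eq_iff mult.assoc)

text \<open>Only the characters are chosen here, not the unitary; they exist by
  \<open>ex_trivialized\<close>, and \<open>trivialized_unique\<close> makes the choice
  irrelevant.\<close>

definition \<Phi> :: "('g \<Rightarrow> (('g \<Rightarrow> 'x) \<Rightarrow> complex) set) \<Rightarrow> ('g \<Rightarrow> complex) \<times> ('h \<Rightarrow> complex)" where
  "\<Phi> w = (SOME p. \<exists>u. trivialized w (fst p) (snd p) u)"

lemma \<Phi>_eq:
  assumes t: "trivialized w \<theta> \<gamma> u"
  shows "\<Phi> w = (\<theta>, \<gamma>)"
proof -
  have "\<exists>p. \<exists>u. trivialized w (fst p) (snd p) u"
    by (rule exI[of _ "(\<theta>, \<gamma>)"], rule exI[of _ u]) (simp add: t)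
  then have "\<exists>u. trivialized w (fst (\<Phi> w)) (snd (\<Phi> w)) u"
    unfolding \<Phi>_def by (rule someI_ex)
  then obtain u' where "trivialized w (fst (\<Phi> w)) (snd (\<Phi> w)) u'" ..
  from trivialized_unique[OF this t] show ?thesis by (simp add: prod_eq_iff)
qed

lemma \<Phi>_trivialized:
  assumes "w \<in> carrier Z"
  obtains u where "trivialized w (fst (\<Phi> w)) (snd (\<Phi> w)) u"
proof -
  obtain \<theta> \<gamma> u where t: "trivialized w \<theta> \<gamma> u" using ex_trivialized[OF assms] by (elim exE)
  with \<Phi>_eq[OF t] show thesis by (intro that[of u]) simp
qed

lemma trivialized_carrier: "trivialized w \<theta> \<gamma> u \<Longrightarrow> w \<in> carrier Z \<and> \<theta> \<in> carrier C \<and> \<gamma> \<in> carrier E"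
  unfolding trivialized_def Z_carrier_iff by blast

definition eigenfunction :: "('h \<Rightarrow> complex) \<Rightarrow> ('g \<Rightarrow> 'x) \<Rightarrow> complex" where
  "eigenfunction \<gamma> = (SOME u. u \<in> unit_functions X \<and> (\<forall>h\<in>carrier \<Gamma>. AE x in X. u (b h x) = \<gamma> h * u x))"

lemma eigenfunction:
  assumes "\<gamma> \<in> carrier E"
  shows "eigenfunction \<gamma> \<in> unit_functions X"
    "h \<in> carrier \<Gamma> \<Longrightarrow> AE x in X. eigenfunction \<gamma> (b h x) = \<gamma> h * eigenfunction \<gamma> x"
proof -
  have "\<exists>u. u \<in> unit_functions X \<and> (\<forall>h\<in>carrier \<Gamma>. AE x in X. u (b h x) = \<gamma> h * u x)"
    using assms unfolding eigenchar_iff by blast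
  then have e: "eigenfunction \<gamma> \<in> unit_functions X \<and>
      (\<forall>h\<in>carrier \<Gamma>. AE x in X. eigenfunction \<gamma> (b h x) = \<gamma> h * eigenfunction \<gamma> x)"
    unfolding eigenfunction_def by (rule someI_ex)
  then show "eigenfunction \<gamma> \<in> unit_functions X"
    "h \<in> carrier \<Gamma> \<Longrightarrow> AE x in X. eigenfunction \<gamma> (b h x) = \<gamma> h * eigenfunction \<gamma> x" by simp_all
qed

text \<open>A right inverse of \<open>\<Phi>\<close>. The eigenfunctions for different
  \<open>\<gamma>\<close> are chosen independently, so it need not be a homomorphism; what counts is
  its continuity.\<close>

definition cocycle_of :: "('g \<Rightarrow> complex) \<times> ('h \<Rightarrow> complex) \<Rightarrow> 'g \<Rightarrow> (('g \<Rightarrow> 'x) \<Rightarrow> complex) set" where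
  "cocycle_of p = (\<lambda>g\<in>carrier G. aeclass X (standard_cocycle (fst p) (eigenfunction (snd p)) g))"

lemma trivialized_standard:
  assumes "\<theta> \<in> carrier C" "\<gamma> \<in> carrier E" "u \<in> unit_functions X"
    "\<And>h. h \<in> carrier \<Gamma> \<Longrightarrow> AE x in X. u (b h x) = \<gamma> h * u x"
  shows "trivialized (\<lambda>g\<in>carrier G. aeclass X (standard_cocycle \<theta> u g)) \<theta> \<gamma> u"
  unfolding trivialized_def by (intro conjI ballI represents_standard_cocycle[OF assms] assms)

lemma trivialized_cocycle_of:
  assumes "p \<in> carrier (C \<times>\<times> E)"
  shows "trivialized (cocycle_of p) (fst p) (snd p) (eigenfunction (snd p))"
proof -
  have p: "fst p \<in> carrier C" "snd p \<in> carrier E" using assms by (auto simp: DirProd_def)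
  show ?thesis
    unfolding cocycle_of_def by (rule trivialized_standard[OF p eigenfunction[OF p(2)]])
qed

lemma \<Phi>_cocycle_of: "p \<in> carrier (C \<times>\<times> E) \<Longrightarrow> \<Phi> (cocycle_of p) = p"
  using \<Phi>_eq[OF trivialized_cocycle_of, of p] by simp

lemma cocycle_of_closed: "p \<in> carrier (C \<times>\<times> E) \<Longrightarrow> cocycle_of p \<in> carrier Z"
  using trivialized_carrier[OF trivialized_cocycle_of] by blast

lemma \<Phi>_closed: "w \<in> carrier Z \<Longrightarrow> \<Phi> w \<in> carrier (C \<times>\<times> E)"
  by (rule \<Phi>_trivialized, assumption, drule trivialized_carrier) (simp add: DirProd_def mem_Times_iff)

lemma group_hom_\<Phi>: "group_hom Z (C \<times>\<times> E) \<Phi>"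
proof (intro group_hom.intro group_Z DirProd_group group_char_group group_E group_hom_axioms.intro homI)
  show "\<Phi> w \<in> carrier (C \<times>\<times> E)" if "w \<in> carrier Z" for w by (rule \<Phi>_closed[OF that])
  fix v w assume v: "v \<in> carrier Z" and w: "w \<in> carrier Z"
  obtain u where u: "trivialized v (fst (\<Phi> v)) (snd (\<Phi> v)) u" by (rule \<Phi>_trivialized[OF v])
  obtain u' where u': "trivialized w (fst (\<Phi> w)) (snd (\<Phi> w)) u'" by (rule \<Phi>_trivialized[OF w])
  show "\<Phi> (v \<otimes>\<^bsub>Z\<^esub> w) = \<Phi> v \<otimes>\<^bsub>C \<times>\<times> E\<^esub> \<Phi> w"
    unfolding \<Phi>_eq[OF trivialized_mult[OF u u']]
    by (simp add: DirProd_def split_beta' char_group_mult E_mult)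
qed

text \<open>A trivial \<open>\<theta>\<close> leaves the factor built from \<open>u\<close> alone,
  and a trivial \<open>\<gamma>\<close> says that \<open>u\<close> is fixed by \<beta>, that is, a
  unitary of the fixed point algebra.\<close>

lemma kernel_\<Phi>: "kernel Z (C \<times>\<times> E) \<Phi> = B1 G X A\<Gamma> \<sigma>"
proof -
  have one: "\<one>\<^bsub>C \<times>\<times> E\<^esub> = (\<one>\<^bsub>C\<^esub>, \<one>\<^bsub>E\<^esub>)" by (simp add: DirProd_def)
  have C1: "\<one>\<^bsub>C\<^esub> \<in> carrier C" using group.is_monoid[OF group_char_group] by (rule monoid.one_closed)
  have coboundary: "(\<lambda>g\<in>carrier G. Lmult X (\<sigma> g (aeclass X f)) (Lstar X (aeclass X f))) =
      (\<lambda>g\<in>carrier G. aeclass X (standard_cocycle \<one>\<^bsub>C\<^esub> f g))" if f: "f \<in> unit_functions X" for f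
  proof (rule restrict_ext)
    fix g assume g: "g \<in> carrier G"
    have m: "f \<in> borel_measurable X" by (rule unit_functions_measurable[OF f])
    have m2: "(\<lambda>x. f (T g x)) \<in> borel_measurable X" by (rule T_comp_measurable[OF g m])
    have m3: "(\<lambda>x. cnj (f x)) \<in> borel_measurable X" using m by simp
    have "Lmult X (\<sigma> g (aeclass X f)) (Lstar X (aeclass X f)) = aeclass X (\<lambda>x. f (T g x) * cnj (f x))"
      by (simp only: \<sigma>_aeclass[OF g m] Lstar_aeclass[OF m] Lmult_aeclass[OF m2 m3])
    also have "(\<lambda>x. f (T g x) * cnj (f x)) = standard_cocycle \<one>\<^bsub>C\<^esub> f g"
      using g by (simp add: standard_cocycle_def fun_eq_iff char_group_one)
    finally show "Lmult X (\<sigma> g (aeclass X f)) (Lstar X (aeclass X f)) = aeclass X (standard_cocycle \<one>\<^bsub>C\<^esub> f g)" .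
  qed
  show ?thesis
  proof (intro equalityI subsetI)
    fix w assume "w \<in> kernel Z (C \<times>\<times> E) \<Phi>"
    then have w: "w \<in> carrier Z" "\<Phi> w = (\<one>\<^bsub>C\<^esub>, \<one>\<^bsub>E\<^esub>)" by (simp_all add: kernel_def one)
    obtain u where u: "trivialized w (fst (\<Phi> w)) (snd (\<Phi> w)) u" by (rule \<Phi>_trivialized[OF w(1)])
    then have t: "u \<in> unit_functions X" "\<forall>h\<in>carrier \<Gamma>. AE x in X. u (b h x) = u x"
      and r: "represents (standard_cocycle \<one>\<^bsub>C\<^esub> u) w"
      by (simp_all add: w(2) trivialized_def E_one)
    have "aeclass X u \<in> Lunitary X A\<Gamma>" unfolding Lunitary_fixed_iff using t by blast
    moreover have "w = (\<lambda>g\<in>carrier G. Lmult X (\<sigma> g (aeclass X u)) (Lstar X (aeclass X u)))"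
      unfolding coboundary[OF t(1)] using r by (simp add: represents_def)
    ultimately show "w \<in> B1 G X A\<Gamma> \<sigma>" unfolding B1_def by (rule image_eqI[rotated])
  next
    fix w assume "w \<in> B1 G X A\<Gamma> \<sigma>"
    then obtain a where a: "a \<in> Lunitary X A\<Gamma>"
      "w = (\<lambda>g\<in>carrier G. Lmult X (\<sigma> g a) (Lstar X a))" unfolding B1_def by (rule imageE)
    from a(1) obtain f where f: "f \<in> unit_functions X" "a = aeclass X f"
      "\<forall>h\<in>carrier \<Gamma>. AE x in X. f (b h x) = f x" unfolding Lunitary_fixed_iff by blast
    have "AE x in X. f (b h x) = \<one>\<^bsub>E\<^esub> h * f x" if "h \<in> carrier \<Gamma>" for h
      using bspec[OF f(3) that] by eventually_elim (simp add: E_one that)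
    from trivialized_standard[OF C1 eigenchar_one f(1) this]
    have "trivialized w \<one>\<^bsub>C\<^esub> \<one>\<^bsub>E\<^esub> f" unfolding a(2) f(2) coboundary[OF f(1)] .
    then show "w \<in> kernel Z (C \<times>\<times> E) \<Phi>"
      using trivialized_carrier \<Phi>_eq by (simp add: kernel_def one)
  qed
qed

section \<open>The topology of the first cohomology group\<close>

abbreviation "TZ \<equiv> Z1_topology G X A\<Gamma> \<sigma>"
abbreviation "TT \<equiv> prod_topology (char_topology G) (discrete_topology (carrier E))"

sublocale Met: Metric_space "Linf X" "L2_dist X"
  by (rule Metric_space_Linf[OF X.prob_space_axioms])

lemma Lunitary_Linf: "Lunitary X A\<Gamma> \<subseteq> Linf X"
  by (auto simp: Lunitary_def fixed_algebra_def)

lemma topspace_unitary_topology: "topspace (unitary_topology X A\<Gamma>) = Lunitary X A\<Gamma>"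
  using Lunitary_Linf by (auto simp: unitary_topology_def)

lemma Z_PiE: "carrier Z \<subseteq> carrier G \<rightarrow>\<^sub>E Lunitary X A\<Gamma>"
  by (auto simp: Z1_def)

lemma topspace_TZ: "topspace TZ = carrier Z"
  using Z_PiE by (auto simp: Z1_topology_def topspace_unitary_topology)

lemma topspace_char_topology: "topspace (char_topology G) = carrier C"
  by (auto simp: char_topology_def char_group_def PiE_def)

lemma topspace_TT: "topspace TT = carrier (C \<times>\<times> E)"
  by (simp add: topspace_char_topology DirProd_def)

lemma Z_apply_Linf: "w \<in> carrier Z \<Longrightarrow> g \<in> carrier G \<Longrightarrow> w g \<in> Linf X"
  using Z_PiE Lunitary_Linf by blast

lemma openin_neighbourhood:
  assumes w: "w \<in> carrier Z" and F: "finite F" "F \<subseteq> carrier G"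
  shows "openin TZ {w' \<in> carrier Z. \<forall>g\<in>F. L2_dist X (w g) (w' g) < \<delta>}"
  using F
proof (induction F rule: finite_induct)
  case empty
  show ?case using openin_topspace[of TZ] by (simp add: topspace_TZ)
next
  case (insert g F)
  have g: "g \<in> carrier G" using insert by simp
  have "continuous_map (product_topology (\<lambda>_. unitary_topology X A\<Gamma>) (carrier G)) (unitary_topology X A\<Gamma>) (\<lambda>w. w g)"
    by (rule continuous_map_product_projection[OF g])
  then have "continuous_map TZ Met.mtopology (\<lambda>w. w g)"
    unfolding Z1_topology_def unitary_topology_def
    by (intro continuous_map_from_subtopology) (rule continuous_map_into_fulltopology)
  from openin_continuous_map_preimage[OF this Met.openin_mball]
  have "openin TZ {w' \<in> carrier Z. w' g \<in> Met.mball (w g) \<delta>}" by (simp only: topspace_TZ)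
  moreover have "openin TZ {w' \<in> carrier Z. \<forall>g\<in>F. L2_dist X (w g) (w' g) < \<delta>}"
    using insert by simp
  ultimately have "openin TZ ({w' \<in> carrier Z. w' g \<in> Met.mball (w g) \<delta>} \<inter>
      {w' \<in> carrier Z. \<forall>g\<in>F. L2_dist X (w g) (w' g) < \<delta>})" by (rule openin_Int)
  also have "{w' \<in> carrier Z. w' g \<in> Met.mball (w g) \<delta>} \<inter>
      {w' \<in> carrier Z. \<forall>g\<in>F. L2_dist X (w g) (w' g) < \<delta>} =
      {w' \<in> carrier Z. \<forall>g\<in>insert g F. L2_dist X (w g) (w' g) < \<delta>}"
    using Z_apply_Linf[OF w g] Z_apply_Linf[OF _ g] by (auto simp: Met.in_mball)
  finally show ?case .
qed

text \<open>On the neighbourhood \<open>N w\<close> given by \<open>trivialized_close\<close> the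
  second component is constant, which yields continuity into the discrete group, and at each
  \<open>g\<close> the first differs from its value at \<open>w\<close> by at most twice the
  distance.\<close>

lemma continuous_\<Phi>: "continuous_map TZ TT \<Phi>"
proof -
  obtain F \<delta> where F: "finite F" "F \<subseteq> carrier G" and \<delta>: "\<delta> > 0" and
    cl: "\<forall>w w' \<theta> \<theta>' \<gamma> \<gamma>' u u'. trivialized w \<theta> \<gamma> u \<longrightarrow> trivialized w' \<theta>' \<gamma>' u' \<longrightarrow>
      (\<forall>g\<in>F. L2_dist X (w g) (w' g) < \<delta>) \<longrightarrow>
      \<gamma> = \<gamma>' \<and> (\<forall>g\<in>carrier G. cmod (\<theta> g - \<theta>' g) \<le> 2 * L2_dist X (w g) (w' g))"
    using trivialized_close by (elim exE conjE)
  define N where "N w = {w' \<in> carrier Z. \<forall>g\<in>F. L2_dist X (w g) (w' g) < \<delta>}" for w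
  have N_open: "openin TZ (N w)" if "w \<in> carrier Z" for w
    unfolding N_def by (rule openin_neighbourhood[OF that F])
  have L0: "L2_dist X a a = 0" for a by (simp add: L2_dist_def)
  have N_self: "w \<in> N w" if "w \<in> carrier Z" for w using that \<delta> by (simp add: N_def L0)
  have close: "snd (\<Phi> w) = snd (\<Phi> w') \<and> (\<forall>g\<in>carrier G. cmod (fst (\<Phi> w) g - fst (\<Phi> w') g) \<le> 2 * L2_dist X (w g) (w' g))"
    if w: "w \<in> carrier Z" and w': "w' \<in> N w" for w w'
  proof -
    have w'Z: "w' \<in> carrier Z" using w' by (simp add: N_def)
    obtain u where u: "trivialized w (fst (\<Phi> w)) (snd (\<Phi> w)) u" by (rule \<Phi>_trivialized[OF w])
    obtain u' where u': "trivialized w' (fst (\<Phi> w')) (snd (\<Phi> w')) u'" by (rule \<Phi>_trivialized[OF w'Z])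
    show ?thesis by (rule cl[rule_format, OF u u']) (use w' in \<open>simp add: N_def\<close>)
  qed
  have \<Phi>_mem: "fst (\<Phi> w) \<in> carrier C" "snd (\<Phi> w) \<in> carrier E" if "w \<in> carrier Z" for w
    using \<Phi>_closed[OF that] by (simp_all add: DirProd_def mem_Times_iff)
  have snd_cont: "continuous_map TZ (discrete_topology (carrier E)) (snd \<circ> \<Phi>)"
    unfolding continuous_map_def
  proof (intro conjI allI impI)
    show "snd \<circ> \<Phi> \<in> topspace TZ \<rightarrow> topspace (discrete_topology (carrier E))"
      using \<Phi>_mem by (simp add: topspace_TZ)
    fix V
    show "openin TZ {w \<in> topspace TZ. (snd \<circ> \<Phi>) w \<in> V}"
    proof (subst openin_subopen, intro ballI)
      fix w assume "w \<in> {w \<in> topspace TZ. (snd \<circ> \<Phi>) w \<in> V}"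
      then have w: "w \<in> carrier Z" "snd (\<Phi> w) \<in> V" by (simp_all add: topspace_TZ)
      have "N w \<subseteq> {w \<in> topspace TZ. (snd \<circ> \<Phi>) w \<in> V}"
      proof
        fix w' assume w': "w' \<in> N w"
        have "w' \<in> carrier Z" using w' by (simp add: N_def)
        with w(2) close[OF w(1) w'] show "w' \<in> {w \<in> topspace TZ. (snd \<circ> \<Phi>) w \<in> V}"
          by (simp add: topspace_TZ)
      qed
      then show "\<exists>S. openin TZ S \<and> w \<in> S \<and> S \<subseteq> {w \<in> topspace TZ. (snd \<circ> \<Phi>) w \<in> V}"
        using N_open[OF w(1)] N_self[OF w(1)] by blast
    qed
  qed
  have comp: "continuous_map TZ euclidean (\<lambda>w. (fst \<circ> \<Phi>) w g)" if g: "g \<in> carrier G" for g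
    unfolding continuous_map_def
  proof (intro conjI allI impI)
    fix V :: "complex set" assume "openin euclidean V"
    then have V: "open V" by simp
    show "openin TZ {w \<in> topspace TZ. (fst \<circ> \<Phi>) w g \<in> V}"
    proof (subst openin_subopen, intro ballI)
      fix w assume "w \<in> {w \<in> topspace TZ. (fst \<circ> \<Phi>) w g \<in> V}"
      then have w: "w \<in> carrier Z" "fst (\<Phi> w) g \<in> V" by (simp_all add: topspace_TZ)
      obtain e where e: "e > 0" "ball (fst (\<Phi> w) g) e \<subseteq> V" using V w(2) open_contains_ball by blast
      let ?S = "N w \<inter> {w' \<in> carrier Z. \<forall>g\<in>{g}. L2_dist X (w g) (w' g) < e / 2}"
      have "?S \<subseteq> {w \<in> topspace TZ. (fst \<circ> \<Phi>) w g \<in> V}"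
      proof
        fix w' assume w': "w' \<in> ?S"
        have "cmod (fst (\<Phi> w) g - fst (\<Phi> w') g) \<le> 2 * L2_dist X (w g) (w' g)"
          using close[OF w(1)] w' g by blast
        also have "\<dots> < e" using w' by simp
        finally have "fst (\<Phi> w') g \<in> ball (fst (\<Phi> w) g) e" by (simp add: dist_norm)
        then show "w' \<in> {w \<in> topspace TZ. (fst \<circ> \<Phi>) w g \<in> V}" using e(2) w' by (auto simp: topspace_TZ)
      qed
      moreover have "openin TZ ?S"
        by (intro openin_Int N_open w openin_neighbourhood) (use g in simp_all)
      moreover have "w \<in> ?S" using N_self[OF w(1)] w(1) e(1) by (simp add: L0)
      ultimately show "\<exists>S. openin TZ S \<and> w \<in> S \<and> S \<subseteq> {w \<in> topspace TZ. (fst \<circ> \<Phi>) w g \<in> V}" by blast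
    qed
  qed simp
  have "continuous_map TZ (char_topology G) (fst \<circ> \<Phi>)"
    unfolding char_topology_def continuous_map_in_subtopology continuous_map_componentwise
    using \<Phi>_mem charD(3) comp by (auto simp: topspace_TZ)
  with snd_cont show ?thesis by (simp add: continuous_map_pairwise)
qed

text \<open>For one and the same \<open>\<gamma>\<close> both cocycles contain the same factor of
  modulus 1, so their difference has constant modulus.\<close>

lemma L2_dist_cocycle_of:
  assumes "\<theta> \<in> carrier C" "\<theta>' \<in> carrier C" "\<gamma> \<in> carrier E" "g \<in> carrier G"
  shows "L2_dist X (cocycle_of (\<theta>, \<gamma>) g) (cocycle_of (\<theta>', \<gamma>) g) = cmod (\<theta> g - \<theta>' g)"
proof -
  let ?u = "eigenfunction \<gamma>"
  have u: "?u \<in> unit_functions X" by (rule eigenfunction(1)[OF assms(3)])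
  have m: "standard_cocycle \<theta> ?u g \<in> borel_measurable X" if "\<theta> \<in> carrier C" for \<theta>
    using XA.unit_cocycleD(1)[OF represents_cocycle[OF represents_standard_cocycle[OF that assms(3) eigenfunction[OF assms(3)]]] assms(4)] .
  have "cmod (standard_cocycle \<theta> ?u g x - standard_cocycle \<theta>' ?u g x) = cmod (\<theta> g - \<theta>' g)" for x
  proof -
    have "standard_cocycle \<theta> ?u g x - standard_cocycle \<theta>' ?u g x = (\<theta> g - \<theta>' g) * (?u (T g x) * cnj (?u x))"
      using assms(4) by (simp add: standard_cocycle_def algebra_simps)
    then show ?thesis by (simp add: norm_mult unit_functions_norm[OF u])
  qed
  then show ?thesis
    using L2_dist_aeclass[OF m[OF assms(1)] m[OF assms(2)]] assms(4)
    by (simp add: cocycle_of_def X.prob_space)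
qed

text \<open>Since the second factor is discrete, \<open>\<gamma>\<close> may be kept fixed near a
  given point; there the map is isometric in the value of the character at each
  \<open>g\<close>.\<close>

lemma continuous_cocycle_of: "continuous_map TT TZ cocycle_of"
proof -
  have unit: "cocycle_of p g \<in> Lunitary X A\<Gamma>" if "p \<in> carrier (C \<times>\<times> E)" "g \<in> carrier G" for p g
    using cocycle_of_closed[OF that(1)] Z_PiE that(2) by blast
  have "continuous_map TT Met.mtopology (\<lambda>p. cocycle_of p g)" if g: "g \<in> carrier G" for g
    unfolding Met.continuous_map_to_metric
  proof (intro ballI allI impI)
    fix p and r :: real assume p: "p \<in> topspace TT" and r: "0 < r"
    obtain \<theta> \<gamma> where pe: "p = (\<theta>, \<gamma>)" by (cases p)
    have pc: "p \<in> carrier (C \<times>\<times> E)" using p by (simp only: topspace_TT)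
    then have \<theta>: "\<theta> \<in> carrier C" and \<gamma>: "\<gamma> \<in> carrier E" by (simp_all add: pe DirProd_def)
    let ?S = "{\<theta>' \<in> carrier C. \<theta>' g \<in> ball (\<theta> g) r}"
    have "continuous_map (char_topology G) euclidean (\<lambda>\<theta>'. \<theta>' g)"
      unfolding char_topology_def
      by (intro continuous_map_from_subtopology continuous_map_product_projection[OF g])
    from openin_continuous_map_preimage[OF this, of "ball (\<theta> g) r"]
    have "openin (char_topology G) ?S" by (simp add: topspace_char_topology)
    then have "openin TT (?S \<times> {\<gamma>})" using \<gamma> by (simp add: openin_prod_Times_iff)
    moreover have "p \<in> ?S \<times> {\<gamma>}" using r \<theta> by (simp add: pe)
    moreover have "cocycle_of q g \<in> Met.mball (cocycle_of p g) r" if q: "q \<in> ?S \<times> {\<gamma>}" for q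
    proof -
      obtain \<theta>' where qe: "q = (\<theta>', \<gamma>)" and \<theta>': "\<theta>' \<in> carrier C" "dist (\<theta> g) (\<theta>' g) < r" using q by auto
      have "q \<in> carrier (C \<times>\<times> E)" using \<theta>' \<gamma> by (simp add: qe DirProd_def)
      then have "cocycle_of q g \<in> Linf X" "cocycle_of p g \<in> Linf X"
        using unit g pc Lunitary_Linf by blast+
      moreover have "L2_dist X (cocycle_of p g) (cocycle_of q g) < r"
        using L2_dist_cocycle_of[OF \<theta> \<theta>'(1) \<gamma> g] \<theta>'(2) by (simp add: pe qe dist_norm)
      ultimately show ?thesis by (simp add: Met.in_mball)
    qed
    ultimately show "\<exists>U. openin TT U \<and> p \<in> U \<and> (\<forall>q\<in>U. cocycle_of q g \<in> Met.mball (cocycle_of p g) r)" by blast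
  qed
  then have comp: "continuous_map TT (unitary_topology X A\<Gamma>) (\<lambda>p. cocycle_of p g)" if "g \<in> carrier G" for g
    unfolding unitary_topology_def continuous_map_in_subtopology
    using that unit unfolding topspace_TT by blast
  have "continuous_map TT (product_topology (\<lambda>_. unitary_topology X A\<Gamma>) (carrier G)) cocycle_of"
    unfolding continuous_map_componentwise using comp by (auto simp: cocycle_of_def)
  then show ?thesis
    unfolding Z1_topology_def continuous_map_in_subtopology
    using cocycle_of_closed unfolding topspace_TT by blast
qed

text \<open>The homomorphism theorem gives the algebraic isomorphism induced by
  \<open>\<Phi>\<close>. It is continuous because the classes carry the quotient topology; its
  inverse sends a pair to the class of \<open>cocycle_of\<close>, a composition of continuous maps,
  so no openness of \<open>\<Phi>\<close> has to be shown.\<close>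

theorem H1_isomorphic:
  "topological_group_isomorphic (H1 G X A\<Gamma> \<sigma>) (H1_topology G X A\<Gamma> \<sigma>) (C \<times>\<times> E) TT"
proof -
  interpret \<Phi>: group_hom Z "C \<times>\<times> E" \<Phi> by (rule group_hom_\<Phi>)
  let ?B = "B1 G X A\<Gamma> \<sigma>"
  let ?q = "\<lambda>w. ?B #>\<^bsub>Z\<^esub> w"
  let ?f = "\<lambda>Y. the_elem (\<Phi> ` Y)"
  have onto: "\<Phi> ` carrier Z = carrier (C \<times>\<times> E)"
  proof (intro equalityI subsetI)
    fix p assume "p \<in> \<Phi> ` carrier Z"
    then show "p \<in> carrier (C \<times>\<times> E)" using \<Phi>_closed by (elim imageE) (simp only:)
  next
    fix p assume "p \<in> carrier (C \<times>\<times> E)"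
    then show "p \<in> \<Phi> ` carrier Z"
      using cocycle_of_closed \<Phi>_cocycle_of by (intro image_eqI[of _ _ "cocycle_of p"]) simp_all
  qed
  have iso: "?f \<in> iso (H1 G X A\<Gamma> \<sigma>) (C \<times>\<times> E)"
    using \<Phi>.FactGroup_iso_set[OF onto] by (simp add: H1_def kernel_\<Phi>)
  have q_carrier: "?q w \<in> carrier (H1 G X A\<Gamma> \<sigma>)" if "w \<in> carrier Z" for w
    using that by (auto simp: H1_def FactGroup_def RCOSETS_def)
  have fq: "?f (?q w) = \<Phi> w" if w: "w \<in> carrier Z" for w
  proof -
    have "\<Phi> v = \<Phi> w" if v: "v \<in> ?q w" for v
    proof -
      obtain k where k: "k \<in> ?B" "v = k \<otimes>\<^bsub>Z\<^esub> w" using v by (auto simp: r_coset_def)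
      have "k \<in> carrier Z" "\<Phi> k = \<one>\<^bsub>C \<times>\<times> E\<^esub>" using k(1) unfolding kernel_\<Phi>[symmetric] kernel_def by auto
      then have "\<Phi> v = \<one>\<^bsub>C \<times>\<times> E\<^esub> \<otimes>\<^bsub>C \<times>\<times> E\<^esub> \<Phi> w"
        using w by (simp only: k(2) \<Phi>.hom_mult)
      then show ?thesis by (simp only: \<Phi>.H.l_one[OF \<Phi>_closed[OF w]])
    qed
    moreover have "w \<in> ?q w"
    proof -
      have "\<one>\<^bsub>Z\<^esub> \<in> ?B" unfolding kernel_\<Phi>[symmetric] by (simp add: kernel_def)
      then show ?thesis using w unfolding r_coset_def by force
    qed
    ultimately have "\<Phi> ` ?q w = {\<Phi> w}" by blast
    then show ?thesis by simp
  qed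
  have quot: "quotient_map TZ (H1_topology G X A\<Gamma> \<sigma>) ?q"
    unfolding H1_topology_def by (rule quotient_map_quotient_topology)
  have top_H1: "topspace (H1_topology G X A\<Gamma> \<sigma>) = ?q ` carrier Z"
    using quotient_imp_surjective_map[OF quot] by (simp add: topspace_TZ)
  have "homeomorphic_maps (H1_topology G X A\<Gamma> \<sigma>) TT ?f (?q \<circ> cocycle_of)"
    unfolding homeomorphic_maps_def
  proof (intro conjI ballI)
    have "continuous_map TZ TT (?f \<circ> ?q)"
      by (rule continuous_map_eq[OF continuous_\<Phi>]) (simp add: topspace_TZ fq)
    then show "continuous_map (H1_topology G X A\<Gamma> \<sigma>) TT ?f"
      by (rule continuous_compose_quotient_map[OF quot])
    show "continuous_map TT (H1_topology G X A\<Gamma> \<sigma>) (?q \<circ> cocycle_of)"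
      by (rule continuous_map_compose[OF continuous_cocycle_of quotient_imp_continuous_map[OF quot]])
  next
    fix Y assume "Y \<in> topspace (H1_topology G X A\<Gamma> \<sigma>)"
    then obtain w where w: "w \<in> carrier Z" "Y = ?q w" unfolding top_H1 by (rule imageE)
    have p: "\<Phi> w \<in> carrier (C \<times>\<times> E)" by (rule \<Phi>_closed[OF w(1)])
    \<comment> \<open>The two cocycles agree only up to a coboundary, so the equality of their
      cosets is read off from the injectivity of the induced map.\<close>
    have "?f (?q (cocycle_of (\<Phi> w))) = ?f (?q w)"
      unfolding fq[OF w(1)] fq[OF cocycle_of_closed[OF p]] by (rule \<Phi>_cocycle_of[OF p])
    moreover have "inj_on ?f (carrier (H1 G X A\<Gamma> \<sigma>))" using iso by (simp add: iso_def bij_betw_def)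
    ultimately have "?q (cocycle_of (\<Phi> w)) = ?q w"
      using q_carrier[OF w(1)] q_carrier[OF cocycle_of_closed[OF p]] by (simp add: inj_on_def)
    then show "(?q \<circ> cocycle_of) (?f Y) = Y" by (simp add: w(2) fq[OF w(1)])
  next
    fix p assume "p \<in> topspace TT"
    then have "p \<in> carrier (C \<times>\<times> E)" by (simp only: topspace_TT)
    then show "?f ((?q \<circ> cocycle_of) p) = p" by (simp add: fq cocycle_of_closed \<Phi>_cocycle_of)
  qed
  then have "homeomorphic_map (H1_topology G X A\<Gamma> \<sigma>) TT ?f"
    by (rule homeomorphic_maps_imp_map)
  with iso show ?thesis unfolding topological_group_isomorphic_def by blast
qed

end

theorem theorem1:
  fixes G :: "'g monoid" and \<Gamma> :: "'h monoid"
    and M0 :: "'x measure"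
    and M :: "('g \<Rightarrow> 'x) measure"
    and \<beta> :: "'h \<Rightarrow> ('g \<Rightarrow> 'x) \<Rightarrow> ('g \<Rightarrow> 'x)"
    and A\<Gamma> :: "(('g \<Rightarrow> 'x) \<Rightarrow> complex) set set"
    and \<sigma> :: "'g \<Rightarrow> (('g \<Rightarrow> 'x) \<Rightarrow> complex) set \<Rightarrow> (('g \<Rightarrow> 'x) \<Rightarrow> complex) set"
  assumes "class_wT G"
    and "standard_prob_space M0" and "nontrivial_prob_space M0"
    and "M = bernoulli_space G M0"
    and "\<sigma> = induced_action G M (bernoulli_shift G)"
    and "Group.group \<Gamma>" and "countable (carrier \<Gamma>)"
    and "mp_action \<Gamma> M \<beta>" and "ess_free \<Gamma> M \<beta>"
    and "\<And>g h. \<lbrakk>g \<in> carrier G; h \<in> carrier \<Gamma>\<rbrakk> \<Longrightarrow>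
           AE x in M. \<beta> h (bernoulli_shift G g x) = bernoulli_shift G g (\<beta> h x)"
    and "A\<Gamma> = fixed_algebra \<Gamma> M \<beta>"
    and "free_on_subalgebra G M A\<Gamma> \<sigma>"
  shows "topological_group_isomorphic
           (H1 G M A\<Gamma> \<sigma>) (H1_topology G M A\<Gamma> \<sigma>)
           (char_group G \<times>\<times> eigenchar_group \<Gamma> M \<beta>)
           (prod_topology (char_topology G) (discrete_topology (carrier (eigenchar_group \<Gamma> M \<beta>))))"
proof -
  from assms(1) obtain H where G: "Group.group G" "countable (carrier G)"
    and H: "subgroup H G" "infinite H" "wq_normal H G" "relative_property_T G H"
    unfolding class_wT_def by blast
  have M0: "prob_space M0" "countably_generated M0"
    using assms(2) countably_generated_standard_borel[of M0] by (simp_all add: standard_prob_space_def)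
  interpret bernoulli_commuting_action G M0 \<Gamma> \<beta> H
  proof (intro bernoulli_commuting_action.intro bernoulli_group.intro bernoulli_group_axioms.intro
      bernoulli_commuting_action_axioms.intro)
    show "mp_action \<Gamma> (bernoulli_space G M0) \<beta>" using assms(4,8) by simp
    show "AE x in bernoulli_space G M0. \<beta> h (bernoulli_shift G g x) = bernoulli_shift G g (\<beta> h x)"
      if "g \<in> carrier G" "h \<in> carrier \<Gamma>" for g h
      using assms(10)[OF that] unfolding assms(4) .
    show "H \<subseteq> carrier G" by (rule subgroup.subset[OF H(1)])
  qed (fact G M0 H assms(6))+
  show ?thesis using H1_isomorphic unfolding assms(4,5,11) .
qed

end
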